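(* Let $X$ be an $n$-dimensional complex Kähler orbifold, let $\omega$ be an orbifold Kähler metric on $X$ and let $\omega_X$ be a Kähler metric on $X$. Let $K$ be a compact subset of $X$ with non-empty, connected interior. Then there exist $C>0$ and $\alpha\in(0,1)$ such that $$C^{-1}d_X\le d_\omega\le C\,d_X^{\alpha}\qquad\text{on }K\times K.$$ In particular, the metric completion $\overline{(K\setminus X_{\rm sing},d_\omega)}$ is homeomorphic to $K$.
   Context: A complex Kähler orbifold here means a normal Kähler variety with at most quotient singularities: every $x\in X$ has a euclidean open neighborhood $U$ admitting a finite quasi-étale (étale in codimension one) Galois cover $p:V\to U$ with $V$ an open subset of $\mathbb C^n$. An orbifold Kähler metric is a Kähler metric $\omega$ on $X_{\rm reg}$ such that for every such $p:V\to U$ the pull-back $p^*(\omega|_{U_{\rm reg}})$ extends to a smooth Kähler metric on $V$. A Kähler metric $\omega_X$ on $X$ is a Kähler form on $X_{\rm reg}$ which, for any local embedding $X\hookrightarrow\mathbb C^N$, extends to a Kähler form on (an open subset of) $\mathbb C^N$. For $a,b\in X_{\rm reg}$, $d_\omega(a,b)$ is the infimum of the $\omega$-lengths of smooth curves in $X_{\rm reg}$ joining $a$ and $b$; $d_X(a,b)$ is defined in the same way using $\omega_X$. Both are extended to $X\times X$ by considering paths which meet $X_{\rm sing}=X\setminus X_{\rm reg}$ at most at their endpoints.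
   Formalization: The claim that the completion of K∖X_sing is homeomorphic to K is stated only when K∖X_sing is dense in K; without this it fails, e.g. for K a closed ball in X_reg together with one singular point outside it. The distance estimates are stated for every K. *)

theory Defs
  imports "HOL-Analysis.Analysis" "HOL-Algebra.Bij"
begin

section \<open>Functions of several complex variables\<close>

text \<open>
  Local embeddings of one space use coordinate spaces of varying dimension, so the dimension cannot
  be a type. The space of \<open>N\<close>-tuples of complex numbers is rendered as the set of sequences that
  vanish from index \<open>N\<close> on; the product topology of \<open>nat \<Rightarrow> complex\<close> induces the
  euclidean topology on it.
\<close>

definition Cn :: "nat \<Rightarrow> (nat \<Rightarrow> complex) set" where
  "Cn N = {z. \<forall>i\<ge>N. z i = 0}"

definition Cn_open :: "nat \<Rightarrow> (nat \<Rightarrow> complex) set \<Rightarrow> bool" where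
  "Cn_open N \<Omega> \<longleftrightarrow> openin (top_of_set (Cn N)) \<Omega>"

definition lcomb ::
    "complex \<Rightarrow> (nat \<Rightarrow> complex) \<Rightarrow> complex \<Rightarrow> (nat \<Rightarrow> complex) \<Rightarrow> (nat \<Rightarrow> complex)" where
  "lcomb a u b v = (\<lambda>i. a * u i + b * v i)"

definition Jmul :: "(nat \<Rightarrow> complex) \<Rightarrow> (nat \<Rightarrow> complex)" where
  "Jmul u = (\<lambda>i. \<i> * u i)"

text \<open>Continuous and holomorphic in each variable separately; used only for open \<open>\<Omega>\<close>.\<close>

definition holo_open :: "nat \<Rightarrow> (nat \<Rightarrow> complex) set \<Rightarrow> ((nat \<Rightarrow> complex) \<Rightarrow> complex) \<Rightarrow> bool" where
  "holo_open N \<Omega> f \<longleftrightarrow> continuous_on \<Omega> f \<and>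
     (\<forall>z\<in>\<Omega>. \<forall>i<N. (\<lambda>w. f (z(i := w))) field_differentiable (at (z i)))"

text \<open>On an arbitrary subset \<open>A\<close>: locally the restriction of an ambient holomorphic function. If
  \<open>A\<close> is analytic, this is the structure sheaf of \<open>A\<close> with its reduced structure.\<close>

definition holo :: "nat \<Rightarrow> (nat \<Rightarrow> complex) set \<Rightarrow> ((nat \<Rightarrow> complex) \<Rightarrow> complex) set" where
  "holo N A = {f. \<forall>x\<in>A. \<exists>\<Omega> g. Cn_open N \<Omega> \<and> x \<in> \<Omega> \<and> holo_open N \<Omega> g \<and> (\<forall>y\<in>A \<inter> \<Omega>. f y = g y)}"

definition ray :: "(nat \<Rightarrow> complex) \<Rightarrow> (nat \<Rightarrow> complex) \<Rightarrow> real \<Rightarrow> (nat \<Rightarrow> complex)" where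
  "ray z u t = lcomb 1 z (of_real t) u"

definition ddir ::
    "((nat \<Rightarrow> complex) \<Rightarrow> 'b::real_normed_vector) \<Rightarrow> (nat \<Rightarrow> complex) \<Rightarrow> (nat \<Rightarrow> complex) \<Rightarrow> 'b" where
  "ddir f z u = vector_derivative (\<lambda>t. f (ray z u t)) (at 0)"

definition dmap ::
    "((nat \<Rightarrow> complex) \<Rightarrow> (nat \<Rightarrow> complex)) \<Rightarrow> (nat \<Rightarrow> complex) \<Rightarrow> (nat \<Rightarrow> complex) \<Rightarrow> (nat \<Rightarrow> complex)" where
  "dmap F z u = (\<lambda>i. ddir (\<lambda>w. F w i) z u)"

primrec Ck :: "nat \<Rightarrow> nat \<Rightarrow> (nat \<Rightarrow> complex) set \<Rightarrow> ((nat \<Rightarrow> complex) \<Rightarrow> real) \<Rightarrow> bool" where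
  "Ck N 0 \<Omega> f \<longleftrightarrow> continuous_on \<Omega> f"
| "Ck N (Suc k) \<Omega> f \<longleftrightarrow> continuous_on \<Omega> f \<and>
     (\<forall>u\<in>Cn N. \<exists>g. Ck N k \<Omega> g \<and>
        (\<forall>z\<in>\<Omega>. ((\<lambda>t. f (ray z u t)) has_real_derivative g z) (at 0)))"

definition smooth_fun :: "nat \<Rightarrow> (nat \<Rightarrow> complex) set \<Rightarrow> ((nat \<Rightarrow> complex) \<Rightarrow> real) \<Rightarrow> bool" where
  "smooth_fun N \<Omega> f \<longleftrightarrow> (\<forall>k. Ck N k \<Omega> f)"

section \<open>Kaehler forms on open subsets of coordinate space\<close>

text \<open>A real 2-form \<open>\<eta>\<close> sends a point and two tangent vectors to a real number.\<close>

type_synonym form = "(nat \<Rightarrow> complex) \<Rightarrow> (nat \<Rightarrow> complex) \<Rightarrow> (nat \<Rightarrow> complex) \<Rightarrow> real"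

definition pullback :: "((nat \<Rightarrow> complex) \<Rightarrow> (nat \<Rightarrow> complex)) \<Rightarrow> form \<Rightarrow> form" where
  "pullback F \<eta> z u v = \<eta> (F z) (dmap F z u) (dmap F z v)"

text \<open>Invariance under \<^const>\<open>Jmul\<close> says that the form has type (1,1). The last clause is the
  vanishing of the exterior derivative, evaluated on constant vector fields.\<close>

definition kaehler_form :: "nat \<Rightarrow> (nat \<Rightarrow> complex) set \<Rightarrow> form \<Rightarrow> bool" where
  "kaehler_form N \<Omega> \<eta> \<longleftrightarrow>
     (\<forall>u\<in>Cn N. \<forall>v\<in>Cn N. smooth_fun N \<Omega> (\<lambda>z. \<eta> z u v)) \<and>
     (\<forall>z\<in>\<Omega>. \<forall>u\<in>Cn N. \<forall>v\<in>Cn N. \<forall>w\<in>Cn N. \<forall>a b::real.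
        \<eta> z (lcomb (of_real a) u (of_real b) v) w = a * \<eta> z u w + b * \<eta> z v w) \<and>
     (\<forall>z\<in>\<Omega>. \<forall>u\<in>Cn N. \<forall>v\<in>Cn N. \<eta> z u v = - \<eta> z v u) \<and>
     (\<forall>z\<in>\<Omega>. \<forall>u\<in>Cn N. \<forall>v\<in>Cn N. \<eta> z (Jmul u) (Jmul v) = \<eta> z u v) \<and>
     (\<forall>z\<in>\<Omega>. \<forall>u\<in>Cn N. u \<noteq> (\<lambda>i. 0) \<longrightarrow> \<eta> z u (Jmul u) > 0) \<and>
     (\<forall>z\<in>\<Omega>. \<forall>u\<in>Cn N. \<forall>v\<in>Cn N. \<forall>w\<in>Cn N.
        ddir (\<lambda>y. \<eta> y v w) z u + ddir (\<lambda>y. \<eta> y w u) z v + ddir (\<lambda>y. \<eta> y u v) z w = 0)"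

section \<open>Reduced complex spaces\<close>

text \<open>
  A reduced complex space is a topological space \<open>X\<close> with a sheaf \<open>\<O>\<close> of complex-valued
  functions that is locally isomorphic to an analytic subset of an open subset of coordinate space
  with its sheaf of holomorphic functions. Sections over \<open>U\<close> are represented by functions on the
  whole type, whose values off \<open>U\<close> are irrelevant.
\<close>

definition analytic_subset ::
    "'a topology \<Rightarrow> ('a set \<Rightarrow> ('a \<Rightarrow> complex) set) \<Rightarrow> 'a set \<Rightarrow> bool" where
  "analytic_subset X \<O> A \<longleftrightarrow> A \<subseteq> topspace X \<and>
     (\<forall>x\<in>topspace X. \<exists>W F. openin X W \<and> x \<in> W \<and> finite F \<and> F \<subseteq> \<O> W \<and>
        A \<inter> W = {y\<in>W. \<forall>f\<in>F. f y = 0})"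

definition local_embedding ::
    "'a topology \<Rightarrow> ('a set \<Rightarrow> ('a \<Rightarrow> complex) set) \<Rightarrow> nat \<Rightarrow> 'a set \<Rightarrow> ('a \<Rightarrow> nat \<Rightarrow> complex) \<Rightarrow> bool" where
  "local_embedding X \<O> N U \<phi> \<longleftrightarrow> openin X U \<and>
     (\<exists>\<Omega>. Cn_open N \<Omega> \<and> analytic_subset (top_of_set \<Omega>) (holo N) (\<phi> ` U)) \<and>
     homeomorphic_map (subtopology X U) (top_of_set (\<phi> ` U)) \<phi> \<and>
     (\<forall>W f. openin X W \<and> W \<subseteq> U \<longrightarrow> (f \<in> \<O> W \<longleftrightarrow> f \<circ> inv_into U \<phi> \<in> holo N (\<phi> ` W)))"

definition reduced_complex_space ::
    "'a topology \<Rightarrow> ('a set \<Rightarrow> ('a \<Rightarrow> complex) set) \<Rightarrow> bool" where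
  "reduced_complex_space X \<O> \<longleftrightarrow> Hausdorff_space X \<and> second_countable X \<and>
     (\<forall>U W f. openin X U \<and> openin X W \<and> W \<subseteq> U \<and> f \<in> \<O> U \<longrightarrow> f \<in> \<O> W) \<and>
     (\<forall>U f. openin X U \<and> (\<forall>x\<in>U. \<exists>W. openin X W \<and> x \<in> W \<and> W \<subseteq> U \<and> f \<in> \<O> W) \<longrightarrow> f \<in> \<O> U) \<and>
     (\<forall>x\<in>topspace X. \<exists>N U \<phi>. local_embedding X \<O> N U \<phi> \<and> x \<in> U)"

definition holo_chart ::
    "'a topology \<Rightarrow> ('a set \<Rightarrow> ('a \<Rightarrow> complex) set) \<Rightarrow> nat \<Rightarrow> 'a set \<Rightarrow> ('a \<Rightarrow> nat \<Rightarrow> complex) \<Rightarrow> bool" where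
  "holo_chart X \<O> N U \<phi> \<longleftrightarrow> local_embedding X \<O> N U \<phi> \<and> Cn_open N (\<phi> ` U)"

definition regular_locus :: "'a topology \<Rightarrow> ('a set \<Rightarrow> ('a \<Rightarrow> complex) set) \<Rightarrow> 'a set" where
  "regular_locus X \<O> = {x. \<exists>N U \<phi>. holo_chart X \<O> N U \<phi> \<and> x \<in> U}"

definition singular_locus :: "'a topology \<Rightarrow> ('a set \<Rightarrow> ('a \<Rightarrow> complex) set) \<Rightarrow> 'a set" where
  "singular_locus X \<O> = topspace X - regular_locus X \<O>"

text \<open>The dimension of a reduced complex space is the supremum of the dimensions at its regular
  points, which are dense.\<close>

definition regular_dims :: "'a topology \<Rightarrow> ('a set \<Rightarrow> ('a \<Rightarrow> complex) set) \<Rightarrow> nat set" where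
  "regular_dims X \<O> = {N. \<exists>U \<phi>. holo_chart X \<O> N U \<phi> \<and> U \<noteq> {}}"

definition has_dimension :: "'a topology \<Rightarrow> ('a set \<Rightarrow> ('a \<Rightarrow> complex) set) \<Rightarrow> nat \<Rightarrow> bool" where
  "has_dimension X \<O> n \<longleftrightarrow> n \<in> regular_dims X \<O> \<and> (\<forall>m\<in>regular_dims X \<O>. m \<le> n)"

definition irreducible_space :: "'a topology \<Rightarrow> ('a set \<Rightarrow> ('a \<Rightarrow> complex) set) \<Rightarrow> bool" where
  "irreducible_space X \<O> \<longleftrightarrow> topspace X \<noteq> {} \<and>
     (\<forall>A B. analytic_subset X \<O> A \<and> analytic_subset X \<O> B \<and> A \<union> B = topspace X \<longrightarrow>
        A = topspace X \<or> B = topspace X)"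

definition germ_eq :: "'a topology \<Rightarrow> 'a \<Rightarrow> ('a \<Rightarrow> complex) \<Rightarrow> ('a \<Rightarrow> complex) \<Rightarrow> bool" where
  "germ_eq X x f g \<longleftrightarrow> (\<exists>W. openin X W \<and> x \<in> W \<and> (\<forall>y\<in>W. f y = g y))"

text \<open>Representatives of the germs at \<open>x\<close>; two represent the same germ iff \<^const>\<open>germ_eq\<close> holds.\<close>

definition stalk :: "'a topology \<Rightarrow> ('a set \<Rightarrow> ('a \<Rightarrow> complex) set) \<Rightarrow> 'a \<Rightarrow> ('a \<Rightarrow> complex) set" where
  "stalk X \<O> x = {f. \<exists>W. openin X W \<and> x \<in> W \<and> f \<in> \<O> W}"

text \<open>The local ring at \<open>x\<close> is an integral domain that is integrally closed in its fraction field: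
  the monic equation of degree \<open>d\<close> for \<open>f / g\<close> is multiplied by the \<open>d\<close>-th power of \<open>g\<close>.\<close>

definition normal_at :: "'a topology \<Rightarrow> ('a set \<Rightarrow> ('a \<Rightarrow> complex) set) \<Rightarrow> 'a \<Rightarrow> bool" where
  "normal_at X \<O> x \<longleftrightarrow>
     (\<forall>f\<in>stalk X \<O> x. \<forall>g\<in>stalk X \<O> x. germ_eq X x (\<lambda>y. f y * g y) (\<lambda>y. 0) \<longrightarrow>
        germ_eq X x f (\<lambda>y. 0) \<or> germ_eq X x g (\<lambda>y. 0)) \<and>
     (\<forall>f\<in>stalk X \<O> x. \<forall>g\<in>stalk X \<O> x. \<forall>d. \<forall>a :: nat \<Rightarrow> 'a \<Rightarrow> complex.
        \<not> germ_eq X x g (\<lambda>y. 0) \<and> (\<forall>i<d. a i \<in> stalk X \<O> x) \<and>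
        germ_eq X x (\<lambda>y. f y ^ d + (\<Sum>i<d. a i y * f y ^ i * g y ^ (d - i))) (\<lambda>y. 0) \<longrightarrow>
        (\<exists>h\<in>stalk X \<O> x. germ_eq X x f (\<lambda>y. h y * g y)))"

definition normal_variety :: "'a topology \<Rightarrow> ('a set \<Rightarrow> ('a \<Rightarrow> complex) set) \<Rightarrow> bool" where
  "normal_variety X \<O> \<longleftrightarrow> reduced_complex_space X \<O> \<and> irreducible_space X \<O> \<and>
     (\<forall>x\<in>topspace X. normal_at X \<O> x)"

section \<open>Quotient singularities\<close>

text \<open>\<open>p\<close> restricts to an isomorphism from a neighbourhood of \<open>z\<close> onto an open subset of \<open>X\<close>.\<close>

definition etale_at ::
    "'a topology \<Rightarrow> ('a set \<Rightarrow> ('a \<Rightarrow> complex) set) \<Rightarrow> nat \<Rightarrow> ((nat \<Rightarrow> complex) \<Rightarrow> 'a) \<Rightarrow> (nat \<Rightarrow> complex) set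
      \<Rightarrow> (nat \<Rightarrow> complex) \<Rightarrow> bool" where
  "etale_at X \<O> n p V z \<longleftrightarrow>
     (\<exists>V'. Cn_open n V' \<and> z \<in> V' \<and> V' \<subseteq> V \<and> inj_on p V' \<and> holo_chart X \<O> n (p ` V') (inv_into V' p))"

definition quasi_etale ::
    "'a topology \<Rightarrow> ('a set \<Rightarrow> ('a \<Rightarrow> complex) set) \<Rightarrow> nat \<Rightarrow> ((nat \<Rightarrow> complex) \<Rightarrow> 'a) \<Rightarrow> (nat \<Rightarrow> complex) set
      \<Rightarrow> bool" where
  "quasi_etale X \<O> n p V \<longleftrightarrow>
     (\<exists>Z. analytic_subset (top_of_set V) (holo n) Z \<and>
          (\<forall>m\<in>regular_dims (top_of_set Z) (holo n). m + 2 \<le> n) \<and>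
          (\<forall>z\<in>V - Z. etale_at X \<O> n p V z))"

text \<open>Galois: \<open>p\<close> is, as a map of ringed spaces, the quotient by a finite group of holomorphic
  automorphisms, i.e. its fibres are the orbits and the sections of \<open>\<O>\<close> are the functions with
  holomorphic pull-back.\<close>

definition quasi_etale_galois_cover ::
    "'a topology \<Rightarrow> ('a set \<Rightarrow> ('a \<Rightarrow> complex) set) \<Rightarrow> nat \<Rightarrow> (nat \<Rightarrow> complex) set \<Rightarrow> 'a set
      \<Rightarrow> ((nat \<Rightarrow> complex) \<Rightarrow> 'a) \<Rightarrow> bool" where
  "quasi_etale_galois_cover X \<O> n V U p \<longleftrightarrow>
     Cn_open n V \<and> openin X U \<and> p ` V = U \<and>
     continuous_map (top_of_set V) (subtopology X U) p \<and>
     proper_map (top_of_set V) (subtopology X U) p \<and>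
     (\<forall>x\<in>U. finite {z\<in>V. p z = x}) \<and>
     (\<forall>W f. openin X W \<and> W \<subseteq> U \<longrightarrow> (f \<in> \<O> W \<longleftrightarrow> f \<circ> p \<in> holo n {z\<in>V. p z \<in> W})) \<and>
     (\<exists>G. subgroup G (BijGroup V) \<and> finite G \<and>
          (\<forall>g\<in>G. \<forall>i. (\<lambda>z. g z i) \<in> holo n V) \<and>
          (\<forall>z\<in>V. \<forall>w\<in>V. p z = p w \<longleftrightarrow> (\<exists>g\<in>G. w = g z))) \<and>
     quasi_etale X \<O> n p V"

definition complex_orbifold ::
    "nat \<Rightarrow> 'a topology \<Rightarrow> ('a set \<Rightarrow> ('a \<Rightarrow> complex) set) \<Rightarrow> bool" where
  "complex_orbifold n X \<O> \<longleftrightarrow> normal_variety X \<O> \<and> has_dimension X \<O> n \<and>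
     (\<forall>x\<in>topspace X. \<exists>V U p. x \<in> U \<and> quasi_etale_galois_cover X \<O> n V U p)"

section \<open>Kaehler metrics\<close>

text \<open>A form on the regular locus is a family indexed by the holomorphic charts: \<open>\<omega> U \<phi>\<close> is its
  expression in the coordinates \<open>\<phi>\<close> on \<open>U\<close>. The second clause is the transformation rule.\<close>

definition kaehler_form_on_reg ::
    "nat \<Rightarrow> 'a topology \<Rightarrow> ('a set \<Rightarrow> ('a \<Rightarrow> complex) set) \<Rightarrow> ('a set \<Rightarrow> ('a \<Rightarrow> nat \<Rightarrow> complex) \<Rightarrow> form) \<Rightarrow> bool" where
  "kaehler_form_on_reg n X \<O> \<omega> \<longleftrightarrow>
     (\<forall>U \<phi>. holo_chart X \<O> n U \<phi> \<longrightarrow> kaehler_form n (\<phi> ` U) (\<omega> U \<phi>)) \<and>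
     (\<forall>U \<phi> W \<psi>. holo_chart X \<O> n U \<phi> \<and> holo_chart X \<O> n W \<psi> \<longrightarrow>
        (\<forall>x\<in>U \<inter> W. \<forall>u\<in>Cn n. \<forall>v\<in>Cn n.
           \<omega> U \<phi> (\<phi> x) u v = pullback (\<psi> \<circ> inv_into U \<phi>) (\<omega> W \<psi>) (\<phi> x) u v))"

definition orbifold_kaehler_metric ::
    "nat \<Rightarrow> 'a topology \<Rightarrow> ('a set \<Rightarrow> ('a \<Rightarrow> complex) set) \<Rightarrow> ('a set \<Rightarrow> ('a \<Rightarrow> nat \<Rightarrow> complex) \<Rightarrow> form) \<Rightarrow> bool" where
  "orbifold_kaehler_metric n X \<O> \<omega> \<longleftrightarrow> kaehler_form_on_reg n X \<O> \<omega> \<and>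
     (\<forall>V U p. quasi_etale_galois_cover X \<O> n V U p \<longrightarrow>
        (\<exists>\<eta>. kaehler_form n V \<eta> \<and>
           (\<forall>W \<phi>. holo_chart X \<O> n W \<phi> \<longrightarrow>
              (\<forall>z\<in>V. p z \<in> W \<longrightarrow>
                 (\<forall>u\<in>Cn n. \<forall>v\<in>Cn n. \<eta> z u v = pullback (\<phi> \<circ> p) (\<omega> W \<phi>) z u v)))))"

text \<open>The ambient extension is required near each point of the domain of the local embedding.\<close>

definition kaehler_metric ::
    "nat \<Rightarrow> 'a topology \<Rightarrow> ('a set \<Rightarrow> ('a \<Rightarrow> complex) set) \<Rightarrow> ('a set \<Rightarrow> ('a \<Rightarrow> nat \<Rightarrow> complex) \<Rightarrow> form) \<Rightarrow> bool" where
  "kaehler_metric n X \<O> \<omega> \<longleftrightarrow> kaehler_form_on_reg n X \<O> \<omega> \<and>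
     (\<forall>N U \<iota>. local_embedding X \<O> N U \<iota> \<longrightarrow>
        (\<forall>x\<in>U. \<exists>\<Omega> \<eta>. Cn_open N \<Omega> \<and> \<iota> x \<in> \<Omega> \<and> kaehler_form N \<Omega> \<eta> \<and>
           (\<forall>W \<phi>. holo_chart X \<O> n W \<phi> \<longrightarrow>
              (\<forall>y\<in>U \<inter> W. \<iota> y \<in> \<Omega> \<longrightarrow>
                 (\<forall>u\<in>Cn n. \<forall>v\<in>Cn n.
                    \<omega> W \<phi> (\<phi> y) u v = pullback (\<iota> \<circ> inv_into W \<phi>) \<eta> (\<phi> y) u v)))))"

section \<open>Lengths and distances\<close>

primrec curve_Ck :: "nat \<Rightarrow> real set \<Rightarrow> (real \<Rightarrow> complex) \<Rightarrow> bool" where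
  "curve_Ck 0 I c \<longleftrightarrow> continuous_on I c"
| "curve_Ck (Suc k) I c \<longleftrightarrow> continuous_on I c \<and>
     (\<exists>c'. curve_Ck k I c' \<and> (\<forall>t\<in>I. (c has_vector_derivative c' t) (at t within I)))"

text \<open>
  Paths from \<open>a\<close> to \<open>b\<close> that meet the singular locus at most at their endpoints, and are smooth
  (one-sidedly at 0 and 1) at every parameter whose value is a regular point. For regular \<open>a\<close> and
  \<open>b\<close> these are the smooth curves in the regular locus joining \<open>a\<close> and \<open>b\<close>.
\<close>

definition admissible_path ::
    "nat \<Rightarrow> 'a topology \<Rightarrow> ('a set \<Rightarrow> ('a \<Rightarrow> complex) set) \<Rightarrow> 'a \<Rightarrow> 'a \<Rightarrow> (real \<Rightarrow> 'a) \<Rightarrow> bool" where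
  "admissible_path n X \<O> a b \<gamma> \<longleftrightarrow>
     continuous_map (top_of_set {0..1}) X \<gamma> \<and> \<gamma> 0 = a \<and> \<gamma> 1 = b \<and>
     (\<forall>t\<in>{0<..<1}. \<gamma> t \<in> regular_locus X \<O>) \<and>
     (\<forall>U \<phi>. holo_chart X \<O> n U \<phi> \<longrightarrow>
        (\<forall>k i. curve_Ck k {t\<in>{0..1}. \<gamma> t \<in> U} (\<lambda>t. \<phi> (\<gamma> t) i)))"

text \<open>The Riemannian metric of \<open>\<omega>\<close> is \<open>g(u, v) = \<omega>(u, Jv)\<close>. By the transformation rule the speed
  does not depend on the chosen chart.\<close>

definition speed ::
    "nat \<Rightarrow> 'a topology \<Rightarrow> ('a set \<Rightarrow> ('a \<Rightarrow> complex) set) \<Rightarrow> ('a set \<Rightarrow> ('a \<Rightarrow> nat \<Rightarrow> complex) \<Rightarrow> form)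
      \<Rightarrow> (real \<Rightarrow> 'a) \<Rightarrow> real \<Rightarrow> real" where
  "speed n X \<O> \<omega> \<gamma> t =
     (let (U, \<phi>) = (SOME (U, \<phi>). holo_chart X \<O> n U \<phi> \<and> \<gamma> t \<in> U);
          u = (\<lambda>i. vector_derivative (\<lambda>s. \<phi> (\<gamma> s) i) (at t))
      in sqrt (\<omega> U \<phi> (\<phi> (\<gamma> t)) u (Jmul u)))"

definition path_len ::
    "nat \<Rightarrow> 'a topology \<Rightarrow> ('a set \<Rightarrow> ('a \<Rightarrow> complex) set) \<Rightarrow> ('a set \<Rightarrow> ('a \<Rightarrow> nat \<Rightarrow> complex) \<Rightarrow> form)
      \<Rightarrow> (real \<Rightarrow> 'a) \<Rightarrow> ennreal" where
  "path_len n X \<O> \<omega> \<gamma> = (\<integral>\<^sup>+ t \<in> {0<..<1}. ennreal (speed n X \<O> \<omega> \<gamma> t) \<partial>lborel)"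

definition kdist ::
    "nat \<Rightarrow> 'a topology \<Rightarrow> ('a set \<Rightarrow> ('a \<Rightarrow> complex) set) \<Rightarrow> ('a set \<Rightarrow> ('a \<Rightarrow> nat \<Rightarrow> complex) \<Rightarrow> form)
      \<Rightarrow> 'a \<Rightarrow> 'a \<Rightarrow> ennreal" where
  "kdist n X \<O> \<omega> a b = (INF \<gamma> \<in> {\<gamma>. admissible_path n X \<O> a b \<gamma>}. path_len n X \<O> \<omega> \<gamma>)"

section \<open>Metric completion\<close>

text \<open>Equivalence classes of Cauchy sequences, with the limit distance. Off the carrier the distance
  is set to 0 because \<^locale>\<open>Metric_space\<close> constrains it on the whole type.\<close>

definition completion_carrier :: "'a set \<Rightarrow> ('a \<Rightarrow> 'a \<Rightarrow> real) \<Rightarrow> (nat \<Rightarrow> 'a) set set" where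
  "completion_carrier M d =
     {\<sigma>. Metric_space.MCauchy M d \<sigma>} //
     {(\<sigma>, \<tau>). Metric_space.MCauchy M d \<sigma> \<and> Metric_space.MCauchy M d \<tau> \<and> (\<lambda>k. d (\<sigma> k) (\<tau> k)) \<longlonglongrightarrow> 0}"

definition completion_dist ::
    "'a set \<Rightarrow> ('a \<Rightarrow> 'a \<Rightarrow> real) \<Rightarrow> (nat \<Rightarrow> 'a) set \<Rightarrow> (nat \<Rightarrow> 'a) set \<Rightarrow> real" where
  "completion_dist M d S T =
     (if S \<in> completion_carrier M d \<and> T \<in> completion_carrier M d
      then lim (\<lambda>k. d ((SOME \<sigma>. \<sigma> \<in> S) k) ((SOME \<tau>. \<tau> \<in> T) k)) else 0)"

definition completion_topology :: "'a set \<Rightarrow> ('a \<Rightarrow> 'a \<Rightarrow> real) \<Rightarrow> (nat \<Rightarrow> 'a) set topology" where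
  "completion_topology M d = Metric_space.mtopology (completion_carrier M d) (completion_dist M d)"

end

theory Submission
  imports Defs "HOL-Complex_Analysis.Complex_Analysis"
begin

text \<open>
  Near a point, \<open>\<omega>\<close> pulls back to a Kaehler form on a smooth Galois cover. The cover maps holomorphically
  to the ambient coordinates of \<open>X\<close>, so the pulled-back form dominates the pull-back of the euclidean
  metric on a compact neighbourhood, and hence \<open>\<omega>\<close> dominates \<open>\<omega>\<^sub>X\<close> on the regular locus. A path that leaves
  a neighbourhood has length bounded below in both metrics, so this compares the distances.

  For the Hoelder bound let \<open>z\<close> and \<open>w\<close> be points of the cover and \<open>\<xi>\<close> a linear form. The product of
  \<open>\<xi> (z - g w)\<close> over the Galois group is a polynomial in \<open>\<xi> z\<close> whose coefficients are invariant in \<open>w\<close>; it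
  vanishes for \<open>w = z\<close>, and invariant functions are Lipschitz in the ambient coordinates. For one of
  finitely many \<open>\<xi>\<close> every factor is comparable to the norm of \<open>z - g w\<close>, so some \<open>g w\<close> lies within a root
  of the ambient distance of \<open>z\<close>, and \<open>z\<close> and \<open>g w\<close> are joined in the cover by a path avoiding the branch
  locus of comparable length.

  Compactness makes the constants uniform on \<open>K\<close>. A compact Hausdorff topology has no strictly coarser
  Hausdorff topology, so the distance of \<open>\<omega>\<close> induces the topology of \<open>K\<close>, and the compact space \<open>K\<close> is the
  completion of any dense subset.
\<close>

section \<open>Polydiscs\<close>

text \<open>Three obstacles shape the argument. First, the cover is known to be etale only off its
  branch locus, so a tangent vector at a regular point of \<open>X\<close> cannot be lifted at once;
  the infinitesimal bounds are proved at etale points and extended by density and continuity.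
  Second, paths may touch the singular locus at their ends only. Concatenation therefore needs a
  regular joint at which all derivatives can be made to vanish, and the triangle inequality through
  a singular point becomes available only once small neighbourhoods are known to have small
  diameter, which is a consequence of the Hoelder estimate. Third, \<open>K\<close> need not be
  connected, so finiteness of distances on \<open>K\<close> rests on connectedness of
  \<open>X\<close>, which irreducibility gives. The local estimates concern small distances; for the
  others the diameters of \<open>K\<close> in both distances supply the constant. The local Hoelder
  exponent is the reciprocal of the order of the Galois group.\<close>

definition pdisc :: "nat \<Rightarrow> (nat \<Rightarrow> complex) \<Rightarrow> real \<Rightarrow> (nat \<Rightarrow> complex) set" where
  "pdisc N z d = {y \<in> Cn N. \<forall>i<N. cmod (y i - z i) < d}"

definition cpdisc :: "nat \<Rightarrow> (nat \<Rightarrow> complex) \<Rightarrow> real \<Rightarrow> (nat \<Rightarrow> complex) set" where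
  "cpdisc N z d = {y \<in> Cn N. \<forall>i<N. cmod (y i - z i) \<le> d}"

text \<open>A sum norm serves instead of the euclidean one: coordinatewise estimates add up without
  square roots, and for fixed \<open>N\<close> the two are equivalent.\<close>

definition l1norm :: "nat \<Rightarrow> (nat \<Rightarrow> complex) \<Rightarrow> real" where
  "l1norm N u = (\<Sum>i<N. cmod (u i))"

lemma l1norm_nonneg [simp]: "0 \<le> l1norm N u"
  by (simp add: l1norm_def sum_nonneg)

lemma component_le_l1norm: "i < N \<Longrightarrow> cmod (u i) \<le> l1norm N u"
  unfolding l1norm_def by (intro member_le_sum) auto

lemma l1norm_le: "(\<And>i. i < N \<Longrightarrow> cmod (u i) \<le> c) \<Longrightarrow> l1norm N u \<le> real N * c"
  unfolding l1norm_def using sum_bounded_above[of "{..<N}" "\<lambda>i. cmod (u i)" c] by simp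

lemma l1norm_mult: "l1norm N (\<lambda>i. a * u i) = cmod a * l1norm N u"
  by (simp add: l1norm_def norm_mult sum_distrib_left)

lemma l1norm_triangle: "l1norm N (\<lambda>i. u i + v i) \<le> l1norm N u + l1norm N v"
  unfolding l1norm_def sum.distrib[symmetric] by (intro sum_mono norm_triangle_ineq)

lemma l1norm_eq_0: "l1norm N u = 0 \<longleftrightarrow> (\<forall>i<N. u i = 0)"
  unfolding l1norm_def by (subst sum_nonneg_eq_0_iff) auto

lemma l1norm_eq_0_Cn: "u \<in> Cn N \<Longrightarrow> l1norm N u = 0 \<longleftrightarrow> u = (\<lambda>i. 0)"
  unfolding l1norm_eq_0 Cn_def by (auto simp: fun_eq_iff) (meson not_le)

lemma Cn_zero [simp]: "(\<lambda>i. 0) \<in> Cn N"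
  by (simp add: Cn_def)

lemma Cn_lcomb [simp]: "u \<in> Cn N \<Longrightarrow> v \<in> Cn N \<Longrightarrow> lcomb a u b v \<in> Cn N"
  by (simp add: Cn_def lcomb_def)

lemma Cn_Jmul [simp]: "u \<in> Cn N \<Longrightarrow> Jmul u \<in> Cn N"
  by (simp add: Cn_def Jmul_def)

lemma Cn_diff: "u \<in> Cn N \<Longrightarrow> v \<in> Cn N \<Longrightarrow> (\<lambda>i. u i - v i) \<in> Cn N"
  by (simp add: Cn_def)

lemma Cn_eqI: "u \<in> Cn N \<Longrightarrow> v \<in> Cn N \<Longrightarrow> (\<And>i. i < N \<Longrightarrow> u i = v i) \<Longrightarrow> u = v"
  unfolding Cn_def by (auto simp: fun_eq_iff) (metis not_le)

lemma pdisc_subset_cpdisc: "pdisc N z d \<subseteq> cpdisc N z d"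
  by (auto simp: pdisc_def cpdisc_def less_imp_le)

lemma cpdisc_subset_pdisc: "d < e \<Longrightarrow> cpdisc N z d \<subseteq> pdisc N z e"
  by (force simp: pdisc_def cpdisc_def)

lemma pdisc_mono: "d \<le> e \<Longrightarrow> pdisc N z d \<subseteq> pdisc N z e"
  by (force simp: pdisc_def)

lemma pdisc_Cn: "pdisc N z d \<subseteq> Cn N"
  by (auto simp: pdisc_def)

lemma centre_in_pdisc: "z \<in> Cn N \<Longrightarrow> 0 < d \<Longrightarrow> z \<in> pdisc N z d"
  by (simp add: pdisc_def)

text \<open>Polydiscs are products, so coordinates of two points may be exchanged one at a time
  without leaving; this is why polydiscs and not balls are used.\<close>

lemma pdisc_mix:
  assumes "y \<in> pdisc N z d" "w \<in> pdisc N z d"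
  shows "(\<lambda>i. if P i then y i else w i) \<in> pdisc N z d"
  using assms by (auto simp: pdisc_def Cn_def)

lemma pdisc_upd: "y \<in> pdisc N z d \<Longrightarrow> i < N \<Longrightarrow> cmod (w - z i) < d \<Longrightarrow> y(i := w) \<in> pdisc N z d"
  by (auto simp: pdisc_def Cn_def)

lemma continuous_on_component: "continuous_on S (\<lambda>z :: nat \<Rightarrow> complex. z i)"
  by (rule continuous_on_subset[OF continuous_on_product_coordinates]) simp

lemma open_polydisc: "open {y :: nat \<Rightarrow> complex. \<forall>i<N. cmod (y i - z i) < d}"
proof -
  have eq: "{y :: nat \<Rightarrow> complex. \<forall>i<N. cmod (y i - z i) < d} = (\<Inter>i\<in>{..<N}. {y. cmod (y i - z i) < d})"
    by auto
  show ?thesis unfolding eq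
    by (intro open_INT ballI open_Collect_less) (auto intro!: continuous_intros continuous_on_component)
qed

lemma pdisc_Int: "pdisc N z d = Cn N \<inter> {y. \<forall>i<N. cmod (y i - z i) < d}"
  by (auto simp: pdisc_def)

lemma Cn_open_pdisc: "Cn_open N (pdisc N z d)"
  unfolding Cn_open_def pdisc_Int using open_polydisc by (simp add: openin_open_Int)

text \<open>A basic open set of the product topology is a product of open sets. The factors of index
  below \<open>N\<close> bound the radius; at the other indices every point of \<open>Cn N\<close>
  agrees with \<open>z\<close>.\<close>

lemma pdisc_nhd:
  assumes "open T" "z \<in> T" "z \<in> Cn N"
  shows "\<exists>d>0. pdisc N z d \<subseteq> T"
proof -
  have "openin (product_topology (\<lambda>i::nat. euclidean :: complex topology) UNIV) T"
    using assms(1) by (simp add: open_fun_def)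
  from product_topology_open_contains_basis[OF this assms(2)]
  obtain X where X: "z \<in> Pi\<^sub>E UNIV X" "\<And>i. open (X i)" "finite {i. X i \<noteq> UNIV}" "Pi\<^sub>E UNIV X \<subseteq> T"
    by auto
  have "\<exists>e>0. ball (z i) e \<subseteq> X i" for i
    using X(1,2) openE[of "X i" "z i"] by (metis PiE_iff UNIV_I)
  then obtain e where e: "\<And>i. e i > 0" "\<And>i. ball (z i) (e i) \<subseteq> X i"
    by metis
  define d where "d = Min (insert 1 (e ` {..<N}))"
  have d: "d > 0" "\<And>i. i < N \<Longrightarrow> d \<le> e i"
    using e(1) by (auto simp: d_def)
  have "y \<in> Pi\<^sub>E UNIV X" if y: "y \<in> pdisc N z d" for y
  proof -
    have "y i \<in> X i" for i
    proof (cases "i < N")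
      case True
      then have "y i \<in> ball (z i) (e i)"
        using y d(2)[OF True] by (auto simp: pdisc_def dist_norm norm_minus_commute)
      then show ?thesis using e(2) by blast
    next
      case False
      then have "y i = z i" using y assms(3) by (auto simp: pdisc_def Cn_def)
      then show ?thesis using X(1) by (auto simp: PiE_iff)
    qed
    then show ?thesis by auto
  qed
  then show ?thesis using d(1) X(4) by blast
qed

lemma Cn_open_iff:
  "Cn_open N \<Omega> \<longleftrightarrow> \<Omega> \<subseteq> Cn N \<and> (\<forall>z\<in>\<Omega>. \<exists>d>0. pdisc N z d \<subseteq> \<Omega>)"
proof
  assume l: "Cn_open N \<Omega>"
  then obtain T where T: "open T" "\<Omega> = Cn N \<inter> T"
    by (auto simp: Cn_open_def openin_open)
  show "\<Omega> \<subseteq> Cn N \<and> (\<forall>z\<in>\<Omega>. \<exists>d>0. pdisc N z d \<subseteq> \<Omega>)"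
    using pdisc_nhd[OF T(1)] T(2) pdisc_Cn by blast
next
  assume r: "\<Omega> \<subseteq> Cn N \<and> (\<forall>z\<in>\<Omega>. \<exists>d>0. pdisc N z d \<subseteq> \<Omega>)"
  show "Cn_open N \<Omega>"
    unfolding Cn_open_def
  proof (subst openin_subopen, safe)
    fix z assume z: "z \<in> \<Omega>"
    then obtain d where "d > 0" "pdisc N z d \<subseteq> \<Omega>" using r by blast
    then show "\<exists>T. openin (top_of_set (Cn N)) T \<and> z \<in> T \<and> T \<subseteq> \<Omega>"
      using Cn_open_pdisc[of N z d] centre_in_pdisc z r unfolding Cn_open_def by blast
  qed
qed

lemma Cn_open_Cn: "Cn_open N \<Omega> \<Longrightarrow> \<Omega> \<subseteq> Cn N"
  by (simp add: Cn_open_iff)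

lemma Cn_open_Int: "Cn_open N A \<Longrightarrow> Cn_open N B \<Longrightarrow> Cn_open N (A \<inter> B)"
  unfolding Cn_open_def by blast

text \<open>Gives continuity the epsilon-delta form with polydiscs as balls, in which coordinate
  estimates apply directly.\<close>

lemma continuous_on_Cn:
  fixes f :: "(nat \<Rightarrow> complex) \<Rightarrow> 'b::metric_space"
  assumes "A \<subseteq> Cn N"
  shows "continuous_on A f \<longleftrightarrow>
    (\<forall>z\<in>A. \<forall>e>0. \<exists>d>0. \<forall>y\<in>A \<inter> pdisc N z d. dist (f y) (f z) < e)"
proof
  assume c: "continuous_on A f"
  show "\<forall>z\<in>A. \<forall>e>0. \<exists>d>0. \<forall>y\<in>A \<inter> pdisc N z d. dist (f y) (f z) < e"
  proof (intro ballI allI impI)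
    fix z and e :: real assume z: "z \<in> A" "e > 0"
    then obtain T where T: "open T" "z \<in> T" "\<And>y. y \<in> A \<Longrightarrow> y \<in> T \<Longrightarrow> f y \<in> ball (f z) e"
      using c[unfolded continuous_on_topological, rule_format, OF z(1), of "ball (f z) e"] by auto
    obtain d where "d > 0" "pdisc N z d \<subseteq> T" using pdisc_nhd[OF T(1,2)] assms z by blast
    then show "\<exists>d>0. \<forall>y\<in>A \<inter> pdisc N z d. dist (f y) (f z) < e"
      using T(3) by (intro exI[of _ d]) (auto simp: dist_commute subset_iff)
  qed
next
  assume r: "\<forall>z\<in>A. \<forall>e>0. \<exists>d>0. \<forall>y\<in>A \<inter> pdisc N z d. dist (f y) (f z) < e"
  show "continuous_on A f"
    unfolding continuous_on_topological
  proof (intro ballI allI impI)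
    fix z B assume z: "z \<in> A" "open B" "f z \<in> B"
    then obtain e where e: "e > 0" "ball (f z) e \<subseteq> B" using openE by blast
    obtain d where d: "d > 0" "\<forall>y\<in>A \<inter> pdisc N z d. dist (f y) (f z) < e" using r z e by blast
    have "f y \<in> B" if "y \<in> A" "y \<in> {y. \<forall>i<N. cmod (y i - z i) < d}" for y
    proof -
      have "y \<in> A \<inter> pdisc N z d" using that assms by (auto simp: pdisc_Int)
      then show ?thesis using d(2) e(2) by (auto simp: dist_commute)
    qed
    then show "\<exists>T. open T \<and> z \<in> T \<and> (\<forall>y\<in>A. y \<in> T \<longrightarrow> f y \<in> B)"
      using open_polydisc[of N z d] d(1) by (intro exI[of _ "{y. \<forall>i<N. cmod (y i - z i) < d}"]) auto
  qed
qed

text \<open>Tychonoff: a product of discs in the first \<open>N\<close> factors and of the single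
  point 0 in the remaining ones.\<close>

lemma compact_cpdisc: "compact (cpdisc N z d)"
proof -
  let ?X = "\<lambda>i. if i < N then cball (z i) d else {0}"
  have "compactin (product_topology (\<lambda>i::nat. euclidean :: complex topology) UNIV) (Pi\<^sub>E UNIV ?X)"
    by (subst compactin_PiE) auto
  then have "compact (Pi\<^sub>E UNIV ?X)"
    by (simp add: euclidean_product_topology)
  moreover have "Pi\<^sub>E UNIV ?X = cpdisc N z d"
    by (auto simp: PiE_iff cpdisc_def Cn_def dist_norm norm_minus_commute split: if_splits)
  ultimately show ?thesis by simp
qed

lemma continuous_on_l1norm: "continuous_on S (l1norm N)"
  unfolding l1norm_def[abs_def] by (intro continuous_intros continuous_on_component)

lemma compact_l1sphere: "compact {u \<in> Cn N. l1norm N u = 1}"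
proof -
  have "{u \<in> Cn N. l1norm N u = 1} = cpdisc N (\<lambda>i. 0) 1 \<inter> {u. l1norm N u = 1}"
    by (auto simp: cpdisc_def) (metis component_le_l1norm)
  moreover have "closed {u. l1norm N u = 1}"
    by (intro closed_Collect_eq continuous_on_l1norm) auto
  ultimately show ?thesis using compact_cpdisc by (simp add: compact_Int_closed)
qed

section \<open>Holomorphic functions of several variables\<close>

definition hpart :: "((nat \<Rightarrow> complex) \<Rightarrow> complex) \<Rightarrow> (nat \<Rightarrow> complex) \<Rightarrow> nat \<Rightarrow> complex" where
  "hpart f z i = deriv (\<lambda>w. f (z(i := w))) (z i)"

lemma holo_open_slice_deriv:
  assumes "holo_open N \<Omega> f" "i < N" "y(i := w) \<in> \<Omega>"
  shows "((\<lambda>w. f (y(i := w))) has_field_derivative hpart f (y(i := w)) i) (at w)"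
proof -
  have "(\<lambda>w'. f ((y(i := w))(i := w'))) field_differentiable (at ((y(i := w)) i))"
    using assms unfolding holo_open_def by blast
  then show ?thesis
    unfolding hpart_def by (simp add: DERIV_deriv_iff_field_differentiable)
qed

lemma holo_open_slice:
  assumes "holo_open N \<Omega> f" "pdisc N z d \<subseteq> \<Omega>" "y \<in> pdisc N z d" "i < N"
  shows "(\<lambda>w. f (y(i := w))) holomorphic_on ball (z i) d"
proof -
  have "y(i := w) \<in> \<Omega>" if "w \<in> ball (z i) d" for w
    using that assms pdisc_upd[of y N z d i w] by (auto simp: dist_norm norm_minus_commute)
  then show ?thesis
    unfolding holomorphic_on_def
    using holo_open_slice_deriv[OF assms(1) assms(4)] field_differentiable_at_within
      field_differentiable_def by blast
qed

text \<open>A tube-lemma argument: finitely many neighbourhoods cover the compact disc over which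
  the \<open>i\<close>-th coordinate varies, so one radius serves the whole slice.\<close>

lemma slice_uniformly_close:
  fixes f :: "(nat \<Rightarrow> complex) \<Rightarrow> complex"
  assumes cont: "continuous_on \<Omega> f" and \<Omega>: "Cn_open N \<Omega>" and z: "z \<in> Cn N" and sub: "pdisc N z d \<subseteq> \<Omega>"
    and r: "r < d" and i: "i < N" and e: "0 < e"
  shows "\<exists>\<delta>>0. \<forall>y\<in>pdisc N z \<delta>. \<forall>w\<in>cball (z i) r. cmod (f (y(i := w)) - f (z(i := w))) < e"
proof (cases "0 \<le> r")
  case False
  then show ?thesis by (intro exI[of _ 1]) auto
next
  case True
  have "\<exists>\<delta>>0. \<forall>y\<in>\<Omega> \<inter> pdisc N (z(i := w)) \<delta>. dist (f y) (f (z(i := w))) < e / 2" if "w \<in> cball (z i) r" for w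
  proof -
    have "z(i := w) \<in> \<Omega>"
      using sub pdisc_upd[of z N z d i w] that r z i True
      by (auto simp: centre_in_pdisc dist_norm norm_minus_commute)
    then show ?thesis
      using cont[unfolded continuous_on_Cn[OF Cn_open_Cn[OF \<Omega>]]] e half_gt_zero by blast
  qed
  then obtain \<delta> where \<delta>: "\<And>w. w \<in> cball (z i) r \<Longrightarrow> \<delta> w > 0"
      "\<And>w y. w \<in> cball (z i) r \<Longrightarrow> y \<in> \<Omega> \<inter> pdisc N (z(i := w)) (\<delta> w) \<Longrightarrow> dist (f y) (f (z(i := w))) < e / 2"
    by metis
  have cov: "cball (z i) r \<subseteq> (\<Union>w\<in>cball (z i) r. ball w (\<delta> w))"
    using \<delta>(1) by force
  obtain C where C: "C \<subseteq> cball (z i) r" "finite C" "cball (z i) r \<subseteq> (\<Union>w\<in>C. ball w (\<delta> w))"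
    using compactE_image[OF compact_cball _ cov] by auto
  \<comment> \<open>The entry \<open>d - r\<close> keeps \<open>y\<close> within the polydisc of
    radius \<open>d\<close>.\<close>
  define \<epsilon> where "\<epsilon> = Min (insert (d - r) (\<delta> ` C))"
  have \<epsilon>: "\<epsilon> > 0" "\<epsilon> \<le> d - r" "\<And>w. w \<in> C \<Longrightarrow> \<epsilon> \<le> \<delta> w"
    using C \<delta>(1) r by (auto simp: \<epsilon>_def)
  have "cmod (f (y(i := w)) - f (z(i := w))) < e" if y: "y \<in> pdisc N z \<epsilon>" and w: "w \<in> cball (z i) r" for y w
  proof -
    obtain v where v: "v \<in> C" "w \<in> ball v (\<delta> v)" using C w by auto
    have pv: "z(i := w) \<in> pdisc N (z(i := v)) (\<delta> v)" "y(i := w) \<in> pdisc N (z(i := v)) (\<delta> v)"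
      using z v y \<epsilon>(3)[OF v(1)] \<epsilon>(1) i
      by (auto simp: pdisc_def Cn_def dist_norm norm_minus_commute intro: less_le_trans)
    have p\<Omega>: "z(i := w) \<in> \<Omega>" "y(i := w) \<in> \<Omega>"
    proof -
      have "y \<in> pdisc N z d" "z \<in> pdisc N z d" using y \<epsilon> r True z by (auto simp: pdisc_def intro: less_le_trans)
      then show "z(i := w) \<in> \<Omega>" "y(i := w) \<in> \<Omega>"
        using sub pdisc_upd[of _ N z d i w] w r i by (auto simp: dist_norm norm_minus_commute)
    qed
    have "dist (f (z(i := w))) (f (z(i := v))) < e / 2" "dist (f (y(i := w))) (f (z(i := v))) < e / 2"
      using \<delta>(2)[of v] v(1) C(1) pv p\<Omega> by blast+
    then show ?thesis
      by (metis dist_norm dist_triangle_half_r dist_commute)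
  qed
  then show ?thesis using \<epsilon>(1) by blast
qed

text \<open>Cauchy's inequality bounds the difference of the derivatives of two nearby slices by the
  uniform distance of the slices; along a fixed slice the derivative is holomorphic, hence
  continuous.\<close>

lemma continuous_on_hpart:
  assumes f: "holo_open N \<Omega> f" and \<Omega>: "Cn_open N \<Omega>" and i: "i < N"
  shows "continuous_on \<Omega> (\<lambda>z. hpart f z i)"
  unfolding continuous_on_Cn[OF Cn_open_Cn[OF \<Omega>]]
proof (intro ballI allI impI)
  fix z and e :: real assume z: "z \<in> \<Omega>" and e: "e > 0"
  then obtain d where d: "d > 0" "pdisc N z d \<subseteq> \<Omega>" and zC: "z \<in> Cn N"
    using \<Omega> unfolding Cn_open_iff by blast
  define r where "r = d / 2"
  have r: "0 < r" "r < d" using d by (auto simp: r_def)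
  define g where "g y w = f (y(i := w))" for y w
  have hol: "g y holomorphic_on ball (z i) d" if "y \<in> pdisc N z d" for y
    unfolding g_def by (rule holo_open_slice[OF f d(2) that i])
  have "isCont (deriv (g z)) (z i)"
    using holomorphic_on_imp_differentiable_at[OF holomorphic_deriv[OF hol[OF centre_in_pdisc[OF zC d(1)]] open_ball] open_ball] d(1)
    by (intro field_differentiable_imp_continuous_at) simp
  then obtain \<delta>1 where \<delta>1: "\<delta>1 > 0" "\<And>w. dist w (z i) < \<delta>1 \<Longrightarrow> dist (deriv (g z) w) (deriv (g z) (z i)) < e / 2"
    using e unfolding continuous_at_eps_delta by (metis half_gt_zero)
  \<comment> \<open>Cauchy's inequality on a disc of radius \<open>r / 2\<close> turns
    \<open>e * r / 8\<close> into \<open>e / 4\<close>.\<close>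
  obtain \<delta>2 where \<delta>2: "\<delta>2 > 0" "\<And>y w. y \<in> pdisc N z \<delta>2 \<Longrightarrow> w \<in> cball (z i) r \<Longrightarrow> cmod (g y w - g z w) < e * r / 8"
    using slice_uniformly_close[of \<Omega> f N z d r i "e * r / 8"] f \<Omega> zC d r i e
    unfolding holo_open_def g_def by auto
  define \<delta> where "\<delta> = min (min \<delta>1 \<delta>2) (r / 2)"
  have "dist (hpart f y i) (hpart f z i) < e" if y: "y \<in> \<Omega> \<inter> pdisc N z \<delta>" for y
  proof -
    have yi: "cmod (y i - z i) < \<delta>1" "cmod (y i - z i) < r / 2" "y \<in> pdisc N z \<delta>2" "y \<in> pdisc N z d"
      using y i r by (auto simp: pdisc_def \<delta>_def r_def)
    have sb: "cball (y i) (r / 2) \<subseteq> cball (z i) r" "cball (y i) (r / 2) \<subseteq> ball (z i) d"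
      using yi r by (auto simp: cball_subset_cball_iff cball_subset_ball_iff dist_norm norm_minus_commute)
    have holy: "(\<lambda>w. g y w - g z w) holomorphic_on ball (z i) d"
      using hol[OF yi(4)] hol[OF centre_in_pdisc[OF zC d(1)]] by (intro holomorphic_intros)
    have "cmod ((deriv ^^ 1) (\<lambda>w. g y w - g z w) (y i)) \<le> fact 1 * (e * r / 8) / (r / 2) ^ 1"
    proof (rule Cauchy_inequality)
      show "(\<lambda>w. g y w - g z w) holomorphic_on ball (y i) (r / 2)"
        using holomorphic_on_subset[OF holy] sb ball_subset_cball by blast
      show "continuous_on (cball (y i) (r / 2)) (\<lambda>w. g y w - g z w)"
        using holomorphic_on_imp_continuous_on[OF holy] sb continuous_on_subset by blast
      show "cmod (g y x - g z x) \<le> e * r / 8" if "cmod (y i - x) = r / 2" for x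
        using \<delta>2(2)[OF yi(3), of x] sb(1) that by (force simp: dist_norm)
    qed (use r in auto)
    then have b: "cmod (deriv (\<lambda>w. g y w - g z w) (y i)) \<le> e / 4" using r by simp
    have fd: "g x field_differentiable at (y i)" if "x \<in> pdisc N z d" for x
      using hol[OF that] sb(2) r by (meson centre_in_cball holomorphic_on_imp_differentiable_at
        less_eq_real_def half_gt_zero open_ball subsetD)
    have "deriv (\<lambda>w. g y w - g z w) (y i) = deriv (g y) (y i) - deriv (g z) (y i)"
      using fd[OF yi(4)] fd[OF centre_in_pdisc[OF zC d(1)]] by (rule deriv_diff)
    then have "dist (deriv (g y) (y i)) (deriv (g z) (y i)) < e / 2"
      using b e by (simp add: dist_norm)
    moreover have "dist (deriv (g z) (y i)) (deriv (g z) (z i)) < e / 2"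
      using \<delta>1(2) yi(1) by (simp add: dist_norm)
    ultimately have "dist (deriv (g y) (y i)) (deriv (g z) (z i)) < e"
      using dist_triangle_half_l dist_commute by metis
    then show ?thesis unfolding hpart_def g_def .
  qed
  moreover have "\<delta> > 0" using \<delta>1 \<delta>2 r by (simp add: \<delta>_def)
  ultimately show "\<exists>d>0. \<forall>y\<in>\<Omega> \<inter> pdisc N z d. dist (hpart f y i) (hpart f z i) < e"
    by blast
qed

text \<open>The coordinates of \<open>w\<close> are replaced by those of \<open>y\<close> one after
  the other, with a one-variable mean value bound at each step. The numbers \<open>a i\<close> are
  free: 0 gives a Lipschitz bound, the derivatives at the centre give differentiability.\<close>

lemma polydisc_mean_value:
  assumes f: "holo_open N \<Omega> f" and sub: "pdisc N z d \<subseteq> \<Omega>"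
    and y: "y \<in> pdisc N z d" and w: "w \<in> pdisc N z d"
    and a: "\<And>x i. x \<in> pdisc N z d \<Longrightarrow> i < N \<Longrightarrow> cmod (hpart f x i - a i) \<le> e"
  shows "cmod (f y - f w - (\<Sum>i<N. a i * (y i - w i))) \<le> e * l1norm N (\<lambda>i. y i - w i)"
proof -
  define mix where "mix k = (\<lambda>i. if i < k then y i else w i)" for k :: nat
  have mixin: "mix k \<in> pdisc N z d" for k
    unfolding mix_def by (rule pdisc_mix[OF y w])
  have "cmod (f (mix k) - f w - (\<Sum>i<k. a i * (y i - w i))) \<le> e * (\<Sum>i<k. cmod (y i - w i))" if "k \<le> N" for k
    using that
  proof (induction k)
    case 0
    then show ?case by (simp add: mix_def)
  next
    case (Suc k)
    have kN: "k < N" using Suc.prems by simp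
    have m1: "mix (Suc k) = (mix k)(k := y k)" and m0: "mix k = (mix k)(k := w k)"
      by (auto simp: mix_def fun_eq_iff less_Suc_eq)
    define g where "g v = f ((mix k)(k := v)) - a k * v" for v
    have "cmod (g (y k) - g (w k)) \<le> e * cmod (y k - w k)"
    proof (rule field_differentiable_bound[where S = "ball (z k) d" and f' = "\<lambda>v. hpart f ((mix k)(k := v)) k - a k"])
      show "convex (ball (z k) d)" by simp
      fix v assume v: "v \<in> ball (z k) d"
      have mv: "(mix k)(k := v) \<in> pdisc N z d"
        using pdisc_upd[OF mixin kN, of v] v by (simp add: dist_norm norm_minus_commute)
      then have "((\<lambda>w. f ((mix k)(k := w))) has_field_derivative hpart f ((mix k)(k := v)) k) (at v)"
        using holo_open_slice_deriv[OF f kN, of "mix k" v] sub by blast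
      from DERIV_diff[OF this DERIV_cmult[OF DERIV_ident]]
      have "(g has_field_derivative hpart f ((mix k)(k := v)) k - a k) (at v)"
        unfolding g_def by simp
      then show "(g has_field_derivative hpart f ((mix k)(k := v)) k - a k) (at v within ball (z k) d)"
        by (rule has_field_derivative_at_within)
      show "cmod (hpart f ((mix k)(k := v)) k - a k) \<le> e" by (rule a[OF mv kN])
    next
      have "dist (y k) (z k) < d" "dist (w k) (z k) < d"
        using y w kN unfolding pdisc_def dist_norm by blast+
      then show "y k \<in> ball (z k) d" "w k \<in> ball (z k) d"
        by (simp_all add: dist_commute)
    qed
    moreover have "g (y k) - g (w k) = f (mix (Suc k)) - f (mix k) - a k * (y k - w k)"
      unfolding g_def m1[symmetric] m0[symmetric] by (simp add: algebra_simps)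
    ultimately have st: "cmod (f (mix (Suc k)) - f (mix k) - a k * (y k - w k)) \<le> e * cmod (y k - w k)" by simp
    have "f (mix (Suc k)) - f w - (\<Sum>i<Suc k. a i * (y i - w i)) =
      (f (mix k) - f w - (\<Sum>i<k. a i * (y i - w i))) + (f (mix (Suc k)) - f (mix k) - a k * (y k - w k))"
      by simp
    also have "cmod \<dots> \<le> e * (\<Sum>i<k. cmod (y i - w i)) + e * cmod (y k - w k)"
      using norm_triangle_le[OF add_mono[OF Suc.IH st]] Suc.prems by simp
    finally show ?case by (simp add: algebra_simps)
  qed
  from this[of N] have "cmod (f (mix N) - f w - (\<Sum>i<N. a i * (y i - w i))) \<le> e * l1norm N (\<lambda>i. y i - w i)"
    by (simp add: l1norm_def)
  moreover have "mix N = y"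
    using subsetD[OF pdisc_Cn mixin] subsetD[OF pdisc_Cn y] by (rule Cn_eqI) (simp add: mix_def)
  ultimately show ?thesis by simp
qed

section \<open>Differentiability, Lipschitz bounds and the chain rule\<close>

lemma holo_open_frechet:
  assumes f: "holo_open N \<Omega> f" and \<Omega>: "Cn_open N \<Omega>" and z: "z \<in> \<Omega>" and e: "e > 0"
  shows "\<exists>d>0. \<forall>w\<in>pdisc N z d. cmod (f w - f z - (\<Sum>i<N. hpart f z i * (w i - z i))) \<le> e * l1norm N (\<lambda>i. w i - z i)"
proof -
  have zC: "z \<in> Cn N" using z Cn_open_Cn[OF \<Omega>] by blast
  obtain d0 where d0: "d0 > 0" "pdisc N z d0 \<subseteq> \<Omega>" using z \<Omega> unfolding Cn_open_iff by blast
  have "\<exists>d>0. \<forall>y\<in>\<Omega> \<inter> pdisc N z d. dist (hpart f y i) (hpart f z i) < e" if "i < N" for i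
    using continuous_on_hpart[OF f \<Omega> that] z e unfolding continuous_on_Cn[OF Cn_open_Cn[OF \<Omega>]] by blast
  then obtain dd where dd: "\<And>i. i < N \<Longrightarrow> dd i > 0"
    "\<And>i y. i < N \<Longrightarrow> y \<in> \<Omega> \<inter> pdisc N z (dd i) \<Longrightarrow> dist (hpart f y i) (hpart f z i) < e"
    by metis
  define d where "d = Min (insert d0 (dd ` {..<N}))"
  have d: "d > 0" "d \<le> d0" "\<And>i. i < N \<Longrightarrow> d \<le> dd i"
    using d0 dd(1) by (auto simp: d_def)
  have sub: "pdisc N z d \<subseteq> \<Omega>" using d0 pdisc_mono[OF d(2)] by blast
  have b: "cmod (hpart f x i - hpart f z i) \<le> e" if "x \<in> pdisc N z d" "i < N" for x i
    using dd(2)[OF that(2), of x] that sub pdisc_mono[OF d(3)[OF that(2)]] by (force simp: dist_norm)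
  show ?thesis
    using polydisc_mean_value[OF f sub _ centre_in_pdisc[OF zC d(1)] b] d(1) by blast
qed

text \<open>The partial derivatives are continuous, hence bounded on a compact polydisc; taking
  finitely many functions at once yields a common radius and constant.\<close>

lemma holo_open_locally_lipschitz:
  fixes M :: nat
  assumes f: "\<And>k. k < M \<Longrightarrow> holo_open N \<Omega> (f k)" and \<Omega>: "Cn_open N \<Omega>" and z: "z \<in> \<Omega>"
  shows "\<exists>d>0. \<exists>L>0. pdisc N z d \<subseteq> \<Omega> \<and> (\<forall>k<M. \<forall>x\<in>pdisc N z d. \<forall>i<N. cmod (hpart (f k) x i) \<le> L) \<and>
     (\<forall>k<M. \<forall>y\<in>pdisc N z d. \<forall>w\<in>pdisc N z d. cmod (f k y - f k w) \<le> L * l1norm N (\<lambda>i. y i - w i))"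
proof -
  obtain d0 where d0: "d0 > 0" "pdisc N z d0 \<subseteq> \<Omega>" using z \<Omega> unfolding Cn_open_iff by blast
  define d where "d = d0 / 2"
  have d: "d > 0" "cpdisc N z d \<subseteq> \<Omega>"
    using d0 cpdisc_subset_pdisc[of d d0 N z] by (auto simp: d_def)
  have "\<exists>B. \<forall>x\<in>cpdisc N z d. cmod (hpart (f k) x i) \<le> B" if "i < N" "k < M" for i k
  proof -
    have "compact ((\<lambda>x. hpart (f k) x i) ` cpdisc N z d)"
      using continuous_on_hpart[OF f[OF that(2)] \<Omega> that(1)] d(2)
      by (intro compact_continuous_image compact_cpdisc) (rule continuous_on_subset)
    then show ?thesis using compact_imp_bounded bounded_iff by (metis imageI)
  qed
  then have ex: "\<exists>B. \<forall>x\<in>cpdisc N z d. cmod (hpart (f k) x i) \<le> B" if "i < N" "k < M" for i k using that by blast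
  define B where "B k i = (SOME B. \<forall>x\<in>cpdisc N z d. cmod (hpart (f k) x i) \<le> B)" for k i
  have B: "\<And>i k x. i < N \<Longrightarrow> k < M \<Longrightarrow> x \<in> cpdisc N z d \<Longrightarrow> cmod (hpart (f k) x i) \<le> B k i"
    using someI_ex[OF ex] unfolding B_def by blast
  \<comment> \<open>The summand 1 keeps \<open>L\<close> positive even if there are no functions or
    no variables.\<close>
  define L where "L = 1 + (\<Sum>k<M. \<Sum>i<N. \<bar>B k i\<bar>)"
  have BL: "B k i \<le> L" if "i < N" "k < M" for i k
  proof -
    have "B k i \<le> \<bar>B k i\<bar>" by simp
    also have "\<dots> \<le> (\<Sum>i<N. \<bar>B k i\<bar>)" using that by (intro member_le_sum) auto
    also have "\<dots> \<le> (\<Sum>k<M. \<Sum>i<N. \<bar>B k i\<bar>)"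
      using that by (intro member_le_sum[of k _ "\<lambda>k. \<Sum>i<N. \<bar>B k i\<bar>"]) (auto intro: sum_nonneg)
    finally show ?thesis by (simp add: L_def)
  qed
  have L: "L > 0" unfolding L_def by (intro add_pos_nonneg sum_nonneg) auto
  have hL: "cmod (hpart (f k) x i) \<le> L" if "x \<in> pdisc N z d" "i < N" "k < M" for x i k
    using B[OF that(2,3), of x] BL[OF that(2,3)] that(1) pdisc_subset_cpdisc by (meson order_trans subsetD)
  have sub: "pdisc N z d \<subseteq> \<Omega>" using d pdisc_subset_cpdisc by blast
  have "cmod (f k y - f k w) \<le> L * l1norm N (\<lambda>i. y i - w i)"
    if "k < M" "y \<in> pdisc N z d" "w \<in> pdisc N z d" for k y w
    using polydisc_mean_value[OF f[OF that(1)] sub that(2,3), of "\<lambda>_. 0" L] hL[OF _ _ that(1)] by simp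
  then show ?thesis using d(1) L sub hL by blast
qed

text \<open>The parameter runs through any real normed space, so that one proof covers complex
  derivatives and real ones within an arbitrary set.\<close>

lemma holo_open_chain:
  fixes c :: "'b::real_normed_vector \<Rightarrow> nat \<Rightarrow> complex"
  assumes f: "holo_open N \<Omega> f" and \<Omega>: "Cn_open N \<Omega>" and z: "c s0 \<in> \<Omega>"
    and c: "\<And>i. i < N \<Longrightarrow> ((\<lambda>s. c s i) has_derivative D i) (at s0 within I)"
    and cC: "\<And>s. s \<in> I \<Longrightarrow> c s \<in> Cn N"
  shows "((\<lambda>s. f (c s)) has_derivative (\<lambda>h. \<Sum>i<N. hpart f (c s0) i * D i h)) (at s0 within I)"
  unfolding has_derivative_within_alt
proof (intro conjI allI impI)
  let ?a = "\<lambda>i. hpart f (c s0) i"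
  have bl: "bounded_linear (D i)" if "i < N" for i using c[OF that] has_derivative_bounded_linear by blast
  show "bounded_linear (\<lambda>h. \<Sum>i<N. hpart f (c s0) i * D i h)"
    using bl by (intro bounded_linear_sum bounded_linear_const_mult) auto
  fix e :: real assume e: "e > 0"
  have "\<exists>K. \<forall>h. cmod (D i h) \<le> norm h * K" if "i < N" for i
    using bounded_linear.bounded[OF bl[OF that]] by blast
  then obtain K where K: "\<And>i h. i < N \<Longrightarrow> cmod (D i h) \<le> norm h * K i" by metis
  define B where "B = 1 + (\<Sum>i<N. \<bar>K i\<bar>)"
  have B: "B > 0" "\<And>i h. i < N \<Longrightarrow> cmod (D i h) \<le> norm h * B"
  proof -
    show "B > 0" unfolding B_def by (intro add_pos_nonneg sum_nonneg) auto
    fix i h assume i: "i < N"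
    have "K i \<le> \<bar>K i\<bar>" by simp
    also have "\<dots> \<le> (\<Sum>i<N. \<bar>K i\<bar>)" using i by (intro member_le_sum) auto
    finally have "K i \<le> B" by (simp add: B_def)
    then show "cmod (D i h) \<le> norm h * B" using K[OF i, of h] by (meson mult_left_mono norm_ge_zero order_trans)
  qed
  define A where "A = 1 + (\<Sum>i<N. cmod (?a i))"
  have A: "A > 0" unfolding A_def by (intro add_pos_nonneg sum_nonneg) auto
  \<comment> \<open>With \<open>e1\<close> and \<open>e2\<close> the linearisation errors of
    \<open>f\<close> and of the curve contribute at most half of \<open>e\<close> each.\<close>
  define e1 where "e1 = e / (2 * (real N + 1) * (B + 1))"
  define e2 where "e2 = min 1 (e / (2 * A))"
  have e12: "e1 > 0" "e2 > 0" "e2 \<le> 1" "A * e2 \<le> e / 2" "e1 * (real N * (B + 1)) \<le> e / 2"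
  proof -
    show "e1 > 0" unfolding e1_def using e B(1) by (intro divide_pos_pos mult_pos_pos) auto
    have "e1 * (real N * (B + 1)) = e / 2 * (real N / (real N + 1))"
      unfolding e1_def using B(1) by (simp add: divide_simps)
    also have "\<dots> \<le> e / 2 * 1" using e by (intro mult_left_mono) (auto simp: divide_simps)
    finally show "e1 * (real N * (B + 1)) \<le> e / 2" by simp
    have "A * e2 \<le> A * (e / (2 * A))" using A by (intro mult_left_mono) (auto simp: e2_def)
    then show "A * e2 \<le> e / 2" using A by simp
  qed (use e A in \<open>auto simp: e2_def\<close>)
  obtain d1 where d1: "d1 > 0" "\<And>w. w \<in> pdisc N (c s0) d1 \<Longrightarrow>
      cmod (f w - f (c s0) - (\<Sum>i<N. ?a i * (w i - c s0 i))) \<le> e1 * l1norm N (\<lambda>i. w i - c s0 i)"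
    using holo_open_frechet[OF f \<Omega> z e12(1)] by blast
  have "\<exists>d>0. \<forall>y\<in>I. norm (y - s0) < d \<longrightarrow> cmod (c y i - c s0 i - D i (y - s0)) \<le> e2 * norm (y - s0)" if "i < N" for i
    using c[OF that] e12(2) unfolding has_derivative_within_alt by blast
  then obtain dd where dd: "\<And>i. i < N \<Longrightarrow> dd i > 0"
    "\<And>i y. i < N \<Longrightarrow> y \<in> I \<Longrightarrow> norm (y - s0) < dd i \<Longrightarrow> cmod (c y i - c s0 i - D i (y - s0)) \<le> e2 * norm (y - s0)"
    by metis
  define d where "d = Min (insert (d1 / (B + 1)) (dd ` {..<N}))"
  have d: "d > 0" "d \<le> d1 / (B + 1)" "\<And>i. i < N \<Longrightarrow> d \<le> dd i"
    using d1 dd(1) B by (auto simp: d_def)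
  have "cmod (f (c y) - f (c s0) - (\<Sum>i<N. ?a i * D i (y - s0))) \<le> e * norm (y - s0)"
    if y: "y \<in> I" "norm (y - s0) < d" for y
  proof -
    define n where "n = norm (y - s0)"
    have r: "cmod (c y i - c s0 i - D i (y - s0)) \<le> e2 * n" if "i < N" for i
      unfolding n_def using dd(2)[OF that y(1)] y(2) d(3)[OF that] by simp
    have ci: "cmod (c y i - c s0 i) \<le> (B + 1) * n" if "i < N" for i
    proof -
      have "cmod (c y i - c s0 i) \<le> cmod (c y i - c s0 i - D i (y - s0)) + cmod (D i (y - s0))"
        by (metis diff_add_cancel norm_triangle_ineq)
      also have "\<dots> \<le> e2 * n + n * B" using r[OF that] B(2)[OF that, of "y - s0"] by (simp add: n_def)
      also have "\<dots> \<le> (B + 1) * n"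
        using e12(3) mult_right_mono[of e2 1 n] by (simp add: n_def algebra_simps)
      finally show ?thesis .
    qed
    have "(B + 1) * n < (B + 1) * d" using y(2) B(1) by (intro mult_strict_left_mono) (auto simp: n_def)
    also have "\<dots> \<le> d1" using d(2) B(1) by (simp add: field_simps)
    finally have "(B + 1) * n < d1" .
    then have cin: "c y \<in> pdisc N (c s0) d1" using ci cC[OF y(1)] by (force simp: pdisc_def)
    have "cmod (f (c y) - f (c s0) - (\<Sum>i<N. ?a i * (c y i - c s0 i))) \<le> e1 * l1norm N (\<lambda>i. c y i - c s0 i)"
      by (rule d1(2)[OF cin])
    also have "\<dots> \<le> e1 * (real N * ((B + 1) * n))"
      using l1norm_le[OF ci] e12(1) by (intro mult_left_mono) auto
    also have "\<dots> \<le> e / 2 * n"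
      using mult_right_mono[OF e12(5), of n] by (simp add: n_def mult.assoc)
    finally have t1: "cmod (f (c y) - f (c s0) - (\<Sum>i<N. ?a i * (c y i - c s0 i))) \<le> e / 2 * n" .
    have "cmod (\<Sum>i<N. ?a i * (c y i - c s0 i - D i (y - s0))) \<le> (\<Sum>i<N. cmod (?a i) * (e2 * n))"
      by (intro sum_norm_le) (auto simp: norm_mult intro!: mult_left_mono r)
    also have "\<dots> = (A - 1) * e2 * n" by (simp add: A_def sum_distrib_right mult.assoc)
    also have "\<dots> \<le> A * e2 * n" using e12 by (intro mult_right_mono) (auto simp: n_def)
    also have "\<dots> \<le> e / 2 * n" using mult_right_mono[OF e12(4), of n] by (simp add: n_def)
    finally have t2: "cmod (\<Sum>i<N. ?a i * (c y i - c s0 i - D i (y - s0))) \<le> e / 2 * n" .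
    have "f (c y) - f (c s0) - (\<Sum>i<N. ?a i * D i (y - s0)) =
      (f (c y) - f (c s0) - (\<Sum>i<N. ?a i * (c y i - c s0 i))) + (\<Sum>i<N. ?a i * (c y i - c s0 i - D i (y - s0)))"
      by (simp add: algebra_simps sum_subtractf sum.distrib)
    then show ?thesis using norm_triangle_le[OF add_mono[OF t1 t2]] by (simp add: n_def field_simps)
  qed
  then show "\<exists>d>0. \<forall>y\<in>I. norm (y - s0) < d \<longrightarrow>
      cmod (f (c y) - f (c s0) - (\<Sum>i<N. ?a i * D i (y - s0))) \<le> e * norm (y - s0)"
    using d(1) by blast
qed

section \<open>Holomorphic functions on open sets as sections of the structure sheaf\<close>

lemma hpart_cong:
  assumes "Cn_open N \<Omega>" "z \<in> \<Omega>" "\<And>y. y \<in> \<Omega> \<Longrightarrow> f y = g y" "i < N"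
  shows "hpart f z i = hpart g z i"
proof -
  obtain d where d: "d > 0" "pdisc N z d \<subseteq> \<Omega>" "z \<in> Cn N" using assms unfolding Cn_open_iff by blast
  have "\<forall>\<^sub>F w in nhds (z i). w \<in> ball (z i) d"
    using d by (intro eventually_nhds_in_open) auto
  then have "\<forall>\<^sub>F w in nhds (z i). f (z(i := w)) = g (z(i := w))"
  proof eventually_elim
    case (elim w)
    then have "z(i := w) \<in> pdisc N z d"
      using pdisc_upd[of z N z d i w] d assms(4) centre_in_pdisc by (simp add: dist_norm norm_minus_commute)
    then show ?case using assms(3) d by blast
  qed
  then show ?thesis unfolding hpart_def by (rule deriv_cong_ev) simp
qed

text \<open>Both sides are local conditions: near each point \<open>f\<close> agrees with its local
  extension on a full polydisc, so continuity and derivatives carry over.\<close>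

lemma holo_iff_open:
  assumes A: "Cn_open N A"
  shows "f \<in> holo N A \<longleftrightarrow> holo_open N A f"
proof
  assume "holo_open N A f"
  then show "f \<in> holo N A" unfolding holo_def using A by blast
next
  assume f: "f \<in> holo N A"
  have loc: "\<exists>d>0. \<exists>g \<Omega>. pdisc N z d \<subseteq> A \<and> pdisc N z d \<subseteq> \<Omega> \<and> holo_open N \<Omega> g \<and> (\<forall>y\<in>pdisc N z d. f y = g y)" if z: "z \<in> A" for z
  proof -
    obtain \<Omega> g where \<Omega>: "Cn_open N \<Omega>" "z \<in> \<Omega>" "holo_open N \<Omega> g" "\<forall>y\<in>A \<inter> \<Omega>. f y = g y"
      using f z unfolding holo_def by blast
    then obtain d where "d > 0" "pdisc N z d \<subseteq> A \<inter> \<Omega>"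
      using Cn_open_Int[OF A \<Omega>(1)] z unfolding Cn_open_iff by blast
    then show ?thesis using \<Omega> by blast
  qed
  show "holo_open N A f"
    unfolding holo_open_def
  proof (intro conjI ballI allI impI)
    show "continuous_on A f"
      unfolding continuous_on_Cn[OF Cn_open_Cn[OF A]]
    proof (intro ballI allI impI)
      fix z and e :: real assume z: "z \<in> A" "e > 0"
      obtain d g \<Omega> where d: "d > 0" "pdisc N z d \<subseteq> \<Omega>" "holo_open N \<Omega> g" "\<forall>y\<in>pdisc N z d. f y = g y"
        using loc[OF z(1)] by blast
      have zC: "z \<in> Cn N" using z A Cn_open_Cn by blast
      have "continuous_on (pdisc N z d) g" using d(2,3) continuous_on_subset unfolding holo_open_def by blast
      then obtain d' where d': "d' > 0" "\<forall>y\<in>pdisc N z d \<inter> pdisc N z d'. dist (g y) (g z) < e"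
        unfolding continuous_on_Cn[OF pdisc_Cn] using z(2) centre_in_pdisc[OF zC d(1)] by blast
      show "\<exists>d>0. \<forall>y\<in>A \<inter> pdisc N z d. dist (f y) (f z) < e"
        using d(1,4) d' centre_in_pdisc[OF zC d(1)]
        by (intro exI[of _ "min d d'"]) (auto simp: pdisc_def)
    qed
    fix z i assume z: "z \<in> A" and i: "i < N"
    obtain d g \<Omega> where d: "d > 0" "pdisc N z d \<subseteq> \<Omega>" "holo_open N \<Omega> g" "\<forall>y\<in>pdisc N z d. f y = g y"
      using loc[OF z(1)] by blast
    have zC: "z \<in> Cn N" using z A Cn_open_Cn by blast
    have "(\<lambda>w. g (z(i := w))) holomorphic_on ball (z i) d"
      by (rule holo_open_slice[OF d(3,2) centre_in_pdisc[OF zC d(1)] i])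
    moreover have "g (z(i := w)) = f (z(i := w))" if "w \<in> ball (z i) d" for w
      using d(4) pdisc_upd[OF centre_in_pdisc[OF zC d(1)] i, of w] that
      by (simp add: dist_norm norm_minus_commute)
    ultimately have "(\<lambda>w. f (z(i := w))) holomorphic_on ball (z i) d"
      by (rule holomorphic_transform)
    then show "(\<lambda>w. f (z(i := w))) field_differentiable at (z i)"
      using d(1) by (meson centre_in_ball holomorphic_on_imp_differentiable_at open_ball)
  qed
qed

lemma holo_open_subset: "holo_open N \<Omega> f \<Longrightarrow> \<Omega>' \<subseteq> \<Omega> \<Longrightarrow> holo_open N \<Omega>' f"
  unfolding holo_open_def using continuous_on_subset by blast

lemma holo_open_const: "holo_open N \<Omega> (\<lambda>z. c)"
  by (simp add: holo_open_def)

lemma holo_open_component: "holo_open N \<Omega> (\<lambda>z. z i)"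
  unfolding holo_open_def
proof (intro conjI ballI allI impI)
  fix z :: "nat \<Rightarrow> complex" and j :: nat
  show "(\<lambda>w. (z(j := w)) i) field_differentiable at (z j)"
    by (cases "i = j") auto
qed (rule continuous_on_component)

lemma holo_open_add: "holo_open N \<Omega> f \<Longrightarrow> holo_open N \<Omega> g \<Longrightarrow> holo_open N \<Omega> (\<lambda>z. f z + g z)"
  unfolding holo_open_def by (auto intro!: continuous_intros derivative_intros)

lemma holo_open_mult: "holo_open N \<Omega> f \<Longrightarrow> holo_open N \<Omega> g \<Longrightarrow> holo_open N \<Omega> (\<lambda>z. f z * g z)"
  unfolding holo_open_def by (auto intro!: continuous_intros derivative_intros)

lemma holo_open_sum:
  "(\<And>i. i \<in> A \<Longrightarrow> holo_open N \<Omega> (f i)) \<Longrightarrow> holo_open N \<Omega> (\<lambda>z. \<Sum>i\<in>A. f i z)"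
  by (induction A rule: infinite_finite_induct) (auto intro: holo_open_const holo_open_add)

lemma holo_open_cong:
  assumes "Cn_open N \<Omega>" "\<And>z. z \<in> \<Omega> \<Longrightarrow> f z = g z" "holo_open N \<Omega> f"
  shows "holo_open N \<Omega> g"
proof -
  have "f \<in> holo N \<Omega>" using assms holo_iff_open by blast
  then have "g \<in> holo N \<Omega>" using assms(2) unfolding holo_def by fastforce
  then show ?thesis using assms holo_iff_open by blast
qed

lemma holo_open_chain_field:
  assumes "holo_open N \<Omega> f" "Cn_open N \<Omega>" "c s0 \<in> \<Omega>"
    and "\<And>i. i < N \<Longrightarrow> ((\<lambda>s. c s i) has_field_derivative D i) (at s0 within I)"
    and "\<And>s. s \<in> I \<Longrightarrow> c s \<in> Cn N"
  shows "((\<lambda>s. f (c s)) has_field_derivative (\<Sum>i<N. hpart f (c s0) i * D i)) (at s0 within I)"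
proof -
  have "((\<lambda>s. f (c s)) has_derivative (\<lambda>h. \<Sum>i<N. hpart f (c s0) i * (D i * h))) (at s0 within I)"
    using assms unfolding has_field_derivative_def by (intro holo_open_chain[of N \<Omega>]) auto
  moreover have "(\<lambda>h. \<Sum>i<N. hpart f (c s0) i * (D i * h)) = (*) (\<Sum>i<N. hpart f (c s0) i * D i)"
    by (simp add: fun_eq_iff sum_distrib_right mult.assoc)
  ultimately show ?thesis unfolding has_field_derivative_def by simp
qed

lemma holo_open_chain_vector:
  assumes "holo_open N \<Omega> f" "Cn_open N \<Omega>" "c s0 \<in> \<Omega>"
    and "\<And>i. i < N \<Longrightarrow> ((\<lambda>s. c s i) has_vector_derivative D i) (at s0 within I)"
    and "\<And>s. s \<in> I \<Longrightarrow> c s \<in> Cn N"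
  shows "((\<lambda>s. f (c s)) has_vector_derivative (\<Sum>i<N. hpart f (c s0) i * D i)) (at s0 within I)"
proof -
  have "((\<lambda>s. f (c s)) has_derivative (\<lambda>h. \<Sum>i<N. hpart f (c s0) i * (h *\<^sub>R D i))) (at s0 within I)"
    using assms unfolding has_vector_derivative_def by (intro holo_open_chain[of N \<Omega>]) auto
  moreover have "(\<lambda>h. \<Sum>i<N. hpart f (c s0) i * (h *\<^sub>R D i)) = (\<lambda>h. h *\<^sub>R (\<Sum>i<N. hpart f (c s0) i * D i))"
    by (simp add: fun_eq_iff scaleR_sum_right)
  ultimately show ?thesis unfolding has_vector_derivative_def by simp
qed

section \<open>Holomorphic maps and their differentials\<close>

definition holo_map :: "nat \<Rightarrow> nat \<Rightarrow> (nat \<Rightarrow> complex) set \<Rightarrow> ((nat \<Rightarrow> complex) \<Rightarrow> (nat \<Rightarrow> complex)) \<Rightarrow> bool" where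
  "holo_map N M \<Omega> F \<longleftrightarrow> Cn_open N \<Omega> \<and> (\<forall>i. holo_open N \<Omega> (\<lambda>z. F z i)) \<and> F ` \<Omega> \<subseteq> Cn M"

lemma holo_mapD:
  assumes "holo_map N M \<Omega> F"
  shows "Cn_open N \<Omega>" "\<And>i. holo_open N \<Omega> (\<lambda>z. F z i)" "\<And>z. z \<in> \<Omega> \<Longrightarrow> F z \<in> Cn M"
  using assms unfolding holo_map_def by auto

lemma holo_map_continuous: "holo_map N M \<Omega> F \<Longrightarrow> continuous_on \<Omega> F"
  unfolding holo_map_def holo_open_def by (intro continuous_on_coordinatewise_then_product) auto

lemma holo_map_subset: "holo_map N M \<Omega> F \<Longrightarrow> Cn_open N \<Omega>' \<Longrightarrow> \<Omega>' \<subseteq> \<Omega> \<Longrightarrow> holo_map N M \<Omega>' F"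
  unfolding holo_map_def using holo_open_subset by blast

lemma holo_map_cong:
  assumes "holo_map N M \<Omega> F" "\<And>z. z \<in> \<Omega> \<Longrightarrow> F z = G z"
  shows "holo_map N M \<Omega> G"
  using assms holo_open_cong[of N \<Omega> "\<lambda>z. F z _" "\<lambda>z. G z _"] unfolding holo_map_def by fastforce

lemma holo_map_preimage_open:
  assumes "holo_map N M \<Omega> F" "Cn_open M \<Omega>'"
  shows "Cn_open N {z \<in> \<Omega>. F z \<in> \<Omega>'}"
proof -
  obtain T where T: "open T" "\<Omega>' = Cn M \<inter> T"
    using assms(2) by (auto simp: Cn_open_def openin_open)
  have "openin (top_of_set \<Omega>) (\<Omega> \<inter> F -` T)"
    using continuous_openin_preimage_gen[OF holo_map_continuous[OF assms(1)] T(1)] .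
  moreover have "\<Omega> \<inter> F -` T = {z \<in> \<Omega>. F z \<in> \<Omega>'}"
    using T(2) holo_mapD(3)[OF assms(1)] by auto
  ultimately show ?thesis
    using holo_mapD(1)[OF assms(1)] unfolding Cn_open_def by (metis openin_trans)
qed

lemma Cn_open_slice:
  assumes "Cn_open N \<Omega>" "z \<in> \<Omega>" "j < N"
  shows "\<exists>d>0. \<forall>w\<in>ball (z j) d. z(j := w) \<in> \<Omega>"
proof -
  obtain d where d: "d > 0" "pdisc N z d \<subseteq> \<Omega>" "z \<in> Cn N" using assms unfolding Cn_open_iff by blast
  then show ?thesis
    using pdisc_upd[OF centre_in_pdisc[OF d(3,1)] assms(3)]
    by (intro exI[of _ d]) (auto simp: dist_norm norm_minus_commute)
qed

lemma holo_open_compose: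
  assumes f: "holo_open N \<Omega> f" and \<Omega>: "Cn_open N \<Omega>" and F: "holo_map M N \<Omega>' F" and sub: "F ` \<Omega>' \<subseteq> \<Omega>"
  shows "holo_open M \<Omega>' (\<lambda>z. f (F z))"
    and "\<And>z j. z \<in> \<Omega>' \<Longrightarrow> j < M \<Longrightarrow> hpart (\<lambda>z. f (F z)) z j = (\<Sum>i<N. hpart f (F z) i * hpart (\<lambda>z. F z i) z j)"
proof -
  have der: "((\<lambda>w. f (F (z(j := w)))) has_field_derivative (\<Sum>i<N. hpart f (F z) i * hpart (\<lambda>z. F z i) z j)) (at (z j))"
    if z: "z \<in> \<Omega>'" and j: "j < M" for z j
  proof -
    obtain d where d: "d > 0" "\<forall>w\<in>ball (z j) d. z(j := w) \<in> \<Omega>'"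
      using Cn_open_slice[OF holo_mapD(1)[OF F] z j] by blast
    have "((\<lambda>w. f (F (z(j := w)))) has_field_derivative
        (\<Sum>i<N. hpart f (F (z(j := z j))) i * hpart (\<lambda>z. F z i) z j)) (at (z j) within ball (z j) d)"
    proof (rule holo_open_chain_field[OF f \<Omega>])
      show "F (z(j := z j)) \<in> \<Omega>" using z sub by auto
      show "F (z(j := w)) \<in> Cn N" if "w \<in> ball (z j) d" for w
        using d(2) that holo_mapD(3)[OF F] by blast
      show "((\<lambda>w. F (z(j := w)) i) has_field_derivative hpart (\<lambda>z. F z i) z j) (at (z j) within ball (z j) d)" for i
        using holo_open_slice_deriv[OF holo_mapD(2)[OF F] j, of z "z j"] z
        by (simp add: has_field_derivative_at_within)
    qed
    then show ?thesis using d(1) by (simp add: at_within_open[of _ "ball (z j) d"])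
  qed
  show "holo_open M \<Omega>' (\<lambda>z. f (F z))"
    unfolding holo_open_def
  proof (intro conjI ballI allI impI)
    show "continuous_on \<Omega>' (\<lambda>z. f (F z))"
      using continuous_on_compose2[OF _ holo_map_continuous[OF F] sub] f unfolding holo_open_def by blast
    show "(\<lambda>w. f (F (z(j := w)))) field_differentiable at (z j)" if "z \<in> \<Omega>'" "j < M" for z j
      using der[OF that] field_differentiable_def by blast
  qed
  show "hpart (\<lambda>z. f (F z)) z j = (\<Sum>i<N. hpart f (F z) i * hpart (\<lambda>z. F z i) z j)" if "z \<in> \<Omega>'" "j < M" for z j
    unfolding hpart_def using DERIV_imp_deriv[OF der[OF that]] by (simp add: hpart_def)
qed

lemma holo_map_compose:
  assumes "holo_map N K \<Omega> G" "holo_map M N \<Omega>' F" "F ` \<Omega>' \<subseteq> \<Omega>"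
  shows "holo_map M K \<Omega>' (\<lambda>z. G (F z))"
  using holo_open_compose(1)[OF holo_mapD(2)[OF assms(1)] holo_mapD(1)[OF assms(1)] assms(2,3)]
    holo_mapD(1)[OF assms(2)] holo_mapD(3)[OF assms(1)] assms(3)
  unfolding holo_map_def by blast

lemma holo_map_id: "Cn_open N \<Omega> \<Longrightarrow> holo_map N N \<Omega> (\<lambda>z. z)"
  unfolding holo_map_def using holo_open_component Cn_open_Cn by auto

lemma ddir_holo:
  assumes f: "holo_open N \<Omega> f" and \<Omega>: "Cn_open N \<Omega>" and z: "z \<in> \<Omega>" and u: "u \<in> Cn N"
  shows "ddir f z u = (\<Sum>i<N. hpart f z i * u i)"
proof -
  have zC: "z \<in> Cn N" using z Cn_open_Cn[OF \<Omega>] by blast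
  have "((\<lambda>t::real. f (ray z u t)) has_vector_derivative (\<Sum>i<N. hpart f (ray z u 0) i * u i)) (at 0)"
  proof (rule holo_open_chain_vector[OF f \<Omega>])
    show "ray z u 0 \<in> \<Omega>" using z by (simp add: ray_def lcomb_def)
    show "ray z u s \<in> Cn N" for s unfolding ray_def using zC u by simp
    show "((\<lambda>s. ray z u s i) has_vector_derivative u i) (at 0)" for i
      unfolding ray_def lcomb_def by (auto intro!: derivative_eq_intros)
  qed
  moreover have "ray z u 0 = z" by (simp add: ray_def lcomb_def)
  ultimately show ?thesis unfolding ddir_def by (simp add: vector_derivative_at)
qed

lemma dmap_holo:
  assumes F: "holo_map N M \<Omega> F" and z: "z \<in> \<Omega>" and u: "u \<in> Cn N"
  shows "dmap F z u = (\<lambda>i. \<Sum>j<N. hpart (\<lambda>z. F z i) z j * u j)"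
  unfolding dmap_def using ddir_holo[OF holo_mapD(2,1)[OF F] z u] by simp

text \<open>Components of \<open>F\<close> beyond \<open>M\<close> vanish identically near the
  point, so their partial derivatives vanish too.\<close>

lemma dmap_Cn:
  assumes F: "holo_map N M \<Omega> F" and z: "z \<in> \<Omega>" and u: "u \<in> Cn N"
  shows "dmap F z u \<in> Cn M"
  unfolding Cn_def
proof (intro CollectI allI impI)
  fix i assume i: "M \<le> i"
  have "hpart (\<lambda>z. F z i) z j = hpart (\<lambda>z. 0) z j" if "j < N" for j
    using holo_mapD(3)[OF F] i by (intro hpart_cong[OF holo_mapD(1)[OF F] z _ that]) (auto simp: Cn_def)
  moreover have "hpart (\<lambda>z. 0) z j = 0" for j by (simp add: hpart_def)
  ultimately show "dmap F z u i = 0" unfolding dmap_holo[OF F z u] by simp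
qed

lemma dmap_Jmul:
  assumes "holo_map N M \<Omega> F" "z \<in> \<Omega>" "u \<in> Cn N"
  shows "dmap F z (Jmul u) = Jmul (dmap F z u)"
  unfolding dmap_holo[OF assms] dmap_holo[OF assms(1,2) Cn_Jmul[OF assms(3)]]
  by (auto simp: Jmul_def sum_distrib_left fun_eq_iff intro!: sum.cong)

lemma dmap_compose:
  assumes G: "holo_map N K \<Omega> G" and F: "holo_map M N \<Omega>' F" and sub: "F ` \<Omega>' \<subseteq> \<Omega>" and z: "z \<in> \<Omega>'" and u: "u \<in> Cn M"
  shows "dmap (\<lambda>z. G (F z)) z u = dmap G (F z) (dmap F z u)"
proof -
  have Fz: "F z \<in> \<Omega>" using sub z by blast
  have "dmap (\<lambda>z. G (F z)) z u i = dmap G (F z) (dmap F z u) i" for i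
  proof -
    have "dmap (\<lambda>z. G (F z)) z u i = (\<Sum>j<M. (\<Sum>k<N. hpart (\<lambda>z. G z i) (F z) k * hpart (\<lambda>z. F z k) z j) * u j)"
      unfolding dmap_holo[OF holo_map_compose[OF G F sub] z u]
      using holo_open_compose(2)[OF holo_mapD(2,1)[OF G] F sub z] by simp
    also have "\<dots> = (\<Sum>k<N. hpart (\<lambda>z. G z i) (F z) k * (\<Sum>j<M. hpart (\<lambda>z. F z k) z j * u j))"
      unfolding sum_distrib_left sum_distrib_right by (subst sum.swap) (simp add: mult.assoc)
    also have "\<dots> = dmap G (F z) (dmap F z u) i"
      by (subst dmap_holo[OF G Fz dmap_Cn[OF F z u]]) (simp add: dmap_holo[OF F z u])
    finally show ?thesis .
  qed
  then show ?thesis by (rule ext)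
qed

text \<open>The differential depends only on values near the point. This matters because maps built
  with \<open>inv_into\<close> are meaningful only on the image of a chart.\<close>

lemma dmap_cong:
  assumes F: "holo_map N M \<Omega> F" and eq: "\<And>z. z \<in> \<Omega> \<Longrightarrow> F z = G z" and z: "z \<in> \<Omega>" and u: "u \<in> Cn N"
  shows "dmap F z u = dmap G z u"
proof -
  have "hpart (\<lambda>z. F z i) z j = hpart (\<lambda>z. G z i) z j" if "j < N" for i j
    using eq by (intro hpart_cong[OF holo_mapD(1)[OF F] z _ that]) auto
  moreover have "holo_map N M \<Omega> G" using F eq by (rule holo_map_cong)
  ultimately show ?thesis using dmap_holo[OF F z u] dmap_holo[of N M \<Omega> G, OF _ z u] by simp
qed

lemma dmap_id:
  assumes "z \<in> Cn N" "u \<in> Cn N"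
  shows "dmap (\<lambda>z. z) z u = u"
proof -
  have "((\<lambda>t::real. ray z u t i) has_vector_derivative u i) (at 0)" for i
    unfolding ray_def lcomb_def by (auto intro!: derivative_eq_intros)
  from vector_derivative_at[OF this] show ?thesis unfolding dmap_def ddir_def by simp
qed

lemma dmap_curve:
  assumes F: "holo_map N M \<Omega> F" and z: "c t \<in> \<Omega>" and D: "D \<in> Cn N"
    and c: "\<And>i. i < N \<Longrightarrow> ((\<lambda>s. c s i) has_vector_derivative D i) (at t within I)"
    and cC: "\<And>s. s \<in> I \<Longrightarrow> c s \<in> Cn N"
  shows "((\<lambda>s. F (c s) i) has_vector_derivative dmap F (c t) D i) (at t within I)"
  using holo_open_chain_vector[OF holo_mapD(2,1)[OF F] z c cC, of i]
  unfolding dmap_holo[OF F z D] .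

lemma l1norm_dmap_le:
  assumes F: "holo_map N M \<Omega> F" and z: "z \<in> \<Omega>" and u: "u \<in> Cn N"
    and L: "\<And>i j. i < M \<Longrightarrow> j < N \<Longrightarrow> cmod (hpart (\<lambda>z. F z i) z j) \<le> L"
  shows "l1norm M (dmap F z u) \<le> real M * L * l1norm N u"
proof -
  have "cmod (dmap F z u i) \<le> L * l1norm N u" if "i < M" for i
  proof -
    have "cmod (dmap F z u i) \<le> (\<Sum>j<N. L * cmod (u j))"
      unfolding dmap_holo[OF F z u] using L[OF that]
      by (intro sum_norm_le) (auto simp: norm_mult intro!: mult_right_mono)
    then show ?thesis by (simp add: l1norm_def sum_distrib_left)
  qed
  from l1norm_le[OF this] show ?thesis by (simp add: mult.assoc)
qed

lemma continuous_on_dmap: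
  assumes F: "holo_map N M \<Omega> F" and u: "u \<in> Cn N"
  shows "continuous_on \<Omega> (\<lambda>z. dmap F z u)"
proof -
  have "continuous_on \<Omega> (\<lambda>z i. \<Sum>j<N. hpart (\<lambda>z. F z i) z j * u j)"
    by (intro continuous_on_coordinatewise_then_product continuous_intros
        continuous_on_hpart[OF holo_mapD(2,1)[OF F]]) auto
  then show ?thesis by (rule continuous_on_eq) (simp add: dmap_holo[OF F _ u])
qed

section \<open>Estimates for Kaehler forms\<close>

lemma kaehler_formD:
  assumes "kaehler_form N \<Omega> \<eta>"
  shows "\<And>u v. u \<in> Cn N \<Longrightarrow> v \<in> Cn N \<Longrightarrow> continuous_on \<Omega> (\<lambda>z. \<eta> z u v)"
    and "\<And>z u v w a b. z \<in> \<Omega> \<Longrightarrow> u \<in> Cn N \<Longrightarrow> v \<in> Cn N \<Longrightarrow> w \<in> Cn N \<Longrightarrow>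
        \<eta> z (lcomb (of_real a) u (of_real b) v) w = a * \<eta> z u w + b * \<eta> z v w"
    and "\<And>z u v. z \<in> \<Omega> \<Longrightarrow> u \<in> Cn N \<Longrightarrow> v \<in> Cn N \<Longrightarrow> \<eta> z u v = - \<eta> z v u"
    and "\<And>z u. z \<in> \<Omega> \<Longrightarrow> u \<in> Cn N \<Longrightarrow> u \<noteq> (\<lambda>i. 0) \<Longrightarrow> \<eta> z u (Jmul u) > 0"
proof -
  have s: "\<And>u v. u \<in> Cn N \<Longrightarrow> v \<in> Cn N \<Longrightarrow> smooth_fun N \<Omega> (\<lambda>z. \<eta> z u v)"
    using assms unfolding kaehler_form_def by blast
  show "\<And>u v. u \<in> Cn N \<Longrightarrow> v \<in> Cn N \<Longrightarrow> continuous_on \<Omega> (\<lambda>z. \<eta> z u v)"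
    using s unfolding smooth_fun_def by (metis Ck.simps(1))
qed (use assms in \<open>unfold kaehler_form_def, blast+\<close>)

lemma kaehler_form_zero:
  assumes "kaehler_form N \<Omega> \<eta>" "z \<in> \<Omega>" "v \<in> Cn N"
  shows "\<eta> z (\<lambda>i. 0) v = 0"
  using kaehler_formD(2)[OF assms(1,2) Cn_zero Cn_zero assms(3), of 0 0] by (simp add: lcomb_def)

lemma kaehler_form_sum:
  assumes \<eta>: "kaehler_form N \<Omega> \<eta>" and z: "z \<in> \<Omega>" and v: "v \<in> Cn N" and A: "finite A"
    and b: "\<And>k. k \<in> A \<Longrightarrow> b k \<in> Cn N"
  shows "\<eta> z (\<lambda>i. \<Sum>k\<in>A. of_real (r k) * b k i) v = (\<Sum>k\<in>A. r k * \<eta> z (b k) v)"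
  using A b
proof (induction A)
  case empty
  then show ?case using kaehler_form_zero[OF \<eta> z v] by simp
next
  case (insert k A)
  have c: "(\<lambda>i. \<Sum>k\<in>A. of_real (r k) * b k i) \<in> Cn N"
    using insert.prems by (auto simp: Cn_def)
  have "(\<lambda>i. \<Sum>k\<in>insert k A. of_real (r k) * b k i) = lcomb (of_real (r k)) (b k) (of_real 1) (\<lambda>i. \<Sum>k\<in>A. of_real (r k) * b k i)"
    using insert.hyps by (simp add: lcomb_def)
  then show ?case
    using kaehler_formD(2)[OF \<eta> z insert.prems[of k] c v, of "r k" 1] insert by simp
qed

text \<open>The real basis of complex \<open>N\<close>-space: the index \<open>(j, 1)\<close> gives
  the \<open>j\<close>-th unit vector and \<open>(j, \<i>)\<close> its multiple by
  \<open>\<i>\<close>.\<close>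

definition rbasis :: "nat \<times> complex \<Rightarrow> nat \<Rightarrow> complex" where
  "rbasis k = (\<lambda>i. if i = fst k then snd k else 0)"

definition rcoord :: "(nat \<Rightarrow> complex) \<Rightarrow> nat \<times> complex \<Rightarrow> real" where
  "rcoord u k = (if snd k = 1 then Re (u (fst k)) else Im (u (fst k)))"

lemma rbasis_expansion:
  assumes "u \<in> Cn N"
  shows "u = (\<lambda>i. \<Sum>k\<in>{..<N} \<times> {1, \<i>}. of_real (rcoord u k) * rbasis k i)"
proof
  fix i
  have ne: "(1::complex) \<noteq> \<i>" "\<i> \<noteq> (1::complex)" by (auto simp: complex_eq_iff)
  have "(\<Sum>k\<in>{..<N} \<times> {1, \<i>}. of_real (rcoord u k) * rbasis k i) =
     (\<Sum>j<N. \<Sum>c\<in>{1, \<i>}. of_real (rcoord u (j, c)) * rbasis (j, c) i)"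
    by (subst sum.cartesian_product) (rule sum.cong, auto)
  also have "\<dots> = (\<Sum>j<N. if j = i then u i else 0)"
    using ne by (intro sum.cong) (auto simp: rcoord_def rbasis_def complex_eq_iff)
  also have "\<dots> = u i" using assms by (auto simp: Cn_def)
  finally show "u i = (\<Sum>k\<in>{..<N} \<times> {1, \<i>}. of_real (rcoord u k) * rbasis k i)" by simp
qed

lemma rbasis_Cn: "k \<in> {..<N} \<times> {1, \<i>} \<Longrightarrow> rbasis k \<in> Cn N"
  by (auto simp: rbasis_def Cn_def)

lemma kaehler_form_expansion:
  assumes \<eta>: "kaehler_form N \<Omega> \<eta>" and z: "z \<in> \<Omega>" and u: "u \<in> Cn N" and v: "v \<in> Cn N"
  shows "\<eta> z u v = (\<Sum>k\<in>{..<N} \<times> {1, \<i>}. \<Sum>l\<in>{..<N} \<times> {1, \<i>}. rcoord u k * rcoord v l * \<eta> z (rbasis k) (rbasis l))"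
proof -
  have 1: "\<eta> z u w = (\<Sum>k\<in>{..<N} \<times> {1, \<i>}. rcoord u k * \<eta> z (rbasis k) w)" if "u \<in> Cn N" "w \<in> Cn N" for u w
    by (subst rbasis_expansion[OF that(1)], rule kaehler_form_sum[OF \<eta> z that(2)]) (auto intro: rbasis_Cn)
  have 2: "\<eta> z (rbasis k) v = (\<Sum>l\<in>{..<N} \<times> {1, \<i>}. rcoord v l * \<eta> z (rbasis k) (rbasis l))"
    if k: "k \<in> {..<N} \<times> {1, \<i>}" for k
  proof -
    have "\<eta> z (rbasis k) v = - (\<Sum>l\<in>{..<N} \<times> {1, \<i>}. rcoord v l * \<eta> z (rbasis l) (rbasis k))"
      using kaehler_formD(3)[OF \<eta> z rbasis_Cn[OF k] v] 1[OF v rbasis_Cn[OF k]] by simp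
    also have "\<dots> = (\<Sum>l\<in>{..<N} \<times> {1, \<i>}. rcoord v l * \<eta> z (rbasis k) (rbasis l))"
      unfolding sum_negf[symmetric]
      using kaehler_formD(3)[OF \<eta> z rbasis_Cn rbasis_Cn[OF k]] by (intro sum.cong) (auto simp del: mult_minus_right)
    finally show ?thesis .
  qed
  show ?thesis unfolding 1[OF u v] by (intro sum.cong refl) (simp add: 2 sum_distrib_left mult.assoc)
qed

text \<open>The definition of a Kaehler form gives regularity in the point for each fixed pair of
  vectors; expanding in a finite real basis yields the joint continuity on which the compactness
  bounds rest.\<close>

lemma continuous_on_kaehler_form:
  assumes \<eta>: "kaehler_form N \<Omega> \<eta>"
    and c: "continuous_on S c" "c ` S \<subseteq> \<Omega>" and u: "continuous_on S u" "u ` S \<subseteq> Cn N"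
  shows "continuous_on S (\<lambda>t. \<eta> (c t) (u t) (Jmul (u t)))"
proof -
  have cr: "continuous_on S (\<lambda>t. rcoord (v t) k)" if "continuous_on S v" for v k
    unfolding rcoord_def using continuous_on_product_then_coordinatewise[OF that, of "fst k"]
    by (cases "snd k = 1") (simp_all add: continuous_on_Re continuous_on_Im)
  have cJ: "continuous_on S (\<lambda>t. Jmul (u t))"
    unfolding Jmul_def using continuous_on_product_then_coordinatewise[OF u(1)]
    by (intro continuous_on_coordinatewise_then_product continuous_intros)
  have ce: "continuous_on S (\<lambda>t. \<eta> (c t) (rbasis k) (rbasis l))"
    if "k \<in> {..<N} \<times> {1, \<i>}" "l \<in> {..<N} \<times> {1, \<i>}" for k l
    using continuous_on_compose2[OF kaehler_formD(1)[OF \<eta> rbasis_Cn[OF that(1)] rbasis_Cn[OF that(2)]] c] .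
  have "continuous_on S (\<lambda>t. \<Sum>k\<in>{..<N} \<times> {1, \<i>}. \<Sum>l\<in>{..<N} \<times> {1, \<i>}.
      rcoord (u t) k * rcoord (Jmul (u t)) l * \<eta> (c t) (rbasis k) (rbasis l))"
    by (intro continuous_intros cr u(1) cJ ce)
  then show ?thesis
    by (rule continuous_on_eq) (use kaehler_form_expansion[OF \<eta>] c(2) u(2) in \<open>auto simp: image_subset_iff\<close>)
qed

lemma kaehler_form_scale:
  assumes \<eta>: "kaehler_form N \<Omega> \<eta>" and z: "z \<in> \<Omega>" and u: "u \<in> Cn N"
  shows "\<eta> z (\<lambda>i. of_real a * u i) (Jmul (\<lambda>i. of_real a * u i)) = a\<^sup>2 * \<eta> z u (Jmul u)"
proof -
  have s: "\<eta> z (\<lambda>i. of_real a * w i) v = a * \<eta> z w v" if "w \<in> Cn N" "v \<in> Cn N" for w v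
    using kaehler_formD(2)[OF \<eta> z that(1) that(1) that(2), of a 0] by (simp add: lcomb_def)
  have c: "(\<lambda>i. of_real a * w i) \<in> Cn N" if "w \<in> Cn N" for w using that by (simp add: Cn_def)
  have J: "Jmul (\<lambda>i. of_real a * u i) = (\<lambda>i. of_real a * Jmul u i)" by (simp add: Jmul_def mult.left_commute)
  have "\<eta> z (\<lambda>i. of_real a * u i) (\<lambda>i. of_real a * Jmul u i) = a * \<eta> z u (\<lambda>i. of_real a * Jmul u i)"
    by (rule s[OF u c]) (simp add: u)
  also have "\<eta> z u (\<lambda>i. of_real a * Jmul u i) = - \<eta> z (\<lambda>i. of_real a * Jmul u i) u"
    by (rule kaehler_formD(3)[OF \<eta> z u c]) (simp add: u)
  also have "\<eta> z (\<lambda>i. of_real a * Jmul u i) u = a * \<eta> z (Jmul u) u"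
    by (rule s) (simp_all add: u)
  also have "\<eta> z (Jmul u) u = - \<eta> z u (Jmul u)"
    by (rule kaehler_formD(3)[OF \<eta> z]) (simp_all add: u)
  finally show ?thesis by (simp add: J power2_eq_square mult.assoc)
qed

lemma kaehler_form_nonneg:
  assumes "kaehler_form N \<Omega> \<eta>" "z \<in> \<Omega>" "u \<in> Cn N"
  shows "0 \<le> \<eta> z u (Jmul u)"
  using kaehler_formD(4)[OF assms] kaehler_form_zero[OF assms(1,2) Cn_Jmul[OF Cn_zero]] less_imp_le
  by (cases "u = (\<lambda>i. 0)") auto

text \<open>Positivity and joint continuity on the product of \<open>C\<close> with the compact unit
  sphere give bounds for unit vectors; homogeneity of degree 2 does the rest.\<close>

lemma kaehler_form_bounds:
  assumes \<eta>: "kaehler_form N \<Omega> \<eta>" and C: "compact C" "C \<subseteq> \<Omega>"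
  shows "\<exists>m>0. \<exists>M>0. \<forall>z\<in>C. \<forall>u\<in>Cn N. m * (l1norm N u)\<^sup>2 \<le> \<eta> z u (Jmul u) \<and> \<eta> z u (Jmul u) \<le> M * (l1norm N u)\<^sup>2"
proof -
  let ?S = "C \<times> {u \<in> Cn N. l1norm N u = 1}"
  let ?q = "\<lambda>x. \<eta> (fst x) (snd x) (Jmul (snd x))"
  have comp: "compact ?S" using C(1) compact_l1sphere by (rule compact_Times)
  have cont: "continuous_on ?S ?q"
    using C(2) by (intro continuous_on_kaehler_form[OF \<eta>] continuous_intros) auto
  have pos: "?q x > 0" if "x \<in> ?S" for x
    using that C(2) by (intro kaehler_formD(4)[OF \<eta>]) (auto simp: l1norm_def)
  have "\<exists>m>0. \<exists>M>0. \<forall>x\<in>?S. m \<le> ?q x \<and> ?q x \<le> M"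
  proof (cases "?S = {}")
    \<comment> \<open>The sphere is empty for \<open>N = 0\<close>, and \<open>C\<close> itself may
      be empty.\<close>
    case True
    then have "\<forall>x\<in>?S. 1 \<le> ?q x \<and> ?q x \<le> 1" by (metis empty_iff)
    then show ?thesis using zero_less_one by blast
  next
    case False
    obtain x where x: "x \<in> ?S" "\<forall>y\<in>?S. ?q x \<le> ?q y" using continuous_attains_inf[OF comp False cont] by blast
    obtain y where y: "y \<in> ?S" "\<forall>x\<in>?S. ?q x \<le> ?q y" using continuous_attains_sup[OF comp False cont] by blast
    show ?thesis using pos[OF x(1)] pos[OF y(1)] x y by blast
  qed
  then obtain m M where mM: "m > 0" "M > 0" "\<And>z u. z \<in> C \<Longrightarrow> u \<in> Cn N \<Longrightarrow> l1norm N u = 1 \<Longrightarrow>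
      m \<le> \<eta> z u (Jmul u) \<and> \<eta> z u (Jmul u) \<le> M"
    by fastforce
  have "m * (l1norm N u)\<^sup>2 \<le> \<eta> z u (Jmul u) \<and> \<eta> z u (Jmul u) \<le> M * (l1norm N u)\<^sup>2"
    if z: "z \<in> C" and u: "u \<in> Cn N" for z u
  proof (cases "l1norm N u = 0")
    case True
    then have "u = (\<lambda>i. 0)" using l1norm_eq_0_Cn[OF u] by simp
    moreover have "\<eta> z (\<lambda>i. 0) (Jmul (\<lambda>i. 0)) = 0"
      using kaehler_form_zero[OF \<eta>, of z "Jmul (\<lambda>i. 0)"] z C(2) by auto
    ultimately show ?thesis by (simp add: l1norm_def)
  next
    case False
    define a where "a = l1norm N u"
    have a: "a > 0" using False l1norm_nonneg[of N u] unfolding a_def by linarith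
    define v where "v = (\<lambda>i. of_real (1 / a) * u i)"
    have vC: "v \<in> Cn N" using u by (simp add: v_def Cn_def)
    have "l1norm N v = 1" unfolding v_def l1norm_mult using a by (simp add: a_def[symmetric] norm_divide)
    note b = mM(3)[OF z vC this]
    have "u = (\<lambda>i. of_real a * v i)" using a by (simp add: v_def fun_eq_iff)
    then have "\<eta> z u (Jmul u) = a\<^sup>2 * \<eta> z v (Jmul v)"
      using kaehler_form_scale[OF \<eta> _ vC, of z a] z C(2) by auto
    then show ?thesis using b a unfolding a_def[symmetric] by (simp add: mult.commute)
  qed
  then show ?thesis using mM(1,2) by blast
qed

section \<open>Local embeddings and charts\<close>

lemma holo_cong: "(\<And>y. y \<in> A \<Longrightarrow> f y = g y) \<Longrightarrow> f \<in> holo N A \<longleftrightarrow> g \<in> holo N A"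
  unfolding holo_def by auto

lemma component_in_holo: "A \<subseteq> Cn N \<Longrightarrow> (\<lambda>z. z i) \<in> holo N A"
  unfolding holo_def using holo_open_component[of N "Cn N" i]
  by (auto simp: Cn_open_def intro!: exI[of _ "Cn N"] exI[of _ "\<lambda>z. z i"])

lemma local_embeddingD:
  assumes le: "local_embedding X \<O> N U \<phi>"
  shows "openin X U" "U \<subseteq> topspace X" "inj_on \<phi> U" "\<phi> ` U \<subseteq> Cn N"
    "homeomorphic_map (subtopology X U) (top_of_set (\<phi> ` U)) \<phi>"
    "\<And>W f. openin X W \<Longrightarrow> W \<subseteq> U \<Longrightarrow> f \<in> \<O> W \<longleftrightarrow> f \<circ> inv_into U \<phi> \<in> holo N (\<phi> ` W)"
proof -
  show o: "openin X U" and h: "homeomorphic_map (subtopology X U) (top_of_set (\<phi> ` U)) \<phi>"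
    using le unfolding local_embedding_def by auto
  show t: "U \<subseteq> topspace X" using o by (rule openin_subset)
  have "topspace X \<inter> U = U" using t by blast
  then show "inj_on \<phi> U" using homeomorphic_imp_injective_map[OF h] by simp
  show "\<phi> ` U \<subseteq> Cn N"
    using le Cn_open_Cn unfolding local_embedding_def analytic_subset_def by fastforce
  show "\<And>W f. openin X W \<Longrightarrow> W \<subseteq> U \<Longrightarrow> f \<in> \<O> W \<longleftrightarrow> f \<circ> inv_into U \<phi> \<in> holo N (\<phi> ` W)"
    using le unfolding local_embedding_def by auto
qed

lemma local_embedding_continuous:
  assumes le: "local_embedding X \<O> N U \<phi>"
  shows "continuous_map (subtopology X U) euclidean \<phi>"
  using homeomorphic_imp_continuous_map[OF local_embeddingD(5)[OF le]]
  by (simp add: continuous_map_in_subtopology)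

lemma local_embedding_preimage_open:
  assumes le: "local_embedding X \<O> N U \<phi>" and "open T"
  shows "openin X {x \<in> U. \<phi> x \<in> T}"
proof -
  have "openin (subtopology X U) {x \<in> topspace (subtopology X U). \<phi> x \<in> T}"
    using openin_continuous_map_preimage[OF local_embedding_continuous[OF le]] assms(2) by simp
  moreover have "{x \<in> topspace (subtopology X U). \<phi> x \<in> T} = {x \<in> U. \<phi> x \<in> T}"
    using local_embeddingD(2)[OF le] by auto
  ultimately show ?thesis using openin_trans_full[OF _ local_embeddingD(1)[OF le]] by simp
qed

lemma local_embedding_image_open:
  assumes le: "local_embedding X \<O> N U \<phi>" and W: "openin X W" "W \<subseteq> U"
  shows "openin (top_of_set (\<phi> ` U)) (\<phi> ` W)"
proof -
  have "openin (subtopology X U) W" using W openin_subset_topspace_eq by (simp add: openin_open_subtopology local_embeddingD(1)[OF le])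
  then show ?thesis
    using homeomorphic_imp_open_map[OF local_embeddingD(5)[OF le]] unfolding open_map_def by blast
qed

lemma local_embedding_inv: "local_embedding X \<O> N U \<phi> \<Longrightarrow> x \<in> U \<Longrightarrow> inv_into U \<phi> (\<phi> x) = x"
  using inv_into_f_f[OF local_embeddingD(3)] .

lemma local_embedding_component:
  assumes le: "local_embedding X \<O> N U \<phi>"
  shows "(\<lambda>x. \<phi> x i) \<in> \<O> U"
proof -
  have "(\<lambda>x. \<phi> x i) \<circ> inv_into U \<phi> \<in> holo N (\<phi> ` U) \<longleftrightarrow> (\<lambda>z. z i) \<in> holo N (\<phi> ` U)"
    by (rule holo_cong) (auto simp: f_inv_into_f)
  then show ?thesis
    using local_embeddingD(6)[OF le local_embeddingD(1)[OF le] order_refl]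
      component_in_holo[OF local_embeddingD(4)[OF le]] by blast
qed

lemma holo_chartD:
  assumes "holo_chart X \<O> N U \<phi>"
  shows "local_embedding X \<O> N U \<phi>" "Cn_open N (\<phi> ` U)"
  using assms unfolding holo_chart_def by auto

lemma holo_chart_image_open:
  assumes "holo_chart X \<O> N U \<phi>" "openin X W" "W \<subseteq> U"
  shows "Cn_open N (\<phi> ` W)"
  using local_embedding_image_open[OF holo_chartD(1)[OF assms(1)] assms(2,3)] holo_chartD(2)[OF assms(1)]
  unfolding Cn_open_def by (metis openin_trans)

locale complex_space =
  fixes X :: "'a topology" and \<O> :: "'a set \<Rightarrow> ('a \<Rightarrow> complex) set"
  assumes reduced: "reduced_complex_space X \<O>"
begin

lemma Hausdorff: "Hausdorff_space X"
  using reduced unfolding reduced_complex_space_def by blast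

lemma sections_restrict: "openin X U \<Longrightarrow> openin X W \<Longrightarrow> W \<subseteq> U \<Longrightarrow> f \<in> \<O> U \<Longrightarrow> f \<in> \<O> W"
  using reduced unfolding reduced_complex_space_def by blast

lemma ex_local_embedding: "x \<in> topspace X \<Longrightarrow> \<exists>N U \<phi>. local_embedding X \<O> N U \<phi> \<and> x \<in> U"
  using reduced unfolding reduced_complex_space_def by blast

text \<open>The coordinates of an embedding are sections of \<open>\<O>\<close>, and in a chart
  sections are exactly the holomorphic functions on an open set.\<close>

lemma chart_to_embedding:
  assumes ch: "holo_chart X \<O> m W \<phi>" and le: "local_embedding X \<O> N U \<iota>"
  shows "holo_map m N (\<phi> ` (W \<inter> U)) (\<lambda>z. \<iota> (inv_into W \<phi> z))"
proof -
  have o: "openin X (W \<inter> U)" using local_embeddingD(1)[OF holo_chartD(1)[OF ch]] local_embeddingD(1)[OF le] by blast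
  have op: "Cn_open m (\<phi> ` (W \<inter> U))" by (rule holo_chart_image_open[OF ch o]) simp
  have "(\<lambda>x. \<iota> x i) \<circ> inv_into W \<phi> \<in> holo m (\<phi> ` (W \<inter> U))" for i
  proof -
    have "(\<lambda>x. \<iota> x i) \<in> \<O> (W \<inter> U)"
      using sections_restrict[OF local_embeddingD(1)[OF le] o _ local_embedding_component[OF le]] by blast
    then show ?thesis using local_embeddingD(6)[OF holo_chartD(1)[OF ch] o] by simp
  qed
  then have "holo_open m (\<phi> ` (W \<inter> U)) (\<lambda>z. \<iota> (inv_into W \<phi> z) i)" for i
    unfolding holo_iff_open[OF op] comp_def .
  moreover have "\<iota> (inv_into W \<phi> z) \<in> Cn N" if "z \<in> \<phi> ` (W \<inter> U)" for z
    using that local_embedding_inv[OF holo_chartD(1)[OF ch]] local_embeddingD(4)[OF le] by auto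
  ultimately show ?thesis using op unfolding holo_map_def by blast
qed

end

section \<open>Quasi-etale Galois covers\<close>

lemma coverD:
  assumes "quasi_etale_galois_cover X \<O> n V U p"
  shows "Cn_open n V" "openin X U" "p ` V = U" "continuous_map (top_of_set V) X p"
    "closed_map (top_of_set V) (subtopology X U) p" "\<And>x. x \<in> U \<Longrightarrow> finite {z \<in> V. p z = x}"
    "\<And>W f. openin X W \<Longrightarrow> W \<subseteq> U \<Longrightarrow> f \<in> \<O> W \<longleftrightarrow> f \<circ> p \<in> holo n {z \<in> V. p z \<in> W}"
    "quasi_etale X \<O> n p V"
  using assms unfolding quasi_etale_galois_cover_def
  by (auto simp: continuous_map_in_subtopology proper_map_def)

lemma cover_preimage_open:
  assumes cov: "quasi_etale_galois_cover X \<O> n V U p" and "openin X W"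
  shows "Cn_open n {z \<in> V. p z \<in> W}"
  using openin_continuous_map_preimage[OF coverD(4)[OF cov] assms(2)] coverD(1)[OF cov]
  unfolding Cn_open_def by (auto intro: openin_trans)

text \<open>For a cover the sections are the functions with holomorphic pull-back; this is applied
  to the coordinates of the embedding.\<close>

lemma (in complex_space) cover_to_embedding:
  assumes cov: "quasi_etale_galois_cover X \<O> n V U p" and le: "local_embedding X \<O> N U1 \<iota>"
  shows "holo_map n N {z \<in> V. p z \<in> U1} (\<lambda>z. \<iota> (p z))"
proof -
  have o: "openin X (U \<inter> U1)" using coverD(2)[OF cov] local_embeddingD(1)[OF le] by blast
  have eq: "{z \<in> V. p z \<in> U1} = {z \<in> V. p z \<in> U \<inter> U1}" using coverD(3)[OF cov] by blast
  have op: "Cn_open n {z \<in> V. p z \<in> U1}" by (rule cover_preimage_open[OF cov local_embeddingD(1)[OF le]])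
  have "(\<lambda>x. \<iota> x i) \<circ> p \<in> holo n {z \<in> V. p z \<in> U1}" for i
  proof -
    have "(\<lambda>x. \<iota> x i) \<in> \<O> (U \<inter> U1)"
      using sections_restrict[OF local_embeddingD(1)[OF le] o _ local_embedding_component[OF le]] by blast
    then show ?thesis using coverD(7)[OF cov o] unfolding eq by simp
  qed
  then have "holo_open n {z \<in> V. p z \<in> U1} (\<lambda>z. \<iota> (p z) i)" for i
    unfolding holo_iff_open[OF op] comp_def .
  then show ?thesis using op local_embeddingD(4)[OF le] unfolding holo_map_def by blast
qed

text \<open>An open subset of coordinate space inside \<open>Z\<close> is itself a chart of
  \<open>Z\<close>, so it contributes \<open>n\<close> to the dimensions of \<open>Z\<close>. A
  branch locus of smaller dimension therefore contains no such set.\<close>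

lemma open_subset_regular_dims:
  assumes B: "Cn_open n B" "B \<noteq> {}" and BZ: "B \<subseteq> Z" and Z: "Z \<subseteq> Cn n"
  shows "n \<in> regular_dims (top_of_set Z) (holo n)"
proof -
  have oB: "openin (top_of_set Z) B"
    using B(1) BZ Z unfolding Cn_open_def by (metis openin_subset_trans)
  have inv: "inv_into B (\<lambda>x. x) y = y" if "y \<in> B" for y using that by (metis f_inv_into_f image_ident)
  have "local_embedding (top_of_set Z) (holo n) n B (\<lambda>x. x)"
    unfolding local_embedding_def
  proof (intro conjI allI impI oB)
    show "\<exists>\<Omega>. Cn_open n \<Omega> \<and> analytic_subset (top_of_set \<Omega>) (holo n) ((\<lambda>x. x) ` B)"
    proof (intro exI[of _ B] conjI B(1))
      have "openin (top_of_set B) B \<and> x \<in> B \<and> finite {} \<and> {} \<subseteq> holo n B \<and> B \<inter> B = {y \<in> B. \<forall>f\<in>{}. f y = 0}"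
        if "x \<in> B" for x using that by auto
      then show "analytic_subset (top_of_set B) (holo n) ((\<lambda>x. x) ` B)"
        unfolding analytic_subset_def image_ident topspace_euclidean_subtopology by blast
    qed
    have "Z \<inter> B = B" using BZ by blast
    then show "homeomorphic_map (subtopology (top_of_set Z) B) (top_of_set ((\<lambda>x. x) ` B)) (\<lambda>x. x)"
      using homeomorphic_map_id[of "top_of_set B" "top_of_set B"] by (simp add: subtopology_subtopology id_def)
    fix W f assume "openin (top_of_set Z) W \<and> W \<subseteq> B"
    then show "f \<in> holo n W \<longleftrightarrow> f \<circ> inv_into B (\<lambda>x. x) \<in> holo n ((\<lambda>x. x) ` W)"
      using inv by (simp, intro holo_cong) auto
  qed
  then show ?thesis
    using B unfolding regular_dims_def holo_chart_def by (auto intro!: exI[of _ B] exI[of _ "\<lambda>x. x"])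
qed

lemma etale_at_regular:
  assumes "etale_at X \<O> n p V z"
  shows "p z \<in> regular_locus X \<O>"
proof -
  obtain V' where "z \<in> V'" "holo_chart X \<O> n (p ` V') (inv_into V' p)"
    using assms unfolding etale_at_def by blast
  then show ?thesis unfolding regular_locus_def by blast
qed

text \<open>The codimension condition is turned into absence of interior points, the form in which
  it yields density of the etale points.\<close>

lemma quasi_etale_locus:
  assumes qe: "quasi_etale X \<O> n p V" and V: "Cn_open n V"
  obtains Z where "analytic_subset (top_of_set V) (holo n) Z" "\<And>z. z \<in> V - Z \<Longrightarrow> etale_at X \<O> n p V z"
    "\<And>B. Cn_open n B \<Longrightarrow> B \<noteq> {} \<Longrightarrow> \<not> B \<subseteq> Z"
proof -
  obtain Z where Z: "analytic_subset (top_of_set V) (holo n) Z" "\<forall>m\<in>regular_dims (top_of_set Z) (holo n). m + 2 \<le> n"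
    "\<forall>z\<in>V - Z. etale_at X \<O> n p V z"
    using qe unfolding quasi_etale_def by blast
  have "Z \<subseteq> Cn n" using Z(1) Cn_open_Cn[OF V] unfolding analytic_subset_def by auto
  have "\<not> B \<subseteq> Z" if "Cn_open n B" "B \<noteq> {}" for B
  proof
    assume "B \<subseteq> Z"
    then have "n + 2 \<le> n" using open_subset_regular_dims[OF that _ \<open>Z \<subseteq> Cn n\<close>] Z(2) by blast
    then show False by simp
  qed
  then show thesis using that[OF Z(1)] Z(3) by blast
qed

lemma etale_dense:
  assumes cov: "quasi_etale_galois_cover X \<O> n V U p" and B: "Cn_open n B" "B \<noteq> {}" "B \<subseteq> V"
  shows "\<exists>z\<in>B. etale_at X \<O> n p V z"
proof -
  obtain Z where "\<And>z. z \<in> V - Z \<Longrightarrow> etale_at X \<O> n p V z" "\<And>B. Cn_open n B \<Longrightarrow> B \<noteq> {} \<Longrightarrow> \<not> B \<subseteq> Z"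
    using quasi_etale_locus[OF coverD(8,1)[OF cov]] by metis
  then show ?thesis using B by blast
qed

text \<open>The Jacobians of mutually inverse maps are inverse matrices; the traces of their two
  products are \<open>m\<close> and \<open>N\<close>, and the trace does not depend on the order of
  the factors.\<close>

lemma holo_map_inverse_dim:
  assumes F: "holo_map m N A F" and G: "holo_map N m B G" and FA: "F ` A \<subseteq> B" and GB: "G ` B \<subseteq> A"
    and GF: "\<And>z. z \<in> A \<Longrightarrow> G (F z) = z" and FG: "\<And>w. w \<in> B \<Longrightarrow> F (G w) = w" and z: "z \<in> A"
  shows "m = N"
proof -
  let ?a = "\<lambda>i j. hpart (\<lambda>z. F z i) z j" and ?b = "\<lambda>i j. hpart (\<lambda>w. G w i) (F z) j"
  have Fz: "F z \<in> B" using FA z by blast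
  have hid: "hpart (\<lambda>z. z i) z' j = (if i = j then 1 else 0)" for i j and z' :: "nat \<Rightarrow> complex"
    unfolding hpart_def by (cases "i = j") auto
  have 1: "(\<Sum>k<N. ?b i k * ?a k i) = 1" if i: "i < m" for i
  proof -
    have "(\<Sum>k<N. ?b i k * ?a k i) = hpart (\<lambda>z. G (F z) i) z i"
      using holo_open_compose(2)[OF holo_mapD(2,1)[OF G] F FA z i, of i] by simp
    also have "\<dots> = hpart (\<lambda>z. z i) z i"
      using GF by (intro hpart_cong[OF holo_mapD(1)[OF F] z _ i]) simp
    finally show ?thesis using hid by simp
  qed
  have 2: "(\<Sum>k<m. ?a i k * ?b k i) = 1" if i: "i < N" for i
  proof -
    have "(\<Sum>k<m. hpart (\<lambda>z. F z i) (G (F z)) k * ?b k i) = hpart (\<lambda>w. F (G w) i) (F z) i"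
      using holo_open_compose(2)[OF holo_mapD(2,1)[OF F] G GB Fz i, of i] by simp
    also have "\<dots> = hpart (\<lambda>z. z i) (F z) i"
      using FG by (intro hpart_cong[OF holo_mapD(1)[OF G] Fz _ i]) simp
    finally show ?thesis using hid GF[OF z] by simp
  qed
  have "of_nat m = (\<Sum>i<m. \<Sum>k<N. ?b i k * ?a k i)" using 1 by simp
  also have "\<dots> = (\<Sum>k<N. \<Sum>i<m. ?a k i * ?b i k)" by (subst sum.swap) (simp add: mult.commute)
  also have "\<dots> = of_nat N" using 2 by simp
  finally show ?thesis by (simp only: of_nat_eq_iff)
qed

section \<open>Dimension of charts and density of regular points\<close>

locale orbifold = complex_space X \<O> for X :: "'a topology" and \<O> +
  fixes n :: nat
  assumes orbifold: "complex_orbifold n X \<O>"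
begin

lemma ex_cover: "x \<in> topspace X \<Longrightarrow> \<exists>V U p. x \<in> U \<and> quasi_etale_galois_cover X \<O> n V U p"
  using orbifold unfolding complex_orbifold_def by blast

lemma etale_point_in_open:
  assumes x: "x \<in> T" and T: "openin X T" and cov: "quasi_etale_galois_cover X \<O> n V U p" and xU: "x \<in> U"
  shows "\<exists>z. etale_at X \<O> n p V z \<and> z \<in> V \<and> p z \<in> T"
proof -
  have "{z \<in> V. p z \<in> T} \<noteq> {}" using coverD(3)[OF cov] x xU by blast
  from etale_dense[OF cov cover_preimage_open[OF cov T] this] show ?thesis by blast
qed

lemma regular_dense:
  assumes "openin X T" "x \<in> T"
  shows "\<exists>y\<in>T. y \<in> regular_locus X \<O>"
proof -
  obtain V U p where "x \<in> U" "quasi_etale_galois_cover X \<O> n V U p"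
    using ex_cover openin_subset[OF assms(1)] assms(2) by blast
  then show ?thesis using etale_point_in_open[OF assms(2,1)] etale_at_regular by blast
qed

text \<open>The regular locus admits charts of any dimension, whereas forms are given in
  \<open>n\<close>-dimensional ones. The open set \<open>W\<close> contains the image of an etale
  point, around which there is an \<open>n\<close>-dimensional chart, and the transition to it is
  biholomorphic.\<close>

lemma chart_dim:
  assumes ch: "holo_chart X \<O> N W \<psi>" and x: "x \<in> W"
  shows "N = n"
proof -
  note leW = holo_chartD(1)[OF ch]
  obtain V U p where cov: "x \<in> U" "quasi_etale_galois_cover X \<O> n V U p"
    using ex_cover local_embeddingD(2)[OF leW] x by blast
  obtain z where z: "etale_at X \<O> n p V z" "p z \<in> W"
    using etale_point_in_open[OF x local_embeddingD(1)[OF leW] cov(2,1)] by blast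
  then obtain V' where V': "z \<in> V'" "inj_on p V'" "holo_chart X \<O> n (p ` V') (inv_into V' p)"
    unfolding etale_at_def by blast
  let ?P = "p ` V'" and ?q = "inv_into V' p"
  note leP = holo_chartD(1)[OF V'(3)]
  have "n = N"
  proof (rule holo_map_inverse_dim)
    show "holo_map n N (?q ` (?P \<inter> W)) (\<lambda>z. \<psi> (inv_into ?P ?q z))" by (rule chart_to_embedding[OF V'(3) leW])
    show "holo_map N n (\<psi> ` (W \<inter> ?P)) (\<lambda>z. ?q (inv_into W \<psi> z))" by (rule chart_to_embedding[OF ch leP])
    show "?q (p z) \<in> ?q ` (?P \<inter> W)" using V'(1) z(2) by blast
  qed (auto simp: local_embedding_inv[OF leP] local_embedding_inv[OF leW])
  then show ?thesis by simp
qed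

lemma regular_chart:
  assumes "x \<in> regular_locus X \<O>"
  shows "\<exists>U \<phi>. holo_chart X \<O> n U \<phi> \<and> x \<in> U"
proof -
  obtain N U \<phi> where ch: "holo_chart X \<O> N U \<phi>" "x \<in> U"
    using assms unfolding regular_locus_def by blast
  then show ?thesis using chart_dim[OF ch] by blast
qed

lemma regular_subset: "regular_locus X \<O> \<subseteq> topspace X"
  unfolding regular_locus_def using local_embeddingD(2)[OF holo_chartD(1)] by blast

end

section \<open>Velocity and speed of paths\<close>

definition vel :: "('a \<Rightarrow> nat \<Rightarrow> complex) \<Rightarrow> (real \<Rightarrow> 'a) \<Rightarrow> real \<Rightarrow> nat \<Rightarrow> complex" where
  "vel \<phi> \<gamma> t = (\<lambda>i. vector_derivative (\<lambda>s. \<phi> (\<gamma> s) i) (at t))"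

text \<open>Everything that \<open>speed\<close> needs at one parameter: continuity there and
  differentiability in charts. Unlike admissibility it is preserved by any reparametrisation that is
  differentiable at the parameter.\<close>

definition chart_diff ::
    "nat \<Rightarrow> 'a topology \<Rightarrow> ('a set \<Rightarrow> ('a \<Rightarrow> complex) set) \<Rightarrow> (real \<Rightarrow> 'a) \<Rightarrow> real \<Rightarrow> bool" where
  "chart_diff n X \<O> \<gamma> t \<longleftrightarrow>
     (\<forall>W. openin X W \<and> \<gamma> t \<in> W \<longrightarrow> (\<forall>\<^sub>F s in nhds t. \<gamma> s \<in> W)) \<and>
     (\<forall>U \<phi> i. holo_chart X \<O> n U \<phi> \<and> \<gamma> t \<in> U \<longrightarrow> (\<lambda>s. \<phi> (\<gamma> s) i) differentiable (at t))"

lemma chart_diff_eventually: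
  "chart_diff n X \<O> \<gamma> t \<Longrightarrow> openin X W \<Longrightarrow> \<gamma> t \<in> W \<Longrightarrow> \<forall>\<^sub>F s in nhds t. \<gamma> s \<in> W"
  unfolding chart_diff_def by blast

lemma chart_diff_open:
  assumes "chart_diff n X \<O> \<gamma> t" "openin X W" "\<gamma> t \<in> W"
  obtains S where "open S" "t \<in> S" "\<And>s. s \<in> S \<Longrightarrow> \<gamma> s \<in> W"
  using chart_diff_eventually[OF assms] unfolding eventually_nhds by blast

lemma vel_deriv:
  assumes "chart_diff n X \<O> \<gamma> t" "holo_chart X \<O> n U \<phi>" "\<gamma> t \<in> U"
  shows "((\<lambda>s. \<phi> (\<gamma> s) i) has_vector_derivative vel \<phi> \<gamma> t i) (at t)"
  using assms unfolding chart_diff_def vel_def vector_derivative_works[symmetric] by blast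

lemma vel_Cn:
  assumes cd: "chart_diff n X \<O> \<gamma> t" and ch: "holo_chart X \<O> n U \<phi>" and t: "\<gamma> t \<in> U"
  shows "vel \<phi> \<gamma> t \<in> Cn n"
  unfolding Cn_def
proof (intro CollectI allI impI)
  fix i assume i: "n \<le> i"
  obtain S where S: "open S" "t \<in> S" "\<And>s. s \<in> S \<Longrightarrow> \<gamma> s \<in> U"
    using chart_diff_open[OF cd local_embeddingD(1)[OF holo_chartD(1)[OF ch]] t] by blast
  have "\<phi> (\<gamma> s) i = 0" if "s \<in> S" for s
    using S(3)[OF that] local_embeddingD(4)[OF holo_chartD(1)[OF ch]] i unfolding Cn_def by auto
  then have "((\<lambda>s. 0 :: complex) has_vector_derivative vel \<phi> \<gamma> t i) (at t)"
    using has_vector_derivative_transform_within_open[OF vel_deriv[OF cd ch t] S(1,2)] by auto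
  then show "vel \<phi> \<gamma> t i = 0"
    using has_vector_derivative_const vector_derivative_at by metis
qed

context complex_space
begin

text \<open>An embedding need not be a chart, so the derivative is taken in a chart and carried over
  by the chain rule.\<close>

lemma vel_embedding:
  assumes cd: "chart_diff n X \<O> \<gamma> t" and ch: "holo_chart X \<O> n U \<phi>" and t: "\<gamma> t \<in> U"
    and le: "local_embedding X \<O> N U1 \<iota>" and t1: "\<gamma> t \<in> U1"
  shows "((\<lambda>s. \<iota> (\<gamma> s) i) has_vector_derivative dmap (\<lambda>z. \<iota> (inv_into U \<phi> z)) (\<phi> (\<gamma> t)) (vel \<phi> \<gamma> t) i) (at t)"
proof -
  note leU = holo_chartD(1)[OF ch]
  have "openin X (U \<inter> U1)" using local_embeddingD(1)[OF leU] local_embeddingD(1)[OF le] by blast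
  then obtain S where S: "open S" "t \<in> S" "\<And>s. s \<in> S \<Longrightarrow> \<gamma> s \<in> U \<inter> U1"
    using chart_diff_open[OF cd] t t1 by (metis IntI)
  have "((\<lambda>s. \<iota> (inv_into U \<phi> (\<phi> (\<gamma> s))) i) has_vector_derivative
      dmap (\<lambda>z. \<iota> (inv_into U \<phi> z)) (\<phi> (\<gamma> t)) (vel \<phi> \<gamma> t) i) (at t within S)"
  proof (rule dmap_curve[OF chart_to_embedding[OF ch le]])
    show "\<phi> (\<gamma> t) \<in> \<phi> ` (U \<inter> U1)" using t t1 by blast
    show "((\<lambda>s. \<phi> (\<gamma> s) i) has_vector_derivative vel \<phi> \<gamma> t i) (at t within S)" for i
      using vel_deriv[OF cd ch t] by (rule has_vector_derivative_at_within)
    show "\<phi> (\<gamma> s) \<in> Cn n" if "s \<in> S" for s using S(3)[OF that] local_embeddingD(4)[OF leU] by blast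
  qed (rule vel_Cn[OF cd ch t])
  then have "((\<lambda>s. \<iota> (inv_into U \<phi> (\<phi> (\<gamma> s))) i) has_vector_derivative
      dmap (\<lambda>z. \<iota> (inv_into U \<phi> z)) (\<phi> (\<gamma> t)) (vel \<phi> \<gamma> t) i) (at t)"
    using at_within_open[OF S(2,1)] by simp
  then show ?thesis
    by (rule has_vector_derivative_transform_within_open[OF _ S(1,2)])
      (use S(3) local_embedding_inv[OF leU] in auto)
qed

lemma vel_transition:
  assumes cd: "chart_diff n X \<O> \<gamma> t" and ch: "holo_chart X \<O> n U \<phi>" and t: "\<gamma> t \<in> U"
    and le: "local_embedding X \<O> N U1 \<iota>" and t1: "\<gamma> t \<in> U1"
  shows "vel \<iota> \<gamma> t = dmap (\<lambda>z. \<iota> (inv_into U \<phi> z)) (\<phi> (\<gamma> t)) (vel \<phi> \<gamma> t)"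
  unfolding vel_def[of \<iota>] using vector_derivative_at[OF vel_embedding[OF assms]] by simp

lemma form_transition:
  assumes \<omega>: "kaehler_form_on_reg n X \<O> \<omega>" and ch: "holo_chart X \<O> n U \<phi>" "holo_chart X \<O> n W \<psi>"
    and x: "x \<in> U" "x \<in> W" and u: "u \<in> Cn n"
  shows "\<omega> U \<phi> (\<phi> x) u (Jmul u) =
    \<omega> W \<psi> (\<psi> x) (dmap (\<lambda>z. \<psi> (inv_into U \<phi> z)) (\<phi> x) u) (Jmul (dmap (\<lambda>z. \<psi> (inv_into U \<phi> z)) (\<phi> x) u))"
proof -
  have "\<omega> U \<phi> (\<phi> x) u (Jmul u) = pullback (\<psi> \<circ> inv_into U \<phi>) (\<omega> W \<psi>) (\<phi> x) u (Jmul u)"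
    using \<omega> ch x u Cn_Jmul[OF u] unfolding kaehler_form_on_reg_def by blast
  moreover have "\<phi> x \<in> \<phi> ` (U \<inter> W)" using x by blast
  ultimately show ?thesis
    using dmap_Jmul[OF chart_to_embedding[OF ch(1) holo_chartD(1)[OF ch(2)]] _ u]
      local_embedding_inv[OF holo_chartD(1)[OF ch(1)] x(1)]
    unfolding pullback_def comp_def by simp
qed

text \<open>The transformation rule of the form cancels that of the velocity, so the chart chosen by
  \<open>SOME\<close> may be replaced by any other.\<close>

lemma speed_chart:
  assumes \<omega>: "kaehler_form_on_reg n X \<O> \<omega>" and cd: "chart_diff n X \<O> \<gamma> t"
    and ch: "holo_chart X \<O> n W \<psi>" and t: "\<gamma> t \<in> W"
  shows "speed n X \<O> \<omega> \<gamma> t = sqrt (\<omega> W \<psi> (\<psi> (\<gamma> t)) (vel \<psi> \<gamma> t) (Jmul (vel \<psi> \<gamma> t)))"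
proof -
  obtain U \<phi> where U: "(SOME (U, \<phi>). holo_chart X \<O> n U \<phi> \<and> \<gamma> t \<in> U) = (U, \<phi>)"
    by (rule prod.exhaust)
  have "case (SOME (U, \<phi>). holo_chart X \<O> n U \<phi> \<and> \<gamma> t \<in> U) of (U, \<phi>) \<Rightarrow> holo_chart X \<O> n U \<phi> \<and> \<gamma> t \<in> U"
    using someI[of "\<lambda>(U, \<phi>). holo_chart X \<O> n U \<phi> \<and> \<gamma> t \<in> U" "(W, \<psi>)"] ch t by simp
  then have ch': "holo_chart X \<O> n U \<phi>" and t': "\<gamma> t \<in> U" unfolding U by auto
  have "speed n X \<O> \<omega> \<gamma> t = sqrt (\<omega> U \<phi> (\<phi> (\<gamma> t)) (vel \<phi> \<gamma> t) (Jmul (vel \<phi> \<gamma> t)))"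
    unfolding speed_def U vel_def by (simp add: Let_def)
  then show ?thesis
    using form_transition[OF \<omega> ch' ch t' t vel_Cn[OF cd ch' t']]
      vel_transition[OF cd ch' t' holo_chartD(1)[OF ch] t] by simp
qed

end

lemma speed_cong:
  assumes "\<forall>\<^sub>F s in nhds t. \<gamma> s = \<delta> s"
  shows "speed n X \<O> \<omega> \<gamma> t = speed n X \<O> \<omega> \<delta> t"
proof -
  have e: "\<gamma> t = \<delta> t" using assms eventually_nhds_x_imp_x by blast
  have "vector_derivative (\<lambda>s. \<phi> (\<gamma> s) i) (at t) = vector_derivative (\<lambda>s. \<phi> (\<delta> s) i) (at t)" for \<phi> :: "'a \<Rightarrow> nat \<Rightarrow> complex" and i
    using assms by (intro vector_derivative_cong_eq) (auto elim: eventually_mono)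
  then show ?thesis unfolding speed_def e by simp
qed

lemma chart_diff_reparam:
  assumes cd: "chart_diff n X \<O> \<gamma> (h t)" and h: "(h has_real_derivative d) (at t)"
  shows "chart_diff n X \<O> (\<lambda>s. \<gamma> (h s)) t"
    and "\<And>U \<phi>. holo_chart X \<O> n U \<phi> \<Longrightarrow> \<gamma> (h t) \<in> U \<Longrightarrow>
      vel \<phi> (\<lambda>s. \<gamma> (h s)) t = (\<lambda>i. of_real d * vel \<phi> \<gamma> (h t) i)"
proof -
  have hv: "(h has_vector_derivative d) (at t)"
    using h by (simp add: has_real_derivative_iff_has_vector_derivative)
  have der: "((\<lambda>s. \<phi> (\<gamma> (h s)) i) has_vector_derivative of_real d * vel \<phi> \<gamma> (h t) i) (at t)"
    if "holo_chart X \<O> n U \<phi>" "\<gamma> (h t) \<in> U" for U \<phi> i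
    using vector_diff_chain_at[OF hv vel_deriv[OF cd that]] by (simp add: comp_def scaleR_conv_of_real)
  have tend: "(h \<longlongrightarrow> h t) (nhds t)"
    using h by (simp add: DERIV_isCont tendsto_nhds_iff isCont_def[symmetric])
  show "chart_diff n X \<O> (\<lambda>s. \<gamma> (h s)) t"
    unfolding chart_diff_def
  proof (intro conjI allI impI)
    fix W assume "openin X W \<and> \<gamma> (h t) \<in> W"
    then have "\<forall>\<^sub>F s in nhds (h t). \<gamma> s \<in> W" using chart_diff_eventually[OF cd] by simp
    then show "\<forall>\<^sub>F s in nhds t. \<gamma> (h s) \<in> W" using tend by (rule eventually_compose_filterlim)
  next
    fix U \<phi> i assume "holo_chart X \<O> n U \<phi> \<and> \<gamma> (h t) \<in> U"
    then show "(\<lambda>s. \<phi> (\<gamma> (h s)) i) differentiable at t" using der differentiableI_vector by blast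
  qed
  show "vel \<phi> (\<lambda>s. \<gamma> (h s)) t = (\<lambda>i. of_real d * vel \<phi> \<gamma> (h t) i)"
    if "holo_chart X \<O> n U \<phi>" "\<gamma> (h t) \<in> U" for U \<phi>
    unfolding vel_def[of \<phi> "\<lambda>s. \<gamma> (h s)"] using vector_derivative_at[OF der[OF that]] by simp
qed

text \<open>The metric is quadratic in the velocity, so its square root scales by the absolute value
  of the derivative.\<close>

lemma (in complex_space) speed_reparam:
  assumes \<omega>: "kaehler_form_on_reg n X \<O> \<omega>" and cd: "chart_diff n X \<O> \<gamma> (h t)"
    and h: "(h has_real_derivative d) (at t)" and ch: "holo_chart X \<O> n W \<psi>" and t: "\<gamma> (h t) \<in> W"
  shows "speed n X \<O> \<omega> (\<lambda>s. \<gamma> (h s)) t = \<bar>d\<bar> * speed n X \<O> \<omega> \<gamma> (h t)"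
proof -
  have k: "kaehler_form n (\<psi> ` W) (\<omega> W \<psi>)" using \<omega> ch unfolding kaehler_form_on_reg_def by blast
  show ?thesis
    unfolding speed_chart[OF \<omega> cd ch t] speed_chart[OF \<omega> chart_diff_reparam(1)[OF cd h] ch t]
      chart_diff_reparam(2)[OF cd h ch t]
    using kaehler_form_scale[OF k imageI[OF t] vel_Cn[OF cd ch t], of d]
    by (simp add: real_sqrt_mult)
qed

section \<open>Admissible paths and their lengths\<close>

lemma admissible_pathD:
  assumes "admissible_path n X \<O> a b \<gamma>"
  shows "continuous_map (top_of_set {0..1}) X \<gamma>" "\<gamma> 0 = a" "\<gamma> 1 = b"
    "\<And>t. 0 < t \<Longrightarrow> t < 1 \<Longrightarrow> \<gamma> t \<in> regular_locus X \<O>"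
    "\<And>U \<phi> k i. holo_chart X \<O> n U \<phi> \<Longrightarrow> curve_Ck k {t\<in>{0..1}. \<gamma> t \<in> U} (\<lambda>t. \<phi> (\<gamma> t) i)"
  using assms unfolding admissible_path_def by auto

lemma admissible_path_open:
  assumes ad: "admissible_path n X \<O> a b \<gamma>" and W: "openin X W"
  shows "open {t \<in> {0<..<1}. \<gamma> t \<in> W}"
proof -
  have "openin (top_of_set {0..1}) {t \<in> {0..1}. \<gamma> t \<in> W}"
    using openin_continuous_map_preimage[OF admissible_pathD(1)[OF ad] W] by simp
  then obtain T where T: "open T" "{t \<in> {0..1}. \<gamma> t \<in> W} = {0..1} \<inter> T" by (auto simp: openin_open)
  have "\<gamma> t \<in> W \<longleftrightarrow> t \<in> T" if "t \<in> {0..1}" for t using T(2) that by blast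
  then have "{t \<in> {0<..<1}. \<gamma> t \<in> W} = {0<..<1} \<inter> T" by force
  then show ?thesis using T(1) by (simp add: open_Int)
qed

text \<open>Smoothness is stated relative to the preimage of a chart in the closed unit interval. In
  the open interval this preimage is open, so derivatives within it become two-sided.\<close>

lemma admissible_path_velocity:
  assumes ad: "admissible_path n X \<O> a b \<gamma>" and ch: "holo_chart X \<O> n U \<phi>"
  shows "\<And>t i. 0 < t \<Longrightarrow> t < 1 \<Longrightarrow> \<gamma> t \<in> U \<Longrightarrow> ((\<lambda>s. \<phi> (\<gamma> s) i) has_vector_derivative vel \<phi> \<gamma> t i) (at t)"
    and "continuous_on {t \<in> {0<..<1}. \<gamma> t \<in> U} (\<lambda>t. vel \<phi> \<gamma> t)"
    and "continuous_on {t \<in> {0<..<1}. \<gamma> t \<in> U} (\<lambda>t. \<phi> (\<gamma> t))"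
proof -
  let ?I = "{t \<in> {0..1}. \<gamma> t \<in> U}" and ?S = "{t \<in> {0<..<1}. \<gamma> t \<in> U}"
  have op: "open ?S" by (rule admissible_path_open[OF ad local_embeddingD(1)[OF holo_chartD(1)[OF ch]]])
  have SI: "?S \<subseteq> ?I" by auto
  have "\<exists>c'. continuous_on ?I c' \<and> (\<forall>t\<in>?I. ((\<lambda>t. \<phi> (\<gamma> t) i) has_vector_derivative c' t) (at t within ?I))" for i
    using admissible_pathD(5)[OF ad ch, of 1 i] by simp
  then obtain c' where "\<forall>i. continuous_on ?I (c' i) \<and>
      (\<forall>t\<in>?I. ((\<lambda>t. \<phi> (\<gamma> t) i) has_vector_derivative c' i t) (at t within ?I))"
    using choice[of "\<lambda>i c'. continuous_on ?I c' \<and>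
      (\<forall>t\<in>?I. ((\<lambda>t. \<phi> (\<gamma> t) i) has_vector_derivative c' t) (at t within ?I))"] by blast
  then have c': "\<And>i. continuous_on ?I (c' i)"
    "\<And>i t. t \<in> ?I \<Longrightarrow> ((\<lambda>t. \<phi> (\<gamma> t) i) has_vector_derivative c' i t) (at t within ?I)"
    by blast+
  have d: "((\<lambda>s. \<phi> (\<gamma> s) i) has_vector_derivative c' i t) (at t)" if "t \<in> ?S" for t i
    using has_vector_derivative_within_subset[OF c'(2) SI, of t i] that SI at_within_open[OF that op] by auto
  have v: "vel \<phi> \<gamma> t i = c' i t" if "t \<in> ?S" for t i
    unfolding vel_def using d[OF that] vector_derivative_at by blast
  show "\<And>t i. 0 < t \<Longrightarrow> t < 1 \<Longrightarrow> \<gamma> t \<in> U \<Longrightarrow> ((\<lambda>s. \<phi> (\<gamma> s) i) has_vector_derivative vel \<phi> \<gamma> t i) (at t)"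
    using d v by simp
  show "continuous_on ?S (\<lambda>t. vel \<phi> \<gamma> t)"
  proof (rule continuous_on_coordinatewise_then_product)
    fix i
    show "continuous_on ?S (\<lambda>t. vel \<phi> \<gamma> t i)"
      using continuous_on_subset[OF c'(1) SI, of i] by (rule continuous_on_eq) (simp add: v)
  qed
  show "continuous_on ?S (\<lambda>t. \<phi> (\<gamma> t))"
  proof (rule continuous_on_coordinatewise_then_product)
    fix i
    have "continuous_on ?I (\<lambda>t. \<phi> (\<gamma> t) i)"
      using admissible_pathD(5)[OF ad ch, of 0 i] by simp
    then show "continuous_on ?S (\<lambda>t. \<phi> (\<gamma> t) i)" using SI continuous_on_subset by blast
  qed
qed

lemma admissible_chart_diff:
  assumes ad: "admissible_path n X \<O> a b \<gamma>" and t: "0 < t" "t < 1"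
  shows "chart_diff n X \<O> \<gamma> t"
  unfolding chart_diff_def
proof (intro conjI allI impI)
  fix W assume "openin X W \<and> \<gamma> t \<in> W"
  then show "\<forall>\<^sub>F s in nhds t. \<gamma> s \<in> W"
    using eventually_nhds_in_open[OF admissible_path_open[OF ad, of W], of t] t
    by (auto elim: eventually_mono)
next
  fix U \<phi> i assume "holo_chart X \<O> n U \<phi> \<and> \<gamma> t \<in> U"
  then show "(\<lambda>s. \<phi> (\<gamma> s) i) differentiable at t"
    using admissible_path_velocity(1)[OF ad] t differentiableI_vector by blast
qed

context orbifold
begin

lemma speed_nonneg:
  assumes \<omega>: "kaehler_form_on_reg n X \<O> \<omega>" and ad: "admissible_path n X \<O> a b \<gamma>" and t: "0 < t" "t < 1"
  shows "0 \<le> speed n X \<O> \<omega> \<gamma> t"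
proof -
  obtain U \<phi> where U: "holo_chart X \<O> n U \<phi>" "\<gamma> t \<in> U"
    using regular_chart[OF admissible_pathD(4)[OF ad t]] by blast
  have k: "kaehler_form n (\<phi> ` U) (\<omega> U \<phi>)" using \<omega> U unfolding kaehler_form_on_reg_def by blast
  note cd = admissible_chart_diff[OF ad t]
  show ?thesis unfolding speed_chart[OF \<omega> cd U]
    using kaehler_form_nonneg[OF k imageI[OF U(2)] vel_Cn[OF cd U]] by simp
qed

lemma continuous_on_speed:
  assumes \<omega>: "kaehler_form_on_reg n X \<O> \<omega>" and ad: "admissible_path n X \<O> a b \<gamma>"
  shows "continuous_on {0<..<1} (speed n X \<O> \<omega> \<gamma>)"
proof (rule continuous_at_imp_continuous_on, intro ballI)
  fix t :: real assume t: "t \<in> {0<..<1}"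
  then have "0 < t" "t < 1" by auto
  then obtain U \<phi> where U: "holo_chart X \<O> n U \<phi>" "\<gamma> t \<in> U"
    using regular_chart[OF admissible_pathD(4)[OF ad]] by blast
  have k: "kaehler_form n (\<phi> ` U) (\<omega> U \<phi>)" using \<omega> U unfolding kaehler_form_on_reg_def by blast
  let ?S = "{t \<in> {0<..<1}. \<gamma> t \<in> U}"
  have op: "open ?S" by (rule admissible_path_open[OF ad local_embeddingD(1)[OF holo_chartD(1)[OF U(1)]]])
  have cd: "chart_diff n X \<O> \<gamma> s" if "s \<in> ?S" for s using that admissible_chart_diff[OF ad] by simp
  have "continuous_on ?S (\<lambda>s. \<omega> U \<phi> (\<phi> (\<gamma> s)) (vel \<phi> \<gamma> s) (Jmul (vel \<phi> \<gamma> s)))"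
    using vel_Cn[OF cd U(1)]
    by (intro continuous_on_kaehler_form[OF k] admissible_path_velocity[OF ad U(1)]) auto
  then have "continuous_on ?S (\<lambda>s. sqrt (\<omega> U \<phi> (\<phi> (\<gamma> s)) (vel \<phi> \<gamma> s) (Jmul (vel \<phi> \<gamma> s))))"
    by (intro continuous_intros)
  then have "continuous_on ?S (speed n X \<O> \<omega> \<gamma>)"
    by (rule continuous_on_eq) (use speed_chart[OF \<omega> cd U(1)] in auto)
  then show "isCont (speed n X \<O> \<omega> \<gamma>) t"
    using op t U(2) by (simp add: continuous_on_eq_continuous_at)
qed

lemma speed_measurable:
  assumes \<omega>: "kaehler_form_on_reg n X \<O> \<omega>" and ad: "admissible_path n X \<O> a b \<gamma>"
  shows "(\<lambda>t. speed n X \<O> \<omega> \<gamma> t * indicator {0<..<1} t) \<in> borel_measurable borel"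
proof -
  have "(\<lambda>t. indicator {0<..<1} t *\<^sub>R speed n X \<O> \<omega> \<gamma> t) \<in> borel_measurable borel"
    by (rule borel_measurable_continuous_on_indicator[OF _ continuous_on_speed[OF \<omega> ad]]) simp
  moreover have "(\<lambda>t. indicator {0<..<1} t *\<^sub>R speed n X \<O> \<omega> \<gamma> t) = (\<lambda>t. speed n X \<O> \<omega> \<gamma> t * indicator {0<..<1} t)"
    by (rule ext) simp
  ultimately show ?thesis by simp
qed

lemma path_len_alt:
  "path_len n X \<O> \<omega> \<gamma> = (\<integral>\<^sup>+ t. ennreal (speed n X \<O> \<omega> \<gamma> t * indicator {0<..<1} t) \<partial>lborel)"
  unfolding path_len_def by (rule nn_integral_cong) (simp split: split_indicator)

end

lemma curve_Ck_cmult: "curve_Ck k I c \<Longrightarrow> curve_Ck k I (\<lambda>t. a * c t)"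
proof (induction k arbitrary: c)
  case 0
  then show ?case by (auto intro!: continuous_intros)
next
  case (Suc k)
  then obtain c' where c': "curve_Ck k I c'" "\<And>t. t \<in> I \<Longrightarrow> (c has_vector_derivative c' t) (at t within I)"
    "continuous_on I c" by auto
  show ?case
    using Suc.IH[OF c'(1)] c'(2,3)
    by (auto intro!: continuous_intros exI[of _ "\<lambda>t. a * c' t"] has_vector_derivative_mult_right)
qed

lemma curve_Ck_affine:
  assumes "curve_Ck k J c" "\<And>t. t \<in> I \<Longrightarrow> \<alpha> + \<beta> * t \<in> J"
  shows "curve_Ck k I (\<lambda>t. c (\<alpha> + \<beta> * t))"
  using assms(1)
proof (induction k arbitrary: c)
  case 0
  then show ?case using assms(2) by (auto intro!: continuous_intros continuous_on_compose2[of J c])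
next
  case (Suc k)
  then obtain c' where c': "curve_Ck k J c'" "\<And>t. t \<in> J \<Longrightarrow> (c has_vector_derivative c' t) (at t within J)"
    "continuous_on J c" by auto
  have "((\<lambda>t. c (\<alpha> + \<beta> * t)) has_vector_derivative of_real \<beta> * c' (\<alpha> + \<beta> * t)) (at t within I)" if t: "t \<in> I" for t
  proof -
    have h: "((\<lambda>t. \<alpha> + \<beta> * t) has_vector_derivative \<beta>) (at t within I)"
      by (auto intro!: derivative_eq_intros simp: has_real_derivative_iff_has_vector_derivative[symmetric])
    have "(c has_vector_derivative c' (\<alpha> + \<beta> * t)) (at (\<alpha> + \<beta> * t) within (\<lambda>t. \<alpha> + \<beta> * t) ` I)"
      using c'(2)[OF assms(2)[OF t]] by (rule has_vector_derivative_within_subset) (use assms(2) in auto)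
    from vector_diff_chain_within[OF h this] show ?thesis by (simp add: comp_def scaleR_conv_of_real)
  qed
  moreover have "continuous_on I (\<lambda>t. c (\<alpha> + \<beta> * t))"
    using assms(2) by (auto intro!: continuous_intros continuous_on_compose2[OF c'(3)])
  ultimately show ?case using curve_Ck_cmult[OF Suc.IH[OF c'(1)], of "of_real \<beta>"] by auto
qed

text \<open>Covers two operations at once: reversal of a path is \<open>\<alpha> = 1\<close>,
  \<open>\<beta> = -1\<close>, and cutting off an initial piece is
  \<open>\<beta> = 1 - \<alpha>\<close>.\<close>

lemma (in orbifold) admissible_affine:
  assumes \<omega>: "kaehler_form_on_reg n X \<O> \<omega>" and ad: "admissible_path n X \<O> a b \<gamma>"
    and \<alpha>: "0 \<le> \<alpha>" "\<alpha> \<le> 1" "0 \<le> \<alpha> + \<beta>" "\<alpha> + \<beta> \<le> 1" and \<beta>: "\<beta> \<noteq> 0"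
  shows "admissible_path n X \<O> (\<gamma> \<alpha>) (\<gamma> (\<alpha> + \<beta>)) (\<lambda>t. \<gamma> (\<alpha> + \<beta> * t))"
    and "path_len n X \<O> \<omega> (\<lambda>t. \<gamma> (\<alpha> + \<beta> * t)) \<le> path_len n X \<O> \<omega> \<gamma>"
proof -
  have in1: "0 \<le> \<alpha> + \<beta> * t \<and> \<alpha> + \<beta> * t \<le> 1" if "0 \<le> t" "t \<le> 1" for t
  proof -
    have "\<alpha> + \<beta> * t = (1 - t) * \<alpha> + t * (\<alpha> + \<beta>)" by (simp add: algebra_simps)
    then show ?thesis using convex_bound_le[of \<alpha> 1 "\<alpha> + \<beta>" "1 - t" t] that \<alpha> by simp
  qed
  have in2: "0 < \<alpha> + \<beta> * t \<and> \<alpha> + \<beta> * t < 1" if "0 < t" "t < 1" for t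
  proof (cases "\<beta> > 0")
    case True
    then have "0 < \<beta> * t" "\<beta> * t < \<beta>" using that by auto
    then show ?thesis using \<alpha> by linarith
  next
    case False
    then have "\<beta> * t < 0" "\<beta> < \<beta> * t" using that \<beta> by (auto simp: mult_neg_pos)
    then show ?thesis using \<alpha> by linarith
  qed
  show ad': "admissible_path n X \<O> (\<gamma> \<alpha>) (\<gamma> (\<alpha> + \<beta>)) (\<lambda>t. \<gamma> (\<alpha> + \<beta> * t))"
    unfolding admissible_path_def
  proof (intro conjI allI impI ballI)
    have "continuous_map (top_of_set {0..1}) (top_of_set {0..1}) (\<lambda>t. \<alpha> + \<beta> * t)"
      using in1 by (auto simp: continuous_map_in_subtopology intro!: continuous_intros)
    from continuous_map_compose[OF this admissible_pathD(1)[OF ad]]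
    show "continuous_map (top_of_set {0..1}) X (\<lambda>t. \<gamma> (\<alpha> + \<beta> * t))" by (simp add: comp_def)
    show "\<gamma> (\<alpha> + \<beta> * t) \<in> regular_locus X \<O>" if "t \<in> {0<..<1}" for t
      using admissible_pathD(4)[OF ad] in2 that by simp
    show "curve_Ck k {t \<in> {0..1}. \<gamma> (\<alpha> + \<beta> * t) \<in> U} (\<lambda>t. \<phi> (\<gamma> (\<alpha> + \<beta> * t)) i)"
      if "holo_chart X \<O> n U \<phi>" for U \<phi> k i
      by (rule curve_Ck_affine[OF admissible_pathD(5)[OF ad that]]) (use in1 in auto)
  qed simp_all
  let ?f = "\<lambda>t. ennreal (speed n X \<O> \<omega> \<gamma> t * indicator {0<..<1} t)"
  have m: "?f \<in> borel_measurable borel" using speed_measurable[OF \<omega> ad] by simp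
  have "path_len n X \<O> \<omega> (\<lambda>t. \<gamma> (\<alpha> + \<beta> * t)) \<le> (\<integral>\<^sup>+ t. ennreal \<bar>\<beta>\<bar> * ?f (\<alpha> + \<beta> * t) \<partial>lborel)"
    unfolding path_len_alt
  proof (rule nn_integral_mono)
    fix t :: real
    show "ennreal (speed n X \<O> \<omega> (\<lambda>t. \<gamma> (\<alpha> + \<beta> * t)) t * indicator {0<..<1} t) \<le> ennreal \<bar>\<beta>\<bar> * ?f (\<alpha> + \<beta> * t)"
    proof (cases "t \<in> {0<..<1}")
      case True
      then have i: "0 < \<alpha> + \<beta> * t" "\<alpha> + \<beta> * t < 1" using in2 by auto
      obtain U \<phi> where U: "holo_chart X \<O> n U \<phi>" "\<gamma> (\<alpha> + \<beta> * t) \<in> U"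
        using regular_chart[OF admissible_pathD(4)[OF ad i]] by blast
      have "((\<lambda>t. \<alpha> + \<beta> * t) has_real_derivative \<beta>) (at t)" by (auto intro!: derivative_eq_intros)
      from speed_reparam[OF \<omega> admissible_chart_diff[OF ad i] this U]
      show ?thesis using True i by (simp add: ennreal_mult' abs_ge_zero)
    qed simp
  qed
  also have "\<dots> = ennreal \<bar>\<beta>\<bar> * (\<integral>\<^sup>+ t. ?f (\<alpha> + \<beta> * t) \<partial>lborel)"
    using measurable_compose[OF _ m, of "\<lambda>t. \<alpha> + \<beta> * t" lborel] by (intro nn_integral_cmult) simp
  also have "\<dots> = path_len n X \<O> \<omega> \<gamma>"
    unfolding path_len_alt by (rule nn_integral_real_affine[OF m \<beta>, symmetric])
  finally show "path_len n X \<O> \<omega> (\<lambda>t. \<gamma> (\<alpha> + \<beta> * t)) \<le> path_len n X \<O> \<omega> \<gamma>" .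
qed

section \<open>The distance as an infimum of lengths\<close>

lemma kdist_le: "admissible_path n X \<O> a b \<gamma> \<Longrightarrow> kdist n X \<O> \<omega> a b \<le> path_len n X \<O> \<omega> \<gamma>"
  unfolding kdist_def by (rule INF_lower) simp

lemma kdist_lessE:
  assumes "kdist n X \<O> \<omega> a b < e"
  obtains \<gamma> where "admissible_path n X \<O> a b \<gamma>" "path_len n X \<O> \<omega> \<gamma> < e"
  using assms unfolding kdist_def INF_less_iff by auto

lemma kdist_greatest:
  "(\<And>\<gamma>. admissible_path n X \<O> a b \<gamma> \<Longrightarrow> e \<le> path_len n X \<O> \<omega> \<gamma>) \<Longrightarrow> e \<le> kdist n X \<O> \<omega> a b"
  unfolding kdist_def by (rule INF_greatest) simp

lemma (in orbifold) kdist_commute: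
  assumes \<omega>: "kaehler_form_on_reg n X \<O> \<omega>"
  shows "kdist n X \<O> \<omega> a b = kdist n X \<O> \<omega> b a"
proof -
  have "kdist n X \<O> \<omega> a b \<le> kdist n X \<O> \<omega> b a" for a b
  proof (rule kdist_greatest)
    fix \<gamma> assume ad: "admissible_path n X \<O> b a \<gamma>"
    show "kdist n X \<O> \<omega> a b \<le> path_len n X \<O> \<omega> \<gamma>"
      using order_trans[OF kdist_le admissible_affine(2)[OF \<omega> ad, of 1 "-1"]]
        admissible_affine(1)[OF \<omega> ad, of 1 "-1"] admissible_pathD(2,3)[OF ad] by simp
  qed
  then show ?thesis by (simp add: antisym)
qed

section \<open>Concatenation of paths\<close>

text \<open>To stay smooth at the joint, both paths are reparametrised by functions all of whose derivatives
  vanish there. The derivatives of \<open>exp (- 1 / s)\<close> are of the following shape.\<close>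

definition flat_fun :: "real \<Rightarrow> real poly \<Rightarrow> real \<Rightarrow> real" where
  "flat_fun m P s = (if 0 < s then poly P (1 / s) * exp (- m / s) else 0)"

lemma poly_times_exp_tendsto_0:
  fixes m :: real
  assumes m: "0 < m"
  shows "((\<lambda>x. poly P x * exp (- m * x)) \<longlongrightarrow> 0) at_top"
proof -
  have 1: "((\<lambda>x::real. x ^ k * exp (- m * x)) \<longlongrightarrow> 0) at_top" for k
  proof -
    have "filterlim (\<lambda>x. m * x) at_top at_top"
      using m by (intro filterlim_tendsto_pos_mult_at_top[OF tendsto_const]) (auto simp: filterlim_ident)
    from filterlim_compose[OF tendsto_power_div_exp_0[of k] this]
    have "((\<lambda>x. (1 / m ^ k) * ((m * x) ^ k / exp (m * x))) \<longlongrightarrow> (1 / m ^ k) * 0) at_top"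
      by (intro tendsto_mult tendsto_const)
    moreover have "(\<lambda>x. (1 / m ^ k) * ((m * x) ^ k / exp (m * x))) = (\<lambda>x. x ^ k * exp (- m * x))"
      using m by (intro ext) (simp add: power_mult_distrib exp_minus field_simps)
    ultimately show ?thesis by simp
  qed
  have "((\<lambda>x. \<Sum>i\<le>degree P. coeff P i * (x ^ i * exp (- m * x))) \<longlongrightarrow> (\<Sum>i\<le>degree P. coeff P i * 0)) at_top"
    by (intro tendsto_sum tendsto_mult tendsto_const 1)
  moreover have "(\<lambda>x. \<Sum>i\<le>degree P. coeff P i * (x ^ i * exp (- m * x))) = (\<lambda>x. poly P x * exp (- m * x))"
    by (intro ext) (simp add: poly_altdef sum_distrib_right mult.assoc)
  ultimately show ?thesis by simp
qed

text \<open>Differentiating \<open>poly P (1 / s) * exp (- m / s)\<close> produces the factor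
  \<open>1 / s\<^sup>2\<close>, the monomial of degree 2 at \<open>1 / s\<close>, times the value of
  \<open>m P - P'\<close> there.\<close>

definition flat_deriv :: "real \<Rightarrow> real poly \<Rightarrow> real poly" where
  "flat_deriv m P = [:0, 0, 1:] * (smult m P - pderiv P)"

lemma flat_fun_0 [simp]: "s \<le> 0 \<Longrightarrow> flat_fun m P s = 0"
  by (simp add: flat_fun_def)

lemma flat_fun_DERIV:
  assumes m: "0 < m"
  shows "(flat_fun m P has_real_derivative flat_fun m (flat_deriv m P) s) (at s)"
proof -
  consider "s < 0" | "s = 0" | "s > 0" by linarith
  then show ?thesis
  proof cases
    case 1
    have "((\<lambda>s. 0) has_real_derivative 0) (at s)" by simp
    then have "(flat_fun m P has_real_derivative 0) (at s)"
      by (rule has_field_derivative_transform_within_open[of _ _ _ "{..<0}"]) (use 1 in auto)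
    then show ?thesis using 1 by simp
  next
    case 2
    \<comment> \<open>With \<open>x = 1 / h\<close> the difference quotient from the right becomes a
      polynomial in \<open>x\<close> times a decaying exponential.\<close>
    have "((\<lambda>h. flat_fun m P h / h) \<longlongrightarrow> 0) (at_right 0)"
    proof -
      have "((\<lambda>h. poly ([:0, 1:] * P) (inverse h) * exp (- m * inverse h)) \<longlongrightarrow> 0) (at_right 0)"
        by (rule filterlim_compose[OF poly_times_exp_tendsto_0[OF m] filterlim_inverse_at_top_right])
      then show ?thesis
      proof (rule Lim_transform_eventually)
        show "\<forall>\<^sub>F h in at_right 0. poly ([:0, 1:] * P) (inverse h) * exp (- m * inverse h) = flat_fun m P h / h"
          by (auto simp: eventually_at_right_field flat_fun_def field_simps intro!: exI[of _ 1])
      qed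
    qed
    moreover have "((\<lambda>h. flat_fun m P h / h) \<longlongrightarrow> 0) (at_left 0)"
      by (rule Lim_transform_eventually[OF tendsto_const])
        (auto simp: eventually_at_left_field intro!: exI[of _ "-1"])
    ultimately have "((\<lambda>h. flat_fun m P h / h) \<longlongrightarrow> 0) (at 0)"
      by (simp add: filterlim_at_split)
    then show ?thesis using 2 by (simp add: DERIV_def)
  next
    case 3
    have "((\<lambda>s. poly P (1 / s) * exp (- m / s)) has_real_derivative
        (poly (pderiv P) (1 / s) * (- 1 / s\<^sup>2)) * exp (- m / s) + (exp (- m / s) * (m / s\<^sup>2)) * poly P (1 / s)) (at s)"
    proof (rule DERIV_mult)
      have "((\<lambda>s. 1 / s) has_real_derivative (- 1 / s\<^sup>2)) (at s)"
        using 3 by (auto intro!: derivative_eq_intros simp: power2_eq_square)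
      from DERIV_chain2[OF poly_DERIV this]
      show "((\<lambda>s. poly P (1 / s)) has_real_derivative poly (pderiv P) (1 / s) * (- 1 / s\<^sup>2)) (at s)" .
      show "((\<lambda>s. exp (- m / s)) has_real_derivative exp (- m / s) * (m / s\<^sup>2)) (at s)"
        using 3 by (auto intro!: derivative_eq_intros simp: power2_eq_square)
    qed
    moreover have "(poly (pderiv P) (1 / s) * (- 1 / s\<^sup>2)) * exp (- m / s) + (exp (- m / s) * (m / s\<^sup>2)) * poly P (1 / s) =
        flat_fun m (flat_deriv m P) s"
      using 3 by (simp add: flat_fun_def flat_deriv_def field_simps power2_eq_square)
    ultimately have "((\<lambda>s. poly P (1 / s) * exp (- m / s)) has_real_derivative flat_fun m (flat_deriv m P) s) (at s)"
      by simp
    then show ?thesis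
      by (rule has_field_derivative_transform_within_open[of _ _ _ "{0<..}"]) (use 3 in \<open>auto simp: flat_fun_def\<close>)
  qed
qed

lemma flat_fun_mult: "flat_fun m P s * flat_fun m' Q s = flat_fun (m + m') (P * Q) s"
  by (simp add: flat_fun_def exp_add[symmetric] diff_divide_distrib)

lemma flat_fun_smult: "c * flat_fun m P s = flat_fun m (smult c P) s"
  by (simp add: flat_fun_def)

text \<open>Besides regularity of order \<open>k\<close>, all derivatives of positive order vanish
  at \<open>x\<close>, while the value there is free. This is what allows two pieces with the same
  value at \<open>x\<close> to be glued.\<close>

primrec curve_flat :: "nat \<Rightarrow> real \<Rightarrow> real set \<Rightarrow> (real \<Rightarrow> complex) \<Rightarrow> bool" where
  "curve_flat 0 x I c \<longleftrightarrow> continuous_on I c"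
| "curve_flat (Suc k) x I c \<longleftrightarrow> continuous_on I c \<and>
     (\<exists>c'. curve_flat k x I c' \<and> (x \<in> I \<longrightarrow> c' x = 0) \<and> (\<forall>t\<in>I. (c has_vector_derivative c' t) (at t within I)))"

lemma curve_flat_add: "curve_flat k x I c \<Longrightarrow> curve_flat k x I d \<Longrightarrow> curve_flat k x I (\<lambda>t. c t + d t)"
proof (induction k arbitrary: c d)
  case 0
  then show ?case by (simp add: continuous_on_add)
next
  case (Suc k)
  from Suc.prems obtain c' d' where 1: "curve_flat k x I c'" "x \<in> I \<longrightarrow> c' x = 0" "\<forall>t\<in>I. (c has_vector_derivative c' t) (at t within I)"
    "curve_flat k x I d'" "x \<in> I \<longrightarrow> d' x = 0" "\<forall>t\<in>I. (d has_vector_derivative d' t) (at t within I)" by auto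
  have "curve_flat k x I (\<lambda>t. c' t + d' t)" using Suc.IH 1 by blast
  moreover have "\<forall>t\<in>I. ((\<lambda>t. c t + d t) has_vector_derivative c' t + d' t) (at t within I)"
    using 1 has_vector_derivative_add by blast
  moreover have "x \<in> I \<longrightarrow> c' x + d' x = 0" using 1 by auto
  moreover have "continuous_on I (\<lambda>t. c t + d t)" using Suc.prems by (auto intro: continuous_on_add)
  ultimately show ?case unfolding curve_flat.simps by (intro conjI exI[of _ "\<lambda>t. c' t + d' t"])
qed

lemma continuous_on_split_le:
  fixes x :: real and c d :: "real \<Rightarrow> complex"
  assumes "continuous_on (I \<inter> {..x}) c" "continuous_on (I \<inter> {x..}) d" "x \<in> I \<Longrightarrow> c x = d x"
  shows "continuous_on I (\<lambda>t. if t \<le> x then c t else d t)"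
proof -
  have eq: "(I \<inter> {..x}) \<union> (I \<inter> {x..}) = I" by auto
  have "closedin (top_of_set I) (I \<inter> {..x})" "closedin (top_of_set I) (I \<inter> {x..})"
    by (simp_all add: closedin_closed_Int)
  then have "continuous_on ((I \<inter> {..x}) \<union> (I \<inter> {x..})) (\<lambda>t. if t \<le> x then c t else d t)"
    using assms by (intro continuous_on_cases_local) (auto simp: eq)
  then show ?thesis by (simp add: eq)
qed

text \<open>The derivatives of the two pieces are again flat and both vanish at \<open>x\<close>, so
  they satisfy the hypotheses one order lower.\<close>

lemma curve_Ck_glue:
  assumes "curve_flat k x (I \<inter> {..x}) c" "curve_flat k x (I \<inter> {x..}) d" "x \<in> I \<Longrightarrow> c x = d x"
  shows "curve_Ck k I (\<lambda>t. if t \<le> x then c t else d t)"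
  using assms
proof (induction k arbitrary: c d)
  case (0 c d)
  then show ?case using continuous_on_split_le[of I x c d] by simp
next
  case (Suc k c d)
  from Suc.prems obtain c' where c': "continuous_on (I \<inter> {..x}) c" "curve_flat k x (I \<inter> {..x}) c'"
      "x \<in> I \<Longrightarrow> c' x = 0" "\<And>t. t \<in> I \<inter> {..x} \<Longrightarrow> (c has_vector_derivative c' t) (at t within I \<inter> {..x})" by auto
  from Suc.prems obtain d' where d': "continuous_on (I \<inter> {x..}) d" "curve_flat k x (I \<inter> {x..}) d'"
      "x \<in> I \<Longrightarrow> d' x = 0" "\<And>t. t \<in> I \<inter> {x..} \<Longrightarrow> (d has_vector_derivative d' t) (at t within I \<inter> {x..})" by auto
  let ?c = "\<lambda>t. if t \<le> x then c t else d t" and ?c' = "\<lambda>t. if t \<le> x then c' t else d' t"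
  have IH: "curve_Ck k I ?c'" using Suc.IH[OF c'(2) d'(2)] c'(3) d'(3) by simp
  have cont: "curve_Ck 0 I ?c" using continuous_on_split_le[OF c'(1) d'(1) Suc.prems(3)] by simp
  have der: "(?c has_vector_derivative ?c' t) (at t within I)" if t: "t \<in> I" for t
  proof -
    consider "t < x" | "t = x" | "t > x" by linarith
    then show ?thesis
    proof cases
      case 1
      have "at t within I = at t within (I \<inter> {..x})"
        by (rule at_within_nhd[of _ "{..<x}"]) (use 1 in auto)
      then have "(c has_vector_derivative c' t) (at t within I)" using c'(4)[of t] t 1 by simp
      then have "(?c has_vector_derivative c' t) (at t within I)"
        by (rule has_vector_derivative_transform_within[where d = "x - t"]) (use 1 t in \<open>auto simp: dist_real_def\<close>)
      then show ?thesis using 1 by simp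
    next
      case 3
      have "at t within I = at t within (I \<inter> {x..})"
        by (rule at_within_nhd[of _ "{x<..}"]) (use 3 in auto)
      then have "(d has_vector_derivative d' t) (at t within I)" using d'(4)[of t] t 3 by simp
      then have "(?c has_vector_derivative d' t) (at t within I)"
        by (rule has_vector_derivative_transform_within[where d = "t - x"]) (use 3 t in \<open>auto simp: dist_real_def\<close>)
      then show ?thesis using 3 by simp
    next
      case 2
      have "(?c has_vector_derivative 0) (at x within I \<inter> {..x})"
        using c'(4)[of x] c'(3) t 2 has_vector_derivative_transform[of x "I \<inter> {..x}" ?c c 0] by auto
      moreover have "(?c has_vector_derivative 0) (at x within I \<inter> {x..})"
      proof (rule has_vector_derivative_transform)
        show "?c y = d y" if "y \<in> I \<inter> {x..}" for y
          using that Suc.prems(3) t 2 by (cases "y = x") auto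
        show "(d has_vector_derivative 0) (at x within I \<inter> {x..})" using d'(4)[of x] d'(3) t 2 by simp
      qed (use t 2 in simp)
      \<comment> \<open>The two one-sided derivatives combine because the filter at \<open>x\<close>
        is the supremum of the left and the right one.\<close>
      moreover have "at x within I = sup (at x within I \<inter> {..x}) (at x within I \<inter> {x..})"
        unfolding at_within_union[symmetric] by (rule arg_cong[where f = "\<lambda>S. at x within S"]) auto
      ultimately have "(?c has_vector_derivative 0) (at x within I)"
        unfolding has_vector_derivative_def has_derivative_within by (auto intro: filterlim_sup)
      then show ?thesis using 2 c'(3) t by simp
    qed
  qed
  show ?case using cont IH der by auto
qed

lemma curve_Ck_SucD: "curve_Ck (Suc k) I c \<Longrightarrow> curve_Ck k I c"
proof (induction k arbitrary: c)
  case (Suc k)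
  then obtain c' where "curve_Ck (Suc k) I c'" "\<forall>t\<in>I. (c has_vector_derivative c' t) (at t within I)" "continuous_on I c"
    by auto
  then show ?case using Suc.IH[of c'] by auto
qed simp

section \<open>Composition with a flat reparametrisation\<close>

context
  fixes I J :: "real set" and \<alpha> \<beta> a b x :: real and F :: "real poly" and h :: "real \<Rightarrow> real"
  assumes h: "h = (\<lambda>t. \<alpha> + \<beta> * flat_fun 1 F (a * t + b))" and hJ: "\<And>t. t \<in> I \<Longrightarrow> h t \<in> J" and x: "a * x + b = 0"
begin

lemma flat_affine_deriv: "0 < m \<Longrightarrow> ((\<lambda>t. flat_fun m P (a * t + b)) has_real_derivative a * flat_fun m (flat_deriv m P) (a * t + b)) (at t)"
proof -
  assume m: "0 < m"
  have "((\<lambda>t. a * t + b) has_real_derivative a) (at t)" by (auto intro!: derivative_eq_intros)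
  from DERIV_chain2[where f = "flat_fun m P" and g = "\<lambda>t. a * t + b", OF flat_fun_DERIV[OF m] this]
  show ?thesis by (simp add: mult.commute)
qed

lemma h_deriv: "(h has_real_derivative \<beta> * (a * flat_fun 1 (flat_deriv 1 F) (a * t + b))) (at t)"
  unfolding h using DERIV_add[OF DERIV_const DERIV_cmult[OF flat_affine_deriv[of 1]]] by simp

lemma h_continuous: "continuous_on S h"
  using DERIV_isCont[OF h_deriv] by (intro continuous_at_imp_continuous_on) blast

lemma flat_affine_continuous: "0 < m \<Longrightarrow> continuous_on S (\<lambda>t. flat_fun m P (a * t + b))"
  using flat_affine_deriv DERIV_isCont by (intro continuous_at_imp_continuous_on) blast

lemma comp_h_deriv:
  assumes g: "\<And>s. s \<in> J \<Longrightarrow> (g has_vector_derivative g' s) (at s within J)" and t: "t \<in> I"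
  shows "((\<lambda>t. g (h t)) has_vector_derivative
    complex_of_real (flat_fun 1 (smult (\<beta> * a) (flat_deriv 1 F)) (a * t + b)) * g' (h t)) (at t within I)"
proof -
  have 1: "(h has_vector_derivative \<beta> * (a * flat_fun 1 (flat_deriv 1 F) (a * t + b))) (at t within I)"
    using h_deriv by (simp add: has_real_derivative_iff_has_vector_derivative has_vector_derivative_at_within)
  have "(g has_vector_derivative g' (h t)) (at (h t) within h ` I)"
    using g[OF hJ[OF t]] by (rule has_vector_derivative_within_subset) (use hJ in auto)
  from vector_diff_chain_within[OF 1 this] show ?thesis
    by (simp add: comp_def scaleR_conv_of_real flat_fun_smult[symmetric] mult.assoc)
qed

text \<open>Differentiation gives two terms of the same shape: one with the derivative of the flat
  factor, one with an extra flat factor coming from the inner derivative, whence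
  \<open>m + 1\<close>. Generality in \<open>m\<close>, \<open>P\<close> and \<open>g\<close> closes
  the induction.\<close>

lemma curve_flat_times:
  assumes "curve_Ck k J g" "0 < m"
  shows "curve_flat k x I (\<lambda>t. complex_of_real (flat_fun m P (a * t + b)) * g (h t))"
  using assms
proof (induction k arbitrary: m P g)
  case 0
  then show ?case
    using hJ by (auto intro!: continuous_intros flat_affine_continuous continuous_on_compose2[of J g I h] h_continuous)
next
  case (Suc k)
  then obtain g' where g': "curve_Ck k J g'" "\<And>s. s \<in> J \<Longrightarrow> (g has_vector_derivative g' s) (at s within J)"
    "continuous_on J g" by auto
  let ?q = "\<lambda>m P t. complex_of_real (flat_fun m P (a * t + b))"
  let ?P1 = "smult a (flat_deriv m P)" and ?P2 = "P * smult (\<beta> * a) (flat_deriv 1 F)"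
  have 1: "curve_flat k x I (\<lambda>t. ?q m ?P1 t * g (h t) + ?q (m + 1) ?P2 t * g' (h t))"
    using Suc.IH curve_Ck_SucD[OF Suc.prems(1)] g'(1) Suc.prems(2) by (intro curve_flat_add) auto
  have 2: "((\<lambda>t. ?q m P t * g (h t)) has_vector_derivative ?q m ?P1 t * g (h t) + ?q (m + 1) ?P2 t * g' (h t)) (at t within I)"
    if t: "t \<in> I" for t
  proof -
    have "((\<lambda>t. flat_fun m P (a * t + b)) has_real_derivative flat_fun m ?P1 (a * t + b)) (at t within I)"
      using flat_affine_deriv[OF Suc.prems(2), of P t] by (simp add: flat_fun_smult has_field_derivative_at_within)
    note * = has_vector_derivative_mult[OF has_vector_derivative_of_real[OF this]
        comp_h_deriv[OF g'(2) t]]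
    have "?q (m + 1) ?P2 t = ?q m P t * complex_of_real (flat_fun 1 (smult (\<beta> * a) (flat_deriv 1 F)) (a * t + b))"
      by (simp only: flat_fun_mult[symmetric] of_real_mult)
    with * show ?thesis by (simp only: add.commute mult.assoc)
  qed
  have 3: "continuous_on I (\<lambda>t. ?q m P t * g (h t))"
    using hJ Suc.prems(2) g'(3)
    by (auto intro!: continuous_intros flat_affine_continuous continuous_on_compose2[of J g I h] h_continuous)
  show ?case
    unfolding curve_flat.simps
    by (intro conjI exI[of _ "\<lambda>t. ?q m ?P1 t * g (h t) + ?q (m + 1) ?P2 t * g' (h t)"] 1 3 ballI 2 impI) (simp_all add: x)
qed

text \<open>The composition carries no flat factor itself, but its derivative does, so
  \<open>curve_flat_times\<close> applies one order lower.\<close>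

lemma curve_flat_comp:
  assumes "curve_Ck k J g"
  shows "curve_flat k x I (\<lambda>t. g (h t))"
proof (cases k)
  case 0
  then show ?thesis using assms hJ by (auto intro!: continuous_on_compose2[of J g I h] h_continuous)
next
  case (Suc j)
  then obtain g' where g': "curve_Ck j J g'" "\<And>s. s \<in> J \<Longrightarrow> (g has_vector_derivative g' s) (at s within J)"
    "continuous_on J g" using assms by auto
  have "continuous_on I (\<lambda>t. g (h t))" using hJ g'(3) by (auto intro!: continuous_on_compose2[of J g I h] h_continuous)
  then show ?thesis
    unfolding Suc curve_flat.simps
    using curve_flat_times[OF g'(1) zero_less_one, of "smult (\<beta> * a) (flat_deriv 1 F)"] comp_h_deriv[of g g', OF g'(2)]
    by (intro conjI exI[of _ "\<lambda>t. complex_of_real (flat_fun 1 (smult (\<beta> * a) (flat_deriv 1 F)) (a * t + b)) * g' (h t)"])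
      (auto simp: x)
qed

end

text \<open>The function \<open>exp (- 1 / s)\<close>, scaled by \<open>exp 1\<close> so that it
  maps the unit interval onto itself; it is flat at 0.\<close>

definition joint :: "real \<Rightarrow> real" where
  "joint s = flat_fun 1 [:exp 1:] s"

lemma joint_values: "joint 0 = 0" "joint 1 = 1"
  by (simp_all add: joint_def flat_fun_def exp_add[symmetric])

lemma joint_bounds: "s \<le> 1 \<Longrightarrow> 0 \<le> joint s \<and> joint s \<le> 1" "0 < s \<Longrightarrow> s < 1 \<Longrightarrow> 0 < joint s \<and> joint s < 1"
  by (simp_all add: joint_def flat_fun_def exp_add[symmetric] field_simps)

lemma joint_deriv: "(joint has_real_derivative flat_fun 1 (flat_deriv 1 [:exp 1:]) s) (at s)"
  unfolding joint_def[abs_def] by (rule flat_fun_DERIV) simp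

lemma joint_deriv_nonneg: "0 \<le> flat_fun 1 (flat_deriv 1 [:exp 1:]) s"
  by (simp add: flat_fun_def flat_deriv_def)

text \<open>Both arguments of \<open>joint\<close> vanish at \<open>t = 1 / 2\<close>, which puts
  the flat points of the two halves at their common point.\<close>

definition concat_path :: "(real \<Rightarrow> 'a) \<Rightarrow> (real \<Rightarrow> 'a) \<Rightarrow> real \<Rightarrow> 'a" where
  "concat_path \<gamma> \<delta> t = (if t \<le> 1 / 2 then \<gamma> (1 - joint (1 - 2 * t)) else \<delta> (joint (2 * t - 1)))"

text \<open>Flatness at the joint makes the glued coordinates smooth in every chart. The joint is an
  interior parameter of the new path, hence has to be regular.\<close>

lemma admissible_concat:
  assumes ad: "admissible_path n X \<O> a b \<gamma>" "admissible_path n X \<O> b c \<delta>" and b: "b \<in> regular_locus X \<O>"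
  shows "admissible_path n X \<O> a c (concat_path \<gamma> \<delta>)"
  unfolding admissible_path_def
proof (intro conjI allI impI ballI)
  let ?h1 = "\<lambda>t. 1 - joint (1 - 2 * t)" and ?h2 = "\<lambda>t. joint (2 * t - 1)"
  have cj: "continuous_on S joint" for S
    using DERIV_isCont[OF joint_deriv] by (intro continuous_at_imp_continuous_on) blast
  have c1: "continuous_on S ?h1" and c2: "continuous_on S ?h2" for S
    by (auto intro!: continuous_intros continuous_on_compose2[OF cj[of UNIV]])
  have r1: "?h1 t \<in> {0..1}" if "0 \<le> t" for t using joint_bounds(1)[of "1 - 2 * t"] that by auto
  have r2: "?h2 t \<in> {0..1}" if "t \<le> 1" for t using joint_bounds(1)[of "2 * t - 1"] that by auto
  have "continuous_map (subtopology (top_of_set {0..1}) {t \<in> topspace (top_of_set {0..1}). t \<le> 1 / 2}) (top_of_set {0..1}) ?h1"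
    using c1 r1 by (auto simp: continuous_map_in_subtopology subtopology_subtopology)
  from continuous_map_compose[OF this admissible_pathD(1)[OF ad(1)]]
  have m1: "continuous_map (subtopology (top_of_set {0..1}) {t \<in> topspace (top_of_set {0..1}). t \<le> 1 / 2}) X (\<lambda>t. \<gamma> (?h1 t))"
    by (simp add: comp_def)
  have "continuous_map (subtopology (top_of_set {0..1}) {t \<in> topspace (top_of_set {0..1}). 1 / 2 \<le> t}) (top_of_set {0..1}) ?h2"
    using c2 r2 by (auto simp: continuous_map_in_subtopology subtopology_subtopology)
  from continuous_map_compose[OF this admissible_pathD(1)[OF ad(2)]]
  have m2: "continuous_map (subtopology (top_of_set {0..1}) {t \<in> topspace (top_of_set {0..1}). 1 / 2 \<le> t}) X (\<lambda>t. \<delta> (?h2 t))"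
    by (simp add: comp_def)
  have half: "\<gamma> (?h1 (1 / 2)) = b" "\<delta> (?h2 (1 / 2)) = b"
    using admissible_pathD(2,3)[OF ad(1)] admissible_pathD(2,3)[OF ad(2)] by (simp_all add: joint_values)
  have "continuous_map (top_of_set {0..1}) X (\<lambda>t. if t \<le> 1 / 2 then \<gamma> (?h1 t) else \<delta> (?h2 t))"
  proof (rule continuous_map_cases_le[OF _ _ m1 m2])
    show "continuous_map (top_of_set {0..1}) euclideanreal (\<lambda>t. t)" "continuous_map (top_of_set {0..1}) euclideanreal (\<lambda>t. 1 / 2)"
      by auto
    show "\<gamma> (?h1 t) = \<delta> (?h2 t)" if "t = 1 / 2" for t unfolding that half by (rule refl)
  qed
  then show "continuous_map (top_of_set {0..1}) X (concat_path \<gamma> \<delta>)"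
    unfolding concat_path_def[abs_def] .
  show "concat_path \<gamma> \<delta> 0 = a" "concat_path \<gamma> \<delta> 1 = c"
    using admissible_pathD(2,3)[OF ad(1)] admissible_pathD(2,3)[OF ad(2)] by (simp_all add: concat_path_def joint_values)
  show "concat_path \<gamma> \<delta> t \<in> regular_locus X \<O>" if t: "t \<in> {0<..<1}" for t
  proof -
    consider "t < 1 / 2" | "t = 1 / 2" | "1 / 2 < t" by linarith
    then show ?thesis
    proof cases
      case 1
      then show ?thesis
        using joint_bounds(2)[of "1 - 2 * t"] admissible_pathD(4)[OF ad(1), of "?h1 t"] t by (simp add: concat_path_def)
    next
      case 2
      show ?thesis unfolding 2 concat_path_def using half(1) b by simp
    next
      case 3
      then show ?thesis
        using joint_bounds(2)[of "2 * t - 1"] admissible_pathD(4)[OF ad(2), of "?h2 t"] t by (simp add: concat_path_def)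
    qed
  qed
  fix U \<phi> k i assume ch: "holo_chart X \<O> n U \<phi>"
  let ?I = "{t \<in> {0..1}. concat_path \<gamma> \<delta> t \<in> U}"
  \<comment> \<open>At \<open>1 / 2\<close> the definition takes the first branch, so the second
    path is reached through the common value \<open>b\<close>.\<close>
  have I2: "\<delta> (?h2 t) \<in> U" if "t \<in> ?I \<inter> {1 / 2..}" for t
  proof (cases "t = 1 / 2")
    case True
    have "\<gamma> (?h1 (1 / 2)) \<in> U" using that unfolding True concat_path_def by simp
    then show ?thesis unfolding True half .
  qed (use that in \<open>auto simp: concat_path_def\<close>)
  have "curve_flat k (1 / 2) (?I \<inter> {..1 / 2}) (\<lambda>t. \<phi> (\<gamma> (?h1 t)) i)"
  proof (rule curve_flat_comp[of ?h1 1 "-1" "[:exp 1:]" "-2" 1])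
    show "?h1 = (\<lambda>t. 1 + - 1 * flat_fun 1 [:exp 1:] (- 2 * t + 1))" by (simp add: joint_def)
    show "?h1 t \<in> {t \<in> {0..1}. \<gamma> t \<in> U}" if "t \<in> ?I \<inter> {..1 / 2}" for t
      using that r1[of t] by (auto simp: concat_path_def)
    show "curve_Ck k {t \<in> {0..1}. \<gamma> t \<in> U} (\<lambda>t. \<phi> (\<gamma> t) i)" by (rule admissible_pathD(5)[OF ad(1) ch])
  qed simp
  moreover have "curve_flat k (1 / 2) (?I \<inter> {1 / 2..}) (\<lambda>t. \<phi> (\<delta> (?h2 t)) i)"
  proof (rule curve_flat_comp[of ?h2 0 1 "[:exp 1:]" 2 "-1"])
    show "?h2 = (\<lambda>t. 0 + 1 * flat_fun 1 [:exp 1:] (2 * t + - 1))" by (simp add: joint_def)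
    show "?h2 t \<in> {t \<in> {0..1}. \<delta> t \<in> U}" if "t \<in> ?I \<inter> {1 / 2..}" for t
      using that r2[of t] I2[OF that] by auto
    show "curve_Ck k {t \<in> {0..1}. \<delta> t \<in> U} (\<lambda>t. \<phi> (\<delta> t) i)" by (rule admissible_pathD(5)[OF ad(2) ch])
  qed simp
  ultimately have "curve_Ck k ?I (\<lambda>t. if t \<le> 1 / 2 then \<phi> (\<gamma> (?h1 t)) i else \<phi> (\<delta> (?h2 t)) i)"
    by (rule curve_Ck_glue) (simp only: half)
  moreover have "(\<lambda>t. if t \<le> 1 / 2 then \<phi> (\<gamma> (?h1 t)) i else \<phi> (\<delta> (?h2 t)) i) = (\<lambda>t. \<phi> (concat_path \<gamma> \<delta> t) i)"
    by (rule ext) (simp add: concat_path_def)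
  ultimately show "curve_Ck k ?I (\<lambda>t. \<phi> (concat_path \<gamma> \<delta> t) i)" by simp
qed

context orbifold
begin

text \<open>Substitution along the monotone \<open>h\<close>. It is enough that
  \<open>\<delta>\<close> agrees with the composition near each interior parameter, as each half of
  a concatenated path does.\<close>

lemma path_len_reparam_half:
  assumes \<omega>: "kaehler_form_on_reg n X \<O> \<omega>" and ad: "admissible_path n X \<O> a b \<gamma>"
    and h: "\<And>t. (h has_real_derivative h' t) (at t)" "continuous_on {l..r} h'" "\<And>t. 0 \<le> h' t" "h l = 0" "h r = 1" "l \<le> r"
    and hr: "\<And>t. l < t \<Longrightarrow> t < r \<Longrightarrow> 0 < h t \<and> h t < 1"
    and eq: "\<And>t. l < t \<Longrightarrow> t < r \<Longrightarrow> \<forall>\<^sub>F s in nhds t. \<delta> s = \<gamma> (h s)"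
  shows "(\<integral>\<^sup>+ t. ennreal (speed n X \<O> \<omega> \<delta> t * indicator {l<..<r} t) \<partial>lborel) \<le> path_len n X \<O> \<omega> \<gamma>"
proof -
  let ?f = "\<lambda>t. speed n X \<O> \<omega> \<gamma> t * indicator {0<..<1} t"
  have "(\<integral>\<^sup>+ t. ennreal (speed n X \<O> \<omega> \<delta> t * indicator {l<..<r} t) \<partial>lborel) \<le>
      (\<integral>\<^sup>+ t. ennreal (?f (h t) * h' t * indicator {l..r} t) \<partial>lborel)"
  proof (rule nn_integral_mono)
    fix t :: real
    show "ennreal (speed n X \<O> \<omega> \<delta> t * indicator {l<..<r} t) \<le> ennreal (?f (h t) * h' t * indicator {l..r} t)"
    proof (cases "l < t \<and> t < r")
      case True
      then have i: "0 < h t" "h t < 1" using hr by auto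
      obtain U \<phi> where U: "holo_chart X \<O> n U \<phi>" "\<gamma> (h t) \<in> U"
        using regular_chart[OF admissible_pathD(4)[OF ad i]] by blast
      have "speed n X \<O> \<omega> \<delta> t = speed n X \<O> \<omega> (\<lambda>s. \<gamma> (h s)) t"
        using speed_cong[OF eq] True by blast
      also have "\<dots> = h' t * speed n X \<O> \<omega> \<gamma> (h t)"
        using speed_reparam[OF \<omega> admissible_chart_diff[OF ad i] h(1) U] h(3)[of t] by simp
      finally show ?thesis using True i by (simp add: mult.commute)
    next
      case False
      then show ?thesis by auto
    qed
  qed
  also have "\<dots> = (\<integral>\<^sup>+ t. ennreal (?f t * indicator {h l..h r} t) \<partial>lborel)"
  proof (rule nn_integral_substitution[symmetric])
    show "set_borel_measurable borel {h l..h r} ?f"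
      unfolding set_borel_measurable_def using speed_measurable[OF \<omega> ad] by (intro borel_measurable_scaleR) auto
  qed (use h in auto)
  also have "\<dots> \<le> path_len n X \<O> \<omega> \<gamma>"
    unfolding path_len_alt using speed_nonneg[OF \<omega> ad] by (intro nn_integral_mono) (auto split: split_indicator)
  finally show ?thesis .
qed

lemma path_len_concat:
  assumes \<omega>: "kaehler_form_on_reg n X \<O> \<omega>"
    and ad: "admissible_path n X \<O> a b \<gamma>" "admissible_path n X \<O> b c \<delta>" and b: "b \<in> regular_locus X \<O>"
  shows "path_len n X \<O> \<omega> (concat_path \<gamma> \<delta>) \<le> path_len n X \<O> \<omega> \<gamma> + path_len n X \<O> \<omega> \<delta>"
proof -
  let ?d = "flat_fun 1 (flat_deriv 1 [:exp 1:])" and ?h1 = "\<lambda>t. 1 - joint (1 - 2 * t)" and ?h2 = "\<lambda>t. joint (2 * t - 1)"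
  let ?s = "speed n X \<O> \<omega> (concat_path \<gamma> \<delta>)"
  have a1: "((\<lambda>t. 1 - 2 * t) has_real_derivative - 2) (at t)" and a2: "((\<lambda>t. 2 * t - 1) has_real_derivative 2) (at t)" for t
    by (auto intro!: derivative_eq_intros)
  have d1: "(?h1 has_real_derivative ?d (1 - 2 * t) * 2) (at t)" for t
    using DERIV_diff[OF DERIV_const[of 1] DERIV_chain2[where f = joint and g = "\<lambda>t. 1 - 2 * t", OF joint_deriv a1]] by simp
  have d2: "(?h2 has_real_derivative ?d (2 * t - 1) * 2) (at t)" for t
    using DERIV_chain2[where f = joint and g = "\<lambda>t. 2 * t - 1", OF joint_deriv a2] by simp
  have cd: "continuous_on S ?d" for S
    using DERIV_isCont[OF flat_fun_DERIV[of 1]] by (intro continuous_at_imp_continuous_on) simp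
  have l1: "(\<integral>\<^sup>+ t. ennreal (?s t * indicator {0<..<1/2} t) \<partial>lborel) \<le> path_len n X \<O> \<omega> \<gamma>"
  proof (rule path_len_reparam_half[OF \<omega> ad(1) d1])
    show "continuous_on {0..1/2} (\<lambda>t. ?d (1 - 2 * t) * 2)"
      by (intro continuous_intros continuous_on_compose2[OF cd[of UNIV]]) auto
    show "\<forall>\<^sub>F s in nhds t. concat_path \<gamma> \<delta> s = \<gamma> (?h1 s)" if "0 < t" "t < 1 / 2" for t
      using eventually_nhds_in_open[of "{..<1/2}" t] that
      by (auto simp: concat_path_def elim!: eventually_mono)
    show "0 < ?h1 t \<and> ?h1 t < 1" if "0 < t" "t < 1 / 2" for t
      using joint_bounds(2)[of "1 - 2 * t"] that by auto
  qed (use joint_deriv_nonneg in \<open>auto simp: joint_values\<close>)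
  have l2: "(\<integral>\<^sup>+ t. ennreal (?s t * indicator {1/2<..<1} t) \<partial>lborel) \<le> path_len n X \<O> \<omega> \<delta>"
  proof (rule path_len_reparam_half[OF \<omega> ad(2) d2])
    show "continuous_on {1/2..1} (\<lambda>t. ?d (2 * t - 1) * 2)"
      by (intro continuous_intros continuous_on_compose2[OF cd[of UNIV]]) auto
    show "\<forall>\<^sub>F s in nhds t. concat_path \<gamma> \<delta> s = \<delta> (?h2 s)" if "1 / 2 < t" "t < 1" for t
      using eventually_nhds_in_open[of "{1/2<..}" t] that
      by (auto simp: concat_path_def elim!: eventually_mono)
    show "0 < ?h2 t \<and> ?h2 t < 1" if "1 / 2 < t" "t < 1" for t
      using joint_bounds(2)[of "2 * t - 1"] that by auto
  qed (use joint_deriv_nonneg in \<open>auto simp: joint_values\<close>)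
  have adc: "admissible_path n X \<O> a c (concat_path \<gamma> \<delta>)" by (rule admissible_concat[OF ad b])
  note m = speed_measurable[OF \<omega> adc]
  have ms: "(\<lambda>t. ennreal (?s t * indicator S t)) \<in> borel_measurable lborel" if "S \<in> sets borel" "S \<subseteq> {0<..<1}" for S
  proof -
    have "(\<lambda>t. ?s t * indicator {0<..<1} t * indicator S t) \<in> borel_measurable borel"
      by (rule borel_measurable_times[OF m borel_measurable_indicator[OF that(1)]])
    moreover have "(\<lambda>t. ?s t * indicator {0<..<1} t * indicator S t) = (\<lambda>t. ?s t * indicator S t)"
      using that(2) by (auto simp: fun_eq_iff split: split_indicator)
    ultimately show ?thesis by simp
  qed
  have "path_len n X \<O> \<omega> (concat_path \<gamma> \<delta>) \<le>
      (\<integral>\<^sup>+ t. ennreal (?s t * indicator {0<..<1/2} t) + ennreal (?s t * indicator {1/2<..<1} t) \<partial>lborel)"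
    unfolding path_len_alt
  \<comment> \<open>The joint is a single parameter, hence a null set.\<close>
  proof (rule nn_integral_mono_AE, rule AE_mp[OF AE_lborel_singleton[of "1/2"] AE_I2], intro impI)
    fix t :: real assume "t \<noteq> 1 / 2"
    then show "ennreal (?s t * indicator {0<..<1} t) \<le> ennreal (?s t * indicator {0<..<1/2} t) + ennreal (?s t * indicator {1/2<..<1} t)"
      by (auto split: split_indicator)
  qed
  also have "\<dots> = (\<integral>\<^sup>+ t. ennreal (?s t * indicator {0<..<1/2} t) \<partial>lborel) + (\<integral>\<^sup>+ t. ennreal (?s t * indicator {1/2<..<1} t) \<partial>lborel)"
    by (intro nn_integral_add ms) auto
  also have "\<dots> \<le> path_len n X \<O> \<omega> \<gamma> + path_len n X \<O> \<omega> \<delta>" by (rule add_mono[OF l1 l2])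
  finally show ?thesis .
qed

text \<open>Nearly shortest paths are concatenated at \<open>b\<close>, which is admissible because
  \<open>b\<close> is regular. A singular \<open>b\<close> requires small neighbourhoods of small
  diameter.\<close>

lemma kdist_triangle_regular:
  assumes \<omega>: "kaehler_form_on_reg n X \<O> \<omega>" and b: "b \<in> regular_locus X \<O>"
  shows "kdist n X \<O> \<omega> a c \<le> kdist n X \<O> \<omega> a b + kdist n X \<O> \<omega> b c"
proof (rule ennreal_le_epsilon)
  fix e :: real assume fin: "kdist n X \<O> \<omega> a b + kdist n X \<O> \<omega> b c < top_class.top" and e: "0 < e"
  have "kdist n X \<O> \<omega> a b < kdist n X \<O> \<omega> a b + ennreal (e / 2)"
    "kdist n X \<O> \<omega> b c < kdist n X \<O> \<omega> b c + ennreal (e / 2)"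
    using fin e by (auto simp: ennreal_add_left_cancel_less less_top[symmetric])
  then obtain \<gamma> \<delta> where \<gamma>: "admissible_path n X \<O> a b \<gamma>" "path_len n X \<O> \<omega> \<gamma> < kdist n X \<O> \<omega> a b + ennreal (e / 2)"
    and \<delta>: "admissible_path n X \<O> b c \<delta>" "path_len n X \<O> \<omega> \<delta> < kdist n X \<O> \<omega> b c + ennreal (e / 2)"
    using kdist_lessE by metis
  have "kdist n X \<O> \<omega> a c \<le> path_len n X \<O> \<omega> \<gamma> + path_len n X \<O> \<omega> \<delta>"
    using kdist_le[OF admissible_concat[OF \<gamma>(1) \<delta>(1) b]] path_len_concat[OF \<omega> \<gamma>(1) \<delta>(1) b] by (rule order_trans)
  also have "\<dots> \<le> (kdist n X \<O> \<omega> a b + ennreal (e / 2)) + (kdist n X \<O> \<omega> b c + ennreal (e / 2))"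
    using \<gamma>(2) \<delta>(2) by (intro add_mono) auto
  also have "\<dots> = kdist n X \<O> \<omega> a b + kdist n X \<O> \<omega> b c + (ennreal (e / 2) + ennreal (e / 2))" by (simp only: ac_simps)
  also have "ennreal (e / 2) + ennreal (e / 2) = ennreal e" using e by (simp flip: ennreal_plus)
  finally show "kdist n X \<O> \<omega> a c \<le> kdist n X \<O> \<omega> a b + kdist n X \<O> \<omega> b c + ennreal e" .
qed

end

section \<open>Paths in quotient charts\<close>

text \<open>At a limit point of the preimage of \<open>Z\<close> the local equations vanish on a
  whole disc by the identity theorem, so the limit points form a clopen subset of \<open>D\<close>.
  The point \<open>s0\<close> excludes all of \<open>D\<close>, and a set without limit points in
  \<open>D\<close> is countable.\<close>

lemma analytic_subset_curve_countable:
  assumes Z: "analytic_subset (top_of_set V) (holo n) Z" and V: "Cn_open n V"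
    and S: "\<And>i. (\<lambda>s. S s i) holomorphic_on D" and D: "open D" "connected D" and SV: "S ` D \<subseteq> V"
    and s0: "s0 \<in> D" "S s0 \<notin> Z"
  shows "countable {s \<in> D. S s \<in> Z}"
proof -
  let ?E = "{s \<in> D. S s \<in> Z}" and ?L = "{s \<in> D. s islimpt {s \<in> D. S s \<in> Z}}"
  have cS: "continuous_on D S"
    using holomorphic_on_imp_continuous_on[OF S] by (intro continuous_on_coordinatewise_then_product)
  have key: "\<exists>e>0. ball s e \<subseteq> ?E" if s: "s \<in> D" "s islimpt ?E" for s
  proof -
    have "S s \<in> topspace (top_of_set V)" using SV s by auto
    then obtain W F where W: "openin (top_of_set V) W" "S s \<in> W" "F \<subseteq> holo n W" "Z \<inter> W = {y \<in> W. \<forall>f\<in>F. f y = 0}"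
      using Z unfolding analytic_subset_def by blast
    have Wo: "Cn_open n W" using W(1) V unfolding Cn_open_def by (rule openin_trans)
    obtain T where T: "open T" "W = V \<inter> T" using W(1) by (auto simp: openin_open)
    have "open (D \<inter> S -` T)" using continuous_open_preimage[OF cS D(1) T(1)] .
    moreover have "s \<in> D \<inter> S -` T" using s W(2) T by blast
    ultimately obtain e where e: "e > 0" "ball s e \<subseteq> D \<inter> S -` T" using openE by blast
    have BW: "S t \<in> W" if "t \<in> ball s e" for t using that e(2) SV T by blast
    \<comment> \<open>On the smaller disc, which is mapped into \<open>W\<close>, the equations of
      \<open>Z\<close> are available, and \<open>s\<close> is still a limit point.\<close>
    have lim: "s islimpt (?E \<inter> ball s e)"
      unfolding islimpt_def
    proof (intro allI impI)
      fix T' assume "s \<in> T'" "open T'"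
      then have "s \<in> T' \<inter> ball s e" "open (T' \<inter> ball s e)" using e(1) by (auto intro: open_Int)
      then show "\<exists>y\<in>?E \<inter> ball s e. y \<in> T' \<and> y \<noteq> s"
        using s(2) unfolding islimpt_def by blast
    qed
    have zero: "f (S t) = 0" if f: "f \<in> F" and t: "t \<in> ball s e" for f t
    proof (rule analytic_continuation[of "\<lambda>t. f (S t)" "ball s e" "?E \<inter> ball s e" s t])
      have fo: "holo_open n W f" using f W(3) holo_iff_open[OF Wo] by blast
      show "(\<lambda>t. f (S t)) holomorphic_on ball s e"
        unfolding holomorphic_on_def
      proof
        fix t assume t: "t \<in> ball s e"
        have "((\<lambda>t. f (S t)) has_field_derivative (\<Sum>i<n. hpart f (S t) i * deriv (\<lambda>s. S s i) t)) (at t within ball s e)"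
        proof (rule holo_open_chain_field[where c = S, OF fo Wo BW[OF t]])
          show "((\<lambda>s. S s i) has_field_derivative deriv (\<lambda>s. S s i) t) (at t within ball s e)" for i
            using holomorphic_derivI[OF S D(1)] e(2) t has_field_derivative_at_within by blast
          show "S u \<in> Cn n" if "u \<in> ball s e" for u using BW[OF that] Cn_open_Cn[OF Wo] by blast
        qed
        then show "(\<lambda>t. f (S t)) field_differentiable at t within ball s e"
          using field_differentiable_def by blast
      qed
      show "f (S u) = 0" if "u \<in> ?E \<inter> ball s e" for u
        using that BW[of u] W(4) f by blast
    qed (use lim t e(1) in auto)
    have "ball s e \<subseteq> ?E" using zero BW e(2) W(4) by blast
    then show ?thesis using e(1) by blast
  qed
  have "?L = {} \<or> ?L = D"
  proof (rule D(2)[unfolded connected_clopen, rule_format])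
    show "openin (top_of_set D) ?L \<and> closedin (top_of_set D) ?L"
    proof
      have "open ?L"
        unfolding open_contains_ball
      proof
        fix s assume "s \<in> ?L"
        then obtain e where e: "e > 0" "ball s e \<subseteq> ?E" using key by blast
        have "t islimpt ?E" if "t \<in> ball s e" for t
          using islimpt_subset[OF _ e(2)] that by (metis mem_ball interior_limit_point interior_open open_ball)
        then show "\<exists>e>0. ball s e \<subseteq> ?L" using e by blast
      qed
      then show "openin (top_of_set D) ?L" using D(1) by (simp add: openin_open_eq Collect_restrict)
      have "?L = D \<inter> {s. s islimpt ?E}" by blast
      then show "closedin (top_of_set D) ?L" using closedin_closed_Int[OF closed_limpts] by metis
    qed
  qed
  moreover have "s0 \<notin> ?L"
  proof
    assume "s0 \<in> ?L"
    then obtain e where "e > 0" "ball s0 e \<subseteq> ?E" using key by blast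
    then show False using s0(2) by (metis (mono_tags, lifting) centre_in_ball mem_Collect_eq subsetD)
  qed
  ultimately have "?L = {}" using s0(1) by blast
  then have "?E sparse_in D" unfolding sparse_in_def using D(1) by blast
  then have "countable (D \<inter> ?E)" by (rule sparse_imp_countable[OF D(1)])
  moreover have "D \<inter> ?E = ?E" by blast
  ultimately show ?thesis by simp
qed

lemma curve_Ck_add: "curve_Ck k I c \<Longrightarrow> curve_Ck k I d \<Longrightarrow> curve_Ck k I (\<lambda>t. c t + d t)"
proof (induction k arbitrary: c d)
  case 0
  then show ?case by (simp add: continuous_on_add)
next
  case (Suc k)
  from Suc.prems obtain c' d' where 1: "curve_Ck k I c'" "\<forall>t\<in>I. (c has_vector_derivative c' t) (at t within I)"
    "curve_Ck k I d'" "\<forall>t\<in>I. (d has_vector_derivative d' t) (at t within I)" by auto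
  have "curve_Ck k I (\<lambda>t. c' t + d' t)" using Suc.IH 1 by blast
  moreover have "\<forall>t\<in>I. ((\<lambda>t. c t + d t) has_vector_derivative c' t + d' t) (at t within I)"
    using 1 has_vector_derivative_add by blast
  moreover have "continuous_on I (\<lambda>t. c t + d t)" using Suc.prems by (auto intro: continuous_on_add)
  ultimately show ?case unfolding curve_Ck.simps by (intro conjI exI[of _ "\<lambda>t. c' t + d' t"])
qed

text \<open>The polynomial factor \<open>q\<close> collects the inner derivatives of
  \<open>T\<close>, so that the shape is preserved by differentiation.\<close>

lemma curve_Ck_holomorphic_poly:
  assumes "G holomorphic_on D" and D: "open D" and T: "\<And>t. t \<in> I \<Longrightarrow> poly T (complex_of_real t) \<in> D"
  shows "curve_Ck k I (\<lambda>t. poly q (complex_of_real t) * G (poly T (complex_of_real t)))"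
  using assms(1)
proof (induction k arbitrary: q G)
  case 0
  show ?case
    using T by (auto intro!: continuous_intros continuous_on_compose2[OF holomorphic_on_imp_continuous_on[OF 0]])
next
  case (Suc k)
  have 1: "curve_Ck k I (\<lambda>t. poly (pderiv q) (complex_of_real t) * G (poly T (complex_of_real t)) +
      poly (q * pderiv T) (complex_of_real t) * deriv G (poly T (complex_of_real t)))"
    using Suc.IH[OF Suc.prems] Suc.IH[OF holomorphic_deriv[OF Suc.prems D]] by (rule curve_Ck_add)
  have 2: "((\<lambda>t. poly q (complex_of_real t) * G (poly T (complex_of_real t))) has_vector_derivative
      poly (pderiv q) (complex_of_real t) * G (poly T (complex_of_real t)) +
      poly (q * pderiv T) (complex_of_real t) * deriv G (poly T (complex_of_real t))) (at t within I)" if t: "t \<in> I" for t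
  proof -
    have "((\<lambda>x. G (poly T x)) has_field_derivative deriv G (poly T (complex_of_real t)) * poly (pderiv T) (complex_of_real t)) (at (complex_of_real t))"
      using DERIV_chain2[OF holomorphic_derivI[OF Suc.prems D T[OF t]] poly_DERIV] .
    from DERIV_mult[OF poly_DERIV[of q] this]
    have "((\<lambda>x. poly q x * G (poly T x)) has_field_derivative
        poly (pderiv q) (complex_of_real t) * G (poly T (complex_of_real t)) +
      poly (q * pderiv T) (complex_of_real t) * deriv G (poly T (complex_of_real t))) (at (complex_of_real t))"
      by (simp add: algebra_simps)
    then show ?thesis
      using has_vector_derivative_real_field has_vector_derivative_at_within by blast
  qed
  have 3: "continuous_on I (\<lambda>t. poly q (complex_of_real t) * G (poly T (complex_of_real t)))"
    using T by (auto intro!: continuous_intros continuous_on_compose2[OF holomorphic_on_imp_continuous_on[OF Suc.prems]])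
  show ?case unfolding curve_Ck.simps using 1 2 3 by blast
qed

lemma (in complex_space) cover_to_etale_chart:
  assumes V': "z \<in> V'" "inj_on p V'" "Cn_open n V'" and z: "z \<in> V'" and u: "u \<in> Cn n"
  shows "dmap (\<lambda>z. inv_into V' p (p z)) z u = u"
proof -
  have "dmap (\<lambda>z. z) z u = dmap (\<lambda>z. inv_into V' p (p z)) z u"
    by (rule dmap_cong[OF holo_map_id[OF V'(3)]]) (use V' z u in auto)
  then show ?thesis using dmap_id[of z n u] Cn_open_Cn[OF V'(3)] z u by auto
qed

section \<open>The orbifold metric on a cover\<close>

locale orbifold_metric = orbifold X \<O> n for X :: "'a topology" and \<O> n +
  fixes \<omega> :: "'a set \<Rightarrow> ('a \<Rightarrow> nat \<Rightarrow> complex) \<Rightarrow> form"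
  assumes orbifold_metric: "orbifold_kaehler_metric n X \<O> \<omega>"
begin

lemma metric_form: "kaehler_form_on_reg n X \<O> \<omega>"
  using orbifold_metric unfolding orbifold_kaehler_metric_def by blast

text \<open>In the chart given by a local inverse of \<open>p\<close>, the map \<open>p\<close> is
  the identity on tangent vectors, so the lifted form is the form itself.\<close>

lemma metric_lift:
  assumes "quasi_etale_galois_cover X \<O> n V U p"
  shows "\<exists>\<eta>. kaehler_form n V \<eta> \<and> (\<forall>z V' u. z \<in> V' \<and> V' \<subseteq> V \<and> inj_on p V' \<and> Cn_open n V' \<and>
      holo_chart X \<O> n (p ` V') (inv_into V' p) \<and> u \<in> Cn n \<longrightarrow>
      \<omega> (p ` V') (inv_into V' p) z u (Jmul u) = \<eta> z u (Jmul u))"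
proof -
  obtain \<eta> where \<eta>: "kaehler_form n V \<eta>" "\<And>W \<phi> z u v. holo_chart X \<O> n W \<phi> \<Longrightarrow> z \<in> V \<Longrightarrow> p z \<in> W \<Longrightarrow>
      u \<in> Cn n \<Longrightarrow> v \<in> Cn n \<Longrightarrow> \<eta> z u v = pullback (\<phi> \<circ> p) (\<omega> W \<phi>) z u v"
    using orbifold_metric assms unfolding orbifold_kaehler_metric_def by metis
  have "\<omega> (p ` V') (inv_into V' p) z u (Jmul u) = \<eta> z u (Jmul u)"
    if V': "z \<in> V'" "V' \<subseteq> V" "inj_on p V'" "Cn_open n V'" "holo_chart X \<O> n (p ` V') (inv_into V' p)" and u: "u \<in> Cn n"
    for z V' u
  proof -
    have "\<eta> z u (Jmul u) = pullback (inv_into V' p \<circ> p) (\<omega> (p ` V') (inv_into V' p)) z u (Jmul u)"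
      using \<eta>(2)[OF V'(5) _ _ u Cn_Jmul[OF u]] V'(1,2) by blast
    then show ?thesis
      using cover_to_etale_chart[OF V'(1,3,4,1)] u V'(1,3) unfolding pullback_def comp_def by simp
  qed
  then show ?thesis using \<eta>(1) by blast
qed

text \<open>The etale condition is imposed at interior parameters: at the ends smoothness still
  holds, since a chart composed with \<open>p\<close> and \<open>S\<close> is holomorphic wherever
  it is defined. Local inverses of \<open>p\<close> compute the speed upstairs.\<close>

lemma cover_path:
  assumes cov: "quasi_etale_galois_cover X \<O> n V U p"
    and \<eta>: "\<And>z V' u. z \<in> V' \<Longrightarrow> V' \<subseteq> V \<Longrightarrow> inj_on p V' \<Longrightarrow> Cn_open n V' \<Longrightarrow>
      holo_chart X \<O> n (p ` V') (inv_into V' p) \<Longrightarrow> u \<in> Cn n \<Longrightarrow>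
      \<omega> (p ` V') (inv_into V' p) z u (Jmul u) = \<eta> z u (Jmul u)"
    and S: "\<And>i. (\<lambda>s. S s i) holomorphic_on D" and D: "open D" and SV: "S ` D \<subseteq> V"
    and T: "\<And>t. t \<in> {0..1} \<Longrightarrow> poly T (complex_of_real t) \<in> D"
    and et: "\<And>t. 0 < t \<Longrightarrow> t < 1 \<Longrightarrow> etale_at X \<O> n p V (S (poly T (complex_of_real t)))"
  shows "admissible_path n X \<O> (p (S (poly T 0))) (p (S (poly T 1))) (\<lambda>t. p (S (poly T (complex_of_real t))))" (is ?adm)
    and "\<And>t u. 0 < t \<Longrightarrow> t < 1 \<Longrightarrow> u = (\<lambda>i. deriv (\<lambda>s. S s i) (poly T (complex_of_real t)) * poly (pderiv T) (complex_of_real t)) \<Longrightarrow>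
      speed n X \<O> \<omega> (\<lambda>t. p (S (poly T (complex_of_real t)))) t = sqrt (\<eta> (S (poly T (complex_of_real t))) u (Jmul u)) \<and> u \<in> Cn n"
proof -
  have cS: "continuous_on D S"
    using holomorphic_on_imp_continuous_on[OF S] by (intro continuous_on_coordinatewise_then_product)
  let ?\<sigma> = "\<lambda>t. S (poly T (complex_of_real t))" and ?\<gamma> = "\<lambda>t. p (S (poly T (complex_of_real t)))"
  have \<sigma>V: "?\<sigma> t \<in> V" if "t \<in> {0..1}" for t using T[OF that] SV by blast
  have c\<sigma>: "continuous_on {0..1} ?\<sigma>"
    using T by (intro continuous_on_compose2[OF cS] continuous_intros) auto
  show ad: ?adm
    unfolding admissible_path_def
  proof (intro conjI allI impI ballI)
    have "continuous_map (top_of_set {0..1}) (top_of_set V) ?\<sigma>"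
      using c\<sigma> \<sigma>V by (auto simp: continuous_map_in_subtopology)
    from continuous_map_compose[OF this coverD(4)[OF cov]]
    show "continuous_map (top_of_set {0..1}) X ?\<gamma>" by (simp add: comp_def)
    show "?\<gamma> t \<in> regular_locus X \<O>" if "t \<in> {0<..<1}" for t
      using etale_at_regular[OF et[of t]] that by auto
    fix W \<phi> k i assume ch: "holo_chart X \<O> n W \<phi>"
    have hm: "holo_map n n {z \<in> V. p z \<in> W} (\<lambda>z. \<phi> (p z))" by (rule cover_to_embedding[OF cov holo_chartD(1)[OF ch]])
    let ?D' = "{s \<in> D. p (S s) \<in> W}"
    obtain T' where T': "open T'" "{z \<in> V. p z \<in> W} = Cn n \<inter> T'"
      using holo_mapD(1)[OF hm] by (auto simp: Cn_open_def openin_open)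
    have "?D' = D \<inter> S -` T'"
    proof -
      have "p (S s) \<in> W \<longleftrightarrow> S s \<in> T'" if "s \<in> D" for s
        using SV that T'(2) Cn_open_Cn[OF coverD(1)[OF cov]] by blast
      then show ?thesis by blast
    qed
    then have oD': "open ?D'" using continuous_open_preimage[OF cS D T'(1)] by simp
    have hG: "(\<lambda>s. \<phi> (p (S s)) i) holomorphic_on ?D'"
      unfolding holomorphic_on_def
    proof
      fix s assume s: "s \<in> ?D'"
      have "((\<lambda>s. \<phi> (p (S s)) i) has_field_derivative (\<Sum>j<n. hpart (\<lambda>z. \<phi> (p z) i) (S s) j * deriv (\<lambda>s. S s j) s)) (at s within ?D')"
      proof (rule holo_open_chain_field[OF holo_mapD(2,1)[OF hm]])
        show "((\<lambda>s. S s j) has_field_derivative deriv (\<lambda>s. S s j) s) (at s within ?D')" for j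
          using holomorphic_derivI[OF S D] s has_field_derivative_at_within by blast
        show "S u \<in> Cn n" if "u \<in> ?D'" for u using that SV Cn_open_Cn[OF coverD(1)[OF cov]] by blast
      qed (use s SV in blast)
      then show "(\<lambda>s. \<phi> (p (S s)) i) field_differentiable at s within ?D'" using field_differentiable_def by blast
    qed
    have "curve_Ck k {t \<in> {0..1}. ?\<gamma> t \<in> W} (\<lambda>t. poly 1 (complex_of_real t) * \<phi> (p (S (poly T (complex_of_real t)))) i)"
      by (rule curve_Ck_holomorphic_poly[OF hG oD']) (use T in auto)
    then show "curve_Ck k {t \<in> {0..1}. ?\<gamma> t \<in> W} (\<lambda>t. \<phi> (?\<gamma> t) i)" by simp
  qed simp_all
  fix t u assume t: "0 < t" "t < 1"
    and u: "u = (\<lambda>i. deriv (\<lambda>s. S s i) (poly T (complex_of_real t)) * poly (pderiv T) (complex_of_real t))"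
  obtain V' where V': "Cn_open n V'" "?\<sigma> t \<in> V'" "V' \<subseteq> V" "inj_on p V'" "holo_chart X \<O> n (p ` V') (inv_into V' p)"
    using et[OF t] unfolding etale_at_def by blast
  let ?q = "inv_into V' p"
  have cd: "chart_diff n X \<O> ?\<gamma> t" by (rule admissible_chart_diff[OF ad t])
  have in\<gamma>: "?\<gamma> t \<in> p ` V'" using V'(2) by blast
  obtain T' where T': "open T'" "V' = Cn n \<inter> T'" using V'(1) by (auto simp: Cn_open_def openin_open)
  have "open ({0<..<1} \<inter> ?\<sigma> -` T')"
    by (rule continuous_open_preimage[OF continuous_on_subset[OF c\<sigma>] _ T'(1)]) auto
  moreover have "t \<in> {0<..<1} \<inter> ?\<sigma> -` T'" using t V'(2) T'(2) by auto
  ultimately obtain A where A: "open A" "t \<in> A" "A \<subseteq> {0<..<1} \<inter> ?\<sigma> -` T'" by blast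
  have q\<gamma>: "?q (?\<gamma> s) = ?\<sigma> s" if "s \<in> A" for s
  proof -
    have "?\<sigma> s \<in> V" using \<sigma>V[of s] A(3) that by auto
    then have "?\<sigma> s \<in> V'" using A(3) that T'(2) Cn_open_Cn[OF coverD(1)[OF cov]] by blast
    then show ?thesis using inv_into_f_f[OF V'(4)] by blast
  qed
  have "vel ?q ?\<gamma> t = u"
  proof
    fix i
    have "poly T (complex_of_real t) \<in> D" using T[of t] t by auto
    from DERIV_chain2[OF holomorphic_derivI[OF S D this] poly_DERIV]
    have "((\<lambda>x. S (poly T x) i) has_field_derivative u i) (at (complex_of_real t))" unfolding u .
    then have "((\<lambda>s. ?\<sigma> s i) has_vector_derivative u i) (at t)" by (rule has_vector_derivative_real_field)
    then have "((\<lambda>s. ?q (?\<gamma> s) i) has_vector_derivative u i) (at t)"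
      by (rule has_vector_derivative_transform_within_open[OF _ A(1,2)]) (simp add: q\<gamma>)
    then show "vel ?q ?\<gamma> t i = u i" unfolding vel_def by (rule vector_derivative_at)
  qed
  then have v: "vel ?q ?\<gamma> t = u" "u \<in> Cn n" using vel_Cn[OF cd V'(5) in\<gamma>] by auto
  show "speed n X \<O> \<omega> ?\<gamma> t = sqrt (\<eta> (?\<sigma> t) u (Jmul u)) \<and> u \<in> Cn n"
    using speed_chart[OF metric_form cd V'(5) in\<gamma>] \<eta>[OF V'(2,3,4,1,5) v(2)] q\<gamma>[OF A(2)] v by simp
qed

text \<open>A set without interior points is avoided by an arbitrarily small shift. The divisor 4
  anticipates the value of \<open>s * (1 - s)\<close> at \<open>s = 1 / 2\<close>.\<close>

lemma ex_perturbation: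
  assumes Z: "\<And>B. Cn_open n B \<Longrightarrow> B \<noteq> {} \<Longrightarrow> \<not> B \<subseteq> Z" and m: "m \<in> Cn n" and e: "0 < e"
  shows "\<exists>v\<in>Cn n. l1norm n v \<le> e \<and> (\<lambda>i. m i + v i / 4) \<notin> Z"
proof -
  define d where "d = e / (4 * (real n + 1))"
  have d: "d > 0" using e by (simp add: d_def)
  obtain b where b: "b \<in> pdisc n m d" "b \<notin> Z"
    using Z[OF Cn_open_pdisc, of m d] centre_in_pdisc[OF m d] by blast
  define v where "v = (\<lambda>i. 4 * (b i - m i))"
  have "v \<in> Cn n" using b m by (auto simp: v_def pdisc_def Cn_def)
  moreover have "l1norm n v \<le> real n * (4 * d)"
  proof (rule l1norm_le)
    fix i assume "i < n"
    then have "cmod (b i - m i) < d" using b(1) by (simp add: pdisc_def)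
    then show "cmod (v i) \<le> 4 * d" unfolding v_def norm_mult by simp
  qed
  moreover have "real n * (4 * d) \<le> e" using e by (simp add: d_def field_simps)
  moreover have "(\<lambda>i. m i + v i / 4) = b" by (rule ext) (simp add: v_def diff_divide_distrib)
  ultimately show ?thesis using b(2) by (intro bexI[of _ v]) auto
qed

text \<open>Two points of the cover are joined by the image of a real path in a complex parabola; the parabola
  is not contained in the branch locus \<open>Z\<close>, so it meets \<open>Z\<close> in a countable set, which one of the
  pairwise disjoint paths \<open>t + \<i> \<epsilon> t (1 - t)\<close> avoids.\<close>

lemma cover_dist:
  assumes cov: "quasi_etale_galois_cover X \<O> n V U p" and z0: "z0 \<in> V"
  shows "\<exists>r>0. \<exists>C>0. pdisc n z0 r \<subseteq> V \<and> (\<forall>z\<in>pdisc n z0 r. \<forall>w\<in>pdisc n z0 r.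
      kdist n X \<O> \<omega> (p z) (p w) \<le> ennreal (C * l1norm n (\<lambda>i. w i - z i)))"
proof -
  note V = coverD(1)[OF cov]
  obtain \<eta> where \<eta>: "kaehler_form n V \<eta>" "\<And>z V' u. z \<in> V' \<Longrightarrow> V' \<subseteq> V \<Longrightarrow> inj_on p V' \<Longrightarrow> Cn_open n V' \<Longrightarrow>
      holo_chart X \<O> n (p ` V') (inv_into V' p) \<Longrightarrow> u \<in> Cn n \<Longrightarrow>
      \<omega> (p ` V') (inv_into V' p) z u (Jmul u) = \<eta> z u (Jmul u)"
    using metric_lift[OF cov] by blast
  obtain Z where Z: "analytic_subset (top_of_set V) (holo n) Z" "\<And>z. z \<in> V - Z \<Longrightarrow> etale_at X \<O> n p V z"
    "\<And>B. Cn_open n B \<Longrightarrow> B \<noteq> {} \<Longrightarrow> \<not> B \<subseteq> Z"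
    using quasi_etale_locus[OF coverD(8)[OF cov] V] by metis
  obtain R0 where R0: "R0 > 0" "pdisc n z0 R0 \<subseteq> V" using V z0 unfolding Cn_open_iff by blast
  define R where "R = R0 / 2"
  have R: "R > 0" "cpdisc n z0 R \<subseteq> V" using R0 cpdisc_subset_pdisc[of R R0 n z0] by (auto simp: R_def)
  obtain M where M: "M > 0" "\<And>z u. z \<in> cpdisc n z0 R \<Longrightarrow> u \<in> Cn n \<Longrightarrow> \<eta> z u (Jmul u) \<le> M * (l1norm n u)\<^sup>2"
    using kaehler_form_bounds[OF \<eta>(1) compact_cpdisc R(2)] by blast
  \<comment> \<open>For \<open>s\<close> in the disc of radius 2 the three terms of
    \<open>S s - z0\<close> below are bounded by \<open>r\<close>, \<open>4 * r\<close> and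
    \<open>r\<close>, together \<open>6 * r = R\<close>.\<close>
  define r where "r = R / 6"
  have r: "r > 0" "r \<le> R" using R by (auto simp: r_def)
  have sub: "pdisc n z0 r \<subseteq> V" using pdisc_mono[OF r(2)] pdisc_subset_cpdisc R(2) by blast
  have main: "kdist n X \<O> \<omega> (p z) (p w) \<le> ennreal (sqrt M * (2 * l1norm n (\<lambda>i. w i - z i) + 4 * \<kappa>))"
    if z: "z \<in> pdisc n z0 r" and w: "w \<in> pdisc n z0 r" and \<kappa>: "0 < \<kappa>" "\<kappa> < r / 6" for z w \<kappa>
  proof -
    have zwC: "z \<in> Cn n" "w \<in> Cn n" using z w pdisc_Cn by auto
    then have "(\<lambda>i. (z i + w i) / 2) \<in> Cn n" by (simp add: Cn_def)
    from ex_perturbation[OF Z(3) this \<kappa>(1)]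
    obtain v where v: "v \<in> Cn n" "l1norm n v \<le> \<kappa>" "(\<lambda>i. (z i + w i) / 2 + v i / 4) \<notin> Z" by blast
    \<comment> \<open>The parabola through \<open>z\<close> at 0 and \<open>w\<close> at 1, bent so
      that it passes through a point off \<open>Z\<close> at \<open>1 / 2\<close>.\<close>
    define S where "S s = (\<lambda>i. z i + s * (w i - z i) + s * (1 - s) * v i)" for s :: complex
    let ?D = "ball (0::complex) 2"
    have SB: "S s \<in> pdisc n z0 R" if s: "s \<in> ?D" for s
    proof -
      have "cmod (S s i - z0 i) < R" if i: "i < n" for i
      proof -
        have a: "cmod (z i - z0 i) < r" "cmod (w i - z0 i) < r" using z w i by (auto simp: pdisc_def)
        have b: "cmod (w i - z i) \<le> 2 * r"
          using norm_triangle_ineq4[of "w i - z0 i" "z i - z0 i"] a by simp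
        have c: "cmod (v i) \<le> r / 6" using component_le_l1norm[OF i, of v] v(2) \<kappa>(2) by simp
        have d: "cmod s \<le> 2" "cmod (1 - s) \<le> 3"
          using s norm_triangle_ineq4[of 1 s] by auto
        have "cmod (s * (w i - z i)) \<le> 2 * (2 * r)" unfolding norm_mult using b d by (intro mult_mono) auto
        moreover have "cmod (s * (1 - s) * v i) \<le> (2 * 3) * (r / 6)"
          unfolding norm_mult using c d by (intro mult_mono) auto
        moreover have "cmod (S s i - z0 i) \<le> cmod (z i - z0 i) + cmod (s * (w i - z i)) + cmod (s * (1 - s) * v i)"
          using norm_triangle_ineq[of "z i - z0 i + s * (w i - z i)" "s * (1 - s) * v i"]
            norm_triangle_ineq[of "z i - z0 i" "s * (w i - z i)"]
          by (simp add: S_def algebra_simps)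
        ultimately show ?thesis using a by (simp add: r_def)
      qed
      moreover have "S s \<in> Cn n" using zwC v(1) by (simp add: S_def Cn_def)
      ultimately show ?thesis by (simp add: pdisc_def)
    qed
    have SV: "S ` ?D \<subseteq> V" using SB pdisc_subset_cpdisc R(2) by blast
    have hS: "(\<lambda>s. S s i) holomorphic_on ?D" for i unfolding S_def by (intro holomorphic_intros)
    have dS: "deriv (\<lambda>s. S s i) s = (w i - z i) + (1 - 2 * s) * v i" for s i
      unfolding S_def by (rule DERIV_imp_deriv) (auto intro!: derivative_eq_intros simp: algebra_simps)
    define E where "E = {s \<in> ?D. S s \<in> Z}"
    have "countable E"
      unfolding E_def
    proof (rule analytic_subset_curve_countable[OF Z(1) V hS _ _ SV])
      have "S (1 / 2) = (\<lambda>i. (z i + w i) / 2 + v i / 4)"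
        unfolding S_def by (rule ext) (simp add: field_simps)
      then show "S (1 / 2) \<notin> Z" using v(3) by simp
    qed auto
    \<comment> \<open>At interior parameters of the path belonging to \<open>\<epsilon>\<close> this
      quotient equals \<open>\<epsilon>\<close>, so only countably many values of
      \<open>\<epsilon>\<close> are bad.\<close>
    then have "countable ((\<lambda>s. Im s / (Re s * (1 - Re s))) ` E)" by (rule countable_image)
    then have "\<not> {0<..<1::real} \<subseteq> (\<lambda>s. Im s / (Re s * (1 - Re s))) ` E"
      using uncountable_open_interval[of "0::real" 1] countable_subset[of "{0<..<1::real}"] zero_less_one by blast
    then obtain \<epsilon> where \<epsilon>: "0 < \<epsilon>" "\<epsilon> < 1" "\<epsilon> \<notin> (\<lambda>s. Im s / (Re s * (1 - Re s))) ` E"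
      unfolding subset_iff greaterThanLessThan_iff by blast
    define T where "T = [:0, 1 + \<i> * of_real \<epsilon>, - \<i> * of_real \<epsilon>:]"
    have T: "poly T (of_real t) = Complex t (\<epsilon> * (t * (1 - t)))" for t :: real
      by (simp add: T_def complex_eq_iff algebra_simps)
    have dT: "poly (pderiv T) (of_real t) = Complex 1 (\<epsilon> * (1 - 2 * t))" for t :: real
      by (simp add: T_def pderiv_pCons complex_eq_iff algebra_simps)
    have t4: "t * (1 - t) \<le> 1 / 4" for t :: real
      using zero_le_power2[of "t - 1 / 2"] by (simp add: power2_eq_square algebra_simps)
    have TD: "poly T (of_real t) \<in> ?D" if "t \<in> {0..1}" for t
    proof -
      have "0 \<le> t * (1 - t)" using that by simp
      then have "\<epsilon> * (t * (1 - t)) \<le> 1 * (1 / 4)" using \<epsilon> t4[of t] by (intro mult_mono) auto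
      moreover have "0 \<le> \<epsilon> * (t * (1 - t))" using \<epsilon>(1) \<open>0 \<le> t * (1 - t)\<close> by simp
      ultimately show ?thesis
        using cmod_le[of "poly T (of_real t)"] that unfolding T by simp
    qed
    have et: "etale_at X \<O> n p V (S (poly T (of_real t)))" if t: "0 < t" "t < 1" for t
    proof (rule Z(2))
      have "poly T (of_real t) \<notin> E"
      proof
        assume "poly T (of_real t) \<in> E"
        moreover have "\<epsilon> = Im (poly T (of_real t)) / (Re (poly T (of_real t)) * (1 - Re (poly T (of_real t))))"
          using t unfolding T by simp
        ultimately show False using \<epsilon>(3) by blast
      qed
      then show "S (poly T (of_real t)) \<in> V - Z" using TD[of t] t SV unfolding E_def by auto
    qed
    let ?\<gamma> = "\<lambda>t. p (S (poly T (complex_of_real t)))"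
    have path1: "admissible_path n X \<O> (p (S (poly T 0))) (p (S (poly T 1))) ?\<gamma>"
      by (rule cover_path(1)[where \<eta> = \<eta> and S = S and D = "?D" and T = T, OF cov _ hS open_ball SV])
        (blast intro: \<eta>(2), blast intro: TD, blast intro: et)
    have path2: "speed n X \<O> \<omega> ?\<gamma> t = sqrt (\<eta> (S (poly T (complex_of_real t))) u (Jmul u)) \<and> u \<in> Cn n"
      if "0 < t" "t < 1" "u = (\<lambda>i. deriv (\<lambda>s. S s i) (poly T (complex_of_real t)) * poly (pderiv T) (complex_of_real t))" for t u
      by (rule cover_path(2)[where \<eta> = \<eta> and S = S and D = "?D" and T = T, OF cov _ hS open_ball SV _ _ that])
        (blast intro: \<eta>(2), blast intro: TD, blast intro: et)
    have ends: "S (poly T 0) = z" "S (poly T 1) = w" by (simp_all add: T_def S_def)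
    \<comment> \<open>In norm the derivative of \<open>T\<close> is at most 2 and that of
      \<open>S\<close> along the path at most the distance of \<open>z\<close> and \<open>w\<close>
      plus \<open>2 * \<kappa>\<close>.\<close>
    let ?c = "2 * l1norm n (\<lambda>i. w i - z i) + 4 * \<kappa>"
    have sp: "speed n X \<O> \<omega> ?\<gamma> t \<le> sqrt M * ?c" if t: "0 < t" "t < 1" for t
    proof -
      define u where "u = (\<lambda>i. deriv (\<lambda>s. S s i) (poly T (complex_of_real t)) * poly (pderiv T) (complex_of_real t))"
      have s: "speed n X \<O> \<omega> ?\<gamma> t = sqrt (\<eta> (S (poly T (complex_of_real t))) u (Jmul u))" "u \<in> Cn n"
        using path2[OF t u_def] by auto
      have "S (poly T (complex_of_real t)) \<in> cpdisc n z0 R"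
        using SB[OF TD[of t]] t pdisc_subset_cpdisc by auto
      then have "\<eta> (S (poly T (complex_of_real t))) u (Jmul u) \<le> M * (l1norm n u)\<^sup>2" using M(2) s(2) by blast
      then have s1: "speed n X \<O> \<omega> ?\<gamma> t \<le> sqrt M * l1norm n u"
        unfolding s(1) using real_sqrt_le_mono by (fastforce simp: real_sqrt_mult)
      let ?x = "poly (pderiv T) (complex_of_real t)" and ?y = "1 - 2 * poly T (complex_of_real t)"
      have x: "cmod ?x \<le> 2"
      proof -
        have "\<bar>\<epsilon> * (1 - 2 * t)\<bar> \<le> 1 * 1" unfolding abs_mult using \<epsilon> t by (intro mult_mono) auto
        then show ?thesis using cmod_le[of ?x] unfolding dT by simp
      qed
      have y: "cmod ?y \<le> 2"
      proof -
        define g where "g = \<epsilon> * (t * (1 - t))"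
        have nn: "0 \<le> t * (1 - t)" using t by simp
        then have "g \<le> 1 * (1 / 4)" unfolding g_def using \<epsilon>(1,2) t4[of t] by (intro mult_mono) auto
        moreover have "0 \<le> g" unfolding g_def using \<epsilon>(1) nn by simp
        moreover have "cmod ?y \<le> \<bar>1 - 2 * t\<bar> + \<bar>2 * g\<bar>"
          using cmod_le[of ?y] unfolding T g_def[symmetric] by simp
        ultimately show ?thesis using t by linarith
      qed
      have "u = (\<lambda>i. ?x * ((w i - z i) + ?y * v i))" unfolding u_def dS by (simp add: mult.commute)
      then have "l1norm n u = cmod ?x * l1norm n (\<lambda>i. (w i - z i) + ?y * v i)" by (simp only: l1norm_mult)
      also have "\<dots> \<le> 2 * (l1norm n (\<lambda>i. w i - z i) + l1norm n (\<lambda>i. ?y * v i))"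
        by (intro mult_mono x l1norm_triangle) auto
      also have "l1norm n (\<lambda>i. ?y * v i) \<le> 2 * \<kappa>"
        unfolding l1norm_mult using v(2) y by (intro mult_mono) auto
      finally have "l1norm n u \<le> ?c" by simp
      then show ?thesis using s1 M(1) by (meson mult_left_mono order_trans real_sqrt_ge_zero less_imp_le)
    qed
    have "kdist n X \<O> \<omega> (p z) (p w) \<le> path_len n X \<O> \<omega> ?\<gamma>"
      using kdist_le[OF path1] unfolding ends .
    also have "\<dots> \<le> (\<integral>\<^sup>+ t. ennreal (sqrt M * ?c) * indicator {0<..<1::real} t \<partial>lborel)"
      unfolding path_len_def using sp by (intro nn_integral_mono) (auto split: split_indicator intro: ennreal_leI)
    also have "\<dots> = ennreal (sqrt M * ?c)" by (simp add: nn_integral_cmult_indicator)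
    finally show ?thesis .
  qed
  have "kdist n X \<O> \<omega> (p z) (p w) \<le> ennreal (2 * sqrt M * l1norm n (\<lambda>i. w i - z i))"
    if z: "z \<in> pdisc n z0 r" and w: "w \<in> pdisc n z0 r" for z w
  proof (rule ennreal_le_epsilon)
    fix e :: real assume e: "0 < e"
    \<comment> \<open>The first entry keeps the parabola in the polydisc, the second makes the
      perturbation cost at most \<open>e\<close>.\<close>
    define \<kappa> where "\<kappa> = min (r / 12) (e / (4 * sqrt M))"
    have \<kappa>: "0 < \<kappa>" "\<kappa> < r / 6" using r e M(1) by (auto simp: \<kappa>_def)
    have "4 * sqrt M * \<kappa> \<le> 4 * sqrt M * (e / (4 * sqrt M))" using M(1) by (intro mult_left_mono) (auto simp: \<kappa>_def)
    also have "\<dots> = e" using M(1) by simp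
    finally have "sqrt M * (2 * l1norm n (\<lambda>i. w i - z i) + 4 * \<kappa>) \<le> 2 * sqrt M * l1norm n (\<lambda>i. w i - z i) + e"
      by (simp add: algebra_simps)
    then have "kdist n X \<O> \<omega> (p z) (p w) \<le> ennreal (2 * sqrt M * l1norm n (\<lambda>i. w i - z i) + e)"
      using main[OF z w \<kappa>] ennreal_leI order_trans by blast
    then show "kdist n X \<O> \<omega> (p z) (p w) \<le> ennreal (2 * sqrt M * l1norm n (\<lambda>i. w i - z i)) + ennreal e"
      using e M(1) by (simp add: ennreal_plus)
  qed
  then show ?thesis using r(1) sub M(1) by (intro exI[of _ r] exI[of _ "2 * sqrt M"] conjI) auto
qed

end

section \<open>Comparison of the metrics near a point\<close>

text \<open>The cover is a closed map: the image of the complement of \<open>B\<close> is closed and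
  misses \<open>x0\<close>, so its complement in \<open>U\<close> is the required
  neighbourhood.\<close>

lemma cover_tube:
  assumes cov: "quasi_etale_galois_cover X \<O> n V U p" and x0: "x0 \<in> U"
    and B: "Cn_open n B" "{z \<in> V. p z = x0} \<subseteq> B"
  shows "\<exists>U0. openin X U0 \<and> x0 \<in> U0 \<and> U0 \<subseteq> U \<and> (\<forall>z\<in>V. p z \<in> U0 \<longrightarrow> z \<in> B)"
proof -
  obtain T where T: "open T" "B = Cn n \<inter> T" using B(1) by (auto simp: Cn_open_def openin_open)
  have VB: "V - T = V - B" using T(2) Cn_open_Cn[OF coverD(1)[OF cov]] by blast
  have "closedin (top_of_set V) (V - T)"
    using T(1) by (auto simp: closedin_closed Diff_eq intro!: exI[of _ "- T"])
  then have c: "closedin (subtopology X U) (p ` (V - B))"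
    using coverD(5)[OF cov] unfolding closed_map_def VB by blast
  have UX: "U \<subseteq> topspace X" using openin_subset[OF coverD(2)[OF cov]] .
  have "openin (subtopology X U) (U - p ` (V - B))"
    using openin_diff[OF openin_topspace c] UX by (simp add: Int_absorb1)
  then have "openin X (U - p ` (V - B))" using openin_trans_full coverD(2)[OF cov] by blast
  moreover have "x0 \<in> U - p ` (V - B)" using x0 B(2) by blast
  moreover have "z \<in> B" if "z \<in> V" "p z \<in> U - p ` (V - B)" for z using that by blast
  ultimately show ?thesis by (intro exI[of _ "U - p ` (V - B)"]) blast
qed

lemma (in complex_space) embedding_nhd:
  assumes le: "local_embedding X \<O> N U1 \<iota>" and x0: "x0 \<in> U1" and U0: "openin X U0" "x0 \<in> U0"
  shows "\<exists>\<rho>>0. \<forall>y\<in>U1. \<iota> y \<in> pdisc N (\<iota> x0) \<rho> \<longrightarrow> y \<in> U0"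
proof -
  have "openin X (U0 \<inter> U1)" using U0(1) local_embeddingD(1)[OF le] by blast
  then have "openin (top_of_set (\<iota> ` U1)) (\<iota> ` (U0 \<inter> U1))"
    by (rule local_embedding_image_open[OF le]) simp
  then obtain T where T: "open T" "\<iota> ` (U0 \<inter> U1) = \<iota> ` U1 \<inter> T" by (auto simp: openin_open)
  have "\<iota> x0 \<in> T" "\<iota> x0 \<in> Cn N" using T(2) x0 U0(2) local_embeddingD(4)[OF le] by auto
  then obtain \<rho> where \<rho>: "\<rho> > 0" "pdisc N (\<iota> x0) \<rho> \<subseteq> T" using pdisc_nhd[OF T(1)] by blast
  have "y \<in> U0" if y: "y \<in> U1" "\<iota> y \<in> pdisc N (\<iota> x0) \<rho>" for y
  proof -
    have "\<iota> y \<in> \<iota> ` (U0 \<inter> U1)" using y \<rho>(2) T(2) by blast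
    then show ?thesis using local_embeddingD(3)[OF le] y(1) unfolding inj_on_def by auto
  qed
  then show ?thesis using \<rho>(1) by blast
qed

context orbifold_metric
begin

text \<open>Near an etale point the embedding factors through the cover. The vector \<open>u\<close>
  is lifted to \<open>w\<close>, the partial derivatives of the lifted embedding are at most
  \<open>L\<close>, and \<open>\<eta>\<close> dominates the squared norm with factor
  \<open>m\<close>.\<close>

lemma etale_estimate:
  assumes cov: "quasi_etale_galois_cover X \<O> n V U p" and le: "local_embedding X \<O> N U1 \<iota>"
    and V': "z \<in> V'" "V' \<subseteq> V" "inj_on p V'" "Cn_open n V'" "holo_chart X \<O> n (p ` V') (inv_into V' p)"
    and \<eta>: "\<And>u. u \<in> Cn n \<Longrightarrow> \<omega> (p ` V') (inv_into V' p) z u (Jmul u) = \<eta> z u (Jmul u)"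
    and m: "0 < m" "\<And>u. u \<in> Cn n \<Longrightarrow> m * (l1norm n u)\<^sup>2 \<le> \<eta> z u (Jmul u)"
    and L: "0 \<le> L" "\<And>i j. i < N \<Longrightarrow> j < n \<Longrightarrow> cmod (hpart (\<lambda>z. \<iota> (p z) i) z j) \<le> L"
    and ch: "holo_chart X \<O> n W \<phi>" and zW: "p z \<in> W" and zU: "p z \<in> U1" and u: "u \<in> Cn n"
  shows "(l1norm N (dmap (\<lambda>x. \<iota> (inv_into W \<phi> x)) (\<phi> (p z)) u))\<^sup>2
    \<le> (real N * L)\<^sup>2 / m * \<omega> W \<phi> (\<phi> (p z)) u (Jmul u)"
proof -
  let ?P = "p ` V'" and ?q = "inv_into V' p"
  note leW = holo_chartD(1)[OF ch] and leP = holo_chartD(1)[OF V'(5)]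
  have zP: "p z \<in> ?P" using V'(1) by blast
  have qz: "?q (p z) = z" using V'(1,3) by simp
  define w where "w = dmap (\<lambda>x. ?q (inv_into W \<phi> x)) (\<phi> (p z)) u"
  have WP: "holo_map n n (\<phi> ` (W \<inter> ?P)) (\<lambda>x. ?q (inv_into W \<phi> x))" by (rule chart_to_embedding[OF ch leP])
  have wC: "w \<in> Cn n" unfolding w_def by (rule dmap_Cn[OF WP _ u]) (use zW zP in blast)
  have form: "\<omega> W \<phi> (\<phi> (p z)) u (Jmul u) = \<eta> z w (Jmul w)"
    using form_transition[OF metric_form ch V'(5) zW zP u] \<eta>[OF wC] unfolding w_def[symmetric] qz by simp
  \<comment> \<open>On the smaller open set inside the etale chart, \<open>p\<close> after its local
    inverse is the identity; this inserts the cover into the embedding.\<close>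
  have "dmap (\<lambda>x. \<iota> (inv_into W \<phi> x)) (\<phi> (p z)) u = dmap (\<lambda>x. \<iota> (p (?q (inv_into W \<phi> x)))) (\<phi> (p z)) u"
  proof (rule dmap_cong[of n N "\<phi> ` (W \<inter> (?P \<inter> U1))"])
    have "openin X (W \<inter> (?P \<inter> U1))"
      using local_embeddingD(1)[OF leW] local_embeddingD(1)[OF leP] local_embeddingD(1)[OF le] by blast
    then have "Cn_open n (\<phi> ` (W \<inter> (?P \<inter> U1)))" by (rule holo_chart_image_open[OF ch]) simp
    then show "holo_map n N (\<phi> ` (W \<inter> (?P \<inter> U1))) (\<lambda>x. \<iota> (inv_into W \<phi> x))"
      by (rule holo_map_subset[OF chart_to_embedding[OF ch le]]) blast
    show "\<iota> (inv_into W \<phi> x) = \<iota> (p (?q (inv_into W \<phi> x)))" if "x \<in> \<phi> ` (W \<inter> (?P \<inter> U1))" for x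
      using that local_embedding_inv[OF leW] V'(3) by (auto simp: f_inv_into_f)
    show "\<phi> (p z) \<in> \<phi> ` (W \<inter> (?P \<inter> U1))" using zW zP zU by blast
  qed (rule u)
  also have "\<dots> = dmap (\<lambda>s. \<iota> (p s)) (?q (inv_into W \<phi> (\<phi> (p z)))) w"
    unfolding w_def
  proof (rule dmap_compose[of n N "{s \<in> V. p s \<in> U1}" "\<lambda>s. \<iota> (p s)" n "\<phi> ` (W \<inter> (?P \<inter> U1))"])
    show "holo_map n N {s \<in> V. p s \<in> U1} (\<lambda>s. \<iota> (p s))" by (rule cover_to_embedding[OF cov le])
    have "openin X (W \<inter> (?P \<inter> U1))"
      using local_embeddingD(1)[OF leW] local_embeddingD(1)[OF leP] local_embeddingD(1)[OF le] by blast
    then have "Cn_open n (\<phi> ` (W \<inter> (?P \<inter> U1)))" by (rule holo_chart_image_open[OF ch]) simp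
    then show "holo_map n n (\<phi> ` (W \<inter> (?P \<inter> U1))) (\<lambda>x. ?q (inv_into W \<phi> x))"
      by (rule holo_map_subset[OF WP]) blast
    show "(\<lambda>x. ?q (inv_into W \<phi> x)) ` \<phi> ` (W \<inter> (?P \<inter> U1)) \<subseteq> {s \<in> V. p s \<in> U1}"
      using local_embedding_inv[OF leW] V'(2,3) by auto
    show "\<phi> (p z) \<in> \<phi> ` (W \<inter> (?P \<inter> U1))" using zW zP zU by blast
  qed (rule u)
  also have "?q (inv_into W \<phi> (\<phi> (p z))) = z" using local_embedding_inv[OF leW zW] qz by simp
  finally have D: "dmap (\<lambda>x. \<iota> (inv_into W \<phi> x)) (\<phi> (p z)) u = dmap (\<lambda>s. \<iota> (p s)) z w" .
  have "l1norm N (dmap (\<lambda>s. \<iota> (p s)) z w) \<le> real N * L * l1norm n w"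
    by (rule l1norm_dmap_le[OF cover_to_embedding[OF cov le] _ wC L(2)]) (use V'(1,2) zU in auto)
  then have "(l1norm N (dmap (\<lambda>s. \<iota> (p s)) z w))\<^sup>2 \<le> (real N * L * l1norm n w)\<^sup>2"
    by (intro power_mono) auto
  also have "\<dots> = (real N * L)\<^sup>2 / m * (m * (l1norm n w)\<^sup>2)" using m(1) by (simp add: power_mult_distrib)
  also have "\<dots> \<le> (real N * L)\<^sup>2 / m * \<eta> z w (Jmul w)"
    using m(2)[OF wC] m(1) by (intro mult_left_mono) auto
  finally show ?thesis unfolding D form .
qed

text \<open>The inequality is a closed condition on the point. If it failed somewhere, it would fail
  on a nonempty open subset of the cover; that subset contains an etale point, where the inequality
  holds.\<close>

lemma cover_estimate:
  assumes cov: "quasi_etale_galois_cover X \<O> n V U p" and le: "local_embedding X \<O> N U1 \<iota>"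
    and z0: "z0 \<in> V" "p z0 \<in> U1"
  shows "\<exists>R>0. \<exists>C>0. pdisc n z0 R \<subseteq> {z \<in> V. p z \<in> U1} \<and> (\<forall>z\<in>pdisc n z0 R. \<forall>W \<phi>. \<forall>u\<in>Cn n.
      holo_chart X \<O> n W \<phi> \<and> p z \<in> W \<longrightarrow>
      (l1norm N (dmap (\<lambda>x. \<iota> (inv_into W \<phi> x)) (\<phi> (p z)) u))\<^sup>2 \<le> C * \<omega> W \<phi> (\<phi> (p z)) u (Jmul u))"
proof -
  obtain \<eta> where \<eta>: "kaehler_form n V \<eta>" "\<And>z V' u. z \<in> V' \<Longrightarrow> V' \<subseteq> V \<Longrightarrow> inj_on p V' \<Longrightarrow> Cn_open n V' \<Longrightarrow>
      holo_chart X \<O> n (p ` V') (inv_into V' p) \<Longrightarrow> u \<in> Cn n \<Longrightarrow>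
      \<omega> (p ` V') (inv_into V' p) z u (Jmul u) = \<eta> z u (Jmul u)"
    using metric_lift[OF cov] by blast
  let ?V1 = "{z \<in> V. p z \<in> U1}"
  note hm = cover_to_embedding[OF cov le]
  obtain d L where d: "d > 0" "L > 0" "pdisc n z0 d \<subseteq> ?V1"
    and L: "\<And>i z j. i < N \<Longrightarrow> z \<in> pdisc n z0 d \<Longrightarrow> j < n \<Longrightarrow> cmod (hpart (\<lambda>z. \<iota> (p z) i) z j) \<le> L"
    using holo_open_locally_lipschitz[of N n ?V1 "\<lambda>i z. \<iota> (p z) i" z0, OF holo_mapD(2,1)[OF hm]] z0 by blast
  define R where "R = d / 2"
  have R: "R > 0" "cpdisc n z0 R \<subseteq> pdisc n z0 d" using d cpdisc_subset_pdisc[of R d] by (auto simp: R_def)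
  have RV: "cpdisc n z0 R \<subseteq> V" using R d by blast
  obtain m where m: "m > 0" "\<And>z u. z \<in> cpdisc n z0 R \<Longrightarrow> u \<in> Cn n \<Longrightarrow> m * (l1norm n u)\<^sup>2 \<le> \<eta> z u (Jmul u)"
    using kaehler_form_bounds[OF \<eta>(1) compact_cpdisc RV] by blast
  \<comment> \<open>The summand 1 makes \<open>C\<close> positive also when
    \<open>N = 0\<close>.\<close>
  define C where "C = (real N * L)\<^sup>2 / m + 1"
  have C: "C > 0" "(real N * L)\<^sup>2 / m \<le> C" using m(1) by (simp_all add: C_def add_nonneg_pos)
  have sub: "pdisc n z0 R \<subseteq> ?V1" using pdisc_subset_cpdisc R(2) d(3) by blast
  have "(l1norm N (dmap (\<lambda>x. \<iota> (inv_into W \<phi> x)) (\<phi> (p z)) u))\<^sup>2 \<le> C * \<omega> W \<phi> (\<phi> (p z)) u (Jmul u)"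
    if z: "z \<in> pdisc n z0 R" and u: "u \<in> Cn n" and ch: "holo_chart X \<O> n W \<phi>" and zW: "p z \<in> W" for z W \<phi> u
  proof (rule ccontr)
    note leW = holo_chartD(1)[OF ch]
    have k: "kaehler_form n (\<phi> ` W) (\<omega> W \<phi>)" using metric_form ch unfolding kaehler_form_on_reg_def by blast
    let ?A = "\<phi> ` (W \<inter> U1)"
    let ?f = "\<lambda>x. (l1norm N (dmap (\<lambda>x. \<iota> (inv_into W \<phi> x)) x u))\<^sup>2 - C * \<omega> W \<phi> x u (Jmul u)"
    assume "\<not> (l1norm N (dmap (\<lambda>x. \<iota> (inv_into W \<phi> x)) (\<phi> (p z)) u))\<^sup>2 \<le> C * \<omega> W \<phi> (\<phi> (p z)) u (Jmul u)"
    then have pos: "?f (\<phi> (p z)) > 0" by simp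
    have "continuous_on ?A (\<lambda>x. l1norm N (dmap (\<lambda>x. \<iota> (inv_into W \<phi> x)) x u))"
      using continuous_on_compose2[OF continuous_on_l1norm[of UNIV N] continuous_on_dmap[OF chart_to_embedding[OF ch le] u]]
      by simp
    moreover have "continuous_on ?A (\<lambda>x. \<omega> W \<phi> x u (Jmul u))"
      using kaehler_formD(1)[OF k u Cn_Jmul[OF u]] by (rule continuous_on_subset) blast
    ultimately have "continuous_on ?A ?f" by (intro continuous_intros)
    then have "openin (top_of_set ?A) (?A \<inter> ?f -` {0<..})"
      by (rule continuous_openin_preimage_gen) simp
    moreover have "Cn_open n ?A" by (rule holo_mapD(1)[OF chart_to_embedding[OF ch le]])
    ultimately have op: "Cn_open n (?A \<inter> ?f -` {0<..})" unfolding Cn_open_def by (rule openin_trans)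
    define Q where "Q = pdisc n z0 R \<inter> {s \<in> {s \<in> V. p s \<in> W}. \<phi> (p s) \<in> ?A \<inter> ?f -` {0<..}}"
    have "Cn_open n Q"
      unfolding Q_def using holo_map_preimage_open[OF cover_to_embedding[OF cov leW] op]
      by (rule Cn_open_Int[OF Cn_open_pdisc])
    moreover have "\<phi> (p z) \<in> ?A \<inter> ?f -` {0<..}"
      using z zW sub pos by (intro IntI vimageI2) (blast, simp)
    then have "z \<in> Q" unfolding Q_def using z zW sub by blast
    moreover have "Q \<subseteq> V" unfolding Q_def by blast
    ultimately obtain z' where zQ: "z' \<in> Q" and et: "etale_at X \<O> n p V z'"
      using etale_dense[OF cov, of Q] by blast
    have z': "z' \<in> pdisc n z0 R" "p z' \<in> W" "0 < ?f (\<phi> (p z'))"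
      using zQ unfolding Q_def by (blast, blast, simp)
    obtain V' where V': "Cn_open n V'" "z' \<in> V'" "V' \<subseteq> V" "inj_on p V'" "holo_chart X \<O> n (p ` V') (inv_into V' p)"
      using et unfolding etale_at_def by blast
    have zc: "z' \<in> cpdisc n z0 R" using z'(1) pdisc_subset_cpdisc by blast
    have zc: "z' \<in> cpdisc n z0 R" "z' \<in> pdisc n z0 d" "p z' \<in> U1" using z'(1) zc R(2) sub by blast+
    have "(l1norm N (dmap (\<lambda>x. \<iota> (inv_into W \<phi> x)) (\<phi> (p z')) u))\<^sup>2
      \<le> (real N * L)\<^sup>2 / m * \<omega> W \<phi> (\<phi> (p z')) u (Jmul u)"
    proof (rule etale_estimate[where z = z' and V' = V' and \<eta> = \<eta> and m = m and L = L and p = p,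
          OF cov le V'(2,3,4,1,5) _ m(1) _ less_imp_le[OF d(2)] _ ch z'(2) zc(3) u])
      show "\<omega> (p ` V') (inv_into V' p) z' u (Jmul u) = \<eta> z' u (Jmul u)" if "u \<in> Cn n" for u
        by (rule \<eta>(2)[OF V'(2,3,4,1,5) that])
      show "m * (l1norm n u)\<^sup>2 \<le> \<eta> z' u (Jmul u)" if "u \<in> Cn n" for u by (rule m(2)[OF zc(1) that])
      show "cmod (hpart (\<lambda>z. \<iota> (p z) i) z' j) \<le> L" if "i < N" "j < n" for i j by (rule L[OF that(1) zc(2) that(2)])
    qed
    also have "\<dots> \<le> C * \<omega> W \<phi> (\<phi> (p z')) u (Jmul u)"
      using C(2) kaehler_form_nonneg[OF k imageI[OF z'(2)] u] by (rule mult_right_mono)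
    finally show False using z'(3) by simp
  qed
  then show ?thesis using R(1) C(1) sub by blast
qed

text \<open>Each point of the finite fibre over \<open>x0\<close> has a neighbourhood with its own
  constant; a tube around the fibre contains all preimages of points near \<open>x0\<close>, and the
  largest constant serves.\<close>

lemma metric_lower_bound:
  assumes le: "local_embedding X \<O> N U1 \<iota>" and x0: "x0 \<in> U1"
  shows "\<exists>\<rho>>0. \<exists>C>0. \<forall>y\<in>U1. \<iota> y \<in> pdisc N (\<iota> x0) \<rho> \<longrightarrow> (\<forall>W \<phi>. \<forall>u\<in>Cn n.
      holo_chart X \<O> n W \<phi> \<and> y \<in> W \<longrightarrow>
      (l1norm N (dmap (\<lambda>x. \<iota> (inv_into W \<phi> x)) (\<phi> y) u))\<^sup>2 \<le> C * \<omega> W \<phi> (\<phi> y) u (Jmul u))"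
proof -
  obtain V U p where cov: "x0 \<in> U" "quasi_etale_galois_cover X \<O> n V U p"
    using ex_cover local_embeddingD(2)[OF le] x0 by blast
  let ?F = "{z \<in> V. p z = x0}"
  \<comment> \<open>Radius and constant are packed into one pair so that a single choice over the
    fibre suffices.\<close>
  define P where "P z0 RC \<longleftrightarrow> 0 < fst RC \<and> 0 < snd RC \<and> (\<forall>z\<in>pdisc n z0 (fst RC). \<forall>W \<phi>. \<forall>u\<in>Cn n.
      holo_chart X \<O> n W \<phi> \<and> p z \<in> W \<longrightarrow>
      (l1norm N (dmap (\<lambda>x. \<iota> (inv_into W \<phi> x)) (\<phi> (p z)) u))\<^sup>2 \<le> snd RC * \<omega> W \<phi> (\<phi> (p z)) u (Jmul u))"
    for z0 and RC :: "real \<times> real"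
  have "\<forall>z0\<in>?F. \<exists>RC. P z0 RC"
  proof
    fix z0 assume "z0 \<in> ?F"
    then have "z0 \<in> V" "p z0 \<in> U1" using x0 by auto
    from cover_estimate[OF cov(2) le this] obtain R C where "R > 0" "C > 0" "\<forall>z\<in>pdisc n z0 R. \<forall>W \<phi>. \<forall>u\<in>Cn n.
      holo_chart X \<O> n W \<phi> \<and> p z \<in> W \<longrightarrow>
      (l1norm N (dmap (\<lambda>x. \<iota> (inv_into W \<phi> x)) (\<phi> (p z)) u))\<^sup>2 \<le> C * \<omega> W \<phi> (\<phi> (p z)) u (Jmul u)"
      by (elim exE conjE) blast
    then have "P z0 (R, C)" unfolding P_def fst_conv snd_conv by blast
    then show "\<exists>RC. P z0 RC" by blast
  qed
  from bchoice[OF this] obtain RC where RCP: "\<And>z0. z0 \<in> ?F \<Longrightarrow> P z0 (RC z0)" by blast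
  have RC: "\<And>z0. z0 \<in> ?F \<Longrightarrow> 0 < fst (RC z0)" "\<And>z0. z0 \<in> ?F \<Longrightarrow> 0 < snd (RC z0)"
    "\<And>z0 z W \<phi> u. z0 \<in> ?F \<Longrightarrow> z \<in> pdisc n z0 (fst (RC z0)) \<Longrightarrow> u \<in> Cn n \<Longrightarrow>
      holo_chart X \<O> n W \<phi> \<Longrightarrow> p z \<in> W \<Longrightarrow>
      (l1norm N (dmap (\<lambda>x. \<iota> (inv_into W \<phi> x)) (\<phi> (p z)) u))\<^sup>2 \<le> snd (RC z0) * \<omega> W \<phi> (\<phi> (p z)) u (Jmul u)"
    using RCP unfolding P_def by blast+
  have finF: "finite ?F" by (rule coverD(6)[OF cov(2,1)])
  let ?B = "\<Union>z0\<in>?F. pdisc n z0 (fst (RC z0))"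
  have "Cn_open n ?B" unfolding Cn_open_def
    using Cn_open_pdisc unfolding Cn_open_def by (intro openin_Union) auto
  moreover have "?F \<subseteq> ?B"
    using RC(1) centre_in_pdisc Cn_open_Cn[OF coverD(1)[OF cov(2)]] by blast
  ultimately obtain U0 where U0: "openin X U0" "x0 \<in> U0" "U0 \<subseteq> U" "\<And>z. z \<in> V \<Longrightarrow> p z \<in> U0 \<Longrightarrow> z \<in> ?B"
    using cover_tube[OF cov(2,1), of ?B] by blast
  obtain \<rho> where \<rho>: "\<rho> > 0" "\<And>y. y \<in> U1 \<Longrightarrow> \<iota> y \<in> pdisc N (\<iota> x0) \<rho> \<Longrightarrow> y \<in> U0"
    using embedding_nhd[OF le x0 U0(1,2)] by blast
  define C where "C = Max (insert 1 ((\<lambda>z. snd (RC z)) ` ?F))"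
  have C: "C > 0" "\<And>z. z \<in> ?F \<Longrightarrow> snd (RC z) \<le> C"
    using finF by (auto simp: C_def less_le_trans[OF zero_less_one])
  have "(l1norm N (dmap (\<lambda>x. \<iota> (inv_into W \<phi> x)) (\<phi> y) u))\<^sup>2 \<le> C * \<omega> W \<phi> (\<phi> y) u (Jmul u)"
    if y: "y \<in> U1" "\<iota> y \<in> pdisc N (\<iota> x0) \<rho>" and u: "u \<in> Cn n" and ch: "holo_chart X \<O> n W \<phi>" "y \<in> W" for y W \<phi> u
  proof -
    have yU: "y \<in> U0" by (rule \<rho>(2)[OF y])
    then obtain z where z: "z \<in> V" "p z = y" using U0(3) coverD(3)[OF cov(2)] by blast
    then obtain z0 where z0: "z0 \<in> ?F" "z \<in> pdisc n z0 (fst (RC z0))" using U0(4) yU by blast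
    have k: "kaehler_form n (\<phi> ` W) (\<omega> W \<phi>)" using metric_form ch unfolding kaehler_form_on_reg_def by blast
    have "(l1norm N (dmap (\<lambda>x. \<iota> (inv_into W \<phi> x)) (\<phi> y) u))\<^sup>2 \<le> snd (RC z0) * \<omega> W \<phi> (\<phi> y) u (Jmul u)"
      using RC(3)[OF z0 u ch(1)] ch(2) z(2) by simp
    also have "\<dots> \<le> C * \<omega> W \<phi> (\<phi> y) u (Jmul u)"
      using C(2)[OF z0(1)] kaehler_form_nonneg[OF k imageI[OF ch(2)] u] by (rule mult_right_mono)
    finally show ?thesis .
  qed
  then show ?thesis using \<rho>(1) C(1) by blast
qed

end

text \<open>Near \<open>x0\<close> the form is the pull-back of a Kaehler form of the ambient space,
  which is comparable to the euclidean metric on a compact polydisc.\<close>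

lemma (in complex_space) ambient_metric_bounds:
  assumes \<omega>X: "kaehler_metric n X \<O> \<omega>X" and le: "local_embedding X \<O> N U1 \<iota>" and x0: "x0 \<in> U1"
  shows "\<exists>\<rho>>0. \<exists>C>0. \<forall>y\<in>U1. \<iota> y \<in> pdisc N (\<iota> x0) \<rho> \<longrightarrow> (\<forall>W \<phi>. \<forall>u\<in>Cn n.
      holo_chart X \<O> n W \<phi> \<and> y \<in> W \<longrightarrow>
      (l1norm N (dmap (\<lambda>x. \<iota> (inv_into W \<phi> x)) (\<phi> y) u))\<^sup>2 \<le> C * \<omega>X W \<phi> (\<phi> y) u (Jmul u) \<and>
      \<omega>X W \<phi> (\<phi> y) u (Jmul u) \<le> C * (l1norm N (dmap (\<lambda>x. \<iota> (inv_into W \<phi> x)) (\<phi> y) u))\<^sup>2)"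
proof -
  obtain \<Omega> \<eta> where \<Omega>: "Cn_open N \<Omega>" "\<iota> x0 \<in> \<Omega>" "kaehler_form N \<Omega> \<eta>"
    and \<eta>: "\<And>W \<phi> y u v. holo_chart X \<O> n W \<phi> \<Longrightarrow> y \<in> U1 \<inter> W \<Longrightarrow> \<iota> y \<in> \<Omega> \<Longrightarrow> u \<in> Cn n \<Longrightarrow> v \<in> Cn n \<Longrightarrow>
      \<omega>X W \<phi> (\<phi> y) u v = pullback (\<iota> \<circ> inv_into W \<phi>) \<eta> (\<phi> y) u v"
    using \<omega>X le x0 unfolding kaehler_metric_def by metis
  obtain \<rho>0 where \<rho>0: "\<rho>0 > 0" "pdisc N (\<iota> x0) \<rho>0 \<subseteq> \<Omega>" using \<Omega>(1,2) unfolding Cn_open_iff by blast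
  define \<rho> where "\<rho> = \<rho>0 / 2"
  have \<rho>: "\<rho> > 0" "cpdisc N (\<iota> x0) \<rho> \<subseteq> \<Omega>"
    using \<rho>0 cpdisc_subset_pdisc[of \<rho> \<rho>0 N "\<iota> x0"] by (auto simp: \<rho>_def)
  obtain m M where mM: "m > 0" "M > 0" "\<And>z u. z \<in> cpdisc N (\<iota> x0) \<rho> \<Longrightarrow> u \<in> Cn N \<Longrightarrow>
      m * (l1norm N u)\<^sup>2 \<le> \<eta> z u (Jmul u) \<and> \<eta> z u (Jmul u) \<le> M * (l1norm N u)\<^sup>2"
    using kaehler_form_bounds[OF \<Omega>(3) compact_cpdisc \<rho>(2)] by blast
  define C where "C = max M (1 / m)"
  have C: "C > 0" "M \<le> C" "1 / m \<le> C" using mM by (auto simp: C_def)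
  have "(l1norm N (dmap (\<lambda>x. \<iota> (inv_into W \<phi> x)) (\<phi> y) u))\<^sup>2 \<le> C * \<omega>X W \<phi> (\<phi> y) u (Jmul u) \<and>
      \<omega>X W \<phi> (\<phi> y) u (Jmul u) \<le> C * (l1norm N (dmap (\<lambda>x. \<iota> (inv_into W \<phi> x)) (\<phi> y) u))\<^sup>2"
    if y: "y \<in> U1" "\<iota> y \<in> pdisc N (\<iota> x0) \<rho>" and u: "u \<in> Cn n" and ch: "holo_chart X \<O> n W \<phi>" "y \<in> W" for y W \<phi> u
  proof -
    define w where "w = dmap (\<lambda>x. \<iota> (inv_into W \<phi> x)) (\<phi> y) u"
    note hm = chart_to_embedding[OF ch(1) le]
    have yA: "\<phi> y \<in> \<phi> ` (W \<inter> U1)" using y ch by blast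
    have wC: "w \<in> Cn N" unfolding w_def by (rule dmap_Cn[OF hm yA u])
    have yc: "\<iota> y \<in> cpdisc N (\<iota> x0) \<rho>" using y(2) pdisc_subset_cpdisc by blast
    have "\<omega>X W \<phi> (\<phi> y) u (Jmul u) = \<eta> (\<iota> y) w (Jmul w)"
      using \<eta>[OF ch(1) _ _ u Cn_Jmul[OF u], of y] y(1) ch(2) yc \<rho>(2) dmap_Jmul[OF hm yA u]
        local_embedding_inv[OF holo_chartD(1)[OF ch(1)] ch(2)]
      unfolding pullback_def comp_def w_def by auto
    moreover have "(l1norm N w)\<^sup>2 \<le> C * \<eta> (\<iota> y) w (Jmul w)"
    proof -
      have n: "0 \<le> \<eta> (\<iota> y) w (Jmul w)" using kaehler_form_nonneg[OF \<Omega>(3) _ wC] yc \<rho>(2) by blast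
      have "(l1norm N w)\<^sup>2 = 1 / m * (m * (l1norm N w)\<^sup>2)" using mM(1) by simp
      also have "\<dots> \<le> 1 / m * \<eta> (\<iota> y) w (Jmul w)"
        using mM(3)[OF yc wC] mM(1) by (intro mult_left_mono) auto
      also have "\<dots> \<le> C * \<eta> (\<iota> y) w (Jmul w)" using C(3) n by (rule mult_right_mono)
      finally show ?thesis .
    qed
    moreover have "\<eta> (\<iota> y) w (Jmul w) \<le> C * (l1norm N w)\<^sup>2"
      using mM(3)[OF yc wC] mult_right_mono[OF C(2), of "(l1norm N w)\<^sup>2"] by auto
    ultimately show ?thesis unfolding w_def by simp
  qed
  then show ?thesis using \<rho>(1) C(1) by blast
qed

section \<open>Hoelder estimate from the invariants of the Galois group\<close>

text \<open>The group law appears as the last clause: right translation by \<open>h\<close> permutes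
  \<open>G\<close>. This is what makes symmetric functions of an orbit invariant.\<close>

definition deck_group :: "nat \<Rightarrow> (nat \<Rightarrow> complex) set \<Rightarrow> ((nat \<Rightarrow> complex) \<Rightarrow> 'a) \<Rightarrow> ((nat \<Rightarrow> complex) \<Rightarrow> (nat \<Rightarrow> complex)) set \<Rightarrow> bool" where
  "deck_group n V p G \<longleftrightarrow> finite G \<and> G \<noteq> {} \<and> (\<forall>g\<in>G. \<forall>z\<in>V. g z \<in> V) \<and> (\<forall>g\<in>G. \<forall>i. (\<lambda>z. g z i) \<in> holo n V) \<and>
     (\<forall>z\<in>V. \<forall>w\<in>V. p z = p w \<longleftrightarrow> (\<exists>g\<in>G. w = g z)) \<and>
     (\<forall>h\<in>G. \<exists>s. bij_betw s G G \<and> (\<forall>g\<in>G. \<forall>z\<in>V. s g z = g (h z)))"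

lemma deck_groupD:
  assumes "deck_group n V p G"
  shows "finite G" "G \<noteq> {}" "\<And>g z. g \<in> G \<Longrightarrow> z \<in> V \<Longrightarrow> g z \<in> V" "\<And>g i. g \<in> G \<Longrightarrow> (\<lambda>z. g z i) \<in> holo n V"
    "\<And>z w. z \<in> V \<Longrightarrow> w \<in> V \<Longrightarrow> p z = p w \<longleftrightarrow> (\<exists>g\<in>G. w = g z)"
    "\<And>h. h \<in> G \<Longrightarrow> \<exists>s. bij_betw s G G \<and> (\<forall>g\<in>G. \<forall>z\<in>V. s g z = g (h z))"
  using assms unfolding deck_group_def by (blast, blast, blast, blast, blast, blast)

text \<open>Right translation is injective by cancellation, and an injective self-map of a finite
  set is a permutation.\<close>

lemma cover_deck_group:
  assumes "quasi_etale_galois_cover X \<O> n V U p"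
  shows "\<exists>G. deck_group n V p G"
proof -
  obtain G where G: "subgroup G (BijGroup V)" "finite G" "\<forall>g\<in>G. \<forall>i. (\<lambda>z. g z i) \<in> holo n V"
    "\<forall>z\<in>V. \<forall>w\<in>V. p z = p w \<longleftrightarrow> (\<exists>g\<in>G. w = g z)"
    using assms unfolding quasi_etale_galois_cover_def by auto
  have car: "G \<subseteq> Bij V" using subgroup.subset[OF G(1)] by (simp add: BijGroup_def)
  have ne: "G \<noteq> {}" using subgroup.one_closed[OF G(1)] by blast
  have maps: "g z \<in> V" if "g \<in> G" "z \<in> V" for g z
    using car that Bij_imp_funcset by fastforce
  have sh: "\<exists>s. bij_betw s G G \<and> (\<forall>g\<in>G. \<forall>z\<in>V. s g z = g (h z))" if h: "h \<in> G" for h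
  proof (intro exI conjI ballI)
    let ?s = "\<lambda>g. g \<otimes>\<^bsub>BijGroup V\<^esub> h"
    have val: "?s g = compose V g h" if "g \<in> G" for g
      using car that h by (auto simp: BijGroup_def)
    have "inj_on ?s G"
      using group.right_cancel[OF group_BijGroup] subgroup.subset[OF G(1)] h
      by (meson inj_onI subsetD)
    moreover have "?s ` G \<subseteq> G" using subgroup.m_closed[OF G(1)] h by blast
    ultimately show "bij_betw ?s G G" using endo_inj_surj[OF G(2)] unfolding bij_betw_def by blast
    show "?s g z = g (h z)" if "g \<in> G" "z \<in> V" for g z
      using val[OF that(1)] that(2) by (simp add: compose_def)
  qed
  have "deck_group n V p G"
    unfolding deck_group_def using G(2,3,4) ne maps sh by (intro conjI) blast+
  then show ?thesis by blast
qed

text \<open>With \<open>v g = g w\<close> the roots are the values of the linear form with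
  coefficients \<open>\<xi> ^ i\<close> on the orbit of \<open>w\<close>. Evaluation at the value of
  this form on \<open>z\<close> gives the product of its values on all
  \<open>z - g w\<close>.\<close>

definition orbit_poly :: "('g \<Rightarrow> nat \<Rightarrow> complex) \<Rightarrow> nat \<Rightarrow> complex \<Rightarrow> 'g set \<Rightarrow> complex poly" where
  "orbit_poly v n \<xi> G = (\<Prod>g\<in>G. [:- (\<Sum>i<n. \<xi> ^ i * v g i), 1:])"

lemma orbit_poly_coeff_holo:
  assumes "finite G" "\<And>g i. g \<in> G \<Longrightarrow> holo_open n V (\<lambda>z. f g z i)"
  shows "holo_open n V (\<lambda>z. coeff (orbit_poly (\<lambda>g. f g z) n \<xi> G) k)"
  using assms
proof (induction G arbitrary: k rule: finite_induct)
  case empty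
  then show ?case by (simp add: orbit_poly_def holo_open_const)
next
  case (insert g G)
  have l: "holo_open n V (\<lambda>z. coeff [:- (\<Sum>i<n. \<xi> ^ i * f g z i), 1:] j)" for j
  proof -
    have "holo_open n V (\<lambda>z. - 1 * (\<Sum>i<n. \<xi> ^ i * f g z i))"
      using insert.prems by (intro holo_open_mult holo_open_const holo_open_sum) auto
    then show ?thesis by (cases j) (auto simp: coeff_pCons split: nat.split intro: holo_open_const)
  qed
  have "holo_open n V (\<lambda>z. \<Sum>j\<le>k. coeff [:- (\<Sum>i<n. \<xi> ^ i * f g z i), 1:] j * coeff (orbit_poly (\<lambda>g. f g z) n \<xi> G) (k - j))"
    using insert.IH insert.prems by (intro holo_open_sum holo_open_mult l) auto
  then show ?case by (simp only: orbit_poly_def prod.insert[OF insert.hyps(1,2)] coeff_mult)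
qed

lemma orbit_poly_degree: "finite G \<Longrightarrow> degree (orbit_poly v n \<xi> G) \<le> card G"
  unfolding orbit_poly_def
proof (induction G rule: finite_induct)
  case (insert g G)
  have "degree ([:- (\<Sum>i<n. \<xi> ^ i * v g i), 1:] * (\<Prod>g\<in>G. [:- (\<Sum>i<n. \<xi> ^ i * v g i), 1:]))
      \<le> 1 + card G"
    using insert.IH by (intro order_trans[OF degree_mult_le] add_mono) auto
  then show ?case using insert.hyps by simp
qed simp

lemma poly_diff_bound:
  fixes P Q :: "complex poly"
  assumes "degree P \<le> m" "degree Q \<le> m" "\<And>k. k \<le> m \<Longrightarrow> cmod (coeff P k - coeff Q k) \<le> e" "cmod x \<le> B"
  shows "cmod (poly P x - poly Q x) \<le> (\<Sum>k\<le>m. B ^ k) * e"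
proof -
  have a: "poly R x = (\<Sum>k\<le>m. coeff R k * x ^ k)" if "degree R \<le> m" for R :: "complex poly"
    unfolding poly_altdef using that by (intro sum.mono_neutral_left) (auto simp: coeff_eq_0)
  have "poly P x - poly Q x = (\<Sum>k\<le>m. (coeff P k - coeff Q k) * x ^ k)"
    unfolding a[OF assms(1)] a[OF assms(2)] by (simp add: sum_subtractf algebra_simps)
  also have "cmod \<dots> \<le> (\<Sum>k\<le>m. e * B ^ k)"
  proof (rule sum_norm_le)
    fix k assume k: "k \<in> {..m}"
    have "0 \<le> e" using assms(3)[of 0] norm_ge_zero order_trans by blast
    then show "cmod ((coeff P k - coeff Q k) * x ^ k) \<le> e * B ^ k"
      unfolding norm_mult norm_power using assms(3,4) k by (intro mult_mono power_mono) auto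
  qed
  finally show ?thesis by (simp add: sum_distrib_left mult.commute)
qed

text \<open>Locally every section is the restriction of an ambient holomorphic function, which is
  Lipschitz on a small polydisc; finitely many sections share radius and constant.\<close>

lemma (in complex_space) section_lipschitz:
  assumes le: "local_embedding X \<O> N U1 \<iota>" and x0: "x0 \<in> U1" "x0 \<in> U" and U: "openin X U"
    and f: "\<And>k. k < M \<Longrightarrow> f k \<in> \<O> U"
  shows "\<exists>\<rho>>0. \<exists>L>0. \<forall>k<(M::nat). \<forall>x\<in>U \<inter> U1. \<forall>y\<in>U \<inter> U1. \<iota> x \<in> pdisc N (\<iota> x0) \<rho> \<and> \<iota> y \<in> pdisc N (\<iota> x0) \<rho> \<longrightarrow>
    cmod (f k x - f k y) \<le> L * l1norm N (\<lambda>i. \<iota> x i - \<iota> y i)"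
  using f
proof (induction M)
  case 0
  show ?case by (intro exI[of _ "1::real"] conjI) auto
next
  case (Suc M)
  obtain \<rho>1 L1 where 1: "\<rho>1 > 0" "L1 > 0" "\<And>k x y. k < M \<Longrightarrow> x \<in> U \<inter> U1 \<Longrightarrow> y \<in> U \<inter> U1 \<Longrightarrow>
      \<iota> x \<in> pdisc N (\<iota> x0) \<rho>1 \<Longrightarrow> \<iota> y \<in> pdisc N (\<iota> x0) \<rho>1 \<Longrightarrow> cmod (f k x - f k y) \<le> L1 * l1norm N (\<lambda>i. \<iota> x i - \<iota> y i)"
  proof -
    have "\<exists>\<rho>>0. \<exists>L>0. \<forall>k<M. \<forall>x\<in>U \<inter> U1. \<forall>y\<in>U \<inter> U1. \<iota> x \<in> pdisc N (\<iota> x0) \<rho> \<and> \<iota> y \<in> pdisc N (\<iota> x0) \<rho> \<longrightarrow>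
      cmod (f k x - f k y) \<le> L * l1norm N (\<lambda>i. \<iota> x i - \<iota> y i)"
      by (rule Suc.IH, rule Suc.prems) simp
    then show thesis using that by (elim exE conjE) blast
  qed
  have o: "openin X (U \<inter> U1)" using U local_embeddingD(1)[OF le] by blast
  have "f M \<in> \<O> (U \<inter> U1)" using sections_restrict[OF U o _ Suc.prems] by blast
  then have "f M \<circ> inv_into U1 \<iota> \<in> holo N (\<iota> ` (U \<inter> U1))" using local_embeddingD(6)[OF le o] by blast
  moreover have "\<iota> x0 \<in> \<iota> ` (U \<inter> U1)" using x0 by blast
  ultimately obtain \<Omega> g where \<Omega>: "Cn_open N \<Omega>" "\<iota> x0 \<in> \<Omega>" "holo_open N \<Omega> g"
    "\<And>y. y \<in> \<iota> ` (U \<inter> U1) \<Longrightarrow> y \<in> \<Omega> \<Longrightarrow> (f M \<circ> inv_into U1 \<iota>) y = g y"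
    unfolding holo_def by blast
  obtain \<rho>2 L2 where 2: "\<rho>2 > 0" "L2 > 0" "pdisc N (\<iota> x0) \<rho>2 \<subseteq> \<Omega>"
    "\<And>y w. y \<in> pdisc N (\<iota> x0) \<rho>2 \<Longrightarrow> w \<in> pdisc N (\<iota> x0) \<rho>2 \<Longrightarrow> cmod (g y - g w) \<le> L2 * l1norm N (\<lambda>i. y i - w i)"
    using holo_open_locally_lipschitz[of 1 N \<Omega> "\<lambda>_. g", OF \<Omega>(3,1,2)] by (metis less_one)
  have fM: "cmod (f M x - f M y) \<le> L2 * l1norm N (\<lambda>i. \<iota> x i - \<iota> y i)"
    if "x \<in> U \<inter> U1" "y \<in> U \<inter> U1" "\<iota> x \<in> pdisc N (\<iota> x0) \<rho>2" "\<iota> y \<in> pdisc N (\<iota> x0) \<rho>2" for x y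
  proof -
    have "f M t = g (\<iota> t)" if "t \<in> U \<inter> U1" "\<iota> t \<in> pdisc N (\<iota> x0) \<rho>2" for t
      using \<Omega>(4)[of "\<iota> t"] local_embedding_inv[OF le, of t] that 2(3) by auto
    then show ?thesis using 2(4) that by simp
  qed
  have mono: "a \<le> max L1 L2 * l1norm N u" if "a \<le> L1 * l1norm N u \<or> a \<le> L2 * l1norm N u" for a u
    using that by (meson max.cobounded1 max.cobounded2 mult_right_mono l1norm_nonneg order_trans)
  have "cmod (f k x - f k y) \<le> max L1 L2 * l1norm N (\<lambda>i. \<iota> x i - \<iota> y i)"
    if k: "k < Suc M" and xy: "x \<in> U \<inter> U1" "y \<in> U \<inter> U1" "\<iota> x \<in> pdisc N (\<iota> x0) (min \<rho>1 \<rho>2)" "\<iota> y \<in> pdisc N (\<iota> x0) (min \<rho>1 \<rho>2)"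
    for k x y
  proof (rule mono, cases "k = M")
    have xy': "\<iota> x \<in> pdisc N (\<iota> x0) \<rho>1" "\<iota> y \<in> pdisc N (\<iota> x0) \<rho>1" "\<iota> x \<in> pdisc N (\<iota> x0) \<rho>2" "\<iota> y \<in> pdisc N (\<iota> x0) \<rho>2"
      using xy(3,4) by (auto simp: pdisc_def)
    {
      case True
      show "cmod (f k x - f k y) \<le> L1 * l1norm N (\<lambda>i. \<iota> x i - \<iota> y i) \<or> cmod (f k x - f k y) \<le> L2 * l1norm N (\<lambda>i. \<iota> x i - \<iota> y i)"
        unfolding True using fM[OF xy(1,2) xy'(3,4)] by blast
    next
      case False
      then show "cmod (f k x - f k y) \<le> L1 * l1norm N (\<lambda>i. \<iota> x i - \<iota> y i) \<or> cmod (f k x - f k y) \<le> L2 * l1norm N (\<lambda>i. \<iota> x i - \<iota> y i)"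
        using 1(3)[OF _ xy(1,2) xy'(1,2)] k by simp
    }
  qed
  moreover have "min \<rho>1 \<rho>2 > 0" "max L1 L2 > 0" using 1(1,2) 2(1,2) by auto
  ultimately show ?case by blast
qed

text \<open>A nonzero polynomial of degree below \<open>n\<close> with coefficients \<open>v\<close>
  cannot vanish at \<open>n\<close> distinct points, so the sum of the moduli is positive.
  Compactness of the unit sphere bounds it from below, and homogeneity extends the bound.\<close>

lemma vandermonde_bound:
  assumes J: "finite J" "n \<le> card (J :: nat set)"
  shows "\<exists>c>0. \<forall>v\<in>Cn n. v \<noteq> (\<lambda>i. 0) \<longrightarrow> (\<exists>j\<in>J. c * l1norm n v \<le> cmod (\<Sum>i<n. of_nat j ^ i * v i))"
proof -
  let ?q = "\<lambda>j v. \<Sum>i<n. of_nat j ^ i * v i :: complex" and ?S = "{v \<in> Cn n. l1norm n v = 1}"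
  let ?h = "\<lambda>v. \<Sum>j\<in>J. cmod (?q j v)"
  have pos: "?h v > 0" if v: "v \<in> Cn n" "v \<noteq> (\<lambda>i. 0)" for v
  proof (rule ccontr)
    assume "\<not> ?h v > 0"
    moreover have "?h v \<ge> 0" by (intro sum_nonneg) auto
    ultimately have "?h v = 0" by linarith
    then have z: "?q j v = 0" if "j \<in> J" for j
      using that J(1) by (subst (asm) sum_nonneg_eq_0_iff) auto
    define Q where "Q = (\<Sum>i<n. monom (v i) i)"
    obtain k where k: "v k \<noteq> 0" using v(2) by auto
    then have kn: "k < n" using v(1) by (auto simp: Cn_def not_le[symmetric])
    have "coeff Q k = v k" using kn by (simp add: Q_def coeff_sum)
    then have Q0: "Q \<noteq> 0" using k by auto
    have deg: "degree Q \<le> n - 1" unfolding Q_def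
      by (rule degree_sum_le) (auto intro!: order_trans[OF degree_monom_le])
    have "poly Q (of_nat j) = ?q j v" for j
      by (simp add: Q_def poly_sum poly_monom mult.commute)
    then have "of_nat ` J \<subseteq> {x. poly Q x = 0}" using z by auto
    then have "card (of_nat ` J :: complex set) \<le> degree Q"
      using card_mono[OF poly_roots_finite[OF Q0]] card_poly_roots_bound[OF Q0] order_trans by blast
    moreover have "card (of_nat ` J :: complex set) = card J"
      by (rule card_image) (simp add: inj_on_def)
    ultimately show False using deg J(2) kn by linarith
  qed
  have cont: "continuous_on ?S ?h"
    by (intro continuous_intros continuous_on_component)
  obtain \<mu> where \<mu>: "\<mu> > 0" "\<And>v. v \<in> ?S \<Longrightarrow> \<mu> \<le> ?h v"
  proof (cases "?S = {}")
    case True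
    show thesis by (rule that[of 1]) (simp, use True in blast)
  next
    case False
    obtain x where x: "x \<in> ?S" "\<forall>y\<in>?S. ?h x \<le> ?h y"
      using continuous_attains_inf[OF compact_l1sphere False cont] by blast
    have "x \<noteq> (\<lambda>i. 0)" using x(1) by (auto simp: l1norm_def)
    then have "?h x > 0" using pos x(1) by blast
    then show thesis by (rule that) (use x(2) in blast)
  qed
  \<comment> \<open>If every modulus were at most \<open>c\<close> on a unit vector, their sum would
    be below \<open>\<mu>\<close>.\<close>
  define c where "c = \<mu> / (real (card J) + 1)"
  have c: "c > 0" using \<mu>(1) by (simp add: c_def add_nonneg_pos)
  have "\<exists>j\<in>J. c * l1norm n v \<le> cmod (?q j v)" if v: "v \<in> Cn n" "v \<noteq> (\<lambda>i. 0)" for v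
  proof (rule ccontr)
    assume "\<not> ?thesis"
    then have less: "cmod (?q j v) \<le> c * l1norm n v" if "j \<in> J" for j using that by force
    define a where "a = l1norm n v"
    have a: "a > 0" using l1norm_nonneg[of n v] l1norm_eq_0_Cn[OF v(1)] v(2) unfolding a_def by linarith
    define w where "w = (\<lambda>i. of_real (1 / a) * v i)"
    have "l1norm n w = 1" unfolding w_def l1norm_mult using a by (simp add: a_def[symmetric] norm_divide)
    then have "w \<in> ?S" using v(1) by (simp add: w_def Cn_def)
    then have "\<mu> \<le> ?h w" by (rule \<mu>(2))
    also have "?h w \<le> (\<Sum>j\<in>J. c)"
    proof (rule sum_mono)
      fix j assume j: "j \<in> J"
      have "?q j w = of_real (1 / a) * ?q j v"
        unfolding w_def sum_distrib_left by (intro sum.cong refl) (simp only: mult.left_commute)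
      then have "cmod (?q j w) = 1 / a * cmod (?q j v)" using a by (simp add: norm_mult norm_divide)
      also have "\<dots> \<le> 1 / a * (c * a)" using less[OF j] a unfolding a_def[symmetric] by (intro mult_left_mono) auto
      finally show "cmod (?q j w) \<le> c" using a by simp
    qed
    also have "\<dots> = real (card J) * c" by simp
    also have "\<dots> < (real (card J) + 1) * c" using c by (simp add: algebra_simps)
    also have "\<dots> = \<mu>" by (simp add: c_def add_nonneg_pos)
    finally show False by simp
  qed
  then show ?thesis using c by blast
qed

text \<open>Pigeonhole: if each of sufficiently many Vandermonde forms were small on some \<open>v g\<close>, then \<open>n\<close> of
  them would be small on the same one.\<close>

lemma generic_linear_form:
  assumes G: "finite G"
  shows "\<exists>M c. c > 0 \<and> (\<forall>v. (\<forall>g\<in>G. v g \<in> Cn n) \<longrightarrow>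
    (\<exists>j<M. \<forall>g\<in>G. c * l1norm n (v g) \<le> cmod (\<Sum>i<n. of_nat j ^ i * v g i)))"
proof -
  \<comment> \<open>This many indices cannot be covered by \<open>card G\<close> sets of at most
    \<open>n\<close> elements each.\<close>
  define M where "M = card G * n + 1"
  let ?J = "{J. J \<subseteq> {..<M} \<and> n \<le> card J}"
  have "\<forall>J\<in>?J. \<exists>c>0. \<forall>v\<in>Cn n. v \<noteq> (\<lambda>i. 0) \<longrightarrow> (\<exists>j\<in>J. c * l1norm n v \<le> cmod (\<Sum>i<n. of_nat j ^ i * v i))"
    using vandermonde_bound finite_subset[OF _ finite_lessThan[of M]] by blast
  from bchoice[OF this] obtain cc where cc: "\<And>J. J \<in> ?J \<Longrightarrow> cc J > 0"
    "\<And>J v. J \<in> ?J \<Longrightarrow> v \<in> Cn n \<Longrightarrow> v \<noteq> (\<lambda>i. 0) \<Longrightarrow> \<exists>j\<in>J. cc J * l1norm n v \<le> cmod (\<Sum>i<n. of_nat j ^ i * v i)"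
    by blast
  have finJ: "finite ?J" by (rule finite_subset[of _ "Pow {..<M}"]) auto
  define c where "c = Min (insert 1 (cc ` ?J))"
  have c: "c > 0" "\<And>J. J \<in> ?J \<Longrightarrow> c \<le> cc J" using finJ cc(1) by (auto simp: c_def)
  have "\<exists>j<M. \<forall>g\<in>G. c * l1norm n (v g) \<le> cmod (\<Sum>i<n. of_nat j ^ i * v g i)" if v: "\<forall>g\<in>G. v g \<in> Cn n" for v
  proof (rule ccontr)
    assume neg: "\<not> ?thesis"
    define A where "A g = {j \<in> {..<M}. cmod (\<Sum>i<n. of_nat j ^ i * v g i) < c * l1norm n (v g)}" for g
    have "{..<M} \<subseteq> (\<Union>g\<in>G. A g)" using neg by (auto simp: A_def not_le)
    then have "M \<le> card (\<Union>g\<in>G. A g)"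
      using card_mono[of "\<Union>g\<in>G. A g" "{..<M}"] G by (auto simp: A_def)
    also have "\<dots> \<le> (\<Sum>g\<in>G. card (A g))" by (rule card_UN_le[OF G])
    finally have M: "M \<le> (\<Sum>g\<in>G. card (A g))" .
    have "\<exists>g\<in>G. n < card (A g)"
    proof (rule ccontr)
      assume "\<not> ?thesis"
      then have "(\<Sum>g\<in>G. card (A g)) \<le> (\<Sum>g\<in>G. n)" by (intro sum_mono) (auto simp: not_less)
      then show False using M by (simp add: M_def)
    qed
    then obtain g where g: "g \<in> G" "n < card (A g)" by blast
    have AJ: "A g \<in> ?J" using g(2) by (auto simp: A_def)
    \<comment> \<open>The inequality defining \<open>A g\<close> is strict, so the zero vector would
      make the set empty.\<close>
    have "A g \<noteq> {}" using g(2) by auto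
    then have "v g \<noteq> (\<lambda>i. 0)" by (auto simp: A_def l1norm_def)
    then obtain j where j: "j \<in> A g" "cc (A g) * l1norm n (v g) \<le> cmod (\<Sum>i<n. of_nat j ^ i * v g i)"
      using cc(2)[OF AJ] v g(1) by blast
    have "c * l1norm n (v g) \<le> cc (A g) * l1norm n (v g)" using c(2)[OF AJ] by (intro mult_right_mono) auto
    then show False using j by (simp add: A_def)
  qed
  then show ?thesis using c(1) by blast
qed

text \<open>The smallest factor works: its power is at most the product.\<close>

lemma prod_le_imp_ex_power_le:
  fixes a :: "'g \<Rightarrow> real"
  assumes "finite G" "G \<noteq> {}" "\<And>g. g \<in> G \<Longrightarrow> 0 \<le> a g" "(\<Prod>g\<in>G. a g) \<le> b"
  shows "\<exists>g\<in>G. a g ^ card G \<le> b"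
proof -
  obtain g where g: "g \<in> G" "\<And>h. h \<in> G \<Longrightarrow> a g \<le> a h"
    using ex_min_if_finite[of "a ` G"] assms(1,2) by (auto simp: not_less)
  have "a g ^ card G = (\<Prod>h\<in>G. a g)" by simp
  also have "\<dots> \<le> (\<Prod>h\<in>G. a h)" using g assms(3) by (intro prod_mono) auto
  finally show ?thesis using g(1) assms(4) by force
qed

lemma powr_root_le:
  fixes x y :: real
  assumes "0 < m" "0 \<le> x" "x ^ m \<le> y"
  shows "x \<le> y powr (1 / real m)"
proof (cases "x = 0")
  case False
  then have x: "x > 0" using assms(2) by simp
  then have "x = (x ^ m) powr (1 / real m)" using assms(1) by (simp add: powr_realpow[symmetric] powr_powr)
  also have "\<dots> \<le> y powr (1 / real m)" using assms(3) x by (intro powr_mono2) auto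
  finally show ?thesis .
qed simp

text \<open>The bound \<open>B\<close> on \<open>z\<close> turns closeness of coefficients into
  closeness of values. \<open>M\<close> counts the linear forms treated simultaneously; the
  pigeonhole argument determines it where the estimate is applied.\<close>

lemma (in complex_space) invariant_estimate:
  assumes cov: "quasi_etale_galois_cover X \<O> n V U p" and le: "local_embedding X \<O> N U1 \<iota>" and x0: "x0 \<in> U" "x0 \<in> U1"
    and dG: "deck_group n V p G"
    and B: "0 \<le> B"
  shows "\<exists>\<rho>>0. \<exists>K>0. \<forall>z\<in>V. \<forall>w\<in>V. p z \<in> U1 \<and> p w \<in> U1 \<and> \<iota> (p z) \<in> pdisc N (\<iota> x0) \<rho> \<and> \<iota> (p w) \<in> pdisc N (\<iota> x0) \<rho> \<and>
      (\<forall>i<n. cmod (z i) \<le> B) \<longrightarrow>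
      (\<forall>j<M. (\<Prod>g\<in>G. cmod (\<Sum>i<n. of_nat j ^ i * (z i - g w i))) \<le> K * l1norm N (\<lambda>i. \<iota> (p z) i - \<iota> (p w) i))"
proof -
  note G = deck_groupD(1,3-6)[OF dG]
  define m where "m = card G"
  \<comment> \<open>One index runs over all pairs of a linear form \<open>j\<close> and a
    coefficient \<open>k \<le> m\<close>, encoded as \<open>j * (m + 1) + k\<close>.\<close>
  define c where "c t z = coeff (orbit_poly (\<lambda>g. g z) n (of_nat (t div (m + 1))) G) (t mod (m + 1))" for t z
  \<comment> \<open>The induced function on \<open>U\<close>; invariance makes the choice of the
    preimage irrelevant.\<close>
  define f where "f t x = c t (SOME z. z \<in> V \<and> p z = x)" for t x
  note V = coverD(1)[OF cov]
  have inv: "c t z = c t w" if zw: "z \<in> V" "w \<in> V" "p z = p w" for t z w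
  proof -
    obtain h where h: "h \<in> G" "w = h z" using G(4)[OF zw(1,2)] zw(3) by blast
    obtain s where s: "bij_betw s G G" "\<And>g. g \<in> G \<Longrightarrow> s g z = g (h z)" using G(5)[OF h(1)] zw(1) by blast
    have "orbit_poly (\<lambda>g. g w) n \<xi> G = orbit_poly (\<lambda>g. g z) n \<xi> G" for \<xi>
    proof -
      have "orbit_poly (\<lambda>g. g w) n \<xi> G = (\<Prod>g\<in>G. [:- (\<Sum>i<n. \<xi> ^ i * s g z i), 1:])"
        unfolding orbit_poly_def h(2) by (intro prod.cong refl) (simp add: s(2))
      also have "\<dots> = orbit_poly (\<lambda>g. g z) n \<xi> G"
        unfolding orbit_poly_def using prod.reindex_bij_betw[OF s(1), of "\<lambda>g. [:- (\<Sum>i<n. \<xi> ^ i * g z i), 1:]"] .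
      finally show ?thesis .
    qed
    then show ?thesis unfolding c_def by simp
  qed
  have fp: "f t (p z) = c t z" if z: "z \<in> V" for t z
  proof -
    have "(SOME w. w \<in> V \<and> p w = p z) \<in> V \<and> p (SOME w. w \<in> V \<and> p w = p z) = p z"
      by (rule someI[of _ z]) (use z in blast)
    then show ?thesis unfolding f_def using inv z by blast
  qed
  have "f t \<in> \<O> U" for t
  proof -
    have "holo_open n V (c t)"
      unfolding c_def using G(1,3) holo_iff_open[OF V] by (intro orbit_poly_coeff_holo) auto
    then have "c t \<in> holo n V" using holo_iff_open[OF V] by blast
    moreover have "f t \<circ> p \<in> holo n V \<longleftrightarrow> c t \<in> holo n V" by (rule holo_cong) (simp add: fp)
    moreover have "{z \<in> V. p z \<in> U} = V" using coverD(3)[OF cov] by blast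
    ultimately show ?thesis using coverD(7)[OF cov coverD(2)[OF cov] order_refl] by simp
  qed
  from section_lipschitz[where f = f and M = "M * (m + 1)", OF le x0(2,1) coverD(2)[OF cov] this]
  obtain \<rho> L where L: "\<rho> > 0" "L > 0" "\<And>t x y. t < M * (m + 1) \<Longrightarrow> x \<in> U \<inter> U1 \<Longrightarrow> y \<in> U \<inter> U1 \<Longrightarrow>
      \<iota> x \<in> pdisc N (\<iota> x0) \<rho> \<Longrightarrow> \<iota> y \<in> pdisc N (\<iota> x0) \<rho> \<Longrightarrow> cmod (f t x - f t y) \<le> L * l1norm N (\<lambda>i. \<iota> x i - \<iota> y i)"
    by (elim exE conjE) blast
  \<comment> \<open>Bounds the value of the linear form on \<open>z\<close> uniformly in
    \<open>j < M\<close>.\<close>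
  define B' where "B' = (\<Sum>i<n. real M ^ i * B)"
  have B': "0 \<le> B'" unfolding B'_def using B by (intro sum_nonneg) auto
  define K where "K = (\<Sum>k\<le>m. B' ^ k) * L + 1"
  have K: "K > 0" unfolding K_def using B' L(2) by (intro add_nonneg_pos mult_nonneg_nonneg sum_nonneg) auto
  have "(\<Prod>g\<in>G. cmod (\<Sum>i<n. of_nat j ^ i * (z i - g w i))) \<le> K * l1norm N (\<lambda>i. \<iota> (p z) i - \<iota> (p w) i)"
    if zw: "z \<in> V" "w \<in> V" "p z \<in> U1" "p w \<in> U1" "\<iota> (p z) \<in> pdisc N (\<iota> x0) \<rho>" "\<iota> (p w) \<in> pdisc N (\<iota> x0) \<rho>"
      and zB: "\<And>i. i < n \<Longrightarrow> cmod (z i) \<le> B" and j: "j < M" for z w j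
  proof -
    let ?\<xi> = "of_nat j :: complex" and ?\<delta> = "l1norm N (\<lambda>i. \<iota> (p z) i - \<iota> (p w) i)"
    let ?P = "orbit_poly (\<lambda>g. g z) n ?\<xi> G" and ?Q = "orbit_poly (\<lambda>g. g w) n ?\<xi> G"
    define T where "T = (\<Sum>i<n. ?\<xi> ^ i * z i)"
    have pU: "p z \<in> U \<inter> U1" "p w \<in> U \<inter> U1" using zw(1-4) coverD(3)[OF cov] by auto
    have coeffs: "cmod (coeff ?Q k - coeff ?P k) \<le> L * ?\<delta>" if k: "k \<le> m" for k
    proof -
      let ?t = "j * (m + 1) + k"
      have "j * (m + 1) + k < (j + 1) * (m + 1)" using k by simp
      also have "\<dots> \<le> M * (m + 1)" using j by (intro mult_right_mono) auto
      finally have t: "?t < M * (m + 1)" .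
      have d: "?t div (m + 1) = j" "?t mod (m + 1) = k"
        using k by (simp_all only: div_mult_self3 mod_mult_self3) simp_all
      have "cmod (f ?t (p z) - f ?t (p w)) \<le> L * ?\<delta>" by (rule L(3)[OF t pU zw(5,6)])
      then show ?thesis unfolding fp[OF zw(1)] fp[OF zw(2)] c_def d by (simp add: norm_minus_commute)
    qed
    have TB: "cmod T \<le> B'"
      unfolding T_def B'_def
    proof (rule sum_norm_le)
      fix i assume "i \<in> {..<n}"
      then show "cmod (?\<xi> ^ i * z i) \<le> real M ^ i * B"
        unfolding norm_mult norm_power using zB j B by (intro mult_mono power_mono) auto
    qed
    have ev: "poly (orbit_poly (\<lambda>g. g y) n ?\<xi> G) T = (\<Prod>g\<in>G. \<Sum>i<n. ?\<xi> ^ i * (z i - g y i))" for y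
      unfolding orbit_poly_def poly_prod T_def by (simp add: sum_subtractf right_diff_distrib)
    \<comment> \<open>Some element of \<open>G\<close> fixes \<open>z\<close>, as \<open>z\<close>
      lies in its own fibre; the corresponding factor vanishes.\<close>
    have "poly ?P T = 0"
    proof -
      obtain g where g: "g \<in> G" "z = g z" using G(4)[OF zw(1,1)] by blast
      have "(\<Sum>i<n. ?\<xi> ^ i * (z i - g z i)) = 0" using g(2) by simp
      then show ?thesis unfolding ev using g(1) G(1) by (intro prod_zero) auto
    qed
    then have "(\<Prod>g\<in>G. cmod (\<Sum>i<n. ?\<xi> ^ i * (z i - g w i))) = cmod (poly ?Q T - poly ?P T)"
      by (simp add: ev prod_norm[symmetric])
    also have "\<dots> \<le> (\<Sum>k\<le>m. B' ^ k) * (L * ?\<delta>)"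
      by (rule poly_diff_bound[OF _ _ coeffs TB]) (use orbit_poly_degree[OF G(1)] m_def in auto)
    also have "\<dots> \<le> K * ?\<delta>" by (simp add: K_def algebra_simps)
    finally show ?thesis .
  qed
  then show ?thesis using L(1) K by blast
qed

context orbifold_metric
begin

text \<open>Here \<open>z\<close> is near the fibre point, while \<open>w\<close> is any point over
  a nearby point of \<open>X\<close>: the estimate itself finds a translate \<open>g w\<close> close
  to \<open>z\<close>, to which the distance bound on the cover applies.\<close>

lemma holder_at_fibre_point:
  assumes cov: "quasi_etale_galois_cover X \<O> n V U p" and le: "local_embedding X \<O> N U1 \<iota>" and x0: "x0 \<in> U1"
    and z0: "z0 \<in> V" "p z0 = x0"
    and dG: "deck_group n V p G"
  shows "\<exists>r>0. \<exists>\<rho>>0. \<exists>C>0. \<forall>z\<in>V \<inter> pdisc n z0 r. \<forall>w\<in>V. p z \<in> U1 \<and> p w \<in> U1 \<and>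
      \<iota> (p z) \<in> pdisc N (\<iota> x0) \<rho> \<and> \<iota> (p w) \<in> pdisc N (\<iota> x0) \<rho> \<longrightarrow>
      kdist n X \<O> \<omega> (p z) (p w) \<le> ennreal (C * l1norm N (\<lambda>i. \<iota> (p z) i - \<iota> (p w) i) powr (1 / real (card G)))"
proof -
  note G = deck_groupD[OF dG]
  define m where "m = card G"
  have m: "m > 0" using G(1,2) by (simp add: m_def card_gt_0_iff)
  have x0U: "x0 \<in> U" using z0 coverD(3)[OF cov] by blast
  obtain r C0 where r: "r > 0" "C0 > 0" "pdisc n z0 r \<subseteq> V" "\<And>z w. z \<in> pdisc n z0 r \<Longrightarrow> w \<in> pdisc n z0 r \<Longrightarrow>
      kdist n X \<O> \<omega> (p z) (p w) \<le> ennreal (C0 * l1norm n (\<lambda>i. w i - z i))"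
    using cover_dist[OF cov z0(1)] by blast
  obtain M c where c: "c > 0" "\<And>v. (\<forall>g\<in>G. v g \<in> Cn n) \<Longrightarrow>
      \<exists>j<M. \<forall>g\<in>G. c * l1norm n (v g) \<le> cmod (\<Sum>i<n. of_nat j ^ i * v g i)"
    using generic_linear_form[OF G(1), of n] by blast
  define B where "B = l1norm n z0 + r"
  have B: "0 \<le> B" using r(1) by (simp add: B_def)
  obtain \<rho>1 K where K: "\<rho>1 > 0" "K > 0" "\<And>z w j. z \<in> V \<Longrightarrow> w \<in> V \<Longrightarrow> p z \<in> U1 \<Longrightarrow> p w \<in> U1 \<Longrightarrow>
      \<iota> (p z) \<in> pdisc N (\<iota> x0) \<rho>1 \<Longrightarrow> \<iota> (p w) \<in> pdisc N (\<iota> x0) \<rho>1 \<Longrightarrow> (\<forall>i<n. cmod (z i) \<le> B) \<Longrightarrow> j < M \<Longrightarrow>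
      (\<Prod>g\<in>G. cmod (\<Sum>i<n. of_nat j ^ i * (z i - g w i))) \<le> K * l1norm N (\<lambda>i. \<iota> (p z) i - \<iota> (p w) i)"
    using invariant_estimate[OF cov le x0U x0 dG B, of M] by (elim exE conjE) blast
  \<comment> \<open>The ambient distance is then at most \<open>2 * N * \<rho>\<close>, and
    \<open>K\<close> times it stays below \<open>(c * (r / 2)) ^ m\<close>. This forces
    \<open>g w\<close> into the polydisc of radius \<open>r\<close>.\<close>
  define \<rho> where "\<rho> = min \<rho>1 ((c * (r / 2)) ^ m / (K * (2 * real N + 1)))"
  have \<rho>: "\<rho> > 0" "\<rho> \<le> \<rho>1" using K(1,2) c(1) r(1) by (auto simp: \<rho>_def intro!: divide_pos_pos mult_pos_pos)
  have \<rho>K: "K * (real N * (2 * \<rho>)) < (c * (r / 2)) ^ m"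
  proof -
    let ?a = "(c * (r / 2)) ^ m"
    have a: "?a > 0" using c(1) r(1) by simp
    have "0 < K * (2 * real N + 1)" using K(2) by simp
    moreover have "\<rho> \<le> ?a / (K * (2 * real N + 1))" by (simp add: \<rho>_def)
    ultimately have "\<rho> * (K * (2 * real N + 1)) \<le> ?a" by (simp add: pos_le_divide_eq)
    then have "K * (real N * (2 * \<rho>)) + K * \<rho> \<le> ?a" by (simp add: algebra_simps)
    then show ?thesis using K(2) \<rho>(1) by (smt (verit) mult_pos_pos)
  qed
  \<comment> \<open>Combines
    \<open>c * l1norm n (v g) \<le> (K * \<delta>) powr (1 / real m)\<close> with the distance bound
    \<open>C0 * l1norm n (v g)\<close>.\<close>
  define C where "C = C0 / c * K powr (1 / real m)"
  have C: "C > 0" using r(2) c(1) K(2) by (simp add: C_def)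
  have "kdist n X \<O> \<omega> (p z) (p w) \<le> ennreal (C * l1norm N (\<lambda>i. \<iota> (p z) i - \<iota> (p w) i) powr (1 / real m))"
    if z: "z \<in> V" "z \<in> pdisc n z0 (r / 2)" and w: "w \<in> V" and zw: "p z \<in> U1" "p w \<in> U1"
      "\<iota> (p z) \<in> pdisc N (\<iota> x0) \<rho>" "\<iota> (p w) \<in> pdisc N (\<iota> x0) \<rho>" for z w
  proof -
    define \<delta> where "\<delta> = l1norm N (\<lambda>i. \<iota> (p z) i - \<iota> (p w) i)"
    have \<delta>: "0 \<le> \<delta>" "\<delta> \<le> real N * (2 * \<rho>)"
    proof -
      show "0 \<le> \<delta>" by (simp add: \<delta>_def)
      show "\<delta> \<le> real N * (2 * \<rho>)" unfolding \<delta>_def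
      proof (rule l1norm_le)
        fix i assume "i < N"
        then have "cmod (\<iota> (p z) i - \<iota> x0 i) < \<rho>" "cmod (\<iota> (p w) i - \<iota> x0 i) < \<rho>" using zw(3,4) by (auto simp: pdisc_def)
        then show "cmod (\<iota> (p z) i - \<iota> (p w) i) \<le> 2 * \<rho>"
          using norm_triangle_ineq4[of "\<iota> (p z) i - \<iota> x0 i" "\<iota> (p w) i - \<iota> x0 i"] by simp
      qed
    qed
    define v where "v g = (\<lambda>i. z i - g w i)" for g :: "(nat \<Rightarrow> complex) \<Rightarrow> nat \<Rightarrow> complex"
    have vC: "\<forall>g\<in>G. v g \<in> Cn n"
      unfolding v_def using Cn_diff z(1) G(3)[OF _ w] Cn_open_Cn[OF coverD(1)[OF cov]] by blast
    obtain j where j: "j < M" "\<And>g. g \<in> G \<Longrightarrow> c * l1norm n (v g) \<le> cmod (\<Sum>i<n. of_nat j ^ i * v g i)"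
      using c(2)[OF vC] by blast
    have zB: "\<forall>i<n. cmod (z i) \<le> B"
    proof (intro allI impI)
      fix i assume i: "i < n"
      have "cmod (z i - z0 i) < r / 2" using z(2) i by (simp add: pdisc_def)
      then show "cmod (z i) \<le> B"
        using norm_triangle_sub[of "z i" "z0 i"] component_le_l1norm[OF i, of z0] r(1) by (simp add: B_def)
    qed
    have zw1: "\<iota> (p z) \<in> pdisc N (\<iota> x0) \<rho>1" "\<iota> (p w) \<in> pdisc N (\<iota> x0) \<rho>1" using zw(3,4) pdisc_mono[OF \<rho>(2)] by auto
    have "(\<Prod>g\<in>G. c * l1norm n (v g)) \<le> (\<Prod>g\<in>G. cmod (\<Sum>i<n. of_nat j ^ i * v g i))"
      using j(2) c(1) by (intro prod_mono) auto
    also have "\<dots> \<le> K * \<delta>"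
      unfolding v_def \<delta>_def by (rule K(3)[OF z(1) w zw(1,2) zw1 zB j(1)])
    finally obtain g where g: "g \<in> G" "(c * l1norm n (v g)) ^ m \<le> K * \<delta>"
      using prod_le_imp_ex_power_le[OF G(1,2), of "\<lambda>g. c * l1norm n (v g)" "K * \<delta>"] c(1) unfolding m_def by auto
    have "K * \<delta> \<le> K * (real N * (2 * \<rho>))" using \<delta>(2) K(2) by (intro mult_left_mono) auto
    then have "(c * l1norm n (v g)) ^ m < (c * (r / 2)) ^ m" using g(2) \<rho>K by linarith
    then have "c * l1norm n (v g) < c * (r / 2)" by (rule power_less_imp_less_base) (use c(1) r(1) in simp)
    then have vr: "l1norm n (v g) < r / 2" using c(1) by simp
    have gw: "g w \<in> pdisc n z0 r"
    proof -
      have "cmod (g w i - z0 i) < r" if i: "i < n" for i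
      proof -
        have "cmod (z i - g w i) < r / 2" using component_le_l1norm[OF i, of "v g"] vr by (simp add: v_def)
        moreover have "cmod (z i - z0 i) < r / 2" using z(2) i by (simp add: pdisc_def)
        ultimately show ?thesis using norm_triangle_ineq4[of "z i - z0 i" "z i - g w i"] by simp
      qed
      moreover have "g w \<in> Cn n" using G(3)[OF g(1) w] Cn_open_Cn[OF coverD(1)[OF cov]] by blast
      ultimately show ?thesis by (simp add: pdisc_def)
    qed
    have pg: "p (g w) = p w" using G(5)[OF w G(3)[OF g(1) w]] g(1) by auto
    have zr: "z \<in> pdisc n z0 r" using z(2) pdisc_mono[of "r / 2" r] r(1) by auto
    have "l1norm n (\<lambda>i. g w i - z i) = l1norm n (v g)" by (simp add: l1norm_def v_def norm_minus_commute)
    then have k: "kdist n X \<O> \<omega> (p z) (p w) \<le> ennreal (C0 * l1norm n (v g))" using r(4)[OF zr gw] pg by simp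
    have "c * l1norm n (v g) \<le> (K * \<delta>) powr (1 / real m)"
      using m g(2) c(1) by (intro powr_root_le) auto
    also have "\<dots> = K powr (1 / real m) * \<delta> powr (1 / real m)" using K(2) \<delta>(1) by (simp add: powr_mult)
    finally have "C0 / c * (c * l1norm n (v g)) \<le> C0 / c * (K powr (1 / real m) * \<delta> powr (1 / real m))"
      using r(2) c(1) by (intro mult_left_mono) auto
    then have "C0 * l1norm n (v g) \<le> C * \<delta> powr (1 / real m)" using c(1) by (simp add: C_def mult.assoc)
    then show ?thesis using k ennreal_leI order_trans unfolding \<delta>_def by blast
  qed
  then have "\<forall>z\<in>V \<inter> pdisc n z0 (r / 2). \<forall>w\<in>V. p z \<in> U1 \<and> p w \<in> U1 \<and>
      \<iota> (p z) \<in> pdisc N (\<iota> x0) \<rho> \<and> \<iota> (p w) \<in> pdisc N (\<iota> x0) \<rho> \<longrightarrow>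
      kdist n X \<O> \<omega> (p z) (p w) \<le> ennreal (C * l1norm N (\<lambda>i. \<iota> (p z) i - \<iota> (p w) i) powr (1 / real m))"
    by blast
  then show ?thesis unfolding m_def using half_gt_zero[OF r(1)] \<rho>(1) C by blast
qed

text \<open>Finitely many fibre points and a tube around the fibre, as for
  \<open>metric_lower_bound\<close>; the exponent is common to all of them since it depends on the
  group alone.\<close>

lemma holder_estimate:
  assumes le: "local_embedding X \<O> N U1 \<iota>" and x0: "x0 \<in> U1"
  shows "\<exists>\<rho>>0. \<exists>C>0. \<exists>m>0. \<forall>x\<in>U1. \<forall>y\<in>U1. \<iota> x \<in> pdisc N (\<iota> x0) \<rho> \<and> \<iota> y \<in> pdisc N (\<iota> x0) \<rho> \<longrightarrow>
      kdist n X \<O> \<omega> x y \<le> ennreal (C * l1norm N (\<lambda>i. \<iota> x i - \<iota> y i) powr (1 / real m))"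
proof -
  obtain V U p where cov: "x0 \<in> U" "quasi_etale_galois_cover X \<O> n V U p"
    using ex_cover local_embeddingD(2)[OF le] x0 by blast
  obtain G where dG: "deck_group n V p G" using cover_deck_group[OF cov(2)] by blast
  note G = deck_groupD[OF dG]
  define m where "m = card G"
  have m: "m > 0" using G(1,2) by (simp add: m_def card_gt_0_iff)
  let ?F = "{z \<in> V. p z = x0}"
  define P where "P z0 q \<longleftrightarrow> 0 < fst q \<and> 0 < fst (snd q) \<and> 0 < snd (snd q) \<and>
      (\<forall>z\<in>V \<inter> pdisc n z0 (fst q). \<forall>w\<in>V. p z \<in> U1 \<and> p w \<in> U1 \<and>
      \<iota> (p z) \<in> pdisc N (\<iota> x0) (fst (snd q)) \<and> \<iota> (p w) \<in> pdisc N (\<iota> x0) (fst (snd q)) \<longrightarrow>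
      kdist n X \<O> \<omega> (p z) (p w) \<le> ennreal (snd (snd q) * l1norm N (\<lambda>i. \<iota> (p z) i - \<iota> (p w) i) powr (1 / real m)))"
    for z0 and q :: "real \<times> real \<times> real"
  have "\<forall>z0\<in>?F. \<exists>q. P z0 q"
  proof
    fix z0 assume "z0 \<in> ?F"
    then have "z0 \<in> V" "p z0 = x0" by auto
    from holder_at_fibre_point[OF cov(2) le x0 this dG] obtain r \<rho> C where "r > 0" "\<rho> > 0" "C > 0"
      "\<forall>z\<in>V \<inter> pdisc n z0 r. \<forall>w\<in>V. p z \<in> U1 \<and> p w \<in> U1 \<and>
      \<iota> (p z) \<in> pdisc N (\<iota> x0) \<rho> \<and> \<iota> (p w) \<in> pdisc N (\<iota> x0) \<rho> \<longrightarrow>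
      kdist n X \<O> \<omega> (p z) (p w) \<le> ennreal (C * l1norm N (\<lambda>i. \<iota> (p z) i - \<iota> (p w) i) powr (1 / real m))"
      unfolding m_def by (elim exE conjE) blast
    then have "P z0 (r, \<rho>, C)" unfolding P_def fst_conv snd_conv by blast
    then show "\<exists>q. P z0 q" by blast
  qed
  from bchoice[OF this] obtain q where q: "\<And>z0. z0 \<in> ?F \<Longrightarrow> P z0 (q z0)" by blast
  have finF: "finite ?F" by (rule coverD(6)[OF cov(2,1)])
  let ?B = "\<Union>z0\<in>?F. pdisc n z0 (fst (q z0))"
  have "Cn_open n ?B" unfolding Cn_open_def
    using Cn_open_pdisc unfolding Cn_open_def by (intro openin_Union) auto
  moreover have "?F \<subseteq> ?B"
  proof
    fix z assume z: "z \<in> ?F"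
    have "z \<in> pdisc n z (fst (q z))"
      using z q[OF z] Cn_open_Cn[OF coverD(1)[OF cov(2)]] by (intro centre_in_pdisc) (auto simp: P_def)
    then show "z \<in> ?B" using z by blast
  qed
  ultimately obtain U0 where U0: "openin X U0" "x0 \<in> U0" "U0 \<subseteq> U" "\<And>z. z \<in> V \<Longrightarrow> p z \<in> U0 \<Longrightarrow> z \<in> ?B"
    using cover_tube[OF cov(2,1), of ?B] by blast
  obtain \<rho>0 where \<rho>0: "\<rho>0 > 0" "\<And>y. y \<in> U1 \<Longrightarrow> \<iota> y \<in> pdisc N (\<iota> x0) \<rho>0 \<Longrightarrow> y \<in> U0"
    using embedding_nhd[OF le x0 U0(1,2)] by blast
  define C where "C = Max (insert 1 ((\<lambda>z. snd (snd (q z))) ` ?F))"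
  have C: "C > 0" "\<And>z. z \<in> ?F \<Longrightarrow> snd (snd (q z)) \<le> C"
    using finF by (auto simp: C_def less_le_trans[OF zero_less_one])
  define \<rho> where "\<rho> = Min (insert \<rho>0 ((\<lambda>z. fst (snd (q z))) ` ?F))"
  have \<rho>: "\<rho> > 0" "\<rho> \<le> \<rho>0" "\<And>z. z \<in> ?F \<Longrightarrow> \<rho> \<le> fst (snd (q z))"
    using finF \<rho>0(1) q unfolding \<rho>_def P_def by auto
  have "kdist n X \<O> \<omega> x y \<le> ennreal (C * l1norm N (\<lambda>i. \<iota> x i - \<iota> y i) powr (1 / real m))"
    if xy: "x \<in> U1" "y \<in> U1" "\<iota> x \<in> pdisc N (\<iota> x0) \<rho>" "\<iota> y \<in> pdisc N (\<iota> x0) \<rho>" for x y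
  proof -
    have xU: "x \<in> U0" "y \<in> U0" using \<rho>0(2) xy pdisc_mono[OF \<rho>(2)] by blast+
    then obtain z w where zw: "z \<in> V" "p z = x" "w \<in> V" "p w = y" using U0(3) coverD(3)[OF cov(2)] by blast
    then obtain z0 where z0: "z0 \<in> ?F" "z \<in> pdisc n z0 (fst (q z0))" using U0(4)[OF zw(1)] xU(1) by blast
    have "\<iota> x \<in> pdisc N (\<iota> x0) (fst (snd (q z0)))" "\<iota> y \<in> pdisc N (\<iota> x0) (fst (snd (q z0)))"
      using xy(3,4) pdisc_mono[OF \<rho>(3)[OF z0(1)]] by blast+
    then have "kdist n X \<O> \<omega> x y \<le> ennreal (snd (snd (q z0)) * l1norm N (\<lambda>i. \<iota> x i - \<iota> y i) powr (1 / real m))"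
      using q[OF z0(1)] zw z0(2) xy(1,2) unfolding P_def by blast
    also have "\<dots> \<le> ennreal (C * l1norm N (\<lambda>i. \<iota> x i - \<iota> y i) powr (1 / real m))"
      using C(2)[OF z0(1)] by (intro ennreal_leI mult_right_mono) auto
    finally show ?thesis .
  qed
  then show ?thesis using \<rho>(1) C(1) m by blast
qed

end

section \<open>Short paths stay near their starting point\<close>

text \<open>\<open>U1\<close> is merely open, so preimages of closed polydiscs may fail to be closed
  in \<open>X\<close>. For small radii the polydisc lies where the analytic equations are defined,
  so the part of the image inside it is compact, and compact sets of a Hausdorff space are
  closed.\<close>

lemma (in complex_space) closed_region:
  assumes le: "local_embedding X \<O> N U1 \<iota>" and x0: "x0 \<in> U1"
  shows "\<exists>\<rho>1>0. \<forall>\<rho>\<le>\<rho>1. closedin X {y \<in> U1. \<iota> y \<in> cpdisc N (\<iota> x0) \<rho>}"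
proof -
  obtain \<Omega> where \<Omega>: "Cn_open N \<Omega>" "analytic_subset (top_of_set \<Omega>) (holo N) (\<iota> ` U1)"
    using le unfolding local_embedding_def by blast
  have "\<iota> x0 \<in> \<Omega>" using \<Omega>(2) x0 unfolding analytic_subset_def by auto
  then obtain W F where W: "openin (top_of_set \<Omega>) W" "\<iota> x0 \<in> W" "F \<subseteq> holo N W"
    "\<iota> ` U1 \<inter> W = {y \<in> W. \<forall>f\<in>F. f y = 0}"
    using \<Omega>(2) unfolding analytic_subset_def by auto
  have Wo: "Cn_open N W" using W(1) \<Omega>(1) unfolding Cn_open_def by (rule openin_trans)
  then obtain d where d: "d > 0" "pdisc N (\<iota> x0) d \<subseteq> W" using W(2) unfolding Cn_open_iff by blast
  have "closedin X {y \<in> U1. \<iota> y \<in> cpdisc N (\<iota> x0) \<rho>}" if \<rho>: "\<rho> \<le> d / 2" for \<rho>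
  proof -
    have cW: "cpdisc N (\<iota> x0) \<rho> \<subseteq> W" using cpdisc_subset_pdisc[of \<rho> d N "\<iota> x0"] d \<rho> by auto
    have cl: "closedin (top_of_set W) {y \<in> W. f y = 0}" if "f \<in> F" for f
    proof -
      have "continuous_on W f" using that W(3) holo_iff_open[OF Wo] unfolding holo_open_def by blast
      from continuous_closedin_preimage[OF this closed_singleton[of 0]]
      show ?thesis by (simp add: vimage_def Int_def)
    qed
    have eq: "\<iota> ` {y \<in> U1. \<iota> y \<in> cpdisc N (\<iota> x0) \<rho>} = cpdisc N (\<iota> x0) \<rho> \<inter> {y \<in> W. \<forall>f\<in>F. f y = 0}"
      unfolding W(4)[symmetric] using cW by blast
    have "closedin (top_of_set W) (W \<inter> (\<Inter>f\<in>F. {y \<in> W. f y = 0}))"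
      using cl by (cases "F = {}") (auto intro!: closedin_Inter closedin_Int)
    moreover have "W \<inter> (\<Inter>f\<in>F. {y \<in> W. f y = 0}) = {y \<in> W. \<forall>f\<in>F. f y = 0}" by blast
    ultimately obtain T where T: "closed T" "{y \<in> W. \<forall>f\<in>F. f y = 0} = W \<inter> T" by (auto simp: closedin_closed)
    have "cpdisc N (\<iota> x0) \<rho> \<inter> {y \<in> W. \<forall>f\<in>F. f y = 0} = cpdisc N (\<iota> x0) \<rho> \<inter> T" using T(2) cW by blast
    then have comp: "compact (\<iota> ` {y \<in> U1. \<iota> y \<in> cpdisc N (\<iota> x0) \<rho>})"
      unfolding eq using compact_Int_closed[OF compact_cpdisc T(1)] by simp
    have "compactin (top_of_set (\<iota> ` U1)) (\<iota> ` {y \<in> U1. \<iota> y \<in> cpdisc N (\<iota> x0) \<rho>})"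
      using comp by (simp add: compactin_subtopology) blast
    moreover have "{y \<in> U1. \<iota> y \<in> cpdisc N (\<iota> x0) \<rho>} \<subseteq> topspace (subtopology X U1)"
      using local_embeddingD(2)[OF le] by auto
    ultimately have "compactin (subtopology X U1) {y \<in> U1. \<iota> y \<in> cpdisc N (\<iota> x0) \<rho>}"
      using homeomorphic_map_compactness_eq[OF local_embeddingD(5)[OF le]] by blast
    then have "compactin X {y \<in> U1. \<iota> y \<in> cpdisc N (\<iota> x0) \<rho>}" by (simp add: compactin_subtopology)
    then show ?thesis by (rule compactin_imp_closedin[OF Hausdorff])
  qed
  then show ?thesis using half_gt_zero[OF d(1)] by blast
qed

lemma (in complex_space) region_open:
  assumes le: "local_embedding X \<O> N U1 \<iota>"
  shows "openin X {y \<in> U1. \<iota> y \<in> pdisc N x \<rho>}"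
proof -
  obtain T where T: "open T" "pdisc N x \<rho> = Cn N \<inter> T"
    using Cn_open_pdisc[of N x \<rho>] by (auto simp: Cn_open_def openin_open)
  have "{y \<in> U1. \<iota> y \<in> pdisc N x \<rho>} = {y \<in> U1. \<iota> y \<in> T}"
    using T(2) local_embeddingD(4)[OF le] by blast
  then show ?thesis using local_embedding_preimage_open[OF le T(1)] by simp
qed

text \<open>Velocities are available at interior parameters; continuity carries the bound to the
  ends, which may be singular points.\<close>

lemma norm_diff_le_by_interior:
  fixes f :: "real \<Rightarrow> complex"
  assumes c: "continuous_on {s..t} f" and st: "s \<le> t"
    and b: "\<And>x y. s < x \<Longrightarrow> x \<le> y \<Longrightarrow> y < t \<Longrightarrow> cmod (f y - f x) \<le> B" and B: "0 \<le> B"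
  shows "cmod (f t - f s) \<le> B"
proof (cases "s = t")
  case False
  then have st: "s < t" using st by simp
  have cl: "closure {s<..<t} = {s..t}" using st by simp
  have 1: "cmod (f t - f x) \<le> B" if x: "s < x" "x < t" for x
  proof (rule continuous_on_closure_norm_le[of "{s<..<t}" "\<lambda>y. f y - f x" B t])
    show "continuous_on (closure {s<..<t}) (\<lambda>y. f y - f x)" unfolding cl using c by (intro continuous_intros)
    show "\<forall>y\<in>{s<..<t}. cmod (f y - f x) \<le> B"
    proof
      fix y assume y: "y \<in> {s<..<t}"
      show "cmod (f y - f x) \<le> B"
        using b[of x y] b[of y x] x y by (cases "x \<le> y") (auto simp: norm_minus_commute)
    qed
    show "t \<in> closure {s<..<t}" unfolding cl using st by simp
  qed
  show ?thesis
  proof (rule continuous_on_closure_norm_le[of "{s<..<t}" "\<lambda>x. f t - f x" B s])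
    show "continuous_on (closure {s<..<t}) (\<lambda>x. f t - f x)" unfolding cl using c by (intro continuous_intros)
    show "\<forall>x\<in>{s<..<t}. cmod (f t - f x) \<le> B" using 1 by simp
    show "s \<in> closure {s<..<t}" unfolding cl using st by simp
  qed
qed (use B in simp)

context orbifold
begin

lemma integral_speed_le:
  assumes \<omega>: "kaehler_form_on_reg n X \<O> \<omega>" and ad: "admissible_path n X \<O> a b \<gamma>"
    and l: "path_len n X \<O> \<omega> \<gamma> \<le> ennreal l" "0 \<le> l" and st: "0 < s" "t < 1"
  shows "speed n X \<O> \<omega> \<gamma> integrable_on {s..t}" "integral {s..t} (speed n X \<O> \<omega> \<gamma>) \<le> l"
proof -
  let ?v = "speed n X \<O> \<omega> \<gamma>"
  have sub: "{s..t} \<subseteq> {0<..<1}" using st by auto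
  show int: "?v integrable_on {s..t}"
    by (rule integrable_continuous_real[OF continuous_on_subset[OF continuous_on_speed[OF \<omega> ad] sub]])
  have nn: "0 \<le> ?v x" if "x \<in> {s..t}" for x using speed_nonneg[OF \<omega> ad] that sub by auto
  have "((\<lambda>x. if x \<in> {s..t} then ?v x else 0) has_integral integral {s..t} ?v) UNIV"
    using int by (simp only: has_integral_restrict_UNIV integrable_integral)
  moreover have "(\<lambda>x. if x \<in> {s..t} then ?v x else 0) = (\<lambda>x. ?v x * indicator {0<..<1} x * indicator {s..t} x)"
    using sub by (auto simp: fun_eq_iff split: split_indicator)
  ultimately have hi: "((\<lambda>x. ?v x * indicator {0<..<1} x * indicator {s..t} x) has_integral integral {s..t} ?v) UNIV" by simp
  have "(\<integral>\<^sup>+ x. ennreal (?v x * indicator {0<..<1} x * indicator {s..t} x) \<partial>lborel) = ennreal (integral {s..t} ?v)"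
  proof (rule nn_integral_has_integral_lborel[OF _ _ hi])
    show "(\<lambda>x. ?v x * indicator {0<..<1} x * indicator {s..t} x) \<in> borel_measurable borel"
      by (rule borel_measurable_times[OF speed_measurable[OF \<omega> ad]]) simp
    show "0 \<le> ?v x * indicator {0<..<1} x * indicator {s..t} x" for x
      using nn[of x] by (simp split: split_indicator)
  qed
  moreover have "(\<integral>\<^sup>+ x. ennreal (?v x * indicator {0<..<1} x * indicator {s..t} x) \<partial>lborel) \<le> path_len n X \<O> \<omega> \<gamma>"
    unfolding path_len_alt by (intro nn_integral_mono) (auto split: split_indicator)
  ultimately have "ennreal (integral {s..t} ?v) \<le> ennreal l" using l(1) by (metis order_trans)
  then show "integral {s..t} ?v \<le> l" using l(2) by (simp add: ennreal_le_iff)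
qed

text \<open>Shared form of the lower bounds for \<open>\<omega>\<close> and
  \<open>\<omega>X\<close>, so that the arguments about leaving a neighbourhood are made once for
  both.\<close>

definition dominates where
  "dominates C N U1 \<iota> \<rho> x \<omega> \<longleftrightarrow> (\<forall>y\<in>U1. \<iota> y \<in> pdisc N x \<rho> \<longrightarrow> (\<forall>W \<phi>. \<forall>u\<in>Cn n. holo_chart X \<O> n W \<phi> \<and> y \<in> W \<longrightarrow>
      (l1norm N (dmap (\<lambda>x. \<iota> (inv_into W \<phi> x)) (\<phi> y) u))\<^sup>2 \<le> C * \<omega> W \<phi> (\<phi> y) u (Jmul u)))"

lemma vel_le_speed:
  assumes \<omega>: "kaehler_form_on_reg n X \<O> \<omega>" and ad: "admissible_path n X \<O> a b \<gamma>" and le: "local_embedding X \<O> N U1 \<iota>"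
    and dom: "dominates C N U1 \<iota> \<rho> x \<omega>" and t: "0 < t" "t < 1" and tR: "\<gamma> t \<in> U1" "\<iota> (\<gamma> t) \<in> pdisc N x \<rho>"
  shows "l1norm N (vel \<iota> \<gamma> t) \<le> sqrt C * speed n X \<O> \<omega> \<gamma> t"
proof -
  obtain W \<phi> where ch: "holo_chart X \<O> n W \<phi>" "\<gamma> t \<in> W"
    using regular_chart[OF admissible_pathD(4)[OF ad t]] by blast
  note cd = admissible_chart_diff[OF ad t]
  have "(l1norm N (vel \<iota> \<gamma> t))\<^sup>2 \<le> C * \<omega> W \<phi> (\<phi> (\<gamma> t)) (vel \<phi> \<gamma> t) (Jmul (vel \<phi> \<gamma> t))"
    unfolding vel_transition[OF cd ch le tR(1)]
    using dom tR ch vel_Cn[OF cd ch] unfolding dominates_def by blast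
  then have "sqrt ((l1norm N (vel \<iota> \<gamma> t))\<^sup>2) \<le> sqrt (C * \<omega> W \<phi> (\<phi> (\<gamma> t)) (vel \<phi> \<gamma> t) (Jmul (vel \<phi> \<gamma> t)))"
    by (rule real_sqrt_le_mono)
  then show ?thesis unfolding speed_chart[OF \<omega> cd ch] by (simp add: real_sqrt_mult)
qed

text \<open>The fundamental theorem of calculus with the velocity bound, valid as long as the path
  stays where the form dominates the euclidean metric.\<close>

lemma embedded_displacement:
  assumes \<omega>: "kaehler_form_on_reg n X \<O> \<omega>" and ad: "admissible_path n X \<O> a b \<gamma>" and le: "local_embedding X \<O> N U1 \<iota>"
    and dom: "dominates C N U1 \<iota> \<rho> x \<omega>" and C: "0 < C"
    and l: "path_len n X \<O> \<omega> \<gamma> \<le> ennreal l" "0 \<le> l"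
    and st: "0 \<le> s" "s \<le> t" "t \<le> 1" and R: "\<And>r. s \<le> r \<Longrightarrow> r \<le> t \<Longrightarrow> \<gamma> r \<in> U1 \<and> \<iota> (\<gamma> r) \<in> pdisc N x \<rho>"
    and i: "i < N"
  shows "cmod (\<iota> (\<gamma> t) i - \<iota> (\<gamma> s) i) \<le> sqrt C * l"
proof (rule norm_diff_le_by_interior[of s t "\<lambda>r. \<iota> (\<gamma> r) i"])
  have "continuous_map (top_of_set {s..t}) (subtopology X U1) \<gamma>"
    unfolding continuous_map_in_subtopology
  proof
    show "continuous_map (top_of_set {s..t}) X \<gamma>"
      using continuous_map_from_subtopology_mono[OF admissible_pathD(1)[OF ad], of "{s..t}"] st by auto
  qed (use R in auto)
  from continuous_map_compose[OF this local_embedding_continuous[OF le]]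
  have "continuous_on {s..t} (\<lambda>r. \<iota> (\<gamma> r))" by (simp add: comp_def)
  then show "continuous_on {s..t} (\<lambda>r. \<iota> (\<gamma> r) i)" by (rule continuous_on_product_then_coordinatewise)
  show "0 \<le> sqrt C * l" using C l(2) by simp
  fix y z assume yz: "s < y" "y \<le> z" "z < t"
  then have i01: "0 < y" "z < 1" using st by auto
  let ?v = "speed n X \<O> \<omega> \<gamma>"
  note int = integral_speed_le[OF \<omega> ad l i01]
  have der: "((\<lambda>r. \<iota> (\<gamma> r) i) has_vector_derivative vel \<iota> \<gamma> r i) (at r within {y..z})" if r: "r \<in> {y..z}" for r
  proof -
    have r01: "0 < r" "r < 1" using r i01 by auto
    obtain W \<phi> where ch: "holo_chart X \<O> n W \<phi>" "\<gamma> r \<in> W"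
      using regular_chart[OF admissible_pathD(4)[OF ad r01]] by blast
    have rU: "\<gamma> r \<in> U1" using R[of r] r yz by auto
    note cd = admissible_chart_diff[OF ad r01]
    show ?thesis
      using vel_embedding[OF cd ch le rU] unfolding vel_transition[OF cd ch le rU, symmetric]
      by (rule has_vector_derivative_at_within)
  qed
  have fi: "((\<lambda>r. vel \<iota> \<gamma> r i) has_integral (\<iota> (\<gamma> z) i - \<iota> (\<gamma> y) i)) {y..z}"
    by (rule fundamental_theorem_of_calculus[OF yz(2) der])
  have "norm (integral {y..z} (\<lambda>r. vel \<iota> \<gamma> r i)) \<le> integral {y..z} (\<lambda>r. sqrt C * ?v r)"
  proof (rule integral_norm_bound_integral)
    show "(\<lambda>r. vel \<iota> \<gamma> r i) integrable_on {y..z}" using fi by blast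
    show "(\<lambda>r. sqrt C * ?v r) integrable_on {y..z}" using integrable_on_cmult_left[OF int(1), of "sqrt C"] by simp
    fix r assume r: "r \<in> {y..z}"
    have "cmod (vel \<iota> \<gamma> r i) \<le> l1norm N (vel \<iota> \<gamma> r)" by (rule component_le_l1norm[OF i])
    also have "\<dots> \<le> sqrt C * ?v r"
      by (rule vel_le_speed[OF \<omega> ad le dom]) (use r i01 R[of r] yz in auto)
    finally show "norm (vel \<iota> \<gamma> r i) \<le> sqrt C * ?v r" .
  qed
  also have "\<dots> = sqrt C * integral {y..z} ?v" by simp
  also have "\<dots> \<le> sqrt C * l" using int(2) C by (intro mult_left_mono) auto
  finally show "cmod (\<iota> (\<gamma> z) i - \<iota> (\<gamma> y) i) \<le> sqrt C * l" using integral_unique[OF fi] by simp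
qed (use st in simp)

text \<open>First exit time. The path starts within \<open>\<rho> / 4\<close> and moves by less than
  \<open>\<rho> / 4\<close>, so at its first exit from the open region of radius
  \<open>\<rho> / 2\<close> it would still be inside. The room up to \<open>\<rho>\<close> is where
  the velocity bound is valid.\<close>

lemma short_path_stays:
  assumes \<omega>: "kaehler_form_on_reg n X \<O> \<omega>" and ad: "admissible_path n X \<O> a b \<gamma>" and le: "local_embedding X \<O> N U1 \<iota>"
    and dom: "dominates C N U1 \<iota> \<rho> x \<omega>" and C: "0 < C" and \<rho>: "0 < \<rho>"
    and cl: "closedin X {y \<in> U1. \<iota> y \<in> cpdisc N x (\<rho> / 2)}"
    and a: "a \<in> U1" "\<iota> a \<in> pdisc N x (\<rho> / 4)"
    and l: "path_len n X \<O> \<omega> \<gamma> \<le> ennreal l" "0 \<le> l" "sqrt C * l < \<rho> / 4"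
    and t: "0 \<le> t" "t \<le> 1"
  shows "\<gamma> t \<in> U1 \<and> \<iota> (\<gamma> t) \<in> pdisc N x (\<rho> / 2)"
proof (rule ccontr)
  let ?R = "{y \<in> U1. \<iota> y \<in> pdisc N x (\<rho> / 2)}" and ?cR = "{y \<in> U1. \<iota> y \<in> cpdisc N x (\<rho> / 2)}"
  define T where "T = {t \<in> {0..1}. \<gamma> t \<notin> ?R}"
  assume "\<not> (\<gamma> t \<in> U1 \<and> \<iota> (\<gamma> t) \<in> pdisc N x (\<rho> / 2))"
  then have "t \<in> T" using t by (simp add: T_def)
  have "openin (top_of_set {0..1}) {t \<in> {0..1}. \<gamma> t \<in> ?R}"
    using openin_continuous_map_preimage[OF admissible_pathD(1)[OF ad] region_open[OF le, of x "\<rho> / 2"]] by simp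
  then obtain A where A: "open A" "{t \<in> {0..1}. \<gamma> t \<in> ?R} = {0..1} \<inter> A" by (auto simp: openin_open)
  have "T = {0..1} \<inter> - A" using A(2) unfolding T_def by blast
  then have "compact T" using A(1) by (simp add: compact_Int_closed closed_Compl)
  then obtain t0 where t0: "t0 \<in> T" "\<And>s. s \<in> T \<Longrightarrow> t0 \<le> s"
    using compact_attains_inf[of T] \<open>t \<in> T\<close> by blast
  have t01: "0 \<le> t0" "t0 \<le> 1" "\<gamma> t0 \<notin> ?R" using t0(1) by (simp_all add: T_def)
  have before: "\<gamma> s \<in> ?R" if "0 \<le> s" "s < t0" for s
  proof (rule ccontr)
    assume "\<gamma> s \<notin> ?R"
    then have "s \<in> T" using that t01 by (simp add: T_def)
    then show False using t0(2) that by fastforce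
  qed
  have \<gamma>0: "\<gamma> 0 = a" by (rule admissible_pathD(2)[OF ad])
  have aR: "a \<in> ?R" using a pdisc_mono[of "\<rho> / 4" "\<rho> / 2" N x] \<rho> by auto
  have t0pos: "0 < t0"
  proof (rule ccontr)
    assume "\<not> 0 < t0"
    then have "t0 = 0" using t01 by simp
    then show False using t01(3) \<gamma>0 aR by simp
  qed
  \<comment> \<open>Closedness in \<open>X\<close> keeps the exit point inside \<open>U1\<close>,
    where its coordinates are meaningful.\<close>
  have "closedin (top_of_set {0..1}) {t \<in> {0..1}. \<gamma> t \<in> ?cR}"
    using closedin_continuous_map_preimage[OF admissible_pathD(1)[OF ad] cl] by simp
  then have "closed {t \<in> {0..1}. \<gamma> t \<in> ?cR}" by (rule closedin_closed_trans) simp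
  moreover have "{0..<t0} \<subseteq> {t \<in> {0..1}. \<gamma> t \<in> ?cR}"
  proof
    fix s assume s: "s \<in> {0..<t0}"
    have "\<gamma> s \<in> ?R" using before s by simp
    then have "\<gamma> s \<in> ?cR" using pdisc_subset_cpdisc by blast
    then show "s \<in> {t \<in> {0..1}. \<gamma> t \<in> ?cR}" using s t01 by simp
  qed
  ultimately have "closure {0..<t0} \<subseteq> {t \<in> {0..1}. \<gamma> t \<in> ?cR}" by (rule closure_minimal[rotated])
  moreover have "t0 \<in> closure {0..<t0}" using t0pos by simp
  ultimately have t0c: "\<gamma> t0 \<in> ?cR" by blast
  have R: "\<gamma> r \<in> U1 \<and> \<iota> (\<gamma> r) \<in> pdisc N x \<rho>" if r: "0 \<le> r" "r \<le> t0" for r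
  proof (cases "r = t0")
    case True
    then show ?thesis using t0c cpdisc_subset_pdisc[of "\<rho> / 2" \<rho> N x] \<rho> by auto
  next
    case False
    then have "\<gamma> r \<in> ?R" using before r by simp
    then show ?thesis using pdisc_mono[of "\<rho> / 2" \<rho> N x] \<rho> by auto
  qed
  have "cmod (\<iota> (\<gamma> t0) i - x i) < \<rho> / 2" if i: "i < N" for i
  proof -
    have "cmod (\<iota> (\<gamma> t0) i - \<iota> (\<gamma> 0) i) \<le> sqrt C * l"
      by (rule embedded_displacement[OF \<omega> ad le dom C l(1,2) order_refl t01(1,2) R i])
    moreover have "cmod (\<iota> a i - x i) < \<rho> / 4" using a(2) i by (simp add: pdisc_def)
    ultimately show ?thesis
      using norm_triangle_ineq[of "\<iota> (\<gamma> t0) i - \<iota> a i" "\<iota> a i - x i"] l(3) \<gamma>0 by simp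
  qed
  then have "\<gamma> t0 \<in> ?R" using t0c by (simp add: pdisc_def cpdisc_def)
  then show False using t01(3) by blast
qed

text \<open>The infimum need not be attained, so the path argument is run for every \<open>l\<close>
  slightly above \<open>d\<close>, and the coordinate bound follows as \<open>l\<close> tends to
  \<open>d\<close>.\<close>

lemma kdist_embedded_bound:
  assumes \<omega>: "kaehler_form_on_reg n X \<O> \<omega>" and le: "local_embedding X \<O> N U1 \<iota>"
    and dom: "dominates C N U1 \<iota> \<rho> x \<omega>" and C: "0 < C" and \<rho>: "0 < \<rho>"
    and cl: "closedin X {y \<in> U1. \<iota> y \<in> cpdisc N x (\<rho> / 2)}"
    and a: "a \<in> U1" "\<iota> a \<in> pdisc N x (\<rho> / 4)"
    and d: "kdist n X \<O> \<omega> a b = ennreal d" "0 \<le> d" "sqrt C * d < \<rho> / 4"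
  shows "b \<in> U1" "\<iota> b \<in> pdisc N x (\<rho> / 2)" "l1norm N (\<lambda>i. \<iota> a i - \<iota> b i) \<le> real N * (sqrt C * d)"
proof -
  have sC: "0 < sqrt C" using C by simp
  have main: "b \<in> U1 \<and> \<iota> b \<in> pdisc N x (\<rho> / 2) \<and> (\<forall>i<N. cmod (\<iota> b i - \<iota> a i) \<le> sqrt C * l)"
    if l: "d < l" "sqrt C * l < \<rho> / 4" for l
  proof -
    have l0: "0 \<le> l" using l d by simp
    have "kdist n X \<O> \<omega> a b < ennreal l" using d l by (simp add: ennreal_lessI)
    then obtain \<gamma> where \<gamma>: "admissible_path n X \<O> a b \<gamma>" "path_len n X \<O> \<omega> \<gamma> < ennreal l" by (rule kdist_lessE)
    have st: "\<gamma> t \<in> U1 \<and> \<iota> (\<gamma> t) \<in> pdisc N x (\<rho> / 2)" if "0 \<le> t" "t \<le> 1" for t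
      by (rule short_path_stays[OF \<omega> \<gamma>(1) le dom C \<rho> cl a less_imp_le[OF \<gamma>(2)] l0 l(2) that])
    have st': "\<gamma> t \<in> U1 \<and> \<iota> (\<gamma> t) \<in> pdisc N x \<rho>" if "0 \<le> t" "t \<le> 1" for t
      using st[OF that] pdisc_mono[of "\<rho> / 2" \<rho> N x] \<rho> by auto
    have "cmod (\<iota> (\<gamma> 1) i - \<iota> (\<gamma> 0) i) \<le> sqrt C * l" if "i < N" for i
      by (rule embedded_displacement[OF \<omega> \<gamma>(1) le dom C less_imp_le[OF \<gamma>(2)] l0 order_refl zero_le_one order_refl st' that])
    then show ?thesis using st[of 1] admissible_pathD(2,3)[OF \<gamma>(1)] by simp
  qed
  \<comment> \<open>The midpoint of \<open>d\<close> and the threshold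
    \<open>\<rho> / 4 / sqrt C\<close> below which paths cannot leave.\<close>
  define l0 where "l0 = (d + \<rho> / 4 / sqrt C) / 2"
  have l0: "d < l0" "sqrt C * l0 < \<rho> / 4"
  proof -
    have "d < \<rho> / 4 / sqrt C" using d(3) sC by (simp add: field_simps)
    then have "d < l0" "l0 < \<rho> / 4 / sqrt C" by (simp_all add: l0_def)
    then show "d < l0" "sqrt C * l0 < \<rho> / 4" using sC by (simp_all add: field_simps)
  qed
  show "b \<in> U1" "\<iota> b \<in> pdisc N x (\<rho> / 2)" using main[OF l0] by auto
  show "l1norm N (\<lambda>i. \<iota> a i - \<iota> b i) \<le> real N * (sqrt C * d)"
  proof (rule l1norm_le)
    fix i assume i: "i < N"
    show "cmod (\<iota> a i - \<iota> b i) \<le> sqrt C * d"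
    proof (rule ccontr)
      assume "\<not> ?thesis"
      then have "d < cmod (\<iota> b i - \<iota> a i) / sqrt C" using sC by (simp add: field_simps norm_minus_commute)
      then obtain l where l: "d < l" "l < min l0 (cmod (\<iota> b i - \<iota> a i) / sqrt C)" using dense l0(1) by (metis min_less_iff_conj)
      have "sqrt C * l < sqrt C * l0" using l(2) sC by (intro mult_strict_left_mono) auto
      then have "sqrt C * l < \<rho> / 4" using l0(2) by linarith
      then have "cmod (\<iota> b i - \<iota> a i) \<le> sqrt C * l" using main[OF l(1)] i by blast
      moreover have "sqrt C * l < cmod (\<iota> b i - \<iota> a i)" using l(2) sC by (simp add: field_simps)
      ultimately show False by linarith
    qed
  qed
qed

end

section \<open>Completion of a dense subset of a compact metric space\<close>

text \<open>Cauchy sequences of \<open>M\<close> converge in the compact space \<open>K\<close>,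
  density makes every point a limit, and two sequences are equivalent iff their limits agree.
  Classes thus correspond to points, isometrically.\<close>

lemma compact_completion_homeomorphic:
  assumes K: "Metric_space K d" and comp: "compact_space (Metric_space.mtopology K d)"
    and MK: "M \<subseteq> K" and dense: "\<And>x e. x \<in> K \<Longrightarrow> 0 < e \<Longrightarrow> \<exists>y\<in>M. d x y < e"
  shows "completion_topology M d homeomorphic_space Metric_space.mtopology K d"
proof -
  interpret K: Metric_space K d by (rule K)
  interpret M: Metric_space M d by (rule K.subspace[OF MK])
  define conv where "conv \<sigma> x \<longleftrightarrow> x \<in> K \<and> (\<lambda>k. d (\<sigma> k) x) \<longlonglongrightarrow> 0" for \<sigma> :: "nat \<Rightarrow> 'a" and x
  let ?S = "{\<sigma>. M.MCauchy \<sigma>}"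
  let ?R = "{(\<sigma>, \<tau>). M.MCauchy \<sigma> \<and> M.MCauchy \<tau> \<and> (\<lambda>k. d (\<sigma> k) (\<tau> k)) \<longlonglongrightarrow> 0}"
  have range: "\<sigma> k \<in> K" "\<sigma> k \<in> M" if "M.MCauchy \<sigma>" for \<sigma> k
    using that MK unfolding M.MCauchy_def by auto
  have ex: "\<exists>x. conv \<sigma> x" if \<sigma>: "M.MCauchy \<sigma>" for \<sigma>
  proof -
    have "K.MCauchy \<sigma>" using \<sigma> MK unfolding M.MCauchy_def K.MCauchy_def by blast
    then obtain x where x: "limitin K.mtopology \<sigma> x sequentially"
      using K.compact_space_imp_mcomplete[OF comp] unfolding K.mcomplete_def by blast
    then have "x \<in> K" "\<And>e. e > 0 \<Longrightarrow> \<forall>\<^sub>F k in sequentially. d (\<sigma> k) x < e"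
      unfolding K.limitin_metric by (auto elim: eventually_mono)
    then show ?thesis unfolding conv_def by (auto simp: tendsto_iff)
  qed
  have lim: "(\<lambda>k. d (\<sigma> k) (\<tau> k)) \<longlonglongrightarrow> d x y"
    if \<sigma>: "M.MCauchy \<sigma>" "conv \<sigma> x" and \<tau>: "M.MCauchy \<tau>" "conv \<tau> y" for \<sigma> \<tau> x y
  proof -
    have xy: "x \<in> K" "y \<in> K" using \<sigma> \<tau> by (auto simp: conv_def)
    have "norm (d (\<sigma> k) (\<tau> k) - d x y) \<le> d (\<sigma> k) x + d (\<tau> k) y" for k
    proof -
      note r = range(1)[OF \<sigma>(1), of k] range(1)[OF \<tau>(1), of k]
      have "d (\<sigma> k) (\<tau> k) \<le> d (\<sigma> k) x + d x (\<tau> k)" "d x (\<tau> k) \<le> d x y + d y (\<tau> k)"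
        "d x y \<le> d x (\<sigma> k) + d (\<sigma> k) y" "d (\<sigma> k) y \<le> d (\<sigma> k) (\<tau> k) + d (\<tau> k) y"
        using r xy by (auto intro: K.triangle)
      then show ?thesis using K.commute[of y "\<tau> k"] K.commute[of x "\<sigma> k"] by (simp add: abs_le_iff)
    qed
    then have ev: "\<forall>\<^sub>F k in sequentially. norm (d (\<sigma> k) (\<tau> k) - d x y) \<le> d (\<sigma> k) x + d (\<tau> k) y"
      by (rule always_eventually[OF allI])
    have "(\<lambda>k. d (\<sigma> k) x) \<longlonglongrightarrow> 0" "(\<lambda>k. d (\<tau> k) y) \<longlonglongrightarrow> 0" using \<sigma>(2) \<tau>(2) by (simp_all add: conv_def)
    from tendsto_add[OF this] have "(\<lambda>k. d (\<sigma> k) x + d (\<tau> k) y) \<longlonglongrightarrow> 0" by simp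
    with ev have "(\<lambda>k. d (\<sigma> k) (\<tau> k) - d x y) \<longlonglongrightarrow> 0" by (rule Lim_null_comparison)
    then show ?thesis by (simp add: LIM_zero_iff)
  qed
  have uniq: "x = y" if "M.MCauchy \<sigma>" "conv \<sigma> x" "conv \<sigma> y" for \<sigma> x y
  proof -
    have "(\<lambda>k. d (\<sigma> k) (\<sigma> k)) \<longlonglongrightarrow> d x y" by (rule lim[OF that(1,2,1,3)])
    moreover have "d (\<sigma> k) (\<sigma> k) = 0" for k using range(1)[OF that(1)] by simp
    ultimately have "d x y = 0" by (simp add: LIMSEQ_const_iff)
    then show ?thesis using that by (simp add: conv_def)
  qed
  have rel: "(\<sigma>, \<tau>) \<in> ?R \<longleftrightarrow> M.MCauchy \<tau> \<and> conv \<tau> x" if \<sigma>: "M.MCauchy \<sigma>" "conv \<sigma> x" for \<sigma> \<tau> x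
  proof
    assume R: "(\<sigma>, \<tau>) \<in> ?R"
    then obtain y where y: "conv \<tau> y" using ex by blast
    have "(\<lambda>k. d (\<sigma> k) (\<tau> k)) \<longlonglongrightarrow> d x y" using lim[OF \<sigma> _ y] R by blast
    moreover have "(\<lambda>k. d (\<sigma> k) (\<tau> k)) \<longlonglongrightarrow> 0" using R by blast
    ultimately have "d x y = 0" by (rule LIMSEQ_unique)
    then have "x = y" using \<sigma>(2) y by (simp add: conv_def)
    then show "M.MCauchy \<tau> \<and> conv \<tau> x" using R y by blast
  next
    assume "M.MCauchy \<tau> \<and> conv \<tau> x"
    moreover have "d x x = 0" using \<sigma>(2) by (simp add: conv_def)
    ultimately show "(\<sigma>, \<tau>) \<in> ?R" using lim[OF \<sigma>, of \<tau> x] \<sigma>(1) by simp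
  qed
  define f where "f x = {\<sigma>. M.MCauchy \<sigma> \<and> conv \<sigma> x}" for x
  have ne: "f x \<noteq> {}" if x: "x \<in> K" for x
  proof -
    have "\<forall>k. \<exists>y\<in>M. d x y < 1 / (real k + 1)" using dense[OF x] by simp
    then obtain \<sigma> where \<sigma>: "\<And>k. \<sigma> k \<in> M" "\<And>k. d x (\<sigma> k) < 1 / (real k + 1)" by metis
    have c: "conv \<sigma> x"
      unfolding conv_def
    proof (intro conjI x, rule tendsto_sandwich[OF _ _ tendsto_const LIMSEQ_inverse_real_of_nat])
      show "\<forall>\<^sub>F k in sequentially. d (\<sigma> k) x \<le> inverse (real (Suc k))"
        using \<sigma>(2) by (intro always_eventually allI) (simp add: K.commute[of _ x] inverse_eq_divide less_imp_le add.commute)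
    qed simp
    have "limitin K.mtopology \<sigma> x sequentially"
      unfolding K.limitin_metric
    proof (intro conjI x allI impI)
      fix e :: real assume "e > 0"
      then have "\<forall>\<^sub>F k in sequentially. d (\<sigma> k) x < e" using c unfolding conv_def tendsto_iff by simp
      moreover have "\<sigma> k \<in> K" for k using \<sigma>(1) MK by blast
      ultimately show "\<forall>\<^sub>F k in sequentially. \<sigma> k \<in> K \<and> d (\<sigma> k) x < e" by simp
    qed
    then have "K.MCauchy \<sigma>" using \<sigma>(1) MK by (intro K.convergent_imp_MCauchy) auto
    then have "M.MCauchy \<sigma>" using \<sigma>(1) unfolding K.MCauchy_def M.MCauchy_def by blast
    then show ?thesis using c unfolding f_def by blast
  qed
  have cls: "?R `` {\<sigma>} = f x" if "M.MCauchy \<sigma>" "conv \<sigma> x" for \<sigma> x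
    using rel[OF that] unfolding f_def by auto
  have car: "completion_carrier M d = f ` K"
  proof
    show "completion_carrier M d \<subseteq> f ` K"
    proof
      fix A assume "A \<in> completion_carrier M d"
      then obtain \<sigma> where \<sigma>: "M.MCauchy \<sigma>" "A = ?R `` {\<sigma>}"
        unfolding completion_carrier_def quotient_def by blast
      then obtain x where x: "conv \<sigma> x" using ex by blast
      then show "A \<in> f ` K" using cls[OF \<sigma>(1) x] \<sigma>(2) x by (auto simp: conv_def)
    qed
    show "f ` K \<subseteq> completion_carrier M d"
    proof
      fix A assume "A \<in> f ` K"
      then obtain x where x: "x \<in> K" "A = f x" by blast
      then obtain \<sigma> where "M.MCauchy \<sigma>" "conv \<sigma> x" using ne unfolding f_def by blast
      then show "A \<in> completion_carrier M d"
        using cls x(2) unfolding completion_carrier_def quotient_def by blast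
    qed
  qed
  have cd: "completion_dist M d (f x) (f y) = d x y" if xy: "x \<in> K" "y \<in> K" for x y
  proof -
    define \<sigma> \<tau> where "\<sigma> = (SOME \<sigma>. \<sigma> \<in> f x)" and "\<tau> = (SOME \<tau>. \<tau> \<in> f y)"
    have "\<sigma> \<in> f x" "\<tau> \<in> f y" unfolding \<sigma>_def \<tau>_def using ne xy some_in_eq by blast+
    then have "(\<lambda>k. d (\<sigma> k) (\<tau> k)) \<longlonglongrightarrow> d x y" using lim unfolding f_def by blast
    then show ?thesis
      unfolding completion_dist_def \<sigma>_def[symmetric] \<tau>_def[symmetric] using xy car limI by auto
  qed
  have cd0: "completion_dist M d A B = 0" if "\<not> (A \<in> f ` K \<and> B \<in> f ` K)" for A B
    using that unfolding completion_dist_def car by auto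
  have inj: "x = y" if xy: "x \<in> K" "y \<in> K" "f x = f y" for x y
  proof -
    obtain \<sigma> where "\<sigma> \<in> f x" using ne[OF xy(1)] by blast
    moreover have "\<sigma> \<in> f y" using calculation xy(3) by simp
    ultimately show ?thesis using uniq unfolding f_def by blast
  qed
  have C: "Metric_space (f ` K) (completion_dist M d)"
  proof
    fix A B
    show "0 \<le> completion_dist M d A B"
      by (cases "A \<in> f ` K \<and> B \<in> f ` K") (auto simp: cd cd0)
    show "completion_dist M d A B = completion_dist M d B A"
      by (cases "A \<in> f ` K \<and> B \<in> f ` K") (auto simp: cd cd0 K.commute)
  next
    fix A B assume "A \<in> f ` K" "B \<in> f ` K"
    then obtain x y where xy: "x \<in> K" "A = f x" "y \<in> K" "B = f y" by blast
    show "completion_dist M d A B = 0 \<longleftrightarrow> A = B"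
      unfolding xy(2,4) cd[OF xy(1,3)] K.zero[OF xy(1,3)] using inj[OF xy(1,3)] by blast
  next
    fix A B D assume "A \<in> f ` K" "B \<in> f ` K" "D \<in> f ` K"
    then show "completion_dist M d A D \<le> completion_dist M d A B + completion_dist M d B D"
      by (auto simp: cd intro: K.triangle)
  qed
  interpret C: Metric_space "f ` K" "completion_dist M d" by (rule C)
  have top: "completion_topology M d = C.mtopology" by (simp add: completion_topology_def car)
  have "continuous_map K.mtopology C.mtopology f"
    unfolding C.continuous_map_to_metric
  proof (intro ballI allI impI)
    fix x and e :: real assume x: "x \<in> topspace K.mtopology" and e: "0 < e"
    have xK: "x \<in> K" using x by simp
    have "\<forall>y\<in>K.mball x e. f y \<in> C.mball (f x) e" using xK by (auto simp: K.in_mball C.in_mball cd)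
    then show "\<exists>U. openin K.mtopology U \<and> x \<in> U \<and> (\<forall>y\<in>U. f y \<in> C.mball (f x) e)"
      using xK e by (intro exI[of _ "K.mball x e"]) simp
  qed
  moreover have "inj_on f K" using inj by (rule inj_onI)
  ultimately have "homeomorphic_map K.mtopology C.mtopology f"
    using comp C.Hausdorff_space_mtopology by (intro continuous_imp_homeomorphic_map) auto
  then have "K.mtopology homeomorphic_space completion_topology M d"
    unfolding top by (rule homeomorphic_map_imp_homeomorphic_space)
  then show ?thesis by (subst homeomorphic_space_sym)
qed

section \<open>Global properties of the distances\<close>

context orbifold
begin

text \<open>Transfers a bound along nearly shortest paths to the infimum; the paths may be taken
  shorter than \<open>r\<close> because \<open>d < r\<close>.\<close>

lemma kdist_le_of_approx:
  assumes d: "kdist n X \<O> \<omega> a b = ennreal d" "0 \<le> d" "d < r" and K: "0 < K"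
    and path: "\<And>\<gamma> l. admissible_path n X \<O> a b \<gamma> \<Longrightarrow> path_len n X \<O> \<omega> \<gamma> \<le> ennreal l \<Longrightarrow> 0 \<le> l \<Longrightarrow> l < r \<Longrightarrow> x \<le> ennreal (K * l)"
  shows "x \<le> ennreal (K * d)"
proof (rule ennreal_le_epsilon)
  fix e :: real assume e: "0 < e"
  define l where "l = d + min ((r - d) / 2) (e / K)"
  have l: "d < l" "l < r" "K * l \<le> K * d + e"
  proof -
    show "d < l" "l < r" using d e K by (auto simp: l_def min_def field_simps)
    have "K * (l - d) \<le> K * (e / K)" using K by (intro mult_left_mono) (auto simp: l_def)
    then show "K * l \<le> K * d + e" using K by (simp add: algebra_simps)
  qed
  have "kdist n X \<O> \<omega> a b < ennreal l" using d l by (simp add: ennreal_lessI)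
  then obtain \<gamma> where "admissible_path n X \<O> a b \<gamma>" "path_len n X \<O> \<omega> \<gamma> < ennreal l" by (rule kdist_lessE)
  then have "x \<le> ennreal (K * l)" using path l d by (metis less_imp_le order_trans)
  also have "\<dots> \<le> ennreal (K * d + e)" by (rule ennreal_leI[OF l(3)])
  also have "\<dots> = ennreal (K * d) + ennreal e" using K d e by (simp add: ennreal_plus)
  finally show "x \<le> ennreal (K * d) + ennreal e" .
qed

text \<open>A clopen set is analytic, being given locally by no equation or by \<open>1 = 0\<close>;
  irreducibility then forbids a proper decomposition.\<close>

lemma connected: "connected_space X"
  unfolding connected_space_clopen_in
proof (intro allI impI)
  fix T assume T: "openin X T \<and> closedin X T"
  have irr: "irreducible_space X \<O>" and red: "reduced_complex_space X \<O>"
    using orbifold unfolding complex_orbifold_def normal_variety_def by auto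
  \<comment> \<open>Constants are not declared to be sections; they are so in every local embedding,
    and the sheaf property glues.\<close>
  have one: "(\<lambda>x. 1) \<in> \<O> W" if W: "openin X W" for W
  proof -
    have "\<exists>W'. openin X W' \<and> x \<in> W' \<and> W' \<subseteq> W \<and> (\<lambda>x. 1) \<in> \<O> W'" if x: "x \<in> W" for x
    proof -
      obtain N U \<phi> where le: "local_embedding X \<O> N U \<phi>" "x \<in> U"
        using ex_local_embedding openin_subset[OF W] x by blast
      have o: "openin X (W \<inter> U)" using W local_embeddingD(1)[OF le(1)] by blast
      have "(\<lambda>x. 1) \<circ> inv_into U \<phi> \<in> holo N (\<phi> ` (W \<inter> U))"
      proof -
        have "\<exists>\<Omega> g. Cn_open N \<Omega> \<and> y \<in> \<Omega> \<and> holo_open N \<Omega> g \<and> (\<forall>z\<in>\<phi> ` (W \<inter> U) \<inter> \<Omega>. ((\<lambda>x. 1) \<circ> inv_into U \<phi>) z = g z)"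
          if "y \<in> \<phi> ` (W \<inter> U)" for y
          using that local_embeddingD(4)[OF le(1)]
          by (intro exI[of _ "Cn N"] exI[of _ "\<lambda>z. 1"]) (auto simp: Cn_open_def holo_open_const)
        then show ?thesis unfolding holo_def by blast
      qed
      then have "(\<lambda>x. 1) \<in> \<O> (W \<inter> U)" using local_embeddingD(6)[OF le(1) o] by blast
      then show ?thesis using o x le(2) by blast
    qed
    moreover have "\<forall>U f. openin X U \<and> (\<forall>x\<in>U. \<exists>W. openin X W \<and> x \<in> W \<and> W \<subseteq> U \<and> f \<in> \<O> W) \<longrightarrow> f \<in> \<O> U"
      using red unfolding reduced_complex_space_def by (elim conjE)
    ultimately show ?thesis using W by (meson)
  qed
  have an: "analytic_subset X \<O> A" if A: "openin X A" "openin X (topspace X - A)" for A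
    unfolding analytic_subset_def
  proof (intro conjI ballI)
    show "A \<subseteq> topspace X" using openin_subset[OF A(1)] .
    fix x assume x: "x \<in> topspace X"
    show "\<exists>W F. openin X W \<and> x \<in> W \<and> finite F \<and> F \<subseteq> \<O> W \<and> A \<inter> W = {y \<in> W. \<forall>f\<in>F. f y = 0}"
    proof (cases "x \<in> A")
      case True
      then show ?thesis using A(1) by (intro exI[of _ A] exI[of _ "{}"]) auto
    next
      case False
      then show ?thesis using A(2) x one[OF A(2)] by (intro exI[of _ "topspace X - A"] exI[of _ "{\<lambda>x. 1}"]) auto
    qed
  qed
  have o: "openin X (topspace X - T)" using T by (simp add: closedin_def)
  have "topspace X - (topspace X - T) = T" using openin_subset T by blast
  then have "analytic_subset X \<O> T" "analytic_subset X \<O> (topspace X - T)" using an T o by auto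
  moreover have "T \<union> (topspace X - T) = topspace X" using openin_subset T by blast
  ultimately have "T = topspace X \<or> topspace X - T = topspace X"
    using irr unfolding irreducible_space_def by blast
  then show "T = {} \<or> T = topspace X" using openin_subset T by blast
qed

text \<open>A clopen argument. The set \<open>A\<close> below speaks of the regular points near
  \<open>x\<close>, because the triangle inequality is at hand for regular middle points. The
  hypothesis \<open>loc\<close> makes the lemma applicable to both metrics.\<close>

lemma kdist_finite:
  assumes \<omega>: "kaehler_form_on_reg n X \<O> \<omega>"
    and loc: "\<And>x. x \<in> topspace X \<Longrightarrow> \<exists>U. openin X U \<and> x \<in> U \<and> (\<forall>a\<in>U. \<forall>b\<in>U. kdist n X \<O> \<omega> a b < \<infinity>)"
    and ab: "a \<in> topspace X" "b \<in> topspace X"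
  shows "kdist n X \<O> \<omega> a b < \<infinity>"
proof -
  let ?R = "regular_locus X \<O>" and ?d = "kdist n X \<O> \<omega>"
  have tri: "?d x z < \<infinity>" if "?d x y < \<infinity>" "?d y z < \<infinity>" "y \<in> ?R" for x y z
    using kdist_triangle_regular[OF \<omega> that(3), of x z] that(1,2)
    by (metis ennreal_add_less_top infinity_ennreal_def le_less_trans)
  obtain U where U': "openin X U" "a \<in> U" "\<forall>x\<in>U. \<forall>y\<in>U. ?d x y < \<infinity>" using loc[OF ab(1)] by (elim exE conjE)
  note U = U'(1,2) U'(3)[rule_format]
  obtain y0 where y0: "y0 \<in> U" "y0 \<in> ?R" using regular_dense[OF U(1,2)] by blast
  define A where "A = {x \<in> topspace X. \<exists>W. openin X W \<and> x \<in> W \<and> (\<forall>y\<in>W \<inter> ?R. ?d y y0 < \<infinity>)}"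
  have "openin X A"
    unfolding openin_subopen[of X A]
  proof
    fix x assume "x \<in> A"
    then obtain W where W: "openin X W" "x \<in> W" "\<forall>y\<in>W \<inter> ?R. ?d y y0 < \<infinity>" by (auto simp: A_def)
    then have "W \<subseteq> A" using openin_subset unfolding A_def by blast
    then show "\<exists>T. openin X T \<and> x \<in> T \<and> T \<subseteq> A" using W by blast
  qed
  moreover have "openin X (topspace X - A)"
    unfolding openin_subopen[of X "topspace X - A"]
  proof
    fix x assume x: "x \<in> topspace X - A"
    then have xX: "x \<in> topspace X" by blast
    obtain W where W': "openin X W" "x \<in> W" "\<forall>y\<in>W. \<forall>z\<in>W. ?d y z < \<infinity>" using loc[OF xX] by (elim exE conjE)
    note W = W'(1,2) W'(3)[rule_format]
    have "\<exists>y\<in>W \<inter> ?R. \<not> ?d y y0 < \<infinity>"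
    proof (rule ccontr)
      assume "\<not> ?thesis"
      then have "x \<in> A" unfolding A_def using xX W(1,2) by (intro CollectI conjI exI[of _ W]) simp_all
      then show False using x by simp
    qed
    then obtain y where y: "y \<in> W" "y \<in> ?R" "\<not> ?d y y0 < \<infinity>" by (elim bexE IntE)
    have "z \<notin> A" if z: "z \<in> W" for z
    proof
      assume "z \<in> A"
      then obtain W' where W': "openin X W'" "z \<in> W'" "\<forall>y\<in>W' \<inter> ?R. ?d y y0 < \<infinity>" by (auto simp: A_def)
      have "openin X (W \<inter> W')" using W(1) W'(1) by blast
      then obtain y' where y': "y' \<in> W \<inter> W'" "y' \<in> ?R" using regular_dense z W'(2) by blast
      then have "?d y y0 < \<infinity>" using tri[OF W(3)[OF y(1)] _ y'(2)] W'(3) by blast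
      then show False using y(3) by simp
    qed
    then show "\<exists>T. openin X T \<and> x \<in> T \<and> T \<subseteq> topspace X - A" using W openin_subset[OF W(1)] by blast
  qed
  moreover have AX: "A \<subseteq> topspace X" unfolding A_def by blast
  ultimately have "A = {} \<or> A = topspace X"
    using connected unfolding connected_space_clopen_in closedin_def by blast
  moreover have "a \<in> A" unfolding A_def
    using ab(1) U(1,2) U(3)[OF _ y0(1)] by (intro CollectI conjI exI[of _ U] ballI) simp_all
  ultimately have A: "A = topspace X" by (metis empty_iff)
  obtain W where W'': "openin X W" "b \<in> W" "\<forall>x\<in>W. \<forall>y\<in>W. ?d x y < \<infinity>" using loc[OF ab(2)] by (elim exE conjE)
  note W = W''(1,2) W''(3)[rule_format]
  obtain W' where W': "openin X W'" "b \<in> W'" "\<forall>y\<in>W' \<inter> ?R. ?d y y0 < \<infinity>" using A ab(2) by (auto simp: A_def)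
  have "openin X (W \<inter> W')" using W(1) W'(1) by blast
  then obtain y where y: "y \<in> W \<inter> W'" "y \<in> ?R" using regular_dense W(2) W'(2) by blast
  have "?d y0 y < \<infinity>" using W'(3) y kdist_commute[OF \<omega>, of y0 y] by simp
  then have "?d a y < \<infinity>" using tri[OF U(3)[OF U(2) y0(1)] _ y0(2)] by blast
  then show ?thesis using tri[OF _ W(3)[OF _ W(2)] y(2)] y(1) by blast
qed

text \<open>A regular base point \<open>y0\<close> bounds all distances through the triangle
  inequality, and finitely many neighbourhoods cover \<open>K\<close>. That the distances to
  \<open>y0\<close> are finite comes from connectedness of \<open>X\<close>, not of
  \<open>K\<close>.\<close>

lemma kdist_bounded:
  assumes \<omega>: "kaehler_form_on_reg n X \<O> \<omega>" and K: "compactin X K"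
    and loc: "\<And>x. x \<in> topspace X \<Longrightarrow> \<exists>U B. openin X U \<and> x \<in> U \<and> (\<forall>a\<in>U. \<forall>b\<in>U. kdist n X \<O> \<omega> a b \<le> ennreal B)"
  shows "\<exists>D>0. \<forall>a\<in>K. \<forall>b\<in>K. kdist n X \<O> \<omega> a b \<le> ennreal D"
proof -
  let ?R = "regular_locus X \<O>" and ?d = "kdist n X \<O> \<omega>"
  have fin: "?d a b < \<infinity>" if "a \<in> topspace X" "b \<in> topspace X" for a b
  proof (rule kdist_finite[OF \<omega> _ that])
    fix x assume "x \<in> topspace X"
    from loc[OF this] obtain U B where U: "openin X U" "x \<in> U" "\<forall>a\<in>U. \<forall>b\<in>U. ?d a b \<le> ennreal B" by (elim exE conjE)
    have "?d a b < \<infinity>" if "a \<in> U" "b \<in> U" for a b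
      using le_less_trans[OF U(3)[rule_format, OF that] ennreal_less_top] by simp
    then show "\<exists>U. openin X U \<and> x \<in> U \<and> (\<forall>a\<in>U. \<forall>b\<in>U. ?d a b < \<infinity>)" using U(1,2) by (intro exI[of _ U]) simp
  qed
  have "topspace X \<noteq> {}"
    using orbifold unfolding complex_orbifold_def normal_variety_def irreducible_space_def by blast
  then obtain y0 where y0: "y0 \<in> ?R" using regular_dense[OF openin_topspace] by blast
  then have y0X: "y0 \<in> topspace X" using regular_subset by blast
  have KX: "K \<subseteq> topspace X" using compactin_subset_topspace[OF K] .
  have "\<forall>x\<in>K. \<exists>U. openin X U \<and> x \<in> U \<and> (\<exists>D\<ge>0. \<forall>a\<in>U. ?d a y0 \<le> ennreal D)"
  proof
    fix x assume "x \<in> K"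
    then have "x \<in> topspace X" using KX by blast
    from loc[OF this] obtain U B where U': "openin X U" "x \<in> U" "\<forall>a\<in>U. \<forall>b\<in>U. ?d a b \<le> ennreal B" by (elim exE conjE)
    note U = U'(1,2) U'(3)[rule_format]
    obtain y where y: "y \<in> U" "y \<in> ?R" using regular_dense[OF U(1,2)] by blast
    obtain c where c: "?d y y0 = ennreal c" "0 \<le> c"
      using fin[of y y0] y(2) regular_subset y0X by (cases "?d y y0" rule: ennreal_cases) auto
    have "?d a y0 \<le> ennreal (max B 0 + c)" if a: "a \<in> U" for a
    proof -
      have "?d a y0 \<le> ?d a y + ?d y y0" by (rule kdist_triangle_regular[OF \<omega> y(2)])
      also have "\<dots> \<le> ennreal (max B 0) + ennreal c"
        using U(3)[OF a y(1)] c ennreal_leI[of B "max B 0"] by (intro add_mono) (auto intro: order_trans)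
      finally show ?thesis using c(2) by (simp add: ennreal_plus)
    qed
    then show "\<exists>U. openin X U \<and> x \<in> U \<and> (\<exists>D\<ge>0. \<forall>a\<in>U. ?d a y0 \<le> ennreal D)"
      using U(1,2) c(2) by (intro exI[of _ U] conjI exI[of _ "max B 0 + c"]) auto
  qed
  from bchoice[OF this] obtain UU where UU: "\<And>x. x \<in> K \<Longrightarrow> openin X (UU x)" "\<And>x. x \<in> K \<Longrightarrow> x \<in> UU x"
    "\<And>x. x \<in> K \<Longrightarrow> \<exists>D\<ge>0. \<forall>a\<in>UU x. ?d a y0 \<le> ennreal D" by blast
  obtain F where F: "finite F" "F \<subseteq> UU ` K" "K \<subseteq> \<Union>F"
    using compactinD[OF K, of "UU ` K"] UU(1,2) by blast
  obtain S where S: "finite S" "S \<subseteq> K" "K \<subseteq> \<Union>(UU ` S)"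
    using finite_subset_image[OF F(1,2)] F(3) by blast
  have "\<forall>x\<in>S. \<exists>D\<ge>0. \<forall>a\<in>UU x. ?d a y0 \<le> ennreal D" using UU(3) S(2) by blast
  from bchoice[OF this] obtain D where D: "\<And>x. x \<in> S \<Longrightarrow> 0 \<le> D x" "\<And>x a. x \<in> S \<Longrightarrow> a \<in> UU x \<Longrightarrow> ?d a y0 \<le> ennreal (D x)"
    by blast
  define E where "E = Max (insert 1 (D ` S))"
  have E: "E > 0" "\<And>x. x \<in> S \<Longrightarrow> D x \<le> E" using S(1) by (auto simp: E_def less_le_trans[OF zero_less_one])
  have aE: "?d a y0 \<le> ennreal E" if aK: "a \<in> K" for a
  proof -
    obtain x where x: "x \<in> S" "a \<in> UU x" using S(3) aK by blast
    show ?thesis using order_trans[OF D(2)[OF x] ennreal_leI[OF E(2)[OF x(1)]]] .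
  qed
  have "?d a b \<le> ennreal (2 * E)" if "a \<in> K" "b \<in> K" for a b
  proof -
    have "?d a b \<le> ?d a y0 + ?d y0 b" by (rule kdist_triangle_regular[OF \<omega> y0])
    also have "\<dots> \<le> ennreal E + ennreal E" using aE[OF that(1)] aE[OF that(2)] kdist_commute[OF \<omega>, of y0 b] by (intro add_mono) auto
    also have "\<dots> = ennreal (2 * E)" using E(1) by (simp flip: ennreal_plus)
    finally show ?thesis .
  qed
  then show ?thesis using E(1) by (intro exI[of _ "2 * E"]) auto
qed

end

section \<open>Metric properties of the orbifold distance\<close>

context orbifold_metric
begin

lemma kdist_small:
  assumes x0: "x0 \<in> topspace X" and e: "0 < e"
  shows "\<exists>U. openin X U \<and> x0 \<in> U \<and> (\<forall>a\<in>U. \<forall>b\<in>U. kdist n X \<O> \<omega> a b < ennreal e)"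
proof -
  obtain N U1 \<iota> where le: "local_embedding X \<O> N U1 \<iota>" "x0 \<in> U1" using ex_local_embedding[OF x0] by blast
  obtain \<rho> C m where h: "\<rho> > 0" "C > 0" "m > (0::nat)" "\<And>x y. x \<in> U1 \<Longrightarrow> y \<in> U1 \<Longrightarrow> \<iota> x \<in> pdisc N (\<iota> x0) \<rho> \<Longrightarrow> \<iota> y \<in> pdisc N (\<iota> x0) \<rho> \<Longrightarrow>
      kdist n X \<O> \<omega> x y \<le> ennreal (C * l1norm N (\<lambda>i. \<iota> x i - \<iota> y i) powr (1 / real m))"
    using holder_estimate[OF le] by blast
  \<comment> \<open>Chosen so that \<open>C * t powr (1 / real m)\<close> equals
    \<open>e / 2\<close>.\<close>
  define t where "t = (e / (2 * C)) ^ m"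
  have t: "t > 0" "t powr (1 / real m) = e / (2 * C)"
    using e h(2,3) by (auto simp: t_def powr_realpow[symmetric] powr_powr)
  define \<sigma> where "\<sigma> = min \<rho> (t / (2 * real N + 1))"
  have \<sigma>: "\<sigma> > 0" "\<sigma> \<le> \<rho>" using h(1) t(1) by (auto simp: \<sigma>_def add_nonneg_pos)
  let ?U = "{y \<in> U1. \<iota> y \<in> pdisc N (\<iota> x0) \<sigma>}"
  have "kdist n X \<O> \<omega> a b < ennreal e" if ab: "a \<in> ?U" "b \<in> ?U" for a b
  proof -
    have "l1norm N (\<lambda>i. \<iota> a i - \<iota> b i) \<le> real N * (2 * \<sigma>)"
    proof (rule l1norm_le)
      fix i assume "i < N"
      then have "cmod (\<iota> a i - \<iota> x0 i) < \<sigma>" "cmod (\<iota> b i - \<iota> x0 i) < \<sigma>" using ab by (auto simp: pdisc_def)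
      then show "cmod (\<iota> a i - \<iota> b i) \<le> 2 * \<sigma>"
        using norm_triangle_ineq4[of "\<iota> a i - \<iota> x0 i" "\<iota> b i - \<iota> x0 i"] by simp
    qed
    also have "\<dots> \<le> (2 * real N + 1) * \<sigma>" using \<sigma>(1) by (simp add: algebra_simps)
    also have "\<dots> \<le> (2 * real N + 1) * (t / (2 * real N + 1))" by (intro mult_left_mono) (auto simp: \<sigma>_def)
    also have "\<dots> = t" by (simp add: add_nonneg_pos)
    finally have "l1norm N (\<lambda>i. \<iota> a i - \<iota> b i) powr (1 / real m) \<le> t powr (1 / real m)"
      by (intro powr_mono2) auto
    then have "C * l1norm N (\<lambda>i. \<iota> a i - \<iota> b i) powr (1 / real m) \<le> C * (e / (2 * C))"
      unfolding t(2) using h(2) by (intro mult_left_mono) auto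
    also have "\<dots> = e / 2" using h(2) by simp
    finally have le2: "C * l1norm N (\<lambda>i. \<iota> a i - \<iota> b i) powr (1 / real m) \<le> e / 2" .
    have "kdist n X \<O> \<omega> a b \<le> ennreal (e / 2)"
      using h(4)[of a b] ab pdisc_mono[OF \<sigma>(2)] ennreal_leI[OF le2] by (blast intro: order_trans)
    also have "\<dots> < ennreal e" using e by (simp add: ennreal_lessI)
    finally show ?thesis .
  qed
  moreover have "x0 \<in> ?U" using le(2) centre_in_pdisc[OF _ \<sigma>(1)] local_embeddingD(4)[OF le(1)] by blast
  ultimately show ?thesis using region_open[OF le(1)] by blast
qed

lemma kdist_metric_finite:
  assumes "a \<in> topspace X" "b \<in> topspace X"
  shows "kdist n X \<O> \<omega> a b < \<infinity>"
proof (rule kdist_finite[OF metric_form _ assms])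
  fix x assume "x \<in> topspace X"
  from kdist_small[OF this zero_less_one] obtain U where U: "openin X U" "x \<in> U"
    "\<forall>a\<in>U. \<forall>b\<in>U. kdist n X \<O> \<omega> a b < ennreal 1" by (elim exE conjE)
  have "kdist n X \<O> \<omega> a b < \<infinity>" if "a \<in> U" "b \<in> U" for a b
    using less_trans[OF U(3)[rule_format, OF that] ennreal_less_top] by simp
  then show "\<exists>U. openin X U \<and> x \<in> U \<and> (\<forall>a\<in>U. \<forall>b\<in>U. kdist n X \<O> \<omega> a b < \<infinity>)" using U(1,2) by (intro exI[of _ U]) simp
qed

text \<open>At a singular \<open>b\<close> two paths cannot be concatenated. Each nearly shortest
  path is cut at a regular point near \<open>b\<close>, and the gap is bridged between two points of
  a neighbourhood of diameter at most \<open>e / 3\<close>.\<close>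

lemma kdist_triangle:
  assumes b: "b \<in> topspace X"
  shows "kdist n X \<O> \<omega> a c \<le> kdist n X \<O> \<omega> a b + kdist n X \<O> \<omega> b c"
proof (rule ennreal_le_epsilon)
  let ?d = "kdist n X \<O> \<omega>"
  fix e :: real assume fin: "?d a b + ?d b c < top_class.top" and e: "0 < e"
  have e3: "0 < e / 3" using e by simp
  obtain U where U': "openin X U" "b \<in> U" "\<forall>x\<in>U. \<forall>y\<in>U. ?d x y < ennreal (e / 3)"
    using kdist_small[OF b e3] by (elim exE conjE)
  note U = U'(1,2) U'(3)[rule_format]
  \<comment> \<open>A path leaving \<open>b\<close> is regular immediately after its start, and its
    tail is no longer than the whole path.\<close>
  have near: "\<exists>c'\<in>U. c' \<in> regular_locus X \<O> \<and> ?d c' c \<le> ?d b c + ennreal (e / 3)" if fin: "?d b c < top_class.top" for c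
  proof -
    have "?d b c < ?d b c + ennreal (e / 3)" using fin e3 by (auto simp: ennreal_add_left_cancel_less less_top[symmetric])
    then obtain \<gamma> where \<gamma>: "admissible_path n X \<O> b c \<gamma>" "path_len n X \<O> \<omega> \<gamma> < ?d b c + ennreal (e / 3)" by (rule kdist_lessE)
    have "openin (top_of_set {0..1}) {t \<in> {0..1}. \<gamma> t \<in> U}"
      using openin_continuous_map_preimage[OF admissible_pathD(1)[OF \<gamma>(1)] U(1)] by simp
    moreover have "0 \<in> {t \<in> {0..1}. \<gamma> t \<in> U}" using admissible_pathD(2)[OF \<gamma>(1)] U(2) by simp
    ultimately obtain \<delta> where \<delta>: "\<delta> > 0" "\<And>t. t \<in> {0..1} \<Longrightarrow> dist t 0 < \<delta> \<Longrightarrow> \<gamma> t \<in> U"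
      unfolding openin_euclidean_subtopology_iff by blast
    define t where "t = min (1 / 2) (\<delta> / 2)"
    have t: "0 < t" "t < 1" "\<gamma> t \<in> U" using \<delta>(1) \<delta>(2)[of t] by (auto simp: t_def dist_real_def)
    have "?d (\<gamma> t) c \<le> path_len n X \<O> \<omega> \<gamma>"
      using order_trans[OF kdist_le admissible_affine(2)[OF metric_form \<gamma>(1), of t "1 - t"]]
        admissible_affine(1)[OF metric_form \<gamma>(1), of t "1 - t"] t admissible_pathD(3)[OF \<gamma>(1)] by simp
    then show ?thesis using \<gamma>(2) t admissible_pathD(4)[OF \<gamma>(1) t(1,2)] less_imp_le order_trans by blast
  qed
  have fin': "?d b a < top_class.top" "?d b c < top_class.top"
    using fin kdist_commute[OF metric_form, of a b] by auto
  obtain a' where a': "a' \<in> U" "a' \<in> regular_locus X \<O>" "?d a' a \<le> ?d b a + ennreal (e / 3)" using near[OF fin'(1)] by blast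
  obtain c' where c': "c' \<in> U" "c' \<in> regular_locus X \<O>" "?d c' c \<le> ?d b c + ennreal (e / 3)" using near[OF fin'(2)] by blast
  have "?d a c \<le> ?d a a' + (?d a' c' + ?d c' c)"
    using kdist_triangle_regular[OF metric_form a'(2), of a c] kdist_triangle_regular[OF metric_form c'(2), of a' c]
    by (meson add_left_mono order_trans)
  also have "\<dots> \<le> (?d a b + ennreal (e / 3)) + (ennreal (e / 3) + (?d b c + ennreal (e / 3)))"
    using a'(3) c'(3) U(3)[OF a'(1) c'(1)] kdist_commute[OF metric_form, of a' a] kdist_commute[OF metric_form, of b a]
    by (intro add_mono) (auto simp: less_imp_le)
  also have "\<dots> = ?d a b + ?d b c + (ennreal (e / 3) + (ennreal (e / 3) + ennreal (e / 3)))" by (simp only: ac_simps)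
  also have "ennreal (e / 3) + (ennreal (e / 3) + ennreal (e / 3)) = ennreal e" using e by (simp flip: ennreal_plus)
  finally show "?d a c \<le> ?d a b + ?d b c + ennreal e" .
qed

text \<open>At a singular point the constant path is not admissible, so the value comes from small
  neighbourhoods.\<close>

lemma kdist_self: "a \<in> topspace X \<Longrightarrow> kdist n X \<O> \<omega> a a = 0"
proof (rule antisym)
  assume a: "a \<in> topspace X"
  show "kdist n X \<O> \<omega> a a \<le> 0"
  proof (rule ennreal_le_epsilon)
    fix e :: real assume "0 < e"
    then show "kdist n X \<O> \<omega> a a \<le> 0 + ennreal e" using kdist_small[OF a] less_imp_le by fastforce
  qed
qed simp

end

section \<open>Comparison of the two distances\<close>

locale two_metrics = orbifold_metric X \<O> n \<omega> for X :: "'a topology" and \<O> n \<omega> +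
  fixes \<omega>X :: "'a set \<Rightarrow> ('a \<Rightarrow> nat \<Rightarrow> complex) \<Rightarrow> form"
  assumes ambient_metric: "kaehler_metric n X \<O> \<omega>X"
begin

lemma ambient_form: "kaehler_form_on_reg n X \<O> \<omega>X"
  using ambient_metric unfolding kaehler_metric_def by blast

text \<open>Both speeds are compared with the euclidean speed of the embedded path: that of
  \<open>\<omega>X\<close> is bounded above by it through \<open>B\<close>, that of
  \<open>\<omega>\<close> below through \<open>A\<close>.\<close>

lemma path_len_comparison:
  assumes ad: "admissible_path n X \<O> a b \<gamma>" and le: "local_embedding X \<O> N U1 \<iota>"
    and dom: "dominates A N U1 \<iota> \<rho> x \<omega>" and A: "0 < A" and B: "0 < B"
    and up: "\<And>y W \<phi> u. y \<in> U1 \<Longrightarrow> \<iota> y \<in> pdisc N x \<rho> \<Longrightarrow> u \<in> Cn n \<Longrightarrow> holo_chart X \<O> n W \<phi> \<Longrightarrow> y \<in> W \<Longrightarrow>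
      \<omega>X W \<phi> (\<phi> y) u (Jmul u) \<le> B * (l1norm N (dmap (\<lambda>x. \<iota> (inv_into W \<phi> x)) (\<phi> y) u))\<^sup>2"
    and R: "\<And>t. 0 < t \<Longrightarrow> t < 1 \<Longrightarrow> \<gamma> t \<in> U1 \<and> \<iota> (\<gamma> t) \<in> pdisc N x \<rho>"
  shows "path_len n X \<O> \<omega>X \<gamma> \<le> ennreal (sqrt (B * A)) * path_len n X \<O> \<omega> \<gamma>"
proof -
  have m: "(\<lambda>t. ennreal (speed n X \<O> \<omega> \<gamma> t * indicator {0<..<1} t)) \<in> borel_measurable lborel"
    using speed_measurable[OF metric_form ad] by simp
  have "path_len n X \<O> \<omega>X \<gamma> \<le> (\<integral>\<^sup>+ t. ennreal (sqrt (B * A)) * ennreal (speed n X \<O> \<omega> \<gamma> t * indicator {0<..<1} t) \<partial>lborel)"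
    unfolding path_len_alt
  proof (rule nn_integral_mono)
    fix t :: real
    show "ennreal (speed n X \<O> \<omega>X \<gamma> t * indicator {0<..<1} t)
      \<le> ennreal (sqrt (B * A)) * ennreal (speed n X \<O> \<omega> \<gamma> t * indicator {0<..<1} t)"
    proof (cases "0 < t \<and> t < 1")
      case True
      then have t: "0 < t" "t < 1" by auto
      obtain W \<phi> where ch: "holo_chart X \<O> n W \<phi>" "\<gamma> t \<in> W"
        using regular_chart[OF admissible_pathD(4)[OF ad t]] by blast
      note cd = admissible_chart_diff[OF ad t]
      have v: "vel \<phi> \<gamma> t \<in> Cn n" by (rule vel_Cn[OF cd ch])
      let ?e = "l1norm N (dmap (\<lambda>x. \<iota> (inv_into W \<phi> x)) (\<phi> (\<gamma> t)) (vel \<phi> \<gamma> t))"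
      have "?e\<^sup>2 \<le> A * \<omega> W \<phi> (\<phi> (\<gamma> t)) (vel \<phi> \<gamma> t) (Jmul (vel \<phi> \<gamma> t))"
        using dom R[OF t] v ch unfolding dominates_def by blast
      then have "B * ?e\<^sup>2 \<le> B * (A * \<omega> W \<phi> (\<phi> (\<gamma> t)) (vel \<phi> \<gamma> t) (Jmul (vel \<phi> \<gamma> t)))"
        using B by (intro mult_left_mono) auto
      moreover have "\<omega>X W \<phi> (\<phi> (\<gamma> t)) (vel \<phi> \<gamma> t) (Jmul (vel \<phi> \<gamma> t)) \<le> B * ?e\<^sup>2"
        using up R[OF t] v ch by blast
      ultimately have "\<omega>X W \<phi> (\<phi> (\<gamma> t)) (vel \<phi> \<gamma> t) (Jmul (vel \<phi> \<gamma> t))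
          \<le> B * A * \<omega> W \<phi> (\<phi> (\<gamma> t)) (vel \<phi> \<gamma> t) (Jmul (vel \<phi> \<gamma> t))" by simp
      then have "speed n X \<O> \<omega>X \<gamma> t \<le> sqrt (B * A) * speed n X \<O> \<omega> \<gamma> t"
        unfolding speed_chart[OF metric_form cd ch] speed_chart[OF ambient_form cd ch]
        using real_sqrt_le_mono by (simp only: real_sqrt_mult[symmetric])
      then have "ennreal (speed n X \<O> \<omega>X \<gamma> t) \<le> ennreal (sqrt (B * A) * speed n X \<O> \<omega> \<gamma> t)" by (rule ennreal_leI)
      also have "\<dots> = ennreal (sqrt (B * A)) * ennreal (speed n X \<O> \<omega> \<gamma> t)"
        using A B by (intro ennreal_mult' ) simp
      finally show ?thesis using t by simp
    next
      case False
      then have "indicator {0<..<1} t = (0::real)" by (auto simp: indicator_def)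
      then show ?thesis by simp
    qed
  qed
  also have "\<dots> = ennreal (sqrt (B * A)) * path_len n X \<O> \<omega> \<gamma>"
    unfolding path_len_alt by (rule nn_integral_cmult[OF m])
  finally show ?thesis .
qed

text \<open>\<open>a\<close> lies in \<open>U\<close> while \<open>b\<close> is arbitrary, since a
  small distance already forces \<open>b\<close> to be near. A cover of \<open>K\<close> by such
  sets therefore handles all pairs at distance below a common threshold.\<close>

definition comparable where
  "comparable U r C m \<longleftrightarrow> openin X U \<and> 0 < r \<and> 0 < C \<and> 0 < (m::nat) \<and> (\<forall>a\<in>U. \<forall>b d. 0 \<le> d \<longrightarrow> d < r \<longrightarrow>
     (kdist n X \<O> \<omega> a b = ennreal d \<longrightarrow> kdist n X \<O> \<omega>X a b \<le> ennreal (C * d)) \<and>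
     (kdist n X \<O> \<omega>X a b = ennreal d \<longrightarrow> kdist n X \<O> \<omega> a b \<le> ennreal (C * d powr (1 / real m))) \<and>
     (kdist n X \<O> \<omega> a b = 0 \<longrightarrow> a = b))"

lemma comparableD:
  assumes "comparable U r C m"
  shows "openin X U" "0 < r" "0 < C" "0 < m"
    and "a \<in> U \<Longrightarrow> 0 \<le> d \<Longrightarrow> d < r \<Longrightarrow> kdist n X \<O> \<omega> a b = ennreal d \<Longrightarrow> kdist n X \<O> \<omega>X a b \<le> ennreal (C * d)"
    and "a \<in> U \<Longrightarrow> 0 \<le> d \<Longrightarrow> d < r \<Longrightarrow> kdist n X \<O> \<omega>X a b = ennreal d \<Longrightarrow>
      kdist n X \<O> \<omega> a b \<le> ennreal (C * d powr (1 / real m))"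
    and "a \<in> U \<Longrightarrow> kdist n X \<O> \<omega> a b = 0 \<Longrightarrow> a = b"
proof -
  note c = assms[unfolded comparable_def]
  note o = c[THEN conjunct1] c[THEN conjunct2, THEN conjunct1] c[THEN conjunct2, THEN conjunct2, THEN conjunct1]
    c[THEN conjunct2, THEN conjunct2, THEN conjunct2, THEN conjunct1]
  note h = c[THEN conjunct2, THEN conjunct2, THEN conjunct2, THEN conjunct2]
  show "openin X U" "0 < r" "0 < C" "0 < m" by (fact o)+
  show "kdist n X \<O> \<omega>X a b \<le> ennreal (C * d)"
    if "a \<in> U" "0 \<le> d" "d < r" "kdist n X \<O> \<omega> a b = ennreal d"
    using h[rule_format, OF that(1-3), of b] that(4) by simp
  show "kdist n X \<O> \<omega> a b \<le> ennreal (C * d powr (1 / real m))"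
    if "a \<in> U" "0 \<le> d" "d < r" "kdist n X \<O> \<omega>X a b = ennreal d"
    using h[rule_format, OF that(1-3), of b] that(4) by simp
  show "a = b" if "a \<in> U" "kdist n X \<O> \<omega> a b = 0"
    using h[rule_format, OF that(1) order_refl o(2), of b] that(2) by simp
qed

lemma local_comparison:
  assumes x0: "x0 \<in> topspace X"
  shows "\<exists>U r C m. x0 \<in> U \<and> comparable U r C m"
proof -
  obtain N U1 \<iota> where le: "local_embedding X \<O> N U1 \<iota>" "x0 \<in> U1" using ex_local_embedding[OF x0] by blast
  obtain \<rho>a A where A: "\<rho>a > 0" "A > 0" "\<forall>y\<in>U1. \<iota> y \<in> pdisc N (\<iota> x0) \<rho>a \<longrightarrow> (\<forall>W \<phi>. \<forall>u\<in>Cn n.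
      holo_chart X \<O> n W \<phi> \<and> y \<in> W \<longrightarrow>
      (l1norm N (dmap (\<lambda>x. \<iota> (inv_into W \<phi> x)) (\<phi> y) u))\<^sup>2 \<le> A * \<omega> W \<phi> (\<phi> y) u (Jmul u))"
    using metric_lower_bound[OF le] by (elim exE conjE)
  obtain \<rho>b B where B: "\<rho>b > 0" "B > 0" "\<forall>y\<in>U1. \<iota> y \<in> pdisc N (\<iota> x0) \<rho>b \<longrightarrow> (\<forall>W \<phi>. \<forall>u\<in>Cn n.
      holo_chart X \<O> n W \<phi> \<and> y \<in> W \<longrightarrow>
      (l1norm N (dmap (\<lambda>x. \<iota> (inv_into W \<phi> x)) (\<phi> y) u))\<^sup>2 \<le> B * \<omega>X W \<phi> (\<phi> y) u (Jmul u) \<and>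
      \<omega>X W \<phi> (\<phi> y) u (Jmul u) \<le> B * (l1norm N (dmap (\<lambda>x. \<iota> (inv_into W \<phi> x)) (\<phi> y) u))\<^sup>2)"
    using ambient_metric_bounds[OF ambient_metric le] by (elim exE conjE)
  obtain \<rho>c H m where H: "\<rho>c > 0" "H > 0" "m > (0::nat)" "\<forall>x\<in>U1. \<forall>y\<in>U1. \<iota> x \<in> pdisc N (\<iota> x0) \<rho>c \<and> \<iota> y \<in> pdisc N (\<iota> x0) \<rho>c \<longrightarrow>
      kdist n X \<O> \<omega> x y \<le> ennreal (H * l1norm N (\<lambda>i. \<iota> x i - \<iota> y i) powr (1 / real m))"
    using holder_estimate[OF le] by (elim exE conjE)
  obtain \<rho>1 where \<rho>1: "\<rho>1 > 0" "\<And>\<rho>. \<rho> \<le> \<rho>1 \<Longrightarrow> closedin X {y \<in> U1. \<iota> y \<in> cpdisc N (\<iota> x0) \<rho>}"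
    using closed_region[OF le] by blast
  \<comment> \<open>The factor 2 belongs to the region of radius \<open>\<rho> / 2\<close>, which
    has to be closed in \<open>X\<close>.\<close>
  define \<rho> where "\<rho> = Min {\<rho>a, \<rho>b, \<rho>c, 2 * \<rho>1}"
  have \<rho>: "\<rho> > 0" "\<rho> \<le> \<rho>a" "\<rho> \<le> \<rho>b" "\<rho> \<le> \<rho>c" "\<rho> / 2 \<le> \<rho>1" using A(1) B(1) H(1) \<rho>1(1) by (auto simp: \<rho>_def)
  note cl = \<rho>1(2)[OF \<rho>(5)]
  have subs: "pdisc N (\<iota> x0) \<rho> \<subseteq> pdisc N (\<iota> x0) \<rho>a" "pdisc N (\<iota> x0) \<rho> \<subseteq> pdisc N (\<iota> x0) \<rho>b"
    "pdisc N (\<iota> x0) \<rho> \<subseteq> pdisc N (\<iota> x0) \<rho>c" "pdisc N (\<iota> x0) (\<rho> / 2) \<subseteq> pdisc N (\<iota> x0) \<rho>" "pdisc N (\<iota> x0) (\<rho> / 4) \<subseteq> pdisc N (\<iota> x0) \<rho>"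
    using \<rho> by (auto intro!: pdisc_mono)
  have domA: "dominates A N U1 \<iota> \<rho> (\<iota> x0) \<omega>"
    unfolding dominates_def using A(3) subs(1) by blast
  have domB: "dominates B N U1 \<iota> \<rho> (\<iota> x0) \<omega>X"
    unfolding dominates_def using B(3) subs(2) by blast
  have up: "\<omega>X W \<phi> (\<phi> y) u (Jmul u) \<le> B * (l1norm N (dmap (\<lambda>x. \<iota> (inv_into W \<phi> x)) (\<phi> y) u))\<^sup>2"
    if "y \<in> U1" "\<iota> y \<in> pdisc N (\<iota> x0) \<rho>" "u \<in> Cn n" "holo_chart X \<O> n W \<phi>" "y \<in> W" for y W \<phi> u
    using B(3)[rule_format, of y u W \<phi>] that subs(2) by blast
  define U where "U = {y \<in> U1. \<iota> y \<in> pdisc N (\<iota> x0) (\<rho> / 4)}"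
  have Uo: "openin X U" unfolding U_def by (rule region_open[OF le(1)])
  have "\<rho> / 4 > 0" using \<rho>(1) by simp
  then have xU: "x0 \<in> U" unfolding U_def using le(2) centre_in_pdisc local_embeddingD(4)[OF le(1)] by blast
  \<comment> \<open>Lengths below \<open>r\<close> meet the condition of the exit argument for both
    constants \<open>A\<close> and \<open>B\<close>.\<close>
  define r where "r = \<rho> / 4 / (1 + sqrt A + sqrt B)"
  have den: "1 + sqrt A + sqrt B > 0" using A(2) B(2) by (intro add_pos_nonneg) auto
  have r: "r > 0" using \<rho>(1) den by (simp add: r_def)
  have rs: "sqrt A * l < \<rho> / 4" "sqrt B * l < \<rho> / 4" if l: "0 \<le> l" "l < r" for l
  proof -
    have "l * (1 + sqrt A + sqrt B) < \<rho> / 4" using l(2) unfolding r_def pos_less_divide_eq[OF den] .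
    then have s: "l + sqrt A * l + sqrt B * l < \<rho> / 4"
      by (simp only: distrib_left mult_1_right mult.commute[of l])
    have p: "0 \<le> sqrt A * l" "0 \<le> sqrt B * l" using l(1) A(2) B(2) by (auto intro!: mult_nonneg_nonneg)
    show "sqrt A * l < \<rho> / 4" "sqrt B * l < \<rho> / 4" using s p l(1) by linarith+
  qed
  define K1 where "K1 = sqrt (B * A)"
  \<comment> \<open>The Hoelder constant after inserting the coordinate bound
    \<open>real N * sqrt B * d\<close>.\<close>
  define K2 where "K2 = H * (real N * sqrt B) powr (1 / real m)"
  define C where "C = max K1 K2"
  have K1: "K1 > 0" using A(2) B(2) by (simp add: K1_def)
  have C: "C > 0" "K1 \<le> C" "K2 \<le> C" using K1 by (auto simp: C_def)
  have 1: "kdist n X \<O> \<omega>X a b \<le> ennreal (C * d)"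
    if a: "a \<in> U" and d: "0 \<le> d" "d < r" and kd: "kdist n X \<O> \<omega> a b = ennreal d" for a b d
  proof -
    have "kdist n X \<O> \<omega>X a b \<le> ennreal (K1 * d)"
    proof (rule kdist_le_of_approx[OF kd d K1])
      fix \<gamma> l assume ad: "admissible_path n X \<O> a b \<gamma>" and l: "path_len n X \<O> \<omega> \<gamma> \<le> ennreal l" "0 \<le> l" "l < r"
      have aU: "a \<in> U1" "\<iota> a \<in> pdisc N (\<iota> x0) (\<rho> / 4)" using a by (auto simp: U_def)
      have R: "\<gamma> t \<in> U1 \<and> \<iota> (\<gamma> t) \<in> pdisc N (\<iota> x0) \<rho>" if "0 < t" "t < 1" for t
        using short_path_stays[OF metric_form ad le(1) domA A(2) \<rho>(1) cl aU l(1,2) rs(1)[OF l(2,3)], of t] that subs(4) by auto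
      have "kdist n X \<O> \<omega>X a b \<le> path_len n X \<O> \<omega>X \<gamma>" by (rule kdist_le[OF ad])
      also have "\<dots> \<le> ennreal K1 * path_len n X \<O> \<omega> \<gamma>"
        unfolding K1_def by (rule path_len_comparison[OF ad le(1) domA A(2) B(2) up R])
      also have "\<dots> \<le> ennreal K1 * ennreal l" using l(1) by (rule mult_left_mono) simp
      also have "\<dots> = ennreal (K1 * l)" using K1 by (simp add: ennreal_mult')
      finally show "kdist n X \<O> \<omega>X a b \<le> ennreal (K1 * l)" .
    qed
    also have "\<dots> \<le> ennreal (C * d)" using C(2) d(1) by (intro ennreal_leI mult_right_mono)
    finally show ?thesis .
  qed
  have 2: "kdist n X \<O> \<omega> a b \<le> ennreal (C * d powr (1 / real m))"
    if a: "a \<in> U" and d: "0 \<le> d" "d < r" and kd: "kdist n X \<O> \<omega>X a b = ennreal d" for a b d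
  proof -
    have aU: "a \<in> U1" "\<iota> a \<in> pdisc N (\<iota> x0) (\<rho> / 4)" using a by (auto simp: U_def)
    note e = kdist_embedded_bound[OF ambient_form le(1) domB B(2) \<rho>(1) cl aU kd d(1) rs(2)[OF d]]
    have ab: "\<iota> a \<in> pdisc N (\<iota> x0) \<rho>c" "\<iota> b \<in> pdisc N (\<iota> x0) \<rho>c" using aU(2) e(2) subs(3,4,5) by auto
    have "kdist n X \<O> \<omega> a b \<le> ennreal (H * l1norm N (\<lambda>i. \<iota> a i - \<iota> b i) powr (1 / real m))"
      using H(4) aU(1) e(1) ab by blast
    also have "H * l1norm N (\<lambda>i. \<iota> a i - \<iota> b i) powr (1 / real m) \<le> H * (real N * sqrt B * d) powr (1 / real m)"
      using e(3) H(2) by (intro mult_left_mono powr_mono2) (auto simp: mult.assoc)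
    also have "\<dots> = K2 * d powr (1 / real m)" using B(2) d(1) by (simp add: K2_def powr_mult)
    also have "\<dots> \<le> C * d powr (1 / real m)" using C(3) by (intro mult_right_mono) auto
    finally show ?thesis using ennreal_leI by (metis order_trans)
  qed
  have 3: "a = b" if a: "a \<in> U" and kd: "kdist n X \<O> \<omega> a b = 0" for a b
  proof -
    have aU: "a \<in> U1" "\<iota> a \<in> pdisc N (\<iota> x0) (\<rho> / 4)" using a by (auto simp: U_def)
    have kd': "kdist n X \<O> \<omega> a b = ennreal 0" using kd by simp
    note e = kdist_embedded_bound[OF metric_form le(1) domA A(2) \<rho>(1) cl aU kd' order_refl rs(1)[OF order_refl r]]
    have "l1norm N (\<lambda>i. \<iota> a i - \<iota> b i) = 0" using e(3) l1norm_nonneg[of N "\<lambda>i. \<iota> a i - \<iota> b i"] by simp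
    then have "\<iota> a = \<iota> b"
      unfolding l1norm_eq_0 using local_embeddingD(4)[OF le(1)] aU(1) e(1) by (intro Cn_eqI[of _ N]) auto
    then show ?thesis using local_embeddingD(3)[OF le(1)] aU(1) e(1) unfolding inj_on_def by blast
  qed
  have "comparable U r C m"
    unfolding comparable_def
    by (intro conjI ballI allI impI) (fact Uo r C(1) H(3) | erule (3) 1 | erule (3) 2 | erule (1) 3)+
  then show ?thesis using xU by blast
qed

text \<open>A neighbourhood that is small for \<open>\<omega>\<close> is bounded for
  \<open>\<omega>X\<close> by the comparison; this supplies \<open>kdist_bounded\<close> for the
  second metric.\<close>

lemma ambient_locally_bounded:
  assumes "x \<in> topspace X"
  shows "\<exists>U B. openin X U \<and> x \<in> U \<and> (\<forall>a\<in>U. \<forall>b\<in>U. kdist n X \<O> \<omega>X a b \<le> ennreal B)"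
proof -
  obtain U r C m where U: "x \<in> U" "comparable U r C m" using local_comparison[OF assms] by blast
  note U2 = comparableD[OF U(2)]
  obtain W where W: "openin X W" "x \<in> W" "\<forall>a\<in>W. \<forall>b\<in>W. kdist n X \<O> \<omega> a b < ennreal r"
    using kdist_small[OF assms U2(2)] by (elim exE conjE)
  have "kdist n X \<O> \<omega>X a b \<le> ennreal (C * r)" if ab: "a \<in> U \<inter> W" "b \<in> U \<inter> W" for a b
  proof -
    have lt: "kdist n X \<O> \<omega> a b < ennreal r" using W(3) ab by blast
    obtain d where d: "kdist n X \<O> \<omega> a b = ennreal d" "0 \<le> d"
      using lt by (cases "kdist n X \<O> \<omega> a b" rule: ennreal_cases) auto
    have "d < r" using lt d by (simp add: ennreal_less_iff)
    then have "kdist n X \<O> \<omega>X a b \<le> ennreal (C * d)" using ab(1) d \<open>d < r\<close> by (intro U2(5)) auto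
    also have "\<dots> \<le> ennreal (C * r)" using \<open>d < r\<close> U2(3) by (intro ennreal_leI mult_left_mono) auto
    finally show ?thesis .
  qed
  then show ?thesis using U(1) U2(1) W(1,2) by (intro exI[of _ "U \<inter> W"] exI[of _ "C * r"]) auto
qed

lemma metric_locally_bounded:
  assumes "x \<in> topspace X"
  shows "\<exists>U B. openin X U \<and> x \<in> U \<and> (\<forall>a\<in>U. \<forall>b\<in>U. kdist n X \<O> \<omega> a b \<le> ennreal B)"
proof -
  obtain W where W: "openin X W" "x \<in> W" "\<forall>a\<in>W. \<forall>b\<in>W. kdist n X \<O> \<omega> a b < ennreal 1"
    using kdist_small[OF assms zero_less_one] by (elim exE conjE)
  then show ?thesis by (intro exI[of _ W] exI[of _ 1]) (auto simp: less_imp_le)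
qed

lemma metric_space: "Metric_space (topspace X) (\<lambda>a b. enn2real (kdist n X \<O> \<omega> a b))"
proof
  show "0 \<le> enn2real (kdist n X \<O> \<omega> a b)" for a b by simp
  show "enn2real (kdist n X \<O> \<omega> a b) = enn2real (kdist n X \<O> \<omega> b a)" for a b
    using kdist_commute[OF metric_form, of a b] by simp
  fix a b assume ab: "a \<in> topspace X" "b \<in> topspace X"
  show "enn2real (kdist n X \<O> \<omega> a b) = 0 \<longleftrightarrow> a = b"
  proof
    assume "enn2real (kdist n X \<O> \<omega> a b) = 0"
    then have k: "kdist n X \<O> \<omega> a b = 0"
      using kdist_metric_finite[OF ab] by (auto simp: enn2real_eq_0_iff)
    obtain U r C m where "a \<in> U" "comparable U r C m" using local_comparison[OF ab(1)] by blast
    then show "a = b" using k by (intro comparableD(7))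
  qed (use kdist_self ab in simp)
  fix c assume c: "c \<in> topspace X"
  have fin: "kdist n X \<O> \<omega> a b + kdist n X \<O> \<omega> b c < top_class.top"
    using kdist_metric_finite[OF ab] kdist_metric_finite[OF ab(2) c] by simp
  have "enn2real (kdist n X \<O> \<omega> a c) \<le> enn2real (kdist n X \<O> \<omega> a b + kdist n X \<O> \<omega> b c)"
    using enn2real_mono[OF kdist_triangle[OF ab(2)] fin] .
  then show "enn2real (kdist n X \<O> \<omega> a c) \<le> enn2real (kdist n X \<O> \<omega> a b) + enn2real (kdist n X \<O> \<omega> b c)"
    using kdist_metric_finite[OF ab] kdist_metric_finite[OF ab(2) c] by (simp add: enn2real_plus)
qed

lemma metric_topology_compact:
  assumes K: "compactin X K"
  shows "Metric_space.mtopology K (\<lambda>a b. enn2real (kdist n X \<O> \<omega> a b)) = subtopology X K"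
proof -
  let ?d = "\<lambda>a b. enn2real (kdist n X \<O> \<omega> a b)"
  have KX: "K \<subseteq> topspace X" by (rule compactin_subset_topspace[OF K])
  interpret K: Metric_space K ?d by (rule Metric_space.subspace[OF metric_space KX])
  have top: "topspace (subtopology X K) = K" using KX by auto
  have "continuous_map (subtopology X K) K.mtopology (\<lambda>x. x)"
    unfolding K.continuous_map_to_metric top
  proof (intro ballI allI impI)
    fix x and e :: real assume x: "x \<in> K" and e: "0 < e"
    obtain U where U: "openin X U" "x \<in> U" "\<forall>a\<in>U. \<forall>b\<in>U. kdist n X \<O> \<omega> a b < ennreal e"
      using kdist_small[of x e] x KX e by blast
    have "y \<in> K.mball x e" if y: "y \<in> U \<inter> K" for y
    proof -
      have "kdist n X \<O> \<omega> x y < ennreal e" using U y by blast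
      then have "enn2real (kdist n X \<O> \<omega> x y) < e"
        using e by (cases "kdist n X \<O> \<omega> x y" rule: ennreal_cases) (auto simp: ennreal_less_iff)
      then show ?thesis using x y by (simp add: K.in_mball)
    qed
    then show "\<exists>U. openin (subtopology X K) U \<and> x \<in> U \<and> (\<forall>y\<in>U. y \<in> K.mball x e)"
      using U(1,2) x by (intro exI[of _ "U \<inter> K"]) (auto simp: openin_subtopology)
  qed
  moreover have "compact_space (subtopology X K)" using K by (simp add: compact_space_subtopology)
  ultimately have h: "homeomorphic_map (subtopology X K) K.mtopology (\<lambda>x. x)"
    using K.Hausdorff_space_mtopology top by (intro continuous_imp_homeomorphic_map) auto
  show ?thesis
    unfolding topology_eq
  proof (intro allI)
    fix S
    have "openin (subtopology X K) S \<longleftrightarrow> S \<subseteq> K \<and> openin K.mtopology S"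
      using homeomorphic_map_openness_eq[OF h, of S] unfolding top image_ident .
    moreover have "openin K.mtopology S \<Longrightarrow> S \<subseteq> K"
      using openin_subset[of K.mtopology S] unfolding K.topspace_mtopology .
    ultimately show "openin K.mtopology S = openin (subtopology X K) S" by argo
  qed
qed

text \<open>Below a common threshold \<open>r\<close> the local comparison decides. From
  \<open>r\<close> on, the bounds \<open>D\<close> and \<open>E\<close> for the distances on
  \<open>K\<close> control one side, and \<open>r\<close> bounds the other from below.\<close>

lemma global_comparison:
  assumes K: "compactin X K"
  shows "\<exists>C>0. \<exists>\<alpha>\<in>{0<..<1}. \<forall>a\<in>K. \<forall>b\<in>K.
            kdist n X \<O> \<omega>X a b < \<infinity> \<and> kdist n X \<O> \<omega> a b < \<infinity> \<and>
            inverse C * enn2real (kdist n X \<O> \<omega>X a b) \<le> enn2real (kdist n X \<O> \<omega> a b) \<and>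
            enn2real (kdist n X \<O> \<omega> a b) \<le> C * enn2real (kdist n X \<O> \<omega>X a b) powr \<alpha>"
proof -
  have KX: "K \<subseteq> topspace X" by (rule compactin_subset_topspace[OF K])
  obtain D where D: "D > 0" "\<forall>a\<in>K. \<forall>b\<in>K. kdist n X \<O> \<omega> a b \<le> ennreal D"
  proof -
    have "\<exists>D>0. \<forall>a\<in>K. \<forall>b\<in>K. kdist n X \<O> \<omega> a b \<le> ennreal D"
      by (rule kdist_bounded[OF metric_form K]) (rule metric_locally_bounded)
    then show thesis using that by (elim exE conjE)
  qed
  obtain E where E: "E > 0" "\<forall>a\<in>K. \<forall>b\<in>K. kdist n X \<O> \<omega>X a b \<le> ennreal E"
  proof -
    have "\<exists>D>0. \<forall>a\<in>K. \<forall>b\<in>K. kdist n X \<O> \<omega>X a b \<le> ennreal D"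
      by (rule kdist_bounded[OF ambient_form K]) (rule ambient_locally_bounded)
    then show thesis using that by (elim exE conjE)
  qed
  have "\<forall>x\<in>K. \<exists>q. x \<in> fst q \<and> comparable (fst q) (fst (snd q)) (fst (snd (snd q))) (snd (snd (snd q)))"
  proof
    fix x assume "x \<in> K"
    then obtain U r C m where "x \<in> U" "comparable U r C m" using local_comparison KX by blast
    then have "x \<in> fst (U, r, C, m) \<and> comparable (fst (U, r, C, m)) (fst (snd (U, r, C, m))) (fst (snd (snd (U, r, C, m)))) (snd (snd (snd (U, r, C, m))))"
      by simp
    then show "\<exists>q. x \<in> fst q \<and> comparable (fst q) (fst (snd q)) (fst (snd (snd q))) (snd (snd (snd q)))" by blast
  qed
  from bchoice[OF this] obtain q where q: "\<forall>x\<in>K. x \<in> fst (q x) \<and>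
    comparable (fst (q x)) (fst (snd (q x))) (fst (snd (snd (q x)))) (snd (snd (snd (q x))))" by blast
  define UU RR CC mm where "UU x = fst (q x)" and "RR x = fst (snd (q x))" and "CC x = fst (snd (snd (q x)))"
    and "mm x = snd (snd (snd (q x)))" for x
  have q': "x \<in> UU x" "comparable (UU x) (RR x) (CC x) (mm x)" if "x \<in> K" for x
    using q that unfolding UU_def RR_def CC_def mm_def by blast+
  have o: "openin X (UU x)" if "x \<in> K" for x by (rule comparableD(1)[OF q'(2)[OF that]])
  obtain F where F: "finite F" "F \<subseteq> UU ` K" "K \<subseteq> \<Union>F"
    using compactinD[OF K, of "UU ` K"] o q'(1) by blast
  obtain S where S: "finite S" "S \<subseteq> K" "K \<subseteq> \<Union>(UU ` S)"
    using finite_subset_image[OF F(1,2)] F(3) by blast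
  have cmp: "comparable (UU x) (RR x) (CC x) (mm x)" if "x \<in> S" for x using q'(2) S(2) that by blast
  \<comment> \<open>The entry 1 makes distances below \<open>r\<close> at most 1, so that lowering
    the exponent enlarges the power.\<close>
  define r where "r = Min (insert 1 (RR ` S))"
  define C0 where "C0 = Max (insert 1 (CC ` S))"
  \<comment> \<open>Adding 1 gives \<open>M \<ge> 2\<close>, hence an exponent strictly below 1 even
    if all local groups are trivial.\<close>
  define M where "M = Max (insert 1 (mm ` S)) + 1"
  have pos: "RR x > 0" "CC x > 0" "mm x > 0" if "x \<in> S" for x using comparableD(2-4)[OF cmp[OF that]] by auto
  have r: "0 < r" "r \<le> 1" "\<And>x. x \<in> S \<Longrightarrow> r \<le> RR x" using S(1) pos(1) by (auto simp: r_def)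
  have C0: "1 \<le> C0" "\<And>x. x \<in> S \<Longrightarrow> CC x \<le> C0" using S(1) by (auto simp: C0_def)
  have M: "2 \<le> M" "\<And>x. x \<in> S \<Longrightarrow> mm x \<le> M"
  proof -
    have "1 \<le> Max (insert 1 (mm ` S))" using S(1) by simp
    then show "2 \<le> M" by (simp add: M_def)
    show "mm x \<le> M" if "x \<in> S" for x
    proof -
      have "mm x \<le> Max (insert 1 (mm ` S))" using S(1) that by (intro Max_ge) auto
      then show ?thesis by (simp add: M_def)
    qed
  qed
  define \<alpha> where "\<alpha> = 1 / real M"
  have \<alpha>: "\<alpha> \<in> {0<..<1}" using M(1) by (simp add: \<alpha>_def)
  \<comment> \<open>The summands serve small distances, large \<open>\<omega>\<close>-distances and
    large \<open>\<omega>X\<close>-distances respectively.\<close>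
  define C where "C = C0 + E / r + D / (r powr \<alpha>)"
  have rp: "r powr \<alpha> > 0" using r(1) by simp
  have C: "0 < C" "C0 \<le> C" "E / r \<le> C" "D / (r powr \<alpha>) \<le> C"
    using C0(1) divide_pos_pos[OF E(1) r(1)] divide_pos_pos[OF D(1) rp] by (simp_all add: C_def)
  have "kdist n X \<O> \<omega>X a b < \<infinity> \<and> kdist n X \<O> \<omega> a b < \<infinity> \<and>
      inverse C * enn2real (kdist n X \<O> \<omega>X a b) \<le> enn2real (kdist n X \<O> \<omega> a b) \<and>
      enn2real (kdist n X \<O> \<omega> a b) \<le> C * enn2real (kdist n X \<O> \<omega>X a b) powr \<alpha>"
    if ab: "a \<in> K" "b \<in> K" for a b
  proof -
    have kD: "kdist n X \<O> \<omega> a b \<le> ennreal D" and kE: "kdist n X \<O> \<omega>X a b \<le> ennreal E" using D(2) E(2) ab by blast+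
    have fin: "kdist n X \<O> \<omega>X a b < \<infinity>" "kdist n X \<O> \<omega> a b < \<infinity>"
      using le_less_trans[OF kE ennreal_less_top] le_less_trans[OF kD ennreal_less_top] by simp_all
    obtain d where d: "kdist n X \<O> \<omega> a b = ennreal d" "0 \<le> d"
      using fin(2) by (cases "kdist n X \<O> \<omega> a b" rule: ennreal_cases) auto
    obtain e where e: "kdist n X \<O> \<omega>X a b = ennreal e" "0 \<le> e"
      using fin(1) by (cases "kdist n X \<O> \<omega>X a b" rule: ennreal_cases) auto
    have dD: "d \<le> D" "e \<le> E" using kD kE d e D(1) E(1) by (simp_all add: ennreal_le_iff)
    obtain x where x: "x \<in> S" "a \<in> UU x" using S(3) ab(1) by blast
    note cx = cmp[OF x(1)]
    have "e \<le> C * d"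
    proof (cases "d < r")
      case True
      then have dr: "d < RR x" using r(3)[OF x(1)] by simp
      have "ennreal e \<le> ennreal (CC x * d)"
        using comparableD(5)[OF cx x(2) d(2) dr d(1)] unfolding e(1) .
      then have "e \<le> CC x * d" using d(2) pos(2)[OF x(1)] by (simp add: ennreal_le_iff)
      also have "\<dots> \<le> C * d" using C0(2)[OF x(1)] C(2) d(2) by (intro mult_right_mono) auto
      finally show ?thesis .
    next
      case False
      have "e \<le> E / r * r" using dD(2) r(1) by simp
      also have "\<dots> \<le> C * d" using C(1,3) False r(1) by (intro mult_mono) auto
      finally show ?thesis .
    qed
    then have 1: "inverse C * e \<le> d" using C(1) by (simp add: field_simps)
    have 2: "d \<le> C * e powr \<alpha>"
    proof (cases "e < r")
      case True
      then have er: "e < RR x" "e \<le> 1" using r(2) r(3)[OF x(1)] by simp_all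
      have "ennreal d \<le> ennreal (CC x * e powr (1 / real (mm x)))"
        using comparableD(6)[OF cx x(2) e(2) er(1) e(1)] unfolding d(1) .
      then have "d \<le> CC x * e powr (1 / real (mm x))" using pos(2)[OF x(1)] by (simp add: ennreal_le_iff)
      also have "\<dots> \<le> C * e powr \<alpha>"
      proof (rule mult_mono)
        show "CC x \<le> C" using C0(2)[OF x(1)] C(2) by simp
        have "\<alpha> \<le> 1 / real (mm x)" unfolding \<alpha>_def
          using M(2)[OF x(1)] pos(3)[OF x(1)] by (intro divide_left_mono) auto
        then show "e powr (1 / real (mm x)) \<le> e powr \<alpha>" using e(2) er(2) by (rule powr_mono')
      qed (use C(1) in auto)
      finally show ?thesis .
    next
      case False
      have "d \<le> D / (r powr \<alpha>) * r powr \<alpha>" using dD(1) rp by simp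
      also have "\<dots> \<le> C * e powr \<alpha>"
      proof (rule mult_mono)
        show "r powr \<alpha> \<le> e powr \<alpha>" using False r(1) \<alpha> by (intro powr_mono2) auto
      qed (use C(1,4) in auto)
      finally show ?thesis .
    qed
    show ?thesis using fin 1 2 d e by simp
  qed
  then show ?thesis using C(1) \<alpha> by blast
qed

end

text \<open>Distances take values in the extended reals, so their finiteness on \<open>K\<close> is
  asserted as well; otherwise \<open>enn2real\<close> would read an infinite distance as 0. The
  density premise of the last clause excludes, for instance, isolated points of \<open>K\<close>
  that are singular, which no completion of the regular part can recover.\<close>

theorem proposition5p7:
  fixes X :: "'a topology" and \<O> :: "'a set \<Rightarrow> ('a \<Rightarrow> complex) set" and n :: nat
    and \<omega> \<omega>X :: "'a set \<Rightarrow> ('a \<Rightarrow> nat \<Rightarrow> complex) \<Rightarrow> form" and K :: "'a set"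
  assumes "complex_orbifold n X \<O>"
    and "orbifold_kaehler_metric n X \<O> \<omega>"
    and "kaehler_metric n X \<O> \<omega>X"
    and "compactin X K"
    and "X interior_of K \<noteq> {}"
    and "connectedin X (X interior_of K)"
  shows "(\<exists>C>0. \<exists>\<alpha>\<in>{0<..<1}. \<forall>a\<in>K. \<forall>b\<in>K.
            kdist n X \<O> \<omega>X a b < \<infinity> \<and> kdist n X \<O> \<omega> a b < \<infinity> \<and>
            inverse C * enn2real (kdist n X \<O> \<omega>X a b) \<le> enn2real (kdist n X \<O> \<omega> a b) \<and>
            enn2real (kdist n X \<O> \<omega> a b) \<le> C * enn2real (kdist n X \<O> \<omega>X a b) powr \<alpha>) \<and>
         Metric_space (K - singular_locus X \<O>) (\<lambda>a b. enn2real (kdist n X \<O> \<omega> a b)) \<and>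
         (K \<subseteq> X closure_of (K - singular_locus X \<O>) \<longrightarrow>
            completion_topology (K - singular_locus X \<O>) (\<lambda>a b. enn2real (kdist n X \<O> \<omega> a b))
              homeomorphic_space subtopology X K)"
proof -
  have "reduced_complex_space X \<O>"
    using assms(1) unfolding complex_orbifold_def normal_variety_def by blast
  then interpret two_metrics X \<O> n \<omega> \<omega>X
    using assms(1,2,3) by unfold_locales
  let ?d = "\<lambda>a b. enn2real (kdist n X \<O> \<omega> a b)" and ?M = "K - singular_locus X \<O>"
  have KX: "K \<subseteq> topspace X" by (rule compactin_subset_topspace[OF assms(4)])
  have MK: "Metric_space K ?d" by (rule Metric_space.subspace[OF metric_space KX])
  have MM: "Metric_space ?M ?d" by (rule Metric_space.subspace[OF MK]) blast
  note top = metric_topology_compact[OF assms(4)]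
  have "completion_topology ?M ?d homeomorphic_space subtopology X K" if cl: "K \<subseteq> X closure_of ?M"
  proof -
    have "completion_topology ?M ?d homeomorphic_space Metric_space.mtopology K ?d"
    proof (rule compact_completion_homeomorphic[OF MK])
      show "compact_space (Metric_space.mtopology K ?d)"
        unfolding top using assms(4) by (simp add: compact_space_subtopology)
      fix x and e :: real assume x: "x \<in> K" and e: "0 < e"
      obtain U where U: "openin X U" "x \<in> U" "\<forall>a\<in>U. \<forall>b\<in>U. kdist n X \<O> \<omega> a b < ennreal e"
        using kdist_small[of x e] x KX e by blast
      obtain y where y: "y \<in> ?M" "y \<in> U" 
        using in_closure_of[THEN iffD1, OF subsetD[OF cl x], THEN conjunct2, rule_format, OF conjI[OF U(2,1)]]
        by (elim exE conjE)
      have "kdist n X \<O> \<omega> x y < ennreal e" using U(2,3) y(2) by blast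
      then have "?d x y < e"
        using e by (cases "kdist n X \<O> \<omega> x y" rule: ennreal_cases) (auto simp: ennreal_less_iff)
      then show "\<exists>y\<in>?M. ?d x y < e" using y(1) by blast
    qed blast
    then show ?thesis unfolding top .
  qed
  then show ?thesis using global_comparison[OF assms(4)] MM by (intro conjI impI)
qed

end
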